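(* Let $\omega,\Omega,c_s,\mathbf b,\rho,p,\phi,\gamma$ satisfy the standing assumptions listed in the context, in particular $\operatorname{supp}\mathbf b\subset B_{r_1}$. Let $r_3>r_2>r_1$ be such that $c_s,\rho\in W^{1,\infty}(B_{r_3})$, let $\omega\neq 0$, and let $\theta$ be as defined in the context (with this $r_2$). Let $\mathbf X$, $\tilde H^1_*$, the sesquilinear form $a(\cdot,\cdot)$ on $\mathbf X\times\tilde H^1_*$ and the associated operator $A\in L(\mathbf X\times\tilde H^1_* )$ be as defined in the context. If $$\|c_s^{-1}\mathbf b\|_{\mathbf L^\infty}^2<\frac{1}{1+\tan^2\theta},$$ then $A$ is bijective, and hence for each $\mathbf f\in\mathbf L^2_\rho$ the equations of stellar oscillations $$-\nabla(c_s^2\rho\operatorname{div}\mathbf u+\nabla p\cdot\mathbf u)+\nabla p\operatorname{div}\mathbf u+\operatorname{Hess}(p)\mathbf u-\rho\operatorname{Hess}(\phi)\mathbf u-\rho\nabla\psi-\rho(\omega+i\partial_{\mathbf b}+i\Omega\times)^2\mathbf u-i\omega\gamma\rho\mathbf u=\rho\mathbf f\ \text{ in }\mathbb R^3,$$ $$-\frac1{4\pi G}\Delta\psi+\operatorname{div}(\rho\mathbf u)=0\ \text{ in }\mathbb R^3,$$ understood in the weak sense $$a\big((\mathbf u,\psi),(\mathbf u',\psi')\big)=\langle\mathbf f,\mathbf u'\rangle\quad\text{for all }(\mathbf u',\psi')\in\mathbf X\times\tilde H^1_*,$$ admit a unique solution $(\mathbf u,\psi)\in\mathbf X\times\tilde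 H^1_*$, and it depends continuously on $\mathbf f$.
   Context: Notation. $B_r:=\{\mathbf x\in\mathbb R^3:|\mathbf x|<r\}$. All function spaces are complex-valued with default domain $\mathbb R^3$ unless indicated; boldface spaces are spaces of $\mathbb C^3$-valued functions, e.g. $\mathbf L^2=(L^2(\mathbb R^3))^3$. Suprema and infima of $L^\infty$ functions are essential ones; $\|c_s^{-1}\mathbf b\|_{\mathbf L^\infty}$ is the essential supremum of $|c_s^{-1}\mathbf b|$ (Euclidean norm). $L(Y)$ denotes the bounded linear operators on $Y$. Standing assumptions. $\omega\in\mathbb R$, $\Omega\in\mathbb R^3$, $G>0$ (gravitational constant). $\rho\in L^\infty(\mathbb R^3,\mathbb R)$ with $\inf_{B_r}\rho>0$ for every $r>0$. $c_s,\gamma\in L^\infty(\mathbb R^3,\mathbb R)$ with $\inf_{\mathbb R^3}c_s>0$, $\inf_{\mathbb R^3}\gamma>0$. $p,\phi\in W^{2,\infty}_{\mathrm{loc}}(\mathbb R^3,\mathbb R)$, and with $$\mathbf q:=\frac{1}{c_s^2\rho}\nabla p,\qquad m_1:=-\rho^{-1}\big(\operatorname{Hess}(p)-\rho\operatorname{Hess}(\phi)-c_s^2\rho\,\mathbf q\mathbf q^\top\big)$$ one has $\mathbf q\in L^\infty(\mathbb R^3,\mathbb R^3)$ and $m_1\in L^\infty(\mathbb R^3,\mathbb R^{3\times3})$. $\mathbf b\in L^\infty(\mathbb R^3,\mathbb R^3)$ with $\operatorname{div}(\rho\mathbf b)\in L^2(\mathbb R^3,\mathbb R)$, and $r_1>0$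 is such that $\operatorname{supp}\mathbf b\subset B_{r_1}$. Weighted spaces. $L^2_\rho(D)$ and $\mathbf L^2_\rho(D)$ carry the scalar products $\langle u,u'\rangle_D=\int_D\rho\,u\,\overline{u'}\,d\mathbf x$ and $\langle\mathbf u,\mathbf u'\rangle_D=\int_D\rho\,\mathbf u\cdot\overline{\mathbf u'}\,d\mathbf x$; $\langle\cdot,\cdot\rangle:=\langle\cdot,\cdot\rangle_{\mathbb R^3}$. Directional derivative. $\partial_{\mathbf b}=\sum_{l=1}^3\mathbf b_l\partial_{\mathbf x_l}$, defined weakly by $\int\rho\,\partial_{\mathbf b}\mathbf u\cdot\overline{\mathbf u'}=-\int\rho\,\mathbf u\cdot\overline{\partial_{\mathbf b}\mathbf u'}-\int\operatorname{div}(\rho\mathbf b)\,\mathbf u\cdot\overline{\mathbf u'}$ for all smooth compactly supported $\mathbf u'$. Spaces. $\mathbf X:=\{\mathbf u\in\mathbf L^2_\rho:\operatorname{div}\mathbf u\in L^2_\rho,\ \partial_{\mathbf b}\mathbf u\in\mathbf L^2_\rho\}$ with $\langle\mathbf u,\mathbf u'\rangle_{\mathbf X}=\langle\operatorname{div}\mathbf u,\operatorname{div}\mathbf u'\rangle+\langle\partial_{\mathbf b}\mathbf u,\partial_{\mathbf b}\mathbf u'\rangle+\langle\mathbf u,\mathbf u'\rangle$. $\tilde H^1_*:=\{\psi\in H^1_{\mathrm{loc}}(\mathbb R^3):\nabla\psi\in\mathbf L^2,\ \int_{B_{r_1}}\psi\,d\mathbf x=0\}$ with $\langle\psi,\psi'\rangle_{\tilde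 H^1_*}=\langle\nabla\psi,\nabla\psi'\rangle_{\mathbf L^2}$. Both are Hilbert spaces. Sesquilinear form. $$\begin{aligned}a\big((\mathbf u,\psi),(\mathbf u',\psi')\big):={}&\langle c_s^2\operatorname{div}\mathbf u,\operatorname{div}\mathbf u'\rangle+\langle\rho^{-1}\nabla p\cdot\mathbf u,\operatorname{div}\mathbf u'\rangle+\langle\operatorname{div}\mathbf u,\rho^{-1}\nabla p\cdot\mathbf u'\rangle\\&-\langle(\omega+i\partial_{\mathbf b}+i\Omega\times)\mathbf u,(\omega+i\partial_{\mathbf b}+i\Omega\times)\mathbf u'\rangle\\&+\langle(\rho^{-1}\operatorname{Hess}(p)-\operatorname{Hess}(\phi))\mathbf u,\mathbf u'\rangle-i\omega\langle\gamma\mathbf u,\mathbf u'\rangle\\&-\langle\nabla\psi,\mathbf u'\rangle-\langle\mathbf u,\nabla\psi'\rangle+\tfrac1{4\pi G}\langle\nabla\psi,\nabla\psi'\rangle_{\mathbf L^2}.\end{aligned}$$ (Equivalently the $\mathbf u$-part reads $\langle c_s^2(\operatorname{div}+\mathbf q\cdot)\mathbf u,(\operatorname{div}+\mathbf q\cdot)\mathbf u'\rangle-\langle(\omega+i\partial_{\mathbf b}+i\Omega\times)\mathbf u,(\omega+i\partial_{\mathbf b}+i\Omega\times)\mathbf u'\rangle-\langle m_1\mathbf u,\mathbf u'\rangle-i\omega\langle\gamma\mathbf u,\mathbf u'\rangle$.) It is bounded, and $A$ is its Riesz representation: $\langle Ay,y'\rangle_{\mathbf X\times\tilde H^1_*}=a(y,y')$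 for all $y,y'\in\mathbf X\times\tilde H^1_*$. Angle $\theta$. With $\arg$ taking values in $(-\pi,\pi]$ and $\operatorname{num\,ran}M:=\{\xi^HM\xi:\xi\in\mathbb C^3,|\xi|=1\}$ for $M\in\mathbb C^{3\times3}$, $$\theta:=\max\Big\{0,\ \sup_{\mathbf x\in B_{r_2}}\ \sup\big|\arg\operatorname{num\,ran}\big(i\omega\gamma(\mathbf x)I_{3\times3}+m_1(\mathbf x)\big)\big|-\pi/2\Big\},$$ where the inner supremum is over the numerical range; one has $\theta\in[0,\pi/2)$. *)

theory Defs
  imports "HOL-Analysis.Analysis" "HOL-Probability.Essential_Supremum"
begin

unbundle no cross3_syntax

section \<open>Test functions and weak derivatives on \<open>\<real>\<^sup>3\<close>\<close>

definition pderiv_at :: "3 \<Rightarrow> (real^3 \<Rightarrow> 'a::real_normed_vector) \<Rightarrow> real^3 \<Rightarrow> 'a" where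
  "pderiv_at i f x = frechet_derivative f (at x) (axis i 1)"

fun C_k :: "nat \<Rightarrow> (real^3 \<Rightarrow> 'a::real_normed_vector) \<Rightarrow> bool" where
  "C_k 0 f \<longleftrightarrow> continuous_on UNIV f"
| "C_k (Suc k) f \<longleftrightarrow> (\<forall>x. f differentiable (at x)) \<and> (\<forall>i. C_k k (pderiv_at i f))"

definition test_function :: "(real^3) set \<Rightarrow> (real^3 \<Rightarrow> 'a::real_normed_vector) \<Rightarrow> bool" where
  "test_function D f \<longleftrightarrow>
     (\<forall>k. C_k k f) \<and> compact (closure {x. f x \<noteq> 0}) \<and> closure {x. f x \<noteq> 0} \<subseteq> D"

definition loc_integrable :: "(real^3) set \<Rightarrow> (real^3 \<Rightarrow> 'a::euclidean_space) \<Rightarrow> bool" where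
  "loc_integrable D f \<longleftrightarrow> (\<forall>K. compact K \<and> K \<subseteq> D \<longrightarrow> set_integrable lebesgue K f)"

text \<open>Real-valued test functions suffice for complex-valued \<open>f\<close>, by linearity.\<close>

definition has_weak_pderiv ::
    "(real^3) set \<Rightarrow> 3 \<Rightarrow> (real^3 \<Rightarrow> 'a::euclidean_space) \<Rightarrow> (real^3 \<Rightarrow> 'a) \<Rightarrow> bool" where
  "has_weak_pderiv D i f g \<longleftrightarrow> loc_integrable D f \<and> loc_integrable D g \<and>
     (\<forall>\<eta>::real^3 \<Rightarrow> real. test_function D \<eta> \<longrightarrow>
        (LINT x:D|lebesgue. pderiv_at i \<eta> x *\<^sub>R f x) = - (LINT x:D|lebesgue. \<eta> x *\<^sub>R g x))"

definition has_weak_div :: "(real^3 \<Rightarrow> 'a::euclidean_space^3) \<Rightarrow> (real^3 \<Rightarrow> 'a) \<Rightarrow> bool" where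
  "has_weak_div f g \<longleftrightarrow> loc_integrable UNIV f \<and> loc_integrable UNIV g \<and>
     (\<forall>\<eta>::real^3 \<Rightarrow> real. test_function UNIV \<eta> \<longrightarrow>
        (LINT x|lebesgue. (\<Sum>i\<in>UNIV. pderiv_at i \<eta> x *\<^sub>R (f x $ i)))
          = - (LINT x|lebesgue. \<eta> x *\<^sub>R g x))"

text \<open>Weak derivatives are unique only up to null sets; the operators below choose a
  representative, and are meaningful when a weak derivative exists.\<close>

definition weak_pderiv :: "3 \<Rightarrow> (real^3 \<Rightarrow> 'a::euclidean_space) \<Rightarrow> real^3 \<Rightarrow> 'a" where
  "weak_pderiv i f = (SOME g. has_weak_pderiv UNIV i f g)"

definition weak_grad :: "(real^3 \<Rightarrow> 'a::euclidean_space) \<Rightarrow> real^3 \<Rightarrow> 'a^3" where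
  "weak_grad f x = (\<chi> i. weak_pderiv i f x)"

definition weak_hess :: "(real^3 \<Rightarrow> real) \<Rightarrow> real^3 \<Rightarrow> real^3^3" where
  "weak_hess f x = (\<chi> i j. weak_pderiv i (weak_pderiv j f) x)"

definition weak_div :: "(real^3 \<Rightarrow> 'a::euclidean_space^3) \<Rightarrow> real^3 \<Rightarrow> 'a" where
  "weak_div f = (SOME g. has_weak_div f g)"

section \<open>Function spaces\<close>

definition ess_inf :: "'a measure \<Rightarrow> ('a \<Rightarrow> real) \<Rightarrow> ereal" where
  "ess_inf M f = - esssup M (\<lambda>x. - ereal (f x))"

definition Linf_norm :: "(real^3 \<Rightarrow> 'a::euclidean_space) \<Rightarrow> ereal" where
  "Linf_norm f = esssup lebesgue (\<lambda>x. ereal (norm (f x)))"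

definition in_Linf :: "(real^3) set \<Rightarrow> (real^3 \<Rightarrow> 'a::euclidean_space) \<Rightarrow> bool" where
  "in_Linf D f \<longleftrightarrow> f \<in> borel_measurable (lebesgue_on D) \<and>
     (\<exists>C. AE x in lebesgue_on D. norm (f x) \<le> C)"

definition in_Linf_loc :: "(real^3 \<Rightarrow> 'a::euclidean_space) \<Rightarrow> bool" where
  "in_Linf_loc f \<longleftrightarrow> (\<forall>r. in_Linf (ball 0 r) f)"

definition in_W1inf :: "(real^3) set \<Rightarrow> (real^3 \<Rightarrow> real) \<Rightarrow> bool" where
  "in_W1inf D f \<longleftrightarrow> in_Linf D f \<and> (\<forall>i. \<exists>g. has_weak_pderiv D i f g \<and> in_Linf D g)"

definition in_W2inf_loc :: "(real^3 \<Rightarrow> real) \<Rightarrow> bool" where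
  "in_W2inf_loc f \<longleftrightarrow> in_Linf_loc f \<and>
     (\<forall>i. \<exists>g. has_weak_pderiv UNIV i f g \<and> in_Linf_loc g \<and>
        (\<forall>j. \<exists>h. has_weak_pderiv UNIV j g h \<and> in_Linf_loc h))"

text \<open>Complement of the largest open set on which \<open>f\<close> vanishes almost everywhere.\<close>

definition ess_support :: "(real^3 \<Rightarrow> 'a::euclidean_space) \<Rightarrow> (real^3) set" where
  "ess_support f = {x. \<forall>r>0. \<not> (AE y in lebesgue. y \<in> ball x r \<longrightarrow> f y = 0)}"

definition in_L2w :: "(real^3 \<Rightarrow> real) \<Rightarrow> (real^3 \<Rightarrow> 'a::euclidean_space) \<Rightarrow> bool" where
  "in_L2w \<rho> f \<longleftrightarrow> f \<in> borel_measurable lebesgue \<and> integrable lebesgue (\<lambda>x. \<rho> x * (norm (f x))\<^sup>2)"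

abbreviation in_L2 :: "(real^3 \<Rightarrow> 'a::euclidean_space) \<Rightarrow> bool" where
  "in_L2 \<equiv> in_L2w (\<lambda>_. 1)"

definition in_L2_loc :: "(real^3 \<Rightarrow> 'a::euclidean_space) \<Rightarrow> bool" where
  "in_L2_loc f \<longleftrightarrow> f \<in> borel_measurable lebesgue \<and>
     (\<forall>r. set_integrable lebesgue (ball 0 r) (\<lambda>x. (norm (f x))\<^sup>2))"

text \<open>Inner products are linear in the first and antilinear in the second argument.\<close>

definition hdot :: "complex^3 \<Rightarrow> complex^3 \<Rightarrow> complex" where
  "hdot u v = (\<Sum>i\<in>UNIV. u $ i * cnj (v $ i))"

definition ipS :: "(real^3 \<Rightarrow> real) \<Rightarrow> (real^3 \<Rightarrow> complex) \<Rightarrow> (real^3 \<Rightarrow> complex) \<Rightarrow> complex" where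
  "ipS \<rho> f g = (LINT x|lebesgue. \<rho> x *\<^sub>R (f x * cnj (g x)))"

definition ipV :: "(real^3 \<Rightarrow> real) \<Rightarrow> (real^3 \<Rightarrow> complex^3) \<Rightarrow> (real^3 \<Rightarrow> complex^3) \<Rightarrow> complex" where
  "ipV \<rho> f g = (LINT x|lebesgue. \<rho> x *\<^sub>R hdot (f x) (g x))"

section \<open>The directional derivative and the energy spaces\<close>

text \<open>The defining identity of \<open>w = \<partial>\<^sub>b u\<close> comes from integration by parts with the density \<open>\<rho>\<close>,
  using \<open>div (\<rho> b)\<close> but no weak derivative of \<open>u\<close>. It is used for \<open>u \<in> L\<^sup>2\<^sub>\<rho>\<close> with
  \<open>div (\<rho> b) \<in> L\<^sup>2\<close>, in which case all the integrals exist.\<close>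

definition has_weak_dirderiv ::
    "(real^3 \<Rightarrow> real) \<Rightarrow> (real^3 \<Rightarrow> real^3) \<Rightarrow> (real^3 \<Rightarrow> complex^3) \<Rightarrow> (real^3 \<Rightarrow> complex^3) \<Rightarrow> bool" where
  "has_weak_dirderiv \<rho> b u w \<longleftrightarrow> loc_integrable UNIV u \<and> loc_integrable UNIV w \<and>
     (\<forall>u'::real^3 \<Rightarrow> complex^3. test_function UNIV u' \<longrightarrow>
        (LINT x|lebesgue. \<rho> x *\<^sub>R hdot (w x) (u' x))
          = - (LINT x|lebesgue. \<rho> x *\<^sub>R hdot (u x) (\<Sum>l\<in>UNIV. (b x $ l) *\<^sub>R pderiv_at l u' x))
            - (LINT x|lebesgue. weak_div (\<lambda>y. \<rho> y *\<^sub>R b y) x *\<^sub>R hdot (u x) (u' x)))"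

definition weak_dirderiv ::
    "(real^3 \<Rightarrow> real) \<Rightarrow> (real^3 \<Rightarrow> real^3) \<Rightarrow> (real^3 \<Rightarrow> complex^3) \<Rightarrow> real^3 \<Rightarrow> complex^3" where
  "weak_dirderiv \<rho> b u = (SOME w. has_weak_dirderiv \<rho> b u w)"

definition in_X :: "(real^3 \<Rightarrow> real) \<Rightarrow> (real^3 \<Rightarrow> real^3) \<Rightarrow> (real^3 \<Rightarrow> complex^3) \<Rightarrow> bool" where
  "in_X \<rho> b u \<longleftrightarrow> in_L2w \<rho> u \<and> (\<exists>g. has_weak_div u g \<and> in_L2w \<rho> g) \<and>
     (\<exists>w. has_weak_dirderiv \<rho> b u w \<and> in_L2w \<rho> w)"

definition ipX ::
    "(real^3 \<Rightarrow> real) \<Rightarrow> (real^3 \<Rightarrow> real^3) \<Rightarrow> (real^3 \<Rightarrow> complex^3) \<Rightarrow> (real^3 \<Rightarrow> complex^3) \<Rightarrow> complex" where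
  "ipX \<rho> b u u' = ipS \<rho> (weak_div u) (weak_div u')
     + ipV \<rho> (weak_dirderiv \<rho> b u) (weak_dirderiv \<rho> b u') + ipV \<rho> u u'"

definition in_H1loc :: "(real^3 \<Rightarrow> complex) \<Rightarrow> bool" where
  "in_H1loc \<psi> \<longleftrightarrow> in_L2_loc \<psi> \<and> (\<forall>i. \<exists>g. has_weak_pderiv UNIV i \<psi> g \<and> in_L2_loc g)"

definition in_H1star :: "real \<Rightarrow> (real^3 \<Rightarrow> complex) \<Rightarrow> bool" where
  "in_H1star r\<^sub>1 \<psi> \<longleftrightarrow> in_H1loc \<psi> \<and> in_L2 (weak_grad \<psi>) \<and> (LINT x:ball 0 r\<^sub>1|lebesgue. \<psi> x) = 0"

definition ipH :: "(real^3 \<Rightarrow> complex) \<Rightarrow> (real^3 \<Rightarrow> complex) \<Rightarrow> complex" where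
  "ipH \<psi> \<psi>' = ipV (\<lambda>_. 1) (weak_grad \<psi>) (weak_grad \<psi>')"

section \<open>Functions modulo equality almost everywhere\<close>

quotient_type 'a aefun = "real^3 \<Rightarrow> 'a" / "\<lambda>f g. AE x in lebesgue. f x = g x"
  by (rule equivpI) (auto simp: reflp_def symp_def transp_def elim: eventually_mono eventually_elim2)

text \<open>\<open>rep_aefun F\<close> is some function in the class \<open>F\<close>. All notions below that use it are invariant
  under changes on null sets.\<close>

instantiation aefun :: (ab_group_add) ab_group_add
begin

lift_definition zero_aefun :: "'a aefun" is "\<lambda>x. 0" .

lift_definition plus_aefun :: "'a aefun \<Rightarrow> 'a aefun \<Rightarrow> 'a aefun" is "\<lambda>f g x. f x + g x"
  by (auto elim: eventually_elim2)

lift_definition minus_aefun :: "'a aefun \<Rightarrow> 'a aefun \<Rightarrow> 'a aefun" is "\<lambda>f g x. f x - g x"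
  by (auto elim: eventually_elim2)

lift_definition uminus_aefun :: "'a aefun \<Rightarrow> 'a aefun" is "\<lambda>f x. - f x"
  by (auto elim: eventually_mono)

instance
  by standard (transfer; simp add: algebra_simps)+

end

lift_definition cscaleS :: "complex \<Rightarrow> complex aefun \<Rightarrow> complex aefun" is "\<lambda>c f x. c * f x"
  by (auto elim: eventually_mono)

lift_definition cscaleV :: "complex \<Rightarrow> (complex^3) aefun \<Rightarrow> (complex^3) aefun" is "\<lambda>c f x. c *s f x"
  by (auto elim: eventually_mono)

type_synonym state = "(complex^3) aefun \<times> complex aefun"

definition cscale :: "complex \<Rightarrow> state \<Rightarrow> state" where
  "cscale c y = (cscaleV c (fst y), cscaleS c (snd y))"

definition L2w :: "(real^3 \<Rightarrow> real) \<Rightarrow> (complex^3) aefun set" where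
  "L2w \<rho> = {F. in_L2w \<rho> (rep_aefun F)}"

definition L2w_norm :: "(real^3 \<Rightarrow> real) \<Rightarrow> (complex^3) aefun \<Rightarrow> real" where
  "L2w_norm \<rho> F = sqrt (Re (ipV \<rho> (rep_aefun F) (rep_aefun F)))"

definition spaceX :: "(real^3 \<Rightarrow> real) \<Rightarrow> (real^3 \<Rightarrow> real^3) \<Rightarrow> (complex^3) aefun set" where
  "spaceX \<rho> b = {U. in_X \<rho> b (rep_aefun U)}"

definition spaceH1star :: "real \<Rightarrow> complex aefun set" where
  "spaceH1star r\<^sub>1 = {\<Psi>. in_H1star r\<^sub>1 (rep_aefun \<Psi>)}"

definition ipY :: "(real^3 \<Rightarrow> real) \<Rightarrow> (real^3 \<Rightarrow> real^3) \<Rightarrow> state \<Rightarrow> state \<Rightarrow> complex" where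
  "ipY \<rho> b y y' = ipX \<rho> b (rep_aefun (fst y)) (rep_aefun (fst y'))
     + ipH (rep_aefun (snd y)) (rep_aefun (snd y'))"

definition normY :: "(real^3 \<Rightarrow> real) \<Rightarrow> (real^3 \<Rightarrow> real^3) \<Rightarrow> state \<Rightarrow> real" where
  "normY \<rho> b y = sqrt (Re (ipY \<rho> b y y))"

definition bounded_operator_on :: "state set \<Rightarrow> (state \<Rightarrow> real) \<Rightarrow> (state \<Rightarrow> state) \<Rightarrow> bool" where
  "bounded_operator_on Y nrm A \<longleftrightarrow> (\<forall>y\<in>Y. A y \<in> Y) \<and>
     (\<forall>y\<in>Y. \<forall>z\<in>Y. A (y + z) = A y + A z) \<and> (\<forall>c. \<forall>y\<in>Y. A (cscale c y) = cscale c (A y)) \<and>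
     (\<exists>C. \<forall>y\<in>Y. nrm (A y) \<le> C * nrm y)"

text \<open>The operator representing the form \<open>a\<close> in the Hilbert space \<open>(Y, ip)\<close>.\<close>

definition riesz_operator ::
    "state set \<Rightarrow> (state \<Rightarrow> state \<Rightarrow> complex) \<Rightarrow> (state \<Rightarrow> state \<Rightarrow> complex) \<Rightarrow> state \<Rightarrow> state" where
  "riesz_operator Y ip a y = (THE w. w \<in> Y \<and> (\<forall>y'\<in>Y. ip w y' = a y y'))"

section \<open>The oscillation form and the angle\<close>

definition cvec :: "real^3 \<Rightarrow> complex^3" where
  "cvec v = (\<chi> i. of_real (v $ i))"

definition cmat :: "real^3^3 \<Rightarrow> complex^3^3" where
  "cmat M = (\<chi> i j. of_real (M $ i $ j))"

text \<open>The library's cross product, with a real first and a complex second argument.\<close>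

definition ccross :: "real^3 \<Rightarrow> complex^3 \<Rightarrow> complex^3" where
  "ccross \<Omega> u = (\<chi> i. Complex (cross3 \<Omega> (\<chi> j. Re (u $ j)) $ i) (cross3 \<Omega> (\<chi> j. Im (u $ j)) $ i))"

definition rdot :: "real^3 \<Rightarrow> complex^3 \<Rightarrow> complex" where
  "rdot v u = (\<Sum>i\<in>UNIV. of_real (v $ i) * u $ i)"

definition rotating_deriv ::
    "real \<Rightarrow> real^3 \<Rightarrow> (real^3 \<Rightarrow> real) \<Rightarrow> (real^3 \<Rightarrow> real^3) \<Rightarrow> (real^3 \<Rightarrow> complex^3) \<Rightarrow> real^3 \<Rightarrow> complex^3" where
  "rotating_deriv \<omega> \<Omega> \<rho> b u x =
     of_real \<omega> *s u x + \<i> *s weak_dirderiv \<rho> b u x + \<i> *s ccross \<Omega> (u x)"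

definition osc_form_fun ::
    "real \<Rightarrow> real^3 \<Rightarrow> real \<Rightarrow> (real^3 \<Rightarrow> real) \<Rightarrow> (real^3 \<Rightarrow> real) \<Rightarrow> (real^3 \<Rightarrow> real) \<Rightarrow>
     (real^3 \<Rightarrow> real) \<Rightarrow> (real^3 \<Rightarrow> real) \<Rightarrow> (real^3 \<Rightarrow> real^3) \<Rightarrow>
     (real^3 \<Rightarrow> complex^3) \<Rightarrow> (real^3 \<Rightarrow> complex) \<Rightarrow> (real^3 \<Rightarrow> complex^3) \<Rightarrow> (real^3 \<Rightarrow> complex) \<Rightarrow> complex" where
  "osc_form_fun \<omega> \<Omega> G \<rho> c\<^sub>s \<gamma> p \<phi> b u \<psi> u' \<psi>' =
      ipS \<rho> (\<lambda>x. of_real ((c\<^sub>s x)\<^sup>2) * weak_div u x) (weak_div u')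
    + ipS \<rho> (\<lambda>x. of_real (1 / \<rho> x) * rdot (weak_grad p x) (u x)) (weak_div u')
    + ipS \<rho> (weak_div u) (\<lambda>x. of_real (1 / \<rho> x) * rdot (weak_grad p x) (u' x))
    - ipV \<rho> (rotating_deriv \<omega> \<Omega> \<rho> b u) (rotating_deriv \<omega> \<Omega> \<rho> b u')
    + ipV \<rho> (\<lambda>x. cmat ((1 / \<rho> x) *\<^sub>R weak_hess p x - weak_hess \<phi> x) *v u x) u'
    - \<i> * of_real \<omega> * ipV \<rho> (\<lambda>x. \<gamma> x *\<^sub>R u x) u'
    - ipV \<rho> (weak_grad \<psi>) u'
    - ipV \<rho> u (weak_grad \<psi>')
    + of_real (1 / (4 * pi * G)) * ipV (\<lambda>_. 1) (weak_grad \<psi>) (weak_grad \<psi>')"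

definition osc_form ::
    "real \<Rightarrow> real^3 \<Rightarrow> real \<Rightarrow> (real^3 \<Rightarrow> real) \<Rightarrow> (real^3 \<Rightarrow> real) \<Rightarrow> (real^3 \<Rightarrow> real) \<Rightarrow>
     (real^3 \<Rightarrow> real) \<Rightarrow> (real^3 \<Rightarrow> real) \<Rightarrow> (real^3 \<Rightarrow> real^3) \<Rightarrow> state \<Rightarrow> state \<Rightarrow> complex" where
  "osc_form \<omega> \<Omega> G \<rho> c\<^sub>s \<gamma> p \<phi> b y y' =
     osc_form_fun \<omega> \<Omega> G \<rho> c\<^sub>s \<gamma> p \<phi> b
       (rep_aefun (fst y)) (rep_aefun (snd y)) (rep_aefun (fst y')) (rep_aefun (snd y'))"

definition q_field :: "(real^3 \<Rightarrow> real) \<Rightarrow> (real^3 \<Rightarrow> real) \<Rightarrow> (real^3 \<Rightarrow> real) \<Rightarrow> real^3 \<Rightarrow> real^3" where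
  "q_field \<rho> c\<^sub>s p x = (1 / ((c\<^sub>s x)\<^sup>2 * \<rho> x)) *\<^sub>R weak_grad p x"

definition m1_field ::
    "(real^3 \<Rightarrow> real) \<Rightarrow> (real^3 \<Rightarrow> real) \<Rightarrow> (real^3 \<Rightarrow> real) \<Rightarrow> (real^3 \<Rightarrow> real) \<Rightarrow> real^3 \<Rightarrow> real^3^3" where
  "m1_field \<rho> c\<^sub>s p \<phi> x = - ((1 / \<rho> x) *\<^sub>R
     (weak_hess p x - \<rho> x *\<^sub>R weak_hess \<phi> x
       - ((c\<^sub>s x)\<^sup>2 * \<rho> x) *\<^sub>R (\<chi> i j. q_field \<rho> c\<^sub>s p x $ i * q_field \<rho> c\<^sub>s p x $ j)))"

definition num_ran :: "complex^3^3 \<Rightarrow> complex set" where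
  "num_ran M = {hdot (M *v \<xi>) \<xi> |\<xi>. norm \<xi> = 1}"

text \<open>The supremum over \<open>x\<close> is essential, since the coefficients are defined up to null sets only.
  \<^const>\<open>Arg\<close> takes values in \<open>(-\<pi>, \<pi>]\<close>, with the junk value \<open>Arg 0 = 0\<close>, which is irrelevant
  for \<open>\<omega> \<noteq> 0\<close>: \<open>m\<^sub>1\<close> is symmetric almost everywhere, so that the imaginary part of the numerical
  range is then \<open>\<omega> \<gamma>(x) \<noteq> 0\<close>.\<close>

definition theta_angle :: "real \<Rightarrow> (real^3 \<Rightarrow> real) \<Rightarrow> (real^3 \<Rightarrow> real^3^3) \<Rightarrow> real \<Rightarrow> real" where
  "theta_angle \<omega> \<gamma> m\<^sub>1 r\<^sub>2 = max 0 (real_of_ereal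
     (esssup (lebesgue_on (ball 0 r\<^sub>2))
        (\<lambda>x. SUP z \<in> num_ran (mat (\<i> * of_real (\<omega> * \<gamma> x)) + cmat (m\<^sub>1 x)). ereal \<bar>Arg z\<bar>)) - pi / 2)"

definition weak_solution ::
    "state set \<Rightarrow> (state \<Rightarrow> state \<Rightarrow> complex) \<Rightarrow> (real^3 \<Rightarrow> real) \<Rightarrow> (complex^3) aefun \<Rightarrow> state \<Rightarrow> bool" where
  "weak_solution Y a \<rho> F y \<longleftrightarrow>
     y \<in> Y \<and> (\<forall>y'\<in>Y. a y y' = ipV \<rho> (rep_aefun F) (rep_aefun (fst y')))"

end

theory Submission
 imports Defs
begin

text \<open>The imaginary part of the form controls \<open>\<parallel>u\<parallel>\<close>, since \<open>\<omega> \<noteq> 0\<close>. If a lower bound for the operator failed, there would be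
normalized states with vanishing residual, hence with \<open>u \<rightarrow> 0\<close> and \<open>\<nabla>\<psi> \<rightarrow> 0\<close>. Testing with \<open>u\<close> and with cut-offs of \<open>u\<close>
makes \<open>div u\<close> and \<open>\<partial>\<^sub>b u\<close> small relative to each other; the decisive test function is \<open>M\<^sub>2 \<nabla>\<eta>\<close>, where \<open>\<nabla>\<eta>\<close>
approximates \<open>M\<^sub>1 u\<close> in divergence and \<open>M\<^sub>1 \<approx> c \<surd>\<rho>\<close>, \<open>M\<^sub>2 \<approx> 1 / (c \<surd>\<rho>)\<close> near the support of \<open>b\<close>. As
\<open>\<parallel>Hess \<eta>\<parallel> = \<parallel>\<Delta>\<eta>\<parallel>\<close>, the flow term is at most \<open>\<parallel>c\<^sup>-\<^sup>1 b\<parallel>\<^sub>\<infinity>\<close> times the divergence term, so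
\<open>\<parallel>c\<^sup>-\<^sup>1 b\<parallel>\<^sub>\<infinity> < 1\<close>, which follows from the hypothesis, gives \<open>div u \<rightarrow> 0\<close> and \<open>\<partial>\<^sub>b u \<rightarrow> 0\<close>, a contradiction. The lower
bound yields closed range, and the sign of the imaginary part makes the orthogonal complement of the range trivial.\<close>

text \<open>No compactness is at hand: on an unbounded domain, u is controlled only through its
  divergence and one directional derivative. The damping takes its place: since u tends to 0 in
  norm, every commutator with a cut-off or weight, which contains u undifferentiated, vanishes in
  the limit. Only the indefinite part, c^2 times the divergence pairing minus the pairing of the
  directional derivatives, survives. The gradient approximates in divergence alone; its directional
  derivative is then computed classically and bounded by the Hessian. As \<open>\<rho>\<close> is
  bounded below only on balls, all fields are multiplied by its square root and live in unweighted
  L2; the reciprocal root in the weak identities is harmless against compactly supported test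
  functions. Lipschitz bounds for c and \<open>\<rho>\<close> near the support of b give smooth
  weights accurate up to factors 1 - \<delta> and 1 + \<delta>, and the closing constant tends to
  the bound for |b|/c as \<delta> tends to 0. Hilbert space arguments run over the reals; complex
  statements are recovered by testing with i y.\<close>

type_synonym 'a fn = "real^3 \<Rightarrow> 'a"

notation scaleR (infixr "*R" 75)

abbreviation LINT_leb (binder "LINT " [60] 60) where "LINT_leb f \<equiv> integral\<^sup>L lebesgue f"
abbreviation AE_leb (binder "AE " 10) where "AE_leb P \<equiv> AE x in lebesgue. P x"
abbreviation "LM \<equiv> borel_measurable lebesgue"
abbreviation "Lint \<equiv> integrable lebesgue"
abbreviation "test \<equiv> test_function UNIV"
abbreviation "pd \<equiv> pderiv_at"
abbreviation "weakd \<equiv> has_weak_pderiv UNIV"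
abbreviation "L1loc \<equiv> loc_integrable UNIV"
abbreviation "indB r \<equiv> indicator (ball 0 r)"
abbreviation tends (infixr "---->" 60) where "X ----> L \<equiv> (X \<longlongrightarrow> L) sequentially"

no_notation suminf (binder "\<Sum>" 10)
abbreviation sum3 :: "(3 \<Rightarrow> 'a::comm_monoid_add) \<Rightarrow> 'a" (binder "\<Sum>" 10) where "sum3 f \<equiv> sum f UNIV"

section \<open>Calculus of smooth functions and test functions\<close>

lemma pderiv_at_eq:
 assumes "(f has_derivative f') (at x)"
 shows "pd i f x = f' (axis i 1)"
 using frechet_derivative_at[OF assms] by (simp add: pderiv_at_def)

lemma linear_axis_sum:
 fixes L :: "('a::real_normed_vector) fn"
 assumes "linear L"
 shows "L h = (\<Sum>i. (h $ i) *R L (axis i 1))"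
proof -
 have "L h = L (\<Sum>i. (h $ i) *R axis i 1)"
  by (simp add: basis_expansion flip: scalar_mult_eq_scaleR)
 thus ?thesis
  by (simp add: linear_sum[OF assms] linear_scale[OF assms])
qed

lemma has_derivative_pderiv_at:
 fixes f :: "('a::real_normed_vector) fn"
 assumes "f differentiable (at x)"
 shows "(f has_derivative (%h. \<Sum>i. (h $ i) *R pd i f x)) (at x)"
proof -
 obtain f' where f': "(f has_derivative f') (at x)"
  using assms by (auto simp: differentiable_def)
 have "f' = (%h. \<Sum>i. (h $ i) *R pd i f x)"
  by (rule ext)
   (simp add: pderiv_at_eq[OF f'] linear_axis_sum[OF bounded_linear.linear[OF has_derivative_bounded_linear[OF f']], symmetric])
 with f' show ?thesis by simp
qed

lemma C_k_cont: "C_k k f ==> continuous_on UNIV f"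
 by (cases k) (auto intro: differentiable_imp_continuous_on simp: differentiable_on_def differentiable_at_imp_differentiable_on)

text \<open>The recursion for \<open>C_k\<close> mentions only the top order; lower orders follow
  because differentiability gives continuity at the bottom.\<close>

lemma C_k_SucD: "C_k (Suc k) f ==> C_k k f"
proof (induction k arbitrary: f)
 case 0
 thus ?case using C_k_cont[of "Suc 0" f] by (simp del: C_k.simps(2))
next
 case (Suc k)
 thus ?case by (metis C_k.simps(2))
qed

definition smooth :: "(('a::real_normed_vector) fn) => bool" where
 "smooth f \<longleftrightarrow> (\<forall>k. C_k k f)"

lemma smooth_C_k: "smooth f ==> C_k k f"
 by (simp add: smooth_def)

lemma smooth_diff: "smooth f ==> f differentiable (at x)"
 using smooth_C_k[of f "Suc 0"] by simp

lemma smooth_pderiv: "smooth f ==> smooth (pd i f)"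
 unfolding smooth_def by (meson C_k.simps(2))

lemma smooth_cont: "smooth f ==> continuous_on A f"
 using C_k_cont continuous_on_subset by (force simp: smooth_def)

lemma C_k_const: "C_k k (%x. c)"
proof (induction k arbitrary: c)
 case (Suc k)
 have "pd i (%x. c) = (%x. 0)" for i
  by (rule ext) (subst pderiv_at_eq[OF has_derivative_const], simp)
 with Suc show ?case by simp
qed simp

lemma pderiv_at_linear:
 assumes L: "bounded_linear L" and f: "f differentiable (at x)"
 shows "pd i (%x. L (f x)) x = L (pd i f x)"
proof -
 obtain f' where f': "(f has_derivative f') (at x)"
  using f by (auto simp: differentiable_def)
 show ?thesis
  by (simp add: pderiv_at_eq[OF bounded_linear.has_derivative[OF L f']] pderiv_at_eq[OF f'])
qed

lemma C_k_linear:
 assumes L: "bounded_linear L"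
 shows "C_k k f ==> C_k k (%x. L (f x))"
proof (induction k arbitrary: f)
 case 0
 thus ?case
  using bounded_linear.continuous_on[OF L] by simp
next
 case (Suc k)
 have "(%x. L (f x)) differentiable (at x)" for x
  using Suc.prems bounded_linear.has_derivative[OF L] unfolding C_k.simps differentiable_def by blast
 moreover have "pd i (%x. L (f x)) = (%x. L (pd i f x))" for i
  using Suc.prems by (intro ext pderiv_at_linear[OF L]) auto
 ultimately show ?case using Suc by simp
qed

lemma pderiv_at_add:
 assumes "f differentiable (at x)" "g differentiable (at x)"
 shows "pd i (%x. f x + g x) x = pd i f x + pd i g x"
proof -
 obtain f' g' where f': "(f has_derivative f') (at x)" "(g has_derivative g') (at x)"
  using assms by (auto simp: differentiable_def)
 show ?thesis
  by (simp add: pderiv_at_eq[OF has_derivative_add[OF f']] pderiv_at_eq[OF f'(1)] pderiv_at_eq[OF f'(2)])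
qed

lemma C_k_add: "C_k k f ==> C_k k g ==> C_k k (%x. f x + g x)"
proof (induction k arbitrary: f g)
 case 0
 thus ?case by (auto intro: continuous_intros)
next
 case (Suc k)
 have "pd i (%x. f x + g x) = (%x. pd i f x + pd i g x)" for i
  using Suc.prems by (intro ext pderiv_at_add) auto
 with Suc show ?case by (auto intro: differentiable_add)
qed

context bounded_bilinear begin

lemma pderiv_at_bilinear:
 assumes "f differentiable (at x)" "g differentiable (at x)"
 shows "pd i (%x. prod (f x) (g x)) x = prod (f x) (pd i g x) + prod (pd i f x) (g x)"
proof -
 obtain f' g' where f': "(f has_derivative f') (at x)" "(g has_derivative g') (at x)"
  using assms by (auto simp: differentiable_def)
 show ?thesis
  by (simp add: pderiv_at_eq[OF FDERIV[OF f']] pderiv_at_eq[OF f'(1)] pderiv_at_eq[OF f'(2)])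
qed

text \<open>By the Leibniz rule a derivative is a sum of two terms of the same bilinear shape, one
  factor differentiated, the other lowered by \<open>C_k_SucD\<close>. Stated for a general bilinear
  map, it serves scalar multiples, products, inner products and \<open>hdot\<close> alike.\<close>

lemma C_k_bilinear: "C_k k f ==> C_k k g ==> C_k k (%x. prod (f x) (g x))"
proof (induction k arbitrary: f g)
 case 0
 thus ?case by (auto intro: continuous_on)
next
 case (Suc k)
 have "(%x. prod (f x) (g x)) differentiable (at x)" for x
  using Suc.prems FDERIV unfolding C_k.simps differentiable_def by blast
 moreover have "pd i (%x. prod (f x) (g x)) = (%x. prod (f x) (pd i g x) + prod (pd i f x) (g x))" for i
  using Suc.prems by (intro ext pderiv_at_bilinear) auto
 moreover have "C_k k (%x. prod (f x) (pd i g x) + prod (pd i f x) (g x))" for i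
  using Suc.prems C_k_SucD[OF Suc.prems(1)] C_k_SucD[OF Suc.prems(2)] by (intro C_k_add Suc.IH) auto
 ultimately show ?case by simp
qed

lemma smooth_bilinear: "smooth f ==> smooth g ==> smooth (%x. prod (f x) (g x))"
 by (simp add: smooth_def C_k_bilinear)

end

lemma pderiv_at_affine:
 fixes f :: "('a::real_normed_vector) fn"
 assumes "f differentiable (at (z + s *R x))"
 shows "pd i (%x. f (z + s *R x)) x = s *R pd i f (z + s *R x)"
proof -
 obtain f' where f': "(f has_derivative f') (at (z + s *R x))"
  using assms by (auto simp: differentiable_def)
 have "((%x. f (z + s *R x)) has_derivative (%h. f' (s *R h))) (at x)"
  by (rule has_derivative_compose[where g=f]) (auto intro!: derivative_eq_intros f')
 thus ?thesis
  using linear_scale[OF bounded_linear.linear[OF has_derivative_bounded_linear[OF f']]]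
  by (simp add: pderiv_at_eq[OF f'] pderiv_at_eq)
qed

lemma C_k_affine:
 fixes f :: "('a::real_normed_vector) fn"
 shows "C_k k f ==> C_k k (%x. f (z + s *R x))"
proof (induction k arbitrary: f)
 case 0
 thus ?case by (auto intro!: continuous_intros continuous_on_compose2[of UNIV f])
next
 case (Suc k)
 have "(%x. f (z + s *R x)) differentiable (at x)" for x
 proof -
  obtain f' where f': "(f has_derivative f') (at (z + s *R x))"
   using Suc.prems by (auto simp: differentiable_def)
  have "((%x. f (z + s *R x)) has_derivative (%h. f' (s *R h))) (at x)"
   by (rule has_derivative_compose[where g=f]) (auto intro!: derivative_eq_intros f')
  thus ?thesis by (auto simp: differentiable_def)
 qed
 moreover have "pd i (%x. f (z + s *R x)) = (%x. s *R pd i f (z + s *R x))" for i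
  using Suc.prems by (intro ext pderiv_at_affine) auto
 ultimately show ?case
  using Suc.prems C_k_linear[OF bounded_linear_scaleR_right Suc.IH] by simp
qed

lemma smooth_const: "smooth (%x. c)"
 and smooth_add: "smooth f ==> smooth g ==> smooth (%x. f x + g x)"
 and smooth_linear: "bounded_linear L ==> smooth h ==> smooth (%x. L (h x))"
 and smooth_affine: "smooth h ==> smooth (%x. h (z + s *R x))"
 by (simp_all add: smooth_def C_k_const C_k_add C_k_linear C_k_affine)

lemma smooth_minus: "smooth f ==> smooth (%x. - f x)"
 by (rule smooth_linear[OF bounded_linear_minus[OF bounded_linear_ident]])

lemma smooth_diff_fun: "smooth f ==> smooth g ==> smooth (%x. f x - g x)"
 using smooth_add[OF _ smooth_minus, of f g] by simp

lemmas smooth_mult = bounded_bilinear.smooth_bilinear[OF bounded_bilinear_mult]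
lemmas pderiv_at_scaleR = bounded_bilinear.pderiv_at_bilinear[OF bounded_bilinear_scaleR]
lemmas pderiv_at_mult = bounded_bilinear.pderiv_at_bilinear[OF bounded_bilinear_mult]

lemma smooth_power: "smooth f ==> smooth (%x. f x ^ n :: real)"
 by (induction n) (simp_all add: smooth_const smooth_mult)

lemma smooth_prod: "(!!i. i \<in> I ==> smooth (f i)) ==> smooth (%x. \<Prod>i\<in>I. f i x :: real)"
 by (induction I rule: infinite_finite_induct) (simp_all add: smooth_const smooth_mult)

lemma pderiv_at_const [simp]: "pd i (%x. c) x = 0"
 by (subst pderiv_at_eq[OF has_derivative_const], simp)

lemma pderiv_at_zero_nbhd:
 assumes "open S" "x \<in> S" "!!y. y \<in> S ==> f y = 0"
 shows "pd i f x = 0"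
proof -
 have "(f has_derivative (%x. 0)) (at x)"
  by (rule has_derivative_transform_within_open[OF has_derivative_const[of 0] assms(1,2)])
   (simp add: assms)
 thus ?thesis by (simp add: pderiv_at_eq)
qed

lemma test_functionI:
 assumes "smooth f" "compact K" "K \<subseteq> D" "!!x. x \<notin> K ==> f x = 0"
 shows "test_function D f"
proof -
 have "{x. f x \<noteq> 0} \<subseteq> K" using assms(4) by auto
 hence "closure {x. f x \<noteq> 0} \<subseteq> K"
  using assms(2) by (simp add: closure_minimal compact_imp_closed)
 thus ?thesis
  using assms compact_Int_closed[OF assms(2), of "closure {x. f x \<noteq> 0}"]
  unfolding test_function_def smooth_def by (auto simp: Int_absorb1)
qed

lemma test_functionE:
 assumes "test_function D f"
 obtains K where "smooth f" "compact K" "K \<subseteq> D" "!!x. x \<notin> K ==> f x = 0"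
proof -
 let ?K = "closure {x. f x \<noteq> 0}"
 have z: "f x = 0" if "x \<notin> ?K" for x
  using that closure_subset[of "{x. f x \<noteq> 0}"] by blast
 thus ?thesis
  using that[of ?K] assms unfolding test_function_def smooth_def by blast
qed

lemma pderiv_at_zero_outside:
 assumes "compact K" "!!x. x \<notin> K ==> f x = 0" "x \<notin> K"
 shows "pd i f x = 0"
 by (rule pderiv_at_zero_nbhd[of "- K"]) (use assms in \<open>auto simp: compact_imp_closed\<close>)

lemma test_smooth: "test_function D f ==> smooth f"
 by (simp add: test_function_def smooth_def)

lemma test_diff: "test_function D f ==> f differentiable (at x)"
 by (simp add: test_smooth smooth_diff)

lemma test_cont: "test_function D f ==> continuous_on A f"
 by (simp add: test_smooth smooth_cont)

lemma test_mono: "test_function D f ==> D \<subseteq> D' ==> test_function D' f"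
 by (auto simp: test_function_def)

lemma test_pderiv: "test_function D f ==> test_function D (pd i f)"
 by (erule test_functionE) (rule test_functionI, erule smooth_pderiv, auto simp: pderiv_at_zero_outside)

lemma test_add:
 assumes "test_function D f" "test_function D g"
 shows "test_function D (%x. f x + g x)"
proof -
 obtain K where K: "smooth f" "compact K" "K \<subseteq> D" "!!x. x \<notin> K ==> f x = 0"
  by (rule test_functionE[OF assms(1)]) blast
 obtain L where L: "smooth g" "compact L" "L \<subseteq> D" "!!x. x \<notin> L ==> g x = 0"
  by (rule test_functionE[OF assms(2)]) blast
 show ?thesis
  by (rule test_functionI[of _ "K \<union> L"]) (use K L in \<open>auto simp: smooth_add\<close>)
qed

lemma test_linear: "bounded_linear L ==> test_function D f ==> test_function D (%x. L (f x))"
 by (erule test_functionE) (rule test_functionI, erule smooth_linear, auto simp: linear_simps(3))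

lemma (in bounded_bilinear) test_bilinear_left:
 "test_function D f ==> smooth g ==> test_function D (%x. prod (f x) (g x))"
 by (erule test_functionE) (rule test_functionI, erule (1) smooth_bilinear, auto simp: zero_left)

lemmas test_scaleR_left = bounded_bilinear.test_bilinear_left[OF bounded_bilinear_scaleR]
lemmas test_mult_left = bounded_bilinear.test_bilinear_left[OF bounded_bilinear_mult]
lemma test_zero: "test_function D (%x. 0)"
 by (rule test_functionI[of _ "{}"]) (simp_all add: smooth_const)

lemma test_sum: "(!!i. i \<in> I ==> test_function D (f i)) ==> test_function D (%x. \<Sum>i\<in>I. f i x)"
 by (induction I rule: infinite_finite_induct) (simp_all add: test_zero test_add)

lemma test_affine:
 fixes f :: "('a::real_normed_vector) fn"
 assumes "test_function D f" "s \<noteq> 0"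
 shows "test_function ((%x. (x - z) /\<^sub>R s) ` D) (%x. f (z + s *R x))"
proof -
 obtain K where K: "smooth f" "compact K" "K \<subseteq> D" "!!x. x \<notin> K ==> f x = 0"
  by (rule test_functionE[OF assms(1)]) blast
 show ?thesis
 proof (rule test_functionI[of _ "(%x. (x - z) /\<^sub>R s) ` K"])
  show "compact ((%x. (x - z) /\<^sub>R s) ` K)"
   by (intro compact_continuous_image continuous_intros K) (use assms in auto)
  fix x assume *: "x \<notin> (%x. (x - z) /\<^sub>R s) ` K"
  have "x = ((z + s *R x) - z) /\<^sub>R s" using assms by simp
  with * have "z + s *R x \<notin> K" by (metis imageI)
  thus "f (z + s *R x) = 0" by (rule K)
 qed (use K in \<open>auto simp: smooth_affine\<close>)
qed

lemma test_reflect: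
 fixes f :: "('a::real_normed_vector) fn"
 shows "test f ==> test (%x. f (z - x))"
 using test_affine[of UNIV f "-1" z] test_mono[of _ "%x. f (z - x)" UNIV] by simp

lemma test_translate:
 fixes f :: "('a::real_normed_vector) fn"
 shows "test_function D f ==> test_function ((%x. x + z) ` D) (%x. f (x - z))"
 using test_affine[of D f 1 "-z"] by simp

lemma pderiv_at_translate:
 fixes f :: "('a::real_normed_vector) fn"
 shows "smooth f ==> pd i (%x. f (x - z)) x = pd i f (x - z)"
 using pderiv_at_affine[of f "-z" 1 x i] by (simp add: smooth_diff)

lemma pderiv_at_reflect:
 fixes f :: "('a::real_normed_vector) fn"
 shows "smooth f ==> pd i (%x. f (z - x)) x = - pd i f (z - x)"
 using pderiv_at_affine[of f z "-1" x i] by (simp add: smooth_diff)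

lemma test_bounded:
 assumes "test_function D f"
 obtains B where "B > 0" "!!x. norm (f x) <= B"
proof -
 obtain K where K: "smooth f" "compact K" "K \<subseteq> D" "!!x. x \<notin> K ==> f x = 0"
  by (rule test_functionE[OF assms(1)]) blast
 have "bounded (f ` K)"
  by (intro compact_imp_bounded compact_continuous_image smooth_cont K)
 then obtain B where B: "B > 0" "!!x. x \<in> K ==> norm (f x) <= B"
  unfolding bounded_pos by auto
 show ?thesis
 proof (rule that[OF B(1)])
  show "norm (f x) <= B" for x
   using B K(4)[of x] by (cases "x \<in> K") auto
 qed
qed

section \<open>Bump functions\<close>

text \<open>The span of this family is closed under differentiation, so smoothness of exp(-1/t),
  extended by 0, follows by one induction over all \<open>k\<close> at once.\<close>

definition expk :: "nat => real => real" where
 "expk k t = (if t > 0 then (1/t)^k * exp (-1/t) else 0)"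

lemma expk_deriv: "(expk k has_real_derivative expk (k+2) t - real k * expk (k+1) t) (at t)"
proof (cases "t = 0")
 case False
 then consider "t > 0" | "t < 0" by linarith
 thus ?thesis
 proof cases
  case 1
  have "((%t. (1/t)^k * exp (-1/t)) has_real_derivative
    (real k * (1/t)^(k-1) * (- 1 / t^2)) * exp (-1/t) + (1/t)^k * (exp (-1/t) * (1 / t^2))) (at t)"
   using 1 by (auto intro!: derivative_eq_intros simp: power2_eq_square)
  moreover have "(real k * (1/t)^(k-1) * (- 1 / t^2)) * exp (-1/t) + (1/t)^k * (exp (-1/t) * (1 / t^2))
    = expk (k+2) t - real k * expk (k+1) t"
   using 1 by (cases k) (simp_all add: expk_def power2_eq_square field_simps)
  ultimately have "((%t. (1/t)^k * exp (-1/t)) has_real_derivative expk (k+2) t - real k * expk (k+1) t) (at t)"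
   by (rule DERIV_cong)
  thus ?thesis
   by (rule has_field_derivative_transform_within_open[of _ _ _ "{0<..}"]) (use 1 in \<open>auto simp: expk_def\<close>)
 next
  case 2
  have "((%t. 0) has_real_derivative expk (k+2) t - real k * expk (k+1) t) (at t)"
   using 2 by (simp add: expk_def)
  thus ?thesis
   by (rule has_field_derivative_transform_within_open[of _ _ _ "{..<0}"]) (use 2 in \<open>auto simp: expk_def\<close>)
 qed
next
 case True
 have lim: "((%s. s ^ (Suc k) / exp s) \<longlongrightarrow> 0) (at_top :: real filter)"
  by (rule tendsto_power_div_exp_0)
 \<comment> \<open>With s = 1/h the quotient is s^(k+1) / exp s, which tends to 0 as s tends to
   infinity.\<close>
 have r: "((%h. expk k h / h) \<longlongrightarrow> 0) (at_right 0)"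
 proof (rule Lim_transform_eventually)
  show "((%h. inverse h ^ (Suc k) / exp (inverse h)) \<longlongrightarrow> 0) (at_right (0::real))"
   by (rule filterlim_compose[OF lim filterlim_inverse_at_top_right])
  show "\<forall>\<^sub>F h in at_right 0. inverse h ^ (Suc k) / exp (inverse h) = expk k h / h"
   by (rule eventually_at_rightI[of 0 1]) (simp_all add: expk_def divide_inverse exp_minus mult_ac)
 qed
 have l: "((%h. expk k h / h) \<longlongrightarrow> 0) (at_left 0)"
  by (rule Lim_transform_eventually[OF tendsto_const], rule eventually_at_leftI[of "-1" 0]) (auto simp: expk_def)
 have "((%h. expk k h / h) \<longlongrightarrow> 0) (at 0)"
  using l r by (simp add: filterlim_at_split)
 thus ?thesis
  using True by (simp add: DERIV_def expk_def)
qed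

lemma C_k_expk: "C_k m (%x::real^3. expk k (c + s * (x $ i)))"
proof (induction m arbitrary: k)
 case 0
 have "continuous_on UNIV (expk k)"
  using DERIV_isCont[OF expk_deriv] by (simp add: continuous_on_eq_continuous_at)
 thus ?case
  by (auto intro!: continuous_intros continuous_on_compose2[of UNIV "expk k"])
next
 case (Suc m)
 let ?f = "%k. (%x::real^3. expk k (c + s * (x $ i)))"
 let ?D = "%x. expk (k+2) (c + s * (x $ i)) - real k * expk (k+1) (c + s * (x $ i))"
 have D: "(?f k has_derivative (%h. ?D x * (s * (h $ i)))) (at x)" for x
 proof -
  have "((%x::real^3. c + s * (x $ i)) has_derivative (%h. s * (h $ i))) (at x)"
   using has_derivative_add[OF has_derivative_const has_derivative_mult_right[OF bounded_linear.has_derivative[OF bounded_linear_vec_nth has_derivative_ident]]]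
   by simp
  from has_derivative_compose[OF this has_field_derivative_imp_has_derivative[OF expk_deriv[of k "c + s * (x $ i)"]]]
  show ?thesis by simp
 qed
 have P: "pd j (?f k) = (%x. (s * axis j 1 $ i) * (?f (k+2) x + (- real k) * ?f (k+1) x))" for j
  by (rule ext, subst pderiv_at_eq[OF D]) (simp add: algebra_simps)
 have "C_k m (%x. (s * axis j 1 $ i) * (?f (k+2) x + (- real k) * ?f (k+1) x))" for j
  by (intro C_k_linear[OF bounded_linear_mult_right] C_k_add Suc)
 thus ?case
  using D unfolding C_k.simps P differentiable_def by blast
qed

definition box_bump :: "real^3 => real^3 => real fn" where
 "box_bump a b x = (\<Prod>i\<in>UNIV. expk 0 (x $ i - a $ i) * expk 0 (b $ i - x $ i))"

lemma expk_0: "0 <= expk 0 t" "expk 0 t < 1" "expk 0 t > 0 \<longleftrightarrow> t > 0"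
 by (auto simp: expk_def)

lemma box_bump_smooth: "smooth (box_bump a b)"
proof -
 have "smooth (%x::real^3. expk 0 (x $ i - a $ i))" for i
  unfolding smooth_def using C_k_expk[of _ 0 "- a $ i" 1 i] by simp
 moreover have "smooth (%x::real^3. expk 0 (b $ i - x $ i))" for i
  unfolding smooth_def using C_k_expk[of _ 0 "b $ i" "-1" i] by simp
 ultimately show ?thesis
  unfolding box_bump_def[abs_def] by (intro smooth_prod smooth_mult)
qed

text \<open>Strictly below 1, and positive exactly on the open box: hence powers of one minus the
  bump tend to 0 on the box and remain 1 off it.\<close>

lemma box_bump_bounds: "0 <= box_bump a b x" "box_bump a b x < 1"
 "box_bump a b x > 0 \<longleftrightarrow> x \<in> box a b"
proof -
 have *: "0 <= expk 0 (x $ i - a $ i) * expk 0 (b $ i - x $ i)" for i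
  by (simp add: expk_0)
 have **: "expk 0 (x $ i - a $ i) * expk 0 (b $ i - x $ i) < 1" for i
 proof -
  have "expk 0 (x $ i - a $ i) * expk 0 (b $ i - x $ i) <= expk 0 (x $ i - a $ i) * 1"
   using expk_0 by (intro mult_left_mono) (auto simp: less_imp_le)
  with expk_0(2)[of "x $ i - a $ i"] show ?thesis by linarith
 qed
 show "0 <= box_bump a b x"
  unfolding box_bump_def by (intro prod_nonneg) (use * in auto)
 show "box_bump a b x < 1"
 proof -
  let ?f = "%i. expk 0 (x $ i - a $ i) * expk 0 (b $ i - x $ i)"
  have "box_bump a b x = ?f 1 * prod ?f (UNIV - {1})"
   unfolding box_bump_def by (rule prod.remove) auto
  moreover have "prod ?f (UNIV - {1}) <= 1"
   by (rule prod_le_1) (use * ** in \<open>auto simp: less_imp_le\<close>)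
  moreover have "?f 1 * prod ?f (UNIV - {1}) <= ?f 1 * 1"
   by (rule mult_left_mono) (use * calculation in auto)
  ultimately show ?thesis using **[of 1] by linarith
 qed
 have "box_bump a b x > 0 \<longleftrightarrow> (\<forall>i. expk 0 (x $ i - a $ i) * expk 0 (b $ i - x $ i) > 0)"
 proof
  assume "box_bump a b x > 0"
  have "expk 0 (x $ i - a $ i) * expk 0 (b $ i - x $ i) \<noteq> 0" for i
  proof
   assume "expk 0 (x $ i - a $ i) * expk 0 (b $ i - x $ i) = 0"
   hence "box_bump a b x = 0"
    unfolding box_bump_def by (intro prod_zero) (simp, blast)
   with \<open>box_bump a b x > 0\<close> show False by simp
  qed
  with * show "\<forall>i. expk 0 (x $ i - a $ i) * expk 0 (b $ i - x $ i) > 0"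
   by (simp add: less_le)
 qed (simp add: box_bump_def prod_pos)
 also have "... \<longleftrightarrow> (\<forall>i. expk 0 (x $ i - a $ i) > 0 \<and> expk 0 (b $ i - x $ i) > 0)"
  using expk_0 by (metis less_le mult_pos_pos mult_zero_left mult_zero_right)
 finally show "box_bump a b x > 0 \<longleftrightarrow> x \<in> box a b"
  by (simp add: expk_0 mem_box_cart)
qed

section \<open>Mean value theorem and symmetry of second derivatives\<close>

lemma pderiv_at_inner:
 fixes f :: "('a::real_inner) fn"
 assumes "f differentiable (at x)"
 shows "pd i (%x. f x \<bullet> v) x = pd i f x \<bullet> v"
 by (rule pderiv_at_linear[OF bounded_linear_inner_left assms])

lemma line_has_derivative:
 fixes f :: "real fn"
 assumes "!!x. f differentiable (at x)"
 shows "((%s. f (x + s *R h)) has_real_derivative (\<Sum>i. h $ i * pd i f (x + s *R h))) (at s)"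
proof -
 have "((%s. x + s *R h) has_derivative (%s. s *R h)) (at s)"
  by (auto intro!: derivative_eq_intros)
 from has_derivative_compose[OF this has_derivative_pderiv_at[OF assms]]
 show ?thesis
  by (rule has_derivative_imp_has_field_derivative) (simp add: sum_distrib_right sum_distrib_left mult_ac)
qed

lemma line_mvt:
 fixes f :: "real fn"
 assumes "!!x. f differentiable (at x)"
 obtains s where "0 < s" "s < 1" "f (x + h) - f x = (\<Sum>i. h $ i * pd i f (x + s *R h))"
proof -
 have "\<exists>s. 0 < s \<and> s < 1 \<and> f (x + 1 *R h) - f (x + 0 *R h) = (1 - 0) * (\<Sum>i. h $ i * pd i f (x + s *R h))"
  by (rule MVT2) (auto intro: line_has_derivative[OF assms])
 thus ?thesis using that by auto
qed

lemma axis_mvt: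
 fixes f :: "real fn"
 assumes "!!x. f differentiable (at x)" "t > 0"
 obtains s where "0 < s" "s < t" "f (x + axis i t) - f x = t * pd i f (x + axis i s)"
proof -
 obtain s where s: "0 < s" "s < 1" "f (x + axis i t) - f x = (\<Sum>j. axis i t $ j * pd j f (x + s *R axis i t))"
  by (rule line_mvt[OF assms(1), of x "axis i t"]) blast
 have "s *R axis i t = axis i (s * t)" by (simp add: axis_def vec_eq_iff)
 moreover have "(\<Sum>j. axis i t $ j * pd j f (x + axis i (s*t))) = t * pd i f (x + axis i (s*t))"
  by (subst sum.remove[of _ i]) (auto simp: axis_def intro!: sum.neutral)
 ultimately show ?thesis
  using s assms(2) by (intro that[of "s * t"]) auto
qed

text \<open>The mixed second difference over a small square is symmetric in the two directions. Two
  mean value steps, in either order, turn it into either mixed derivative at nearby points, and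
  continuity brings both back to \<open>x\<close>.\<close>

lemma pderiv_at_commute_real:
 fixes f :: "real fn"
 assumes "smooth f"
 shows "pd i (pd j f) x = pd j (pd i f) x"
proof (rule ccontr)
 assume neq: "pd i (pd j f) x \<noteq> pd j (pd i f) x"
 let ?A = "pd i (pd j f)" and ?B = "pd j (pd i f)"
 define e where "e = \<bar>?A x - ?B x\<bar> / 2"
 have e: "e > 0" using neq by (simp add: e_def)
 have d: "f differentiable (at x)" "pd k f differentiable (at x)" for x k
  using assms by (auto intro!: smooth_diff smooth_pderiv)
 have "continuous (at x) ?A" "continuous (at x) ?B"
  using smooth_cont[OF smooth_pderiv[OF smooth_pderiv[OF assms]], of UNIV] by (auto simp: continuous_on_eq_continuous_at)
 with e obtain d1 d2 where d12: "d1 > 0" "!!y. dist y x < d1 ==> \<bar>?A y - ?A x\<bar> < e"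
  "d2 > 0" "!!y. dist y x < d2 ==> \<bar>?B y - ?B x\<bar> < e"
  unfolding continuous_at_eps_delta dist_real_def by metis
 \<comment> \<open>The intermediate points lie within 2 t of \<open>x\<close>, which must stay below
   both radii of continuity.\<close>
 define t where "t = min d1 d2 / 3"
 have t: "t > 0" "2 * t < d1" "2 * t < d2" using d12 by (auto simp: t_def)
 have near: "dist (x + axis k r + axis l s) x < 2 * t" if "0 < r" "r < t" "0 < s" "s < t" for k l r s
 proof -
  have "norm (axis k r + axis l s :: real^3) <= norm (axis k r :: real^3) + norm (axis l s :: real^3)"
   by (rule norm_triangle_ineq)
  thus ?thesis using that by (simp add: dist_norm add.assoc norm_eq_sqrt_inner[of "axis _ _"] inner_axis_axis)
 qed
 have tr: "(%y. f (y + v) - f y) differentiable (at y)"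
  "pd k (%y. f (y + v) - f y) y = pd k f (y + v) - pd k f y" for v y k
 proof -
  have s: "smooth (%y. f (y + v))" using smooth_affine[OF assms, of v 1] by (simp add: add.commute)
  thus "(%y. f (y + v) - f y) differentiable (at y)" by (intro smooth_diff smooth_diff_fun assms)
  show "pd k (%y. f (y + v) - f y) y = pd k f (y + v) - pd k f y"
   using pderiv_at_add[OF smooth_diff[OF s] smooth_diff[OF smooth_minus[OF assms]], of k y]
    pderiv_at_affine[of f v 1 y k] pderiv_at_linear[OF bounded_linear_minus[OF bounded_linear_ident] d(1), of k y] d(1)
   by (simp add: add.commute)
 qed
 have main: "\<exists>r s. 0 < r \<and> r < t \<and> 0 < s \<and> s < t \<and>
   f (x + axis k t + axis l t) - f (x + axis k t) - (f (x + axis l t) - f x)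
    = t * t * pd l (pd k f) (x + axis k r + axis l s)" for k l
 proof -
  obtain r where r: "0 < r" "r < t" "(%y. f (y + axis l t) - f y) (x + axis k t) - (%y. f (y + axis l t) - f y) x
    = t * pd k (%y. f (y + axis l t) - f y) (x + axis k r)"
   by (rule axis_mvt[OF tr(1)[of "axis l t"] t(1), of x k]) blast
  obtain s where s: "0 < s" "s < t" "pd k f (x + axis k r + axis l t) - pd k f (x + axis k r)
    = t * pd l (pd k f) (x + axis k r + axis l s)"
   by (rule axis_mvt[where f="pd k f" and x="x + axis k r" and i=l, OF d(2) t(1)]) blast
  show ?thesis
   using r s tr(2) by (intro exI[of _ r] exI[of _ s]) (simp add: algebra_simps)
 qed
 obtain r s where rs: "0 < r" "r < t" "0 < s" "s < t"
   "f (x + axis i t + axis j t) - f (x + axis i t) - (f (x + axis j t) - f x) = t * t * ?B (x + axis i r + axis j s)"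
  using main[of i j] by blast
 obtain r' s' where rs': "0 < r'" "r' < t" "0 < s'" "s' < t"
   "f (x + axis j t + axis i t) - f (x + axis j t) - (f (x + axis i t) - f x) = t * t * ?A (x + axis j r' + axis i s')"
  using main[of j i] by blast
 have eq: "x + axis j t + axis i t = x + axis i t + axis j t"
  by (simp add: add.assoc add.commute)
 hence "t * t * ?B (x + axis i r + axis j s) = t * t * ?A (x + axis j r' + axis i s')"
  unfolding rs(5)[symmetric] rs'(5)[symmetric] eq by simp
 hence "?B (x + axis i r + axis j s) = ?A (x + axis j r' + axis i s')" using t by simp
 moreover have "\<bar>?B (x + axis i r + axis j s) - ?B x\<bar> < e"
  using near[OF rs(1-4), of i j] t by (intro d12) linarith
 moreover have "\<bar>?A (x + axis j r' + axis i s') - ?A x\<bar> < e"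
  using near[OF rs'(1-4), of j i] t by (intro d12) linarith
 ultimately have "\<bar>?A x - ?B x\<bar> < 2 * e" by linarith
 thus False by (simp add: e_def)
qed

lemma pderiv_at_commute:
 fixes f :: "('a::euclidean_space) fn"
 assumes "smooth f"
 shows "pd i (pd j f) x = pd j (pd i f) x"
proof (rule euclidean_eqI)
 fix v :: 'a assume "v \<in> Basis"
 have s: "smooth (%x. f x \<bullet> v)"
  by (rule smooth_linear[OF bounded_linear_inner_left assms])
 have d: "f differentiable (at x)" "pd k f differentiable (at x)" for x k
  using assms by (auto intro!: smooth_diff smooth_pderiv)
 have *: "pd k (%x. f x \<bullet> v) = (%x. pd k f x \<bullet> v)" for k
  by (intro ext pderiv_at_inner d)
 show "pd i (pd j f) x \<bullet> v = pd j (pd i f) x \<bullet> v"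
  using pderiv_at_commute_real[OF s, of i j x] by (simp add: * pderiv_at_inner d)
qed

section \<open>Integration against test functions\<close>

text \<open>The test function is bounded and vanishes off a compact set, so the product is dominated
  by a multiple of \<open>f\<close> on that set. A general bilinear product covers every pairing
  that occurs later.\<close>

lemma integrable_test:
 fixes f :: "('b::euclidean_space) fn" and \<eta> :: "('a::euclidean_space) fn"
  and prod :: "'a => 'b => 'c::euclidean_space"
 assumes "bounded_bilinear prod" "test_function D \<eta>" "loc_integrable D f"
 shows "Lint (%x. prod (\<eta> x) (f x))"
proof -
 interpret bounded_bilinear prod by fact
 obtain K where K: "compact K" "K \<subseteq> D" "!!x. x \<notin> K ==> \<eta> x = 0"
  by (rule test_functionE[OF assms(2)]) blast
 obtain B where B: "B > 0" "!!x. norm (\<eta> x) <= B"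
  by (rule test_bounded[OF assms(2)]) blast
 obtain C where C: "C > 0" "!!a b. norm (prod a b) <= norm a * norm b * C"
  using pos_bounded by blast
 have int: "Lint (%x. indicator K x *R f x)"
  using assms(3) K unfolding loc_integrable_def set_integrable_def by blast
 have eq: "prod (\<eta> x) (f x) = prod (\<eta> x) (indicator K x *R f x)" for x
  using K(3)[of x] by (cases "x \<in> K") (auto simp: zero_left)
 have m: "\<eta> \<in> LM"
  using borel_measurable_continuous_onI[OF test_cont[OF assms(2)]] by (simp add: measurable_completion)
 show ?thesis
  unfolding eq
 proof (rule Bochner_Integration.integrable_bound[OF integrable_mult_left[of "B * C", OF integrable_norm[OF int]]])
  have "(%(a, b). prod a b) \<in> borel_measurable (borel \<Otimes>\<^sub>M borel)"
   unfolding borel_prod by (intro borel_measurable_continuous_onI) (auto simp: split_beta intro!: continuous_on continuous_intros)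
  from measurable_compose[OF measurable_Pair[OF m borel_measurable_integrable[OF int]] this]
  show "(%x. prod (\<eta> x) (indicat_real K x *R f x)) \<in> LM" by simp
  show "AE x. norm (prod (\<eta> x) (indicat_real K x *R f x)) <= norm (norm (indicat_real K x *R f x) * (B * C))"
  proof (rule AE_I2)
   fix x
   have "norm (prod (\<eta> x) (indicat_real K x *R f x)) <= norm (\<eta> x) * norm (indicat_real K x *R f x) * C"
    by (rule C)
   also have "... <= B * norm (indicat_real K x *R f x) * C"
    using B C by (intro mult_right_mono) auto
   finally show "norm (prod (\<eta> x) (indicat_real K x *R f x)) <= norm (norm (indicat_real K x *R f x) * (B * C))"
    using B C by (simp add: mult_ac abs_mult)
  qed
 qed
qed

lemmas integrable_test_scaleR = integrable_test[OF bounded_bilinear_scaleR]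

lemma loc_integrable_continuous:
 fixes f :: "('a::euclidean_space) fn"
 assumes "continuous_on UNIV f" shows "loc_integrable D f"
proof -
 have "Lint (%x. indicator K x *R f x)" if "compact K" for K
 proof -
  have "(%x. indicator K x *R f x) = (%x. if x \<in> K then f x else 0)"
   by auto
  hence "integrable lborel (%x. indicator K x *R f x)"
   using borel_integrable_compact[OF that continuous_on_subset[OF assms subset_UNIV]] by simp
  thus ?thesis
   using integrable_completion borel_measurable_integrable by blast
 qed
 thus ?thesis by (simp add: loc_integrable_def set_integrable_def)
qed

lemma loc_integrable_linear:
 assumes "bounded_linear L" "loc_integrable D f"
 shows "loc_integrable D (%x. L (f x))"
 unfolding loc_integrable_def
proof (intro allI impI)
 fix K assume "compact K \<and> K \<subseteq> D"
 hence "Lint (%x. indicator K x *R f x)"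
  using assms(2) unfolding loc_integrable_def set_integrable_def by blast
 from integrable_bounded_linear[OF assms(1) this]
 show "set_integrable lebesgue K (%x. L (f x))"
  by (simp add: set_integrable_def linear_simps(5)[OF assms(1)])
qed

lemma loc_integrable_add:
 assumes "loc_integrable D f" "loc_integrable D g"
 shows "loc_integrable D (%x. f x + g x)"
 unfolding loc_integrable_def set_integrable_def scaleR_add_right
proof (intro allI impI Bochner_Integration.integrable_add)
 fix K assume K: "compact K \<and> K \<subseteq> D"
 show "Lint (%x. indicator K x *R f x)" "Lint (%x. indicator K x *R g x)"
  using assms K unfolding loc_integrable_def set_integrable_def by simp_all
qed

lemma test_integrable:
 fixes \<eta> :: "('a::euclidean_space) fn"
 assumes "test_function D \<eta>" shows "Lint \<eta>"
proof -
 have "Lint (%x. (%a (b::real). b *R a) (\<eta> x) ((%_. 1) x))"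
  by (intro integrable_test[of "%a (b::real). b *R a" D \<eta>] bounded_bilinear.flip[OF bounded_bilinear_scaleR] assms
    loc_integrable_continuous continuous_on_const)
 thus ?thesis by simp
qed

lemma lborel_distr_affine:
 fixes z :: "'a::euclidean_space"
 assumes "\<bar>s\<bar> = 1"
 shows "distr lborel borel (%x. z + s *R x) = lborel"
proof -
 have "lborel = density (distr lborel borel (%x. z + s *R x)) (%_. \<bar>s\<bar> ^ DIM('a))"
  by (rule lborel_affine) (use assms in auto)
 also have "... = distr lborel borel (%x. z + s *R x)"
  unfolding assms by (simp add: density_1)
 finally show ?thesis by (rule sym)
qed

lemma integral_reflect:
 fixes \<eta> :: "('a::euclidean_space) fn"
 assumes "\<eta> \<in> borel_measurable borel"
 shows "(LINT x. \<eta> (z - x)) = (LINT x. \<eta> x)"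
proof -
 have [measurable]: "\<eta> \<in> borel_measurable borel" by fact
 have "(LINT x. \<eta> (z - x)) = (LINT x|lborel. \<eta> (z + (-1) *R x))"
  by (simp add: integral_completion)
 also have "... = (LINT x|distr lborel borel (%x. z + (-1) *R x). \<eta> x)"
  by (rule integral_distr[symmetric]) auto
 also have "... = (LINT x|lborel. \<eta> x)"
  by (subst lborel_distr_affine) auto
 finally show ?thesis by (simp add: integral_completion)
qed

section \<open>Convolution with test functions\<close>

definition conv :: "(('a::euclidean_space) fn) => (real fn) => 'a fn" where
 "conv g \<phi> z = (LINT x. \<phi> (z - x) *R g x)"

lemma norm_sum_vec_le:
 fixes h :: "real^3" and g :: "3 => real"
 assumes "!!i. \<bar>g i\<bar> <= B"
 shows "\<bar>\<Sum>i. h $ i * g i\<bar> <= 3 * (norm h * B)"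
proof -
 have "\<bar>\<Sum>i. h $ i * g i\<bar> <= (\<Sum>i\<in>(UNIV::3 set). norm h * B)"
 proof (rule order_trans[OF sum_abs], rule sum_mono)
  show "\<bar>h $ i * g i\<bar> <= norm h * B" for i
   unfolding abs_mult by (intro mult_mono assms component_le_norm_cart) auto
 qed
 thus ?thesis by simp
qed

lemma test_grad_bounded:
 fixes \<phi> :: "('a::real_normed_vector) fn"
 assumes "test_function D \<phi>"
 obtains B where "B > 0" "!!i x. norm (pd i \<phi> x) <= B"
proof -
 have "\<exists>B. B > 0 \<and> (\<forall>x. norm (pd i \<phi> x) <= B)" for i
  using test_bounded[OF test_pderiv[OF assms, of i]] by metis
 then obtain B where B: "!!i. B i > 0" "!!i x. norm (pd i \<phi> x) <= B i" by metis
 have "B i <= sum B UNIV" for i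
  using B(1) by (intro member_le_sum) (auto simp: less_imp_le)
 with B show ?thesis
  by (intro that[of "sum B UNIV"]) (auto intro!: sum_pos order_trans[OF B(2)])
qed

lemma test_lipschitz:
 fixes \<phi> :: "real fn"
 assumes "test_function D \<phi>"
 obtains L where "L > 0" "!!x h. \<bar>\<phi> (x + h) - \<phi> x\<bar> <= L * norm h"
proof -
 obtain B where B: "B > 0" "!!i x. norm (pd i \<phi> x) <= B"
  by (rule test_grad_bounded[OF assms]) blast
 show ?thesis
 proof (rule that[of "3 * B"])
  fix x h
  obtain s where s: "\<phi> (x + h) - \<phi> x = (\<Sum>i. h $ i * pd i \<phi> (x + s *R h))"
   by (rule line_mvt[OF test_diff[OF assms]]) blast
  show "\<bar>\<phi> (x + h) - \<phi> x\<bar> <= 3 * B * norm h"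
   unfolding s using norm_sum_vec_le[of "%i. pd i \<phi> (x + s *R h)" B h] B by (simp add: mult_ac)
 qed (use B in simp)
qed

text \<open>The gradient is Lipschitz, so the mean value theorem leaves a quadratic remainder. Its
  constant does not depend on the base point, which is what differentiation under an integral
  requires.\<close>

lemma test_taylor:
 fixes \<phi> :: "real fn"
 assumes "test_function D \<phi>"
 obtains L where "L > 0" "!!x h. \<bar>\<phi> (x + h) - \<phi> x - (\<Sum>i. h $ i * pd i \<phi> x)\<bar> <= L * (norm h)^2"
proof -
 have "\<exists>L. L > 0 \<and> (\<forall>x h. \<bar>pd i \<phi> (x + h) - pd i \<phi> x\<bar> <= L * norm h)" for i
  using test_lipschitz[OF test_pderiv[OF assms, of i]] by metis
 then obtain L where L: "!!i. L i > 0" "!!i x h. \<bar>pd i \<phi> (x + h) - pd i \<phi> x\<bar> <= L i * norm h"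
  by metis
 have "L i <= sum L UNIV" for i
  using L(1) by (intro member_le_sum) (auto simp: less_imp_le)
 hence L': "\<bar>pd i \<phi> (x + h) - pd i \<phi> x\<bar> <= sum L UNIV * norm h" for i x h
  using L(2)[of i x h] by (meson mult_right_mono norm_ge_zero order_trans)
 have Lp: "sum L UNIV > 0" using L by (intro sum_pos) auto
 show ?thesis
 proof (rule that[of "3 * sum L UNIV"])
  fix x h
  obtain s where s: "0 < s" "s < 1" "\<phi> (x + h) - \<phi> x = (\<Sum>i. h $ i * pd i \<phi> (x + s *R h))"
   by (rule line_mvt[OF test_diff[OF assms]]) blast
  have "\<bar>pd i \<phi> (x + s *R h) - pd i \<phi> x\<bar> <= sum L UNIV * norm h" for i
  proof -
   have "\<bar>pd i \<phi> (x + s *R h) - pd i \<phi> x\<bar> <= sum L UNIV * norm (s *R h)" by (rule L')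
   also have "... <= sum L UNIV * norm h"
    using s Lp by (intro mult_left_mono) (auto simp: mult_left_le_one_le)
   finally show ?thesis .
  qed
  from norm_sum_vec_le[OF this, of h]
  show "\<bar>\<phi> (x + h) - \<phi> x - (\<Sum>i. h $ i * pd i \<phi> x)\<bar> <= 3 * sum L UNIV * (norm h)^2"
   unfolding s by (simp add: sum_subtractf[symmetric] right_diff_distrib[symmetric] power2_eq_square mult_ac)
 qed (use Lp in simp)
qed

lemma conv_integrable:
 assumes "test \<phi>" "L1loc g"
 shows "Lint (%x. \<phi> (z - x) *R g x)"
 by (rule integrable_test_scaleR[OF test_reflect[OF assms(1)] assms(2)])

text \<open>The uniform quadratic Taylor remainder of \<open>\<phi>\<close>, integrated against
  \<open>g\<close> over a fixed ball, bounds the error of the linearization by a multiple of the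
  squared increment.\<close>

lemma conv_has_derivative:
 fixes g :: "('a::euclidean_space) fn"
 assumes \<phi>: "test \<phi>" and g: "L1loc g"
 shows "(conv g \<phi> has_derivative (%h. \<Sum>i. h $ i *R conv g (pd i \<phi>) z)) (at z)"
proof -
 obtain K where K: "compact K" "!!x. x \<notin> K ==> \<phi> x = 0"
  by (rule test_functionE[OF \<phi>]) blast
 obtain r where r: "!!x. x \<in> K ==> norm x <= r"
  using K(1) compact_imp_bounded bounded_iff by metis
 obtain L where L: "L > 0" "!!x h. \<bar>\<phi> (x + h) - \<phi> x - (\<Sum>i. h $ i * pd i \<phi> x)\<bar> <= L * (norm h)^2"
  by (rule test_taylor[OF \<phi>]) blast
 \<comment> \<open>For increments of norm at most 1, both shifted copies of \<open>\<phi>\<close>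
   vanish when \<open>x\<close> is outside this ball.\<close>
 let ?C = "cball z (r + 1)"
 have int: "Lint (%x. indicator ?C x *R g x)"
  using g unfolding loc_integrable_def set_integrable_def by simp
 let ?M = "LINT x. norm (indicator ?C x *R g x)"
 let ?D = "%h. \<Sum>i. h $ i *R conv g (pd i \<phi>) z"
 have bl: "bounded_linear ?D"
  by (intro bounded_linear_sum bounded_linear_scaleR_const bounded_linear_vec_nth)
 have est: "norm (conv g \<phi> (z + h) - conv g \<phi> z - ?D h) <= L * (norm h)^2 * ?M" if h: "norm h <= 1" for h
 proof -
  let ?R = "%x. \<phi> (z - x + h) - \<phi> (z - x) - (\<Sum>i. h $ i * pd i \<phi> (z - x))"
  have i1: "Lint (%x. \<phi> (z + h - x) *R g x)" "Lint (%x. \<phi> (z - x) *R g x)"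
   "!!i. Lint (%x. pd i \<phi> (z - x) *R g x)"
   using conv_integrable[OF \<phi> g] conv_integrable[OF test_pderiv[OF \<phi>] g] by auto
  have "conv g \<phi> (z + h) - conv g \<phi> z - ?D h =
   (LINT x. \<phi> (z + h - x) *R g x - \<phi> (z - x) *R g x - (\<Sum>i. h $ i *R (pd i \<phi> (z - x) *R g x)))"
   using i1 by (simp add: conv_def del: scaleR_scaleR)
  also have "... = (LINT x. ?R x *R g x)"
   by (rule arg_cong[of _ _ "integral\<^sup>L lebesgue"], rule ext) (simp add: algebra_simps scaleR_left.sum[symmetric] scaleR_left_diff_distrib)
  also have "norm ... <= (LINT x. L * (norm h)^2 * norm (indicator ?C x *R g x))"
  proof (rule order_trans[OF integral_norm_bound integral_mono], rule integrable_norm)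
   have "Lint (%x. \<phi> (z + h - x) *R g x - \<phi> (z - x) *R g x - (\<Sum>i. h $ i *R (pd i \<phi> (z - x) *R g x)))"
    using i1 by (auto simp del: scaleR_scaleR)
   also have "(%x. \<phi> (z + h - x) *R g x - \<phi> (z - x) *R g x - (\<Sum>i. h $ i *R (pd i \<phi> (z - x) *R g x))) = (%x. ?R x *R g x)"
    by (rule ext) (simp add: algebra_simps scaleR_left.sum[symmetric] scaleR_left_diff_distrib)
   finally show "Lint (%x. ?R x *R g x)" .
   show "Lint (%x. L * (norm h)^2 * norm (indicator ?C x *R g x))"
    by (intro integrable_mult_right integrable_norm int)
   fix x
   show "norm (?R x *R g x) <= L * (norm h)^2 * norm (indicator ?C x *R g x)"
   proof (cases "x \<in> ?C")
    case True
    thus ?thesis using L(2)[of "z - x" h] by (simp add: mult_right_mono)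
   next
    case False
    hence "norm (z - x) > r + 1" by (simp add: dist_norm)
    moreover have "norm (z - x) <= norm (z - x + h) + norm h"
     using norm_triangle_ineq4[of "z - x + h" h] by simp
    ultimately have "norm (z - x + h) > r" using h by linarith
    with r have *: "z - x \<notin> K" "z - x + h \<notin> K"
     using \<open>norm (z - x) > r + 1\<close> by (auto dest!: r)
    with K have "?R x = 0" by (simp add: pderiv_at_zero_outside[OF K])
    thus ?thesis using False by simp
   qed
  qed
  finally show ?thesis using int by simp
 qed
 have "((%y. norm (conv g \<phi> y - conv g \<phi> z - ?D (y - z)) / norm (y - z)) \<longlongrightarrow> 0) (at z)"
 proof (rule tendsto_sandwich[OF always_eventually _ tendsto_const])
  show "\<forall>y. 0 <= norm (conv g \<phi> y - conv g \<phi> z - ?D (y - z)) / norm (y - z)" by simp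
  show "\<forall>\<^sub>F y in at z. norm (conv g \<phi> y - conv g \<phi> z - ?D (y - z)) / norm (y - z) <= L * ?M * norm (y - z)"
   unfolding eventually_at
  proof (intro exI[of _ 1] conjI ballI impI)
   fix y assume "y \<noteq> z \<and> dist y z < 1"
   thus "norm (conv g \<phi> y - conv g \<phi> z - ?D (y - z)) / norm (y - z) <= L * ?M * norm (y - z)"
    using est[of "y - z"] by (simp add: dist_norm divide_le_eq power2_eq_square mult_ac)
  qed simp
  have "((%y. L * ?M * norm (y - z)) \<longlongrightarrow> L * ?M * norm (z - z)) (at z)"
   by (intro tendsto_intros)
  thus "((%y. L * ?M * norm (y - z)) \<longlongrightarrow> 0) (at z)" by simp
 qed
 thus ?thesis
  using bl by (simp add: has_derivative_def Lim_within divide_inverse mult.commute has_derivative_iff_norm)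
qed

lemma pderiv_at_conv:
 assumes "test \<phi>" "L1loc g"
 shows "pd i (conv g \<phi>) z = conv g (pd i \<phi>) z"
 unfolding pderiv_at_eq[OF conv_has_derivative[OF assms]]
 by (subst sum.remove[of _ i]) (auto simp: axis_def intro!: sum.neutral)

lemma smooth_conv:
 assumes "test \<phi>" "L1loc g"
 shows "smooth (conv g \<phi>)"
proof -
 have "C_k k (conv g \<phi>)" for k
  using assms(1)
 proof (induction k arbitrary: \<phi>)
  case 0
  thus ?case
   using has_derivative_continuous[OF conv_has_derivative[OF 0 assms(2)]] by (simp add: continuous_on_eq_continuous_at)
 next
  case (Suc k)
  have "pd i (conv g \<phi>) = conv g (pd i \<phi>)" for i
   by (intro ext pderiv_at_conv Suc.prems assms)
  thus ?case
   using Suc conv_has_derivative[OF Suc.prems assms(2)] by (auto simp: differentiable_def test_pderiv)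
 qed
 thus ?thesis by (simp add: smooth_def)
qed

section \<open>Vanishing integrals of derivatives and the fundamental lemma of the calculus of
  variations\<close>

lemma integral_pderiv_zero_real:
 fixes \<phi> :: "real fn"
 assumes "test_function D \<phi>"
 shows "(LINT x. pd i \<phi> x) = 0"
proof -
 have \<phi>: "test \<phi>" using assms test_mono by blast
 have m: "\<phi> \<in> borel_measurable borel" "pd i \<phi> \<in> borel_measurable borel"
  using test_cont[OF \<phi>] test_cont[OF test_pderiv[OF \<phi>]] by (auto intro!: borel_measurable_continuous_onI)
 have l: "L1loc (%_::real^3. 1::real)" by (rule loc_integrable_continuous) simp
 \<comment> \<open>Convolution with the constant 1 does not depend on the point, so its partial
   derivative vanishes; that derivative is the convolution of 1 with the derivative of
   \<open>\<phi>\<close>, hence the wanted integral.\<close>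
 have "conv (%_. 1::real) \<phi> = (%z. LINT x. \<phi> x)"
  by (rule ext) (simp add: conv_def integral_reflect[OF m(1)])
 hence "pd i (conv (%_. 1::real) \<phi>) 0 = 0" by (simp only: pderiv_at_const)
 thus ?thesis
  by (simp add: pderiv_at_conv[OF \<phi> l] conv_def integral_reflect[OF m(2), of 0, simplified])
qed

lemma integral_pderiv_zero:
 fixes \<phi> :: "('a::euclidean_space) fn"
 assumes "test_function D \<phi>"
 shows "(LINT x. pd i \<phi> x) = 0"
proof (rule euclidean_eqI)
 fix v :: 'a
 have "test_function D (%x. \<phi> x \<bullet> v)"
  by (rule test_linear[OF bounded_linear_inner_left assms])
 from integral_pderiv_zero_real[OF this]
 have "(LINT x. pd i \<phi> x \<bullet> v) = 0"
  by (simp add: pderiv_at_inner test_diff[OF assms])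
 thus "(LINT x. pd i \<phi> x) \<bullet> v = 0 \<bullet> v"
  by (simp only: integral_inner_left[OF test_integrable[OF test_pderiv[OF assms]]] inner_zero_left)
qed

text \<open>Test functions between 0 and the indicator of the open box, converging to it pointwise
  as \<open>n\<close> grows.\<close>

definition box_approx :: "real^3 => real^3 => nat => real fn" where
 "box_approx a b n x = 1 - (1 - box_bump a b x) ^ n"

lemma box_approx_test:
 assumes "cbox a b \<subseteq> D"
 shows "test_function D (box_approx a b n)"
proof (rule test_functionI[of _ "cbox a b"])
 show "smooth (box_approx a b n)"
  unfolding box_approx_def[abs_def]
  by (intro smooth_diff_fun smooth_power smooth_const box_bump_smooth)
 fix x assume "x \<notin> cbox a b"
 hence "x \<notin> box a b" using box_subset_cbox by blast
 hence "box_bump a b x = 0"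
  using box_bump_bounds(1,3)[of a b x] by linarith
 thus "box_approx a b n x = 0" by (simp add: box_approx_def)
qed (use assms in auto)

lemma box_approx_bounds: "0 <= box_approx a b n x" "box_approx a b n x <= indicator (box a b) x"
proof -
 have b: "0 <= 1 - box_bump a b x" "1 - box_bump a b x <= 1"
  using box_bump_bounds[of a b x] by simp_all
 hence "(1 - box_bump a b x) ^ n <= 1" by (intro power_le_one)
 thus "0 <= box_approx a b n x" by (simp add: box_approx_def)
 show "box_approx a b n x <= indicator (box a b) x"
 proof (cases "x \<in> box a b")
  case True
  thus ?thesis using zero_le_power[OF b(1)] by (simp add: box_approx_def)
 next
  case False
  hence "box_bump a b x = 0"
   using box_bump_bounds(1,3)[of a b x] by linarith
  thus ?thesis using False by (simp add: box_approx_def)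
 qed
qed

lemma box_approx_limit: "(%n. box_approx a b n x) ----> indicator (box a b) x"
proof (cases "x \<in> box a b")
 case True
 hence "0 <= 1 - box_bump a b x" "1 - box_bump a b x < 1"
  using box_bump_bounds[of a b x] by simp_all
 hence "(%n. (1 - box_bump a b x) ^ n) ----> 0" by (intro LIMSEQ_realpow_zero)
 from tendsto_diff[OF tendsto_const[of 1] this]
 show ?thesis using True by (simp add: box_approx_def)
next
 case False
 hence "box_bump a b x = 0"
  using box_bump_bounds(1,3)[of a b x] by linarith
 thus ?thesis using False by (simp add: box_approx_def)
qed

text \<open>Dominated convergence along \<open>box_approx\<close>, with the restriction of
  \<open>f\<close> to the box as majorant.\<close>

lemma integral_box_zero:
 fixes f :: "real fn"
 assumes f: "loc_integrable D f" and ab: "cbox a b \<subseteq> D"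
  and z: "!!\<eta>. test_function D \<eta> ==> (LINT x. \<eta> x * f x) = 0"
 shows "Lint (%x. indicator (box a b) x * f x)"
  "(LINT x. indicator (box a b) x * f x) = 0"
proof -
 have int: "Lint (%x. indicator (cbox a b) x * f x)"
  using f ab unfolding loc_integrable_def set_integrable_def by simp
 have eq: "indicator (box a b) x * f x = indicator (box a b) x * (indicator (cbox a b) x * f x)" for x
  using box_subset_cbox[of a b] by (auto split: split_indicator)
 have bm: "box a b \<in> sets lebesgue" by simp
 show int': "Lint (%x. indicator (box a b) x * f x)"
  unfolding eq using integrable_mult_indicator[OF bm int] by simp
 have "(%n. LINT x. box_approx a b n x * f x) ----> (LINT x. indicator (box a b) x * f x)"
 proof (rule integral_dominated_convergence)
  show "(%x. indicator (box a b) x * f x) \<in> LM"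
   using int' by (rule borel_measurable_integrable)
  show "(%x. box_approx a b n x * f x) \<in> LM" for n
   using borel_measurable_integrable[OF integrable_test_scaleR[OF box_approx_test[OF ab] f]] by simp
  show "Lint (%x. \<bar>indicator (box a b) x * f x\<bar>)"
   using integrable_abs[OF int'] .
  show "AE x. (%n. box_approx a b n x * f x) ----> indicator (box a b) x * f x"
   by (intro AE_I2 tendsto_mult box_approx_limit tendsto_const)
  show "AE x. norm (box_approx a b n x * f x) <= \<bar>indicator (box a b) x * f x\<bar>" for n
  proof (rule AE_I2)
   fix x
   have "\<bar>box_approx a b n x\<bar> <= \<bar>indicator (box a b) x\<bar>"
    using box_approx_bounds[where a=a and b=b and n=n and x=x] by simp
   thus "norm (box_approx a b n x * f x) <= \<bar>indicator (box a b) x * f x\<bar>"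
    by (simp add: abs_mult mult_right_mono)
  qed
 qed
 moreover have "(LINT x. box_approx a b n x * f x) = 0" for n
  by (rule z[OF box_approx_test[OF ab]])
 ultimately have "(%n. 0) ----> (LINT x. indicator (box a b) x * f x)" by simp
 thus "(LINT x. indicator (box a b) x * f x) = 0"
  by (simp add: LIMSEQ_const_iff)
qed

text \<open>Open boxes form an intersection-stable generator of the Borel sets, so a Dynkin system
  argument extends the vanishing of the integrals to all Borel sets; the sets where \<open>F\<close>
  has a fixed sign then force \<open>F\<close> to vanish.\<close>

lemma AE_zero_of_box_integrals:
 fixes F :: "real fn"
 assumes F: "Lint F" and F0: "(LINT x. F x) = 0"
  and z: "!!c d. (LINT x. indicator (box c d) x * F x) = 0"
 shows "AE x. F x = 0"
proof -
 have borelz: "(LINT x. indicator A x * F x) = 0" if "A \<in> sets borel" for A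
 proof -
  have "Int_stable (range (%(a, b). box a b :: (real^3) set))"
   by (auto simp: Int_stable_def box_Int_box)
  moreover have "range (%(a, b). box a b :: (real^3) set) \<subseteq> Pow UNIV" by simp
  moreover have "A \<in> sigma_sets UNIV (range (%(a, b). box a b :: (real^3) set))"
   using that by (simp add: borel_eq_box)
  ultimately show ?thesis
  proof (induction rule: sigma_sets_induct_disjoint)
   case (basic A)
   thus ?case using z by auto
  next
   case empty
   thus ?case by simp
  next
   case (compl A)
   have A: "A \<in> sets lebesgue"
   proof -
    have "A \<in> sets borel" using compl(1) by (simp add: borel_eq_box)
    thus ?thesis by simp
   qed
   have "(LINT x. indicator (UNIV - A) x * F x) = (LINT x. F x - indicator A x * F x)"
    by (rule Bochner_Integration.integral_cong) (auto split: split_indicator)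
   also have "... = (LINT x. F x) - (LINT x. indicator A x * F x)"
    by (rule Bochner_Integration.integral_diff[OF F integrable_mult_indicator[OF A F, simplified]])
   finally show ?case using F0 compl by simp
  next
   case (union A)
   have A: "A i \<in> sets lebesgue" for i
   proof -
    have "A i \<in> sigma_sets UNIV (range (%(a, b). box a b :: (real^3) set))" using union by auto
    hence "A i \<in> sets borel" by (simp add: borel_eq_box)
    thus ?thesis by simp
   qed
   have "(LINT x:(\<Union>i. A i)|lebesgue. F x) = suminf (%i. LINT x:(A i)|lebesgue. F x)"
   proof (rule lebesgue_integral_countable_add)
    show "A i \<inter> A j = {}" if "i \<noteq> j" for i j
     using union(1) that by (auto simp: disjoint_family_on_def)
    show "set_integrable lebesgue (\<Union> (range A)) F"
     unfolding set_integrable_def using A by (intro integrable_mult_indicator F) auto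
   qed (use A in auto)
   thus ?case using union by (simp add: set_lebesgue_integral_def)
  qed
 qed
 \<comment> \<open>The sign sets of \<open>F\<close> itself need only be Lebesgue measurable; a
   Borel representative makes them accessible to the previous step.\<close>
 obtain F' where F': "F' \<in> borel_measurable lborel" "AE x in lborel. F x = F' x"
  using completion_ex_borel_measurable_real[OF borel_measurable_integrable[OF F]] by blast
 have ae: "AE x. F x = F' x" using F'(2) by (rule AE_completion)
 have m: "F' \<in> LM" using F'(1) by (rule measurable_completion)
 have int': "Lint F'"
  using F m ae borel_measurable_integrable[OF F] by (subst integrable_cong_AE[of F' _ F]) (auto elim: eventually_mono)
 have z': "(LINT x. indicator A x * F' x) = 0" if "A \<in> sets borel" for A
 proof -
  have "A \<in> sets lebesgue" using that by simp
  hence "(LINT x. indicator A x * F' x) = (LINT x. indicator A x * F x)"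
   using ae m borel_measurable_integrable[OF F] by (intro integral_cong_AE) (auto elim: eventually_mono)
  thus ?thesis using borelz[OF that] by simp
 qed
 have pos: "AE x. indicator A x * G x = 0"
  if "A \<in> sets borel" "Lint G" "(LINT x. indicator A x * G x) = 0" "!!x. x \<in> A ==> G x >= 0" for A and G :: "real fn"
 proof -
  have i: "Lint (%x. indicator A x * G x)"
   using integrable_mult_indicator[OF _ that(2), of A] that(1) by simp
  show ?thesis
   using integral_nonneg_eq_0_iff_AE[OF i] that(3,4) by (auto split: split_indicator)
 qed
 have sets: "{x. F' x >= 0} \<in> sets borel" "{x. F' x <= 0} \<in> sets borel"
  using F'(1) by (auto intro!: borel_measurable_le[of "%x. 0" lborel F', simplified] borel_measurable_le[of F' lborel "%x. 0", simplified])
 have p1: "AE x. indicator {x. F' x >= 0} x * F' x = 0"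
  by (rule pos[OF sets(1) int' z'[OF sets(1)]]) simp
 have "(LINT x. indicator {x. F' x <= 0} x * (- F' x)) = 0"
  using z'[OF sets(2)] by simp
 hence p2: "AE x. indicator {x. F' x <= 0} x * (- F' x) = 0"
  by (intro pos[OF sets(2)] integrable_minus int') auto
 show ?thesis
  using ae p1 p2 by eventually_elim (auto simp: indicator_def split: if_splits)
qed

text \<open>The open set is exhausted by countably many closed boxes. On each of them the integrals
  over all smaller boxes vanish, since box indicators are limits of test functions supported in
  \<open>D\<close>.\<close>

lemma fundamental_lemma_real:
 fixes f :: "real fn"
 assumes D: "open D" and f: "loc_integrable D f"
  and z: "!!\<eta>. test_function D \<eta> ==> (LINT x. \<eta> x * f x) = 0"
 shows "AE x. x \<in> D --> f x = 0"
proof -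
 obtain \<D> where \<D>: "countable \<D>" "\<D> \<subseteq> Pow D" "!!X. X \<in> \<D> ==> \<exists>a b. X = cbox a b" "\<Union>\<D> = D"
  using open_countable_Union_open_cbox[OF D] by blast
 have "AE x. x \<in> X --> f x = 0" if X\<D>: "X \<in> \<D>" for X
 proof -
  obtain a b where X: "X = cbox a b" using \<D>(3)[OF X\<D>] by blast
  hence ab: "cbox a b \<subseteq> D" using \<D>(2) X\<D> by blast
  have "AE x. indicator (box a b) x * f x = 0"
  proof (rule AE_zero_of_box_integrals)
   fix c d
   have "(%x. indicator (box c d) x * (indicator (box a b) x * f x)) = (%x. indicator (box c d \<inter> box a b) x * f x)"
    by (auto simp: fun_eq_iff split: split_indicator)
   moreover obtain a' b' where ab': "box c d \<inter> box a b = box a' b'"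
    using box_Int_box by blast
   moreover have "(LINT x. indicator (box a' b') x * f x) = 0"
   proof (cases "box a' b' = {}")
    case False
    have "box a' b' \<subseteq> cbox a b" using ab' box_subset_cbox by blast
    hence "cbox a' b' \<subseteq> cbox a b"
     using False closure_minimal[OF _ closed_cbox, of "box a' b'" a b] by (simp add: closure_box)
    thus ?thesis using ab by (intro integral_box_zero(2)[OF f _ z]) auto
   qed simp
   ultimately show "(LINT x. indicator (box c d) x * (indicator (box a b) x * f x)) = 0"
    by (simp only:)
  qed (use integral_box_zero[OF f ab z] in auto)
  \<comment> \<open>The cover consists of closed boxes whereas the argument sees open ones; the
    boundaries are null sets.\<close>
  moreover have "AE x. x \<notin> cbox a b - box a b"
   using AE_not_in[OF negligible_frontier_interval[of a b, unfolded negligible_iff_null_sets]] .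
  ultimately show ?thesis
   unfolding X by eventually_elim (auto split: split_indicator_asm)
 qed
 hence "AE x. \<forall>X\<in>\<D>. x \<in> X --> f x = 0"
  by (subst AE_ball_countable[OF \<D>(1)]) blast
 thus ?thesis
  using \<D>(4) by (auto elim!: eventually_mono)
qed

lemma fundamental_lemma:
 fixes f :: "('a::euclidean_space) fn"
 assumes D: "open D" and f: "loc_integrable D f"
  and z: "!!\<eta>. test_function D \<eta> ==> (LINT x. \<eta> x *R f x) = 0"
 shows "AE x. x \<in> D --> f x = 0"
proof -
 have "AE x. x \<in> D --> f x \<bullet> v = 0" for v
 proof (rule fundamental_lemma_real[OF D])
  show "loc_integrable D (%x. f x \<bullet> v)"
   by (rule loc_integrable_linear[OF bounded_linear_inner_left f])
  fix \<eta> :: "real fn" assume \<eta>: "test_function D \<eta>"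
  have "(LINT x. \<eta> x * (f x \<bullet> v)) = (LINT x. (\<eta> x *R f x) \<bullet> v)" by simp
  also have "... = (LINT x. \<eta> x *R f x) \<bullet> v"
   by (rule integral_inner_left[OF integrable_test_scaleR[OF \<eta> f]])
  finally show "(LINT x. \<eta> x * (f x \<bullet> v)) = 0" by (simp add: z[OF \<eta>])
 qed
 hence "AE x. \<forall>v\<in>Basis. x \<in> D --> f x \<bullet> v = 0"
  by (subst AE_ball_countable) (auto simp: countable_finite)
 thus ?thesis
  by (rule eventually_mono) (auto intro: euclidean_eqI)
qed

lemma fundamental_lemma_eq:
 fixes f g :: "('a::euclidean_space) fn"
 assumes D: "open D" and f: "loc_integrable D f" and g: "loc_integrable D g"
  and z: "!!\<eta>. test_function D \<eta> ==> (LINT x. \<eta> x *R f x) = (LINT x. \<eta> x *R g x)"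
 shows "AE x. x \<in> D --> f x = g x"
proof -
 have "AE x. x \<in> D --> f x + - g x = 0"
 proof (rule fundamental_lemma[OF D])
  show "loc_integrable D (%x. f x + - g x)"
   by (intro loc_integrable_add f loc_integrable_linear[OF bounded_linear_minus[OF bounded_linear_ident] g])
  fix \<eta> :: "real fn" assume \<eta>: "test_function D \<eta>"
  have "(LINT x. \<eta> x *R (f x + - g x)) = (LINT x. \<eta> x *R f x - \<eta> x *R g x)"
   by (simp add: scaleR_diff_right)
  also have "... = (LINT x. \<eta> x *R f x) - (LINT x. \<eta> x *R g x)"
   by (rule Bochner_Integration.integral_diff[OF integrable_test_scaleR[OF \<eta> f] integrable_test_scaleR[OF \<eta> g]])
  finally show "(LINT x. \<eta> x *R (f x + - g x)) = 0" by (simp add: z[OF \<eta>])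
 qed
 thus ?thesis by (auto elim: eventually_mono)
qed

section \<open>The Hilbert space of square integrable functions\<close>

lemma in_L2_measurable: "in_L2 f ==> f \<in> LM"
 and in_L2_integrable: "in_L2 f ==> Lint (%x. (norm (f x))^2)"
 by (simp_all add: in_L2w_def)

lemma in_L2_bound:
 assumes "in_L2 f" "g \<in> LM" "AE x. norm (g x) <= C * norm (f x)"
 shows "in_L2 g"
 unfolding in_L2w_def
proof
 have "Lint (%x. (norm (g x))^2)"
 proof (rule Bochner_Integration.integrable_bound[OF integrable_mult_right[of "C\<^sup>2", OF in_L2_integrable[OF assms(1)]]])
  show "(%x. (norm (g x))^2) \<in> LM"
   using assms(2) by simp
  show "AE x. norm ((norm (g x))^2) <= norm (C\<^sup>2 * (norm (f x))^2)"
   using assms(3)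
  proof eventually_elim
   case (elim x)
   hence "(norm (g x))^2 <= (C * norm (f x))^2" by (intro power_mono) auto
   thus ?case by (simp add: power_mult_distrib)
  qed
 qed
 thus "Lint (%x. 1 * (norm (g x))^2)" by simp
qed (fact assms(2))

lemma L2_prod_integrable:
 fixes h :: "real^3 => 'c::{banach, second_countable_topology}"
 assumes f: "in_L2 f" and g: "in_L2 g" and h: "h \<in> LM"
  and b: "AE x. norm (h x) <= C * norm (f x) * norm (g x)"
 shows "Lint h"
proof (rule Bochner_Integration.integrable_bound)
 show "h \<in> LM" by fact
 show "Lint (%x. \<bar>C\<bar> * ((norm (f x))^2 + (norm (g x))^2))"
  by (intro integrable_mult_right Bochner_Integration.integrable_add in_L2_integrable f g)
 show "AE x. norm (h x) <= norm (\<bar>C\<bar> * ((norm (f x))^2 + (norm (g x))^2))"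
  using b
 proof eventually_elim
  case (elim x)
  have "norm (f x) * norm (g x) <= (norm (f x))^2 + (norm (g x))^2"
   using sum_squares_bound[of "norm (f x)" "norm (g x)"] mult_nonneg_nonneg[of "norm (f x)" "norm (g x)", OF norm_ge_zero norm_ge_zero] by linarith
  hence "\<bar>C\<bar> * (norm (f x) * norm (g x)) <= \<bar>C\<bar> * ((norm (f x))^2 + (norm (g x))^2)"
   by (rule mult_left_mono) simp
  moreover have "C * (norm (f x) * norm (g x)) <= \<bar>C\<bar> * (norm (f x) * norm (g x))"
   by (rule mult_right_mono) auto
  ultimately show ?case using elim by (simp add: mult.assoc)
 qed
qed

lemma in_L2_add: "in_L2 f ==> in_L2 g ==> in_L2 (%x. f x + g x)"
 unfolding in_L2w_def
proof (intro conjI)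
 assume f: "f \<in> LM \<and> Lint (%x. 1 * (norm (f x))^2)"
  and g: "g \<in> LM \<and> Lint (%x. 1 * (norm (g x))^2)"
 thus m: "(%x. f x + g x) \<in> LM" by (auto intro: borel_measurable_add)
 show "Lint (%x. 1 * (norm (f x + g x))^2)"
 proof (rule Bochner_Integration.integrable_bound)
  show "Lint (%x. 2 * (norm (f x))^2 + 2 * (norm (g x))^2)"
   using f g by (intro Bochner_Integration.integrable_add integrable_mult_right) auto
  show "(%x. 1 * (norm (f x + g x))^2) \<in> LM" using m by simp
  show "AE x. norm (1 * (norm (f x + g x))^2) <= norm (2 * (norm (f x))^2 + 2 * (norm (g x))^2)"
  proof (rule AE_I2)
   fix x
   have "(norm (f x + g x))^2 <= (norm (f x) + norm (g x))^2"
    by (intro power_mono norm_triangle_ineq) simp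
   also have "... <= 2 * (norm (f x))^2 + 2 * (norm (g x))^2"
    using sum_squares_bound[of "norm (f x)" "norm (g x)"] by (simp add: power2_sum)
   finally show "norm (1 * (norm (f x + g x))^2) <= norm (2 * (norm (f x))^2 + 2 * (norm (g x))^2)" by simp
  qed
 qed
qed

lemma in_L2_zero: "in_L2 (%x. 0)"
 by (simp add: in_L2w_def)

lemma in_L2_linear:
 assumes "bounded_linear L" "in_L2 f" shows "in_L2 (%x. L (f x))"
proof -
 obtain K where "!!v. norm (L v) <= norm v * K"
  using bounded_linear.bounded[OF assms(1)] by blast
 hence "norm (L (f x)) <= K * norm (f x)" for x by (simp add: mult.commute)
 moreover have "(%x. L (f x)) \<in> LM"
  using measurable_compose[OF in_L2_measurable[OF assms(2)] borel_measurable_continuous_onI[OF linear_continuous_on[OF assms(1)]]] .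
 ultimately show ?thesis by (intro in_L2_bound[OF assms(2)]) auto
qed

lemma in_L2_minus: "in_L2 f ==> in_L2 (%x. - f x)"
 by (rule in_L2_linear[OF bounded_linear_minus[OF bounded_linear_ident]])

lemma in_L2_diff: "in_L2 f ==> in_L2 g ==> in_L2 (%x. f x - g x)"
 using in_L2_add[OF _ in_L2_minus, of f g] by simp

lemma in_L2_scaleR: "in_L2 f ==> in_L2 (%x. c *R f x)"
 by (rule in_L2_linear[OF bounded_linear_scaleR_right])

lemma L2_inner_integrable: "in_L2 f ==> in_L2 g ==> Lint (%x. f x \<bullet> g x)"
 by (rule L2_prod_integrable[where C=1 and f=f and g=g])
  (auto simp: Cauchy_Schwarz_ineq2 intro: borel_measurable_inner in_L2_measurable)

lemma in_L2_norm: "in_L2 f ==> in_L2 (%x. norm (f x))"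
 by (rule in_L2_bound[of f _ 1]) (auto intro: measurable_compose[OF in_L2_measurable borel_measurable_norm])

lemma in_L2_AE_cong:
 assumes "in_L2 f" "g \<in> LM" "AE x. g x = f x"
 shows "in_L2 g"
 by (rule in_L2_bound[OF assms(1,2), of 1]) (use assms(3) in \<open>auto elim: eventually_mono\<close>)

\<comment> \<open>Classes of square integrable functions as a type of their own, so that class-based
  topology and inner product lemmas apply. The inner product is real; for complex fields it is the
  real part of the Hermitian one.\<close>
quotient_type (overloaded) 'a l2 = "('a::euclidean_space) fn" / partial:
 "%f g. in_L2 f \<and> in_L2 g \<and> (AE x. f x = g x)"
proof (rule part_equivpI)
 show "\<exists>f::real^3 => 'a. in_L2 f \<and> in_L2 f \<and> (AE x. f x = f x)"
  using in_L2_zero by auto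
qed (auto simp: symp_def transp_def elim: eventually_mono eventually_elim2)

instantiation l2 :: (euclidean_space) real_inner
begin

lift_definition zero_l2 :: "'a l2" is "%x. 0" by (simp add: in_L2_zero)
lift_definition plus_l2 :: "'a l2 => 'a l2 => 'a l2" is "%f g x. f x + g x"
 by (auto simp: in_L2_add elim: eventually_elim2)
lift_definition minus_l2 :: "'a l2 => 'a l2 => 'a l2" is "%f g x. f x - g x"
 by (auto simp: in_L2_diff elim: eventually_elim2)
lift_definition uminus_l2 :: "'a l2 => 'a l2" is "%f x. - f x"
 by (auto simp: in_L2_minus elim: eventually_mono)
lift_definition scaleR_l2 :: "real => 'a l2 => 'a l2" is "%c f x. c *R f x"
 by (auto simp: in_L2_scaleR elim: eventually_mono)
lift_definition inner_l2 :: "'a l2 => 'a l2 => real" is "%f g. LINT x. f x \<bullet> g x"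
 by (auto intro!: integral_cong_AE simp: in_L2_measurable borel_measurable_inner elim: eventually_elim2)

definition norm_l2 :: "'a l2 => real" where "norm_l2 X = sqrt (X \<bullet> X)"
definition dist_l2 :: "'a l2 => 'a l2 => real" where "dist_l2 X Y = norm (X - Y)"
definition sgn_l2 :: "'a l2 => 'a l2" where "sgn_l2 X = inverse (norm X) *R X"
definition uniformity_l2 :: "('a l2 \<times> 'a l2) filter" where
 "uniformity_l2 = (INF e\<in>{0 <..}. principal {(x, y). dist x y < e})"
definition open_l2 :: "'a l2 set => bool" where
 "open_l2 U = (\<forall>x\<in>U. eventually (%(x', y). x' = x --> y \<in> U) uniformity)"

instance
proof
 fix X Y Z :: "'a l2" and r s :: real
 show "X + Y + Z = X + (Y + Z)" by transfer (auto simp: in_L2_add add.assoc)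
 show "X + Y = Y + X" by transfer (auto simp: in_L2_add add.commute)
 show "0 + X = X" by transfer (auto simp: in_L2_zero)
 show "- X + X = 0" by transfer (auto simp: in_L2_zero)
 show "X - Y = X + - Y" by transfer (auto simp: in_L2_diff)
 show "r *R (X + Y) = r *R X + r *R Y" by transfer (auto simp: in_L2_add in_L2_scaleR scaleR_add_right)
 show "(r + s) *R X = r *R X + s *R X" by transfer (auto simp: in_L2_add in_L2_scaleR scaleR_add_left)
 show "r *R s *R X = (r * s) *R X" by transfer (auto simp: in_L2_scaleR)
 show "1 *R X = X" by transfer auto
 show "X \<bullet> Y = Y \<bullet> X" by transfer (auto simp: inner_commute)
 show "(X + Y) \<bullet> Z = X \<bullet> Z + Y \<bullet> Z"
  by transfer (auto simp: inner_add_left L2_inner_integrable)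
 show "(r *R X) \<bullet> Y = r * (X \<bullet> Y)" by transfer auto
 show "0 <= X \<bullet> X" by transfer (auto intro: integral_nonneg_AE)
 show "(X \<bullet> X = 0) = (X = 0)"
 proof transfer
  fix f :: "'a fn" assume f: "in_L2 f \<and> in_L2 f \<and> (AE x. f x = f x)"
  thus "((LINT x. f x \<bullet> f x) = 0) = (in_L2 f \<and> in_L2 (%x. 0::'a) \<and> (AE x. f x = 0))"
   using integral_nonneg_eq_0_iff_AE[OF L2_inner_integrable[of f f]] by (auto simp: in_L2_zero)
 qed
qed (simp_all add: norm_l2_def dist_l2_def sgn_l2_def uniformity_l2_def open_l2_def)

end

lemma l2_of_surj: obtains f where "in_L2 f" "X = abs_l2 f"
 using Quotient3_rep_reflp[OF Quotient3_l2] Quotient3_abs_rep[OF Quotient3_l2] by metis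

lemma abs_l2_eq_iff: "in_L2 f ==> in_L2 g ==> abs_l2 f = abs_l2 g \<longleftrightarrow> (AE x. f x = g x)"
 using Quotient3_rel[OF Quotient3_l2, of f g] by auto

abbreviation L2n :: "(real^3 \<Rightarrow> 'a::euclidean_space) \<Rightarrow> real" where
 "L2n f \<equiv> norm (abs_l2 f)"

lemma abs_l2_add: "in_L2 f ==> in_L2 g ==> abs_l2 f + abs_l2 g = abs_l2 (%x. f x + g x)"
 and abs_l2_diff: "in_L2 f ==> in_L2 g ==> abs_l2 f - abs_l2 g = abs_l2 (%x. f x - g x)"
 and abs_l2_scaleR: "in_L2 f ==> c *R abs_l2 f = abs_l2 (%x. c *R f x)"
 and inner_abs_l2: "in_L2 f ==> in_L2 g ==> abs_l2 f \<bullet> abs_l2 g = (LINT x. f x \<bullet> g x)"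
 by (auto simp: plus_l2.abs_eq minus_l2.abs_eq scaleR_l2.abs_eq inner_l2.abs_eq)

lemma abs_l2_zero: "abs_l2 (%x. 0) = 0"
 by (simp add: zero_l2.abs_eq)

lemma norm_abs_l2: "in_L2 f ==> (L2n f)^2 = (LINT x. (norm (f x))^2)"
 by (simp add: power2_norm_eq_inner inner_abs_l2)

text \<open>Riesz-Fischer: an almost everywhere convergent subsequence provides the candidate limit,
  and Fatou's lemma turns it into a limit in norm of the whole sequence.\<close>

instance l2 :: (euclidean_space) complete_space
proof
 fix X :: "nat => 'a l2" assume X: "Cauchy X"
 have "\<forall>n. \<exists>f. in_L2 f \<and> X n = abs_l2 f" using l2_of_surj by metis
 then obtain f where f: "!!n. in_L2 (f n)" and Xf: "!!n. X n = abs_l2 (f n)" by metis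
 have fm[measurable]: "f n \<in> LM" for n by (rule in_L2_measurable[OF f])
 have dL: "in_L2 (%x. f i x - f j x)" for i j by (intro in_L2_diff f)
 have d: "dist (X i) (X j) = L2n (%x. f i x - f j x)" for i j by (simp add: Xf dist_norm abs_l2_diff f)
 \<comment> \<open>The measure is infinite, so L2 is not contained in L1. A positive weight in L2
   makes the weighted sequence Cauchy in L1, where almost everywhere convergent subsequences are
   available; being positive, it can be divided out again.\<close>
 obtain w :: "real fn" where w: "w \<in> borel_measurable lborel" "!!x. w x > 0" "!!x. w x <= 1" "integrable lborel w"
  by (rule sigma_finite_measure.obtain_positive_integrable_function[OF sigma_finite_lborel]) blast
 have wm[measurable]: "w \<in> LM" using w(1) by (rule measurable_completion)
 have "Lint (%x. 1 * (norm (w x))^2)"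
 proof (rule Bochner_Integration.integrable_bound)
  show "Lint w" using w(1,4) by (simp add: integrable_completion)
  have "(w x)^2 <= w x" for x
   using w(2)[of x] w(3)[of x] by (simp add: power2_eq_square mult_left_le)
  thus "AE x. norm (1 * (norm (w x))^2) <= norm (w x)" using w(2) by (simp add: less_imp_le)
 qed simp
 hence wL: "in_L2 w" unfolding in_L2w_def using wm by simp
 let ?W = "L2n w"
 have L1: "(LINT x. norm (w x *R f i x - w x *R f j x)) <= ?W * dist (X i) (X j)" for i j
 proof -
  have "(LINT x. norm (w x *R f i x - w x *R f j x)) = abs_l2 w \<bullet> abs_l2 (%x. norm (f i x - f j x))"
   unfolding inner_abs_l2[OF wL in_L2_norm[OF dL]] using w(2) by (simp add: scaleR_diff_right[symmetric] less_imp_le)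
  also have "... <= ?W * L2n (%x. norm (f i x - f j x))" by (rule norm_cauchy_schwarz)
  also have "L2n (%x. norm (f i x - f j x)) = dist (X i) (X j)"
   unfolding d by (rule power2_eq_imp_eq) (simp_all add: norm_abs_l2 dL in_L2_norm[OF dL])
  finally show ?thesis .
 qed
 have i: "Lint (%x. w x *R f n x)" for n
  by (rule L2_prod_integrable[OF wL f[of n], of _ 1]) auto
 have c: "\<exists>N. \<forall>i\<ge>N. \<forall>j\<ge>N. (LINT x. norm (w x *R f i x - w x *R f j x)) < e" if "e > 0" for e
 proof -
  have W: "?W + 1 > 0" by (simp add: add_nonneg_pos)
  hence "e / (?W + 1) > 0" using that by (intro divide_pos_pos)
  from metric_CauchyD[OF X this] obtain N where N: "!!i j. i >= N ==> j >= N ==> dist (X i) (X j) < e / (?W + 1)" by blast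
  have "(LINT x. norm (w x *R f i x - w x *R f j x)) < e" if "i >= N" "j >= N" for i j
  proof -
   have "?W * dist (X i) (X j) <= (?W + 1) * dist (X i) (X j)" by (intro mult_right_mono) auto
   also have "... < e" using N[OF that] W by (simp add: pos_less_divide_eq mult.commute)
   finally show ?thesis using L1[of i j] by linarith
  qed
  thus ?thesis by blast
 qed
 obtain r where r: "strict_mono r" "AE x. Cauchy (%k. w x *R f (r k) x)"
  by (rule cauchy_L1_AE_cauchy_subseq[OF i c]) blast
 define g where "g x = lim (%k. f (r k) x)" for x
 have lim: "AE x. (%k. f (r k) x) ----> g x"
  using r(2)
 proof eventually_elim
  case (elim x)
  then obtain l where "(%k. w x *R f (r k) x) ----> l"
   using Cauchy_convergent_iff convergent_def by blast
  from tendsto_scaleR[OF tendsto_const[of "inverse (w x)"] this]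
  have "(%k. f (r k) x) ----> inverse (w x) *R l" using w(2)[of x] by simp
  thus ?case unfolding g_def by (simp add: limI)
 qed
 have [measurable]: "g \<in> LM"
  unfolding g_def[abs_def] by (rule borel_measurable_lim_metric) simp
 \<comment> \<open>Fatou's lemma along the subsequence: a bound on the distances from
   \<open>X n\<close> to all late members passes to the pointwise limit, and membership in L2 comes
   with it.\<close>
 have int: "in_L2 (%x. f n x - g x)" "L2n (%x. f n x - g x) <= e"
  if e: "e > 0" "!!j. j >= N ==> dist (X n) (X j) < e" for n N e
 proof -
  have "(\<integral>\<^sup>+x. ennreal ((norm (f n x - g x))^2) \<partial>lebesgue) = (\<integral>\<^sup>+x. liminf (%k. ennreal ((norm (f n x - f (r k) x))^2)) \<partial>lebesgue)"
  proof (rule nn_integral_cong_AE, use lim in eventually_elim)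
   case (elim x)
   have "(%k. ennreal ((norm (f n x - f (r k) x))^2)) ----> ennreal ((norm (f n x - g x))^2)"
    by (intro tendsto_intros elim)
   thus ?case by (rule lim_imp_Liminf[OF sequentially_bot, symmetric])
  qed
  also have "... <= liminf (%k. \<integral>\<^sup>+x. ennreal ((norm (f n x - f (r k) x))^2) \<partial>lebesgue)"
   by (intro nn_integral_liminf) measurable
  also have "... = liminf (%k. ennreal ((dist (X n) (X (r k)))^2))"
   unfolding d norm_abs_l2[OF dL] by (intro arg_cong[of _ _ liminf] ext nn_integral_eq_integral in_L2_integrable[OF dL]) auto
  also have "... <= ennreal (e\<^sup>2)"
  proof (rule Liminf_le)
   show "\<forall>\<^sub>F k in sequentially. ennreal ((dist (X n) (X (r k)))^2) <= ennreal (e\<^sup>2)"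
    using eventually_ge_at_top[of N]
   proof eventually_elim
    case (elim k)
    hence "r k >= N" using seq_suble[OF r(1), of k] by linarith
    from less_imp_le[OF e(2)[OF this]] show ?case by (intro ennreal_leI power_mono) auto
   qed
  qed simp
  finally have nn: "(\<integral>\<^sup>+x. ennreal ((norm (f n x - g x))^2) \<partial>lebesgue) <= ennreal (e\<^sup>2)" .
  have i: "Lint (%x. (norm (f n x - g x))^2)"
   using le_less_trans[OF nn ennreal_less_top] by (intro integrableI_bounded) auto
  thus L: "in_L2 (%x. f n x - g x)" by (simp add: in_L2w_def)
  have "(L2n (%x. f n x - g x))^2 <= e\<^sup>2"
   using nn unfolding norm_abs_l2[OF L] nn_integral_eq_integral[OF i AE_I2[OF zero_le_power2]] by simp
  thus "L2n (%x. f n x - g x) <= e" by (rule power2_le_imp_le) (use e in simp)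
 qed
 obtain N where "!!j. j >= N ==> dist (X N) (X j) < 1" using metric_CauchyD[OF X, of 1] by auto
 from in_L2_diff[OF f[of N] int(1)[OF _ this]] have g: "in_L2 g" by simp
 have "X ----> abs_l2 g"
 proof (rule metric_LIMSEQ_I)
  fix e :: real assume e: "0 < e"
  obtain N where N: "!!i j. i >= N ==> j >= N ==> dist (X i) (X j) < e / 2" using metric_CauchyD[OF X, of "e / 2"] e by auto
  have "dist (X n) (abs_l2 g) < e" if "n >= N" for n
   using int(2)[of "e / 2" N n] N[OF that] e by (simp add: Xf dist_norm abs_l2_diff f g)
  thus "\<exists>N. \<forall>n\<ge>N. dist (X n) (abs_l2 g) < e" by blast
 qed
 thus "convergent X" by (auto simp: convergent_def)
qed

section \<open>Projections and the Riesz representation theorem\<close>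

text \<open>A minimizing sequence for the distance is Cauchy by the parallelogram identity,
  midpoints staying in the subspace; at the minimizer a variation along any direction of the
  subspace yields orthogonality.\<close>

lemma closed_subspace_projection:
 fixes S :: "'h::{real_inner, complete_space} set"
 assumes S: "subspace S" "closed S"
 obtains p where "p \<in> S" "!!s. s \<in> S ==> (x - p) \<bullet> s = 0"
proof -
 define D where "D = (%s. (norm (x - s))^2) ` S"
 define d where "d = Inf D"
 have ne: "D \<noteq> {}" using subspace_0[OF S(1)] by (auto simp: D_def)
 have bdd: "bdd_below D" by (rule bdd_belowI[of _ 0]) (auto simp: D_def)
 have low: "d <= (norm (x - s))^2" if "s \<in> S" for s
  unfolding d_def using that by (intro cInf_lower bdd) (auto simp: D_def)
 have "\<exists>s\<in>S. (norm (x - s))^2 < d + 1 / (real n + 1)" for n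
 proof -
  have "Inf D < d + 1 / (real n + 1)" by (simp add: d_def)
  from cInf_lessD[OF ne this] show ?thesis by (auto simp: D_def)
 qed
 then obtain s where s: "!!n. s n \<in> S" "!!n. (norm (x - s n))^2 < d + 1 / (real n + 1)" by metis
 have par: "(norm (s m - s n))^2 <= 2 / (real m + 1) + 2 / (real n + 1)" for m n
 proof -
  have mid: "(1/2) *R (s m + s n) \<in> S" using s(1) S(1) by (intro subspace_scale subspace_add)
  have "(norm (s m - s n))^2 = 2 * (norm (x - s m))^2 + 2 * (norm (x - s n))^2 - 4 * (norm (x - (1/2) *R (s m + s n)))^2"
   by (simp add: power2_norm_eq_inner algebra_simps inner_commute)
  with low[OF mid] s(2)[of m] s(2)[of n] show ?thesis by simp
 qed
 have "Cauchy s"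
 proof (rule metric_CauchyI)
  fix e :: real assume e: "e > 0"
  obtain N where N: "real N > 4 / e\<^sup>2" using reals_Archimedean2 by blast
  have "dist (s m) (s n) < e" if "m >= N" "n >= N" for m n
  proof -
   have *: "2 / (real k + 1) < e\<^sup>2 / 2" if "k >= N" for k
   proof -
    have "4 / e\<^sup>2 < real k + 1" using N that by linarith
    thus ?thesis using e by (simp add: field_simps)
   qed
   have "(norm (s m - s n))^2 < e\<^sup>2" using par[of m n] *[OF that(1)] *[OF that(2)] by linarith
   thus ?thesis using e by (simp add: dist_norm power_less_imp_less_base)
  qed
  thus "\<exists>N. \<forall>m\<ge>N. \<forall>n\<ge>N. dist (s m) (s n) < e" by blast
 qed
 then obtain p where p: "s ----> p" using Cauchy_convergent_iff convergent_def by blast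
 have pS: "p \<in> S" using closed_sequentially[OF S(2) _ p] s(1) by blast
 have lim: "(%n. (norm (x - s n))^2) ----> (norm (x - p))\<^sup>2" by (intro tendsto_intros p)
 have "(%n. d + 1 / (real n + 1)) ----> d + 0"
  using LIMSEQ_inverse_real_of_nat by (intro tendsto_add tendsto_const) (simp add: inverse_eq_divide add.commute)
 hence min: "(norm (x - p))^2 <= d"
  by (intro LIMSEQ_le[OF lim]) (use s(2) in \<open>auto intro!: exI[of _ 0] less_imp_le\<close>)
 have "(x - p) \<bullet> v = 0" if v: "v \<in> S" for v
 proof (cases "v = 0")
  case False
  \<comment> \<open>The minimizer of the quadratic in \<open>t\<close> given by the squared distance
    from \<open>x\<close> to \<open>p + t v\<close>.\<close>
  define t where "t = ((x - p) \<bullet> v) / (v \<bullet> v)"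
  have "d <= (norm (x - (p + t *R v)))^2"
   by (intro low subspace_add subspace_scale S pS v)
  also have "... = (norm (x - p))^2 - 2 * t * ((x - p) \<bullet> v) + t\<^sup>2 * (v \<bullet> v)"
   unfolding power2_norm_eq_inner by (simp add: algebra_simps inner_commute power2_eq_square)
  also have "... = (norm (x - p))^2 - ((x - p) \<bullet> v)^2 / (v \<bullet> v)"
   using False by (simp add: t_def power2_eq_square)
  finally have "((x - p) \<bullet> v)^2 / (v \<bullet> v) <= 0" using min by linarith
  moreover have "v \<bullet> v > 0" using False by simp
  ultimately have "((x - p) \<bullet> v)^2 <= 0" by (simp add: divide_le_0_iff not_less)
  thus ?thesis by simp
 qed simp
 with pS show ?thesis by (rule that)
qed

text \<open>The functional is given on \<open>S\<close> only. If it is not zero, a vector of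
  \<open>S\<close> orthogonal to its kernel exists, and every element of \<open>S\<close> differs
  from a multiple of that vector by a kernel element.\<close>

lemma riesz_representation:
 fixes S :: "'h::{real_inner, complete_space} set" and \<phi> :: "'h => real"
 assumes S: "subspace S" "closed S"
  and add: "!!u v. u \<in> S ==> v \<in> S ==> \<phi> (u + v) = \<phi> u + \<phi> v"
  and scale: "!!c v. v \<in> S ==> \<phi> (c *R v) = c * \<phi> v"
  and bnd: "!!v. v \<in> S ==> \<bar>\<phi> v\<bar> <= C * norm v"
 obtains w where "w \<in> S" "!!v. v \<in> S ==> \<phi> v = w \<bullet> v"
proof (cases "\<forall>v\<in>S. \<phi> v = 0")
 case True
 thus ?thesis using subspace_0[OF S(1)] by (intro that[of 0]) auto
next
 case False
 then obtain v0 where v0: "v0 \<in> S" "\<phi> v0 \<noteq> 0" by blast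
 define N where "N = {v \<in> S. \<phi> v = 0}"
 have diff: "\<phi> (u - v) = \<phi> u - \<phi> v" if "u \<in> S" "v \<in> S" for u v
  using add[OF that(1) subspace_scale[OF S(1) that(2), of "-1"]] scale[OF that(2), of "-1"] by simp
 have N: "subspace N"
  using subspace_0[OF S(1)] subspace_add[OF S(1)] subspace_scale[OF S(1)] scale[OF subspace_0[OF S(1)], of 0]
  by (auto simp: subspace_def N_def add scale)
 have "closed N"
  unfolding closed_sequential_limits
 proof (intro allI impI, elim conjE)
  fix x l assume x: "\<forall>n. x n \<in> N" and l: "x ----> l"
  have lS: "l \<in> S" using closed_sequentially[OF S(2) _ l] x by (auto simp: N_def)
  have "\<bar>\<phi> l\<bar> <= C * norm (l - x n)" for n
   using bnd[OF subspace_diff[OF S(1) lS], of "x n"] diff[OF lS, of "x n"] x by (auto simp: N_def)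
  moreover have "(%n. C * norm (l - x n)) ----> C * norm (l - l)" by (intro tendsto_intros l)
  ultimately have "\<bar>\<phi> l\<bar> <= C * norm (l - l)" by (intro LIMSEQ_le_const) auto
  thus "l \<in> N" using lS by (simp add: N_def)
 qed
 then obtain p where p: "p \<in> N" "!!s. s \<in> N ==> (v0 - p) \<bullet> s = 0"
  by (rule closed_subspace_projection[OF N]) blast
 define r where "r = v0 - p"
 have r: "r \<in> S" "\<phi> r = \<phi> v0" using p v0 by (auto simp: r_def N_def diff intro: subspace_diff[OF S(1)])
 have r0: "r \<bullet> r > 0"
  using r v0 scale[OF subspace_0[OF S(1)], of 0] by auto
 show ?thesis
 proof (rule that[of "(\<phi> r / (r \<bullet> r)) *R r"])
  show "(\<phi> r / (r \<bullet> r)) *R r \<in> S" by (rule subspace_scale[OF S(1) r(1)])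
  fix v assume v: "v \<in> S"
  have "v - (\<phi> v / \<phi> r) *R r \<in> N"
   using v r v0 by (auto simp: N_def diff scale subspace_scale[OF S(1)] intro: subspace_diff[OF S(1)])
  from p(2)[OF this] have "r \<bullet> v = (\<phi> v / \<phi> r) * (r \<bullet> r)"
   by (simp add: r_def[symmetric] inner_diff_right)
  thus "\<phi> v = ((\<phi> r / (r \<bullet> r)) *R r) \<bullet> v" using r0 r v0 by simp
 qed
qed

section \<open>Density of test functions\<close>

lemma borel_lebesgue: "f \<in> borel_measurable borel ==> f \<in> LM"
 by (simp add: measurable_completion)

lemma test_borel:
 fixes \<eta> :: "('a::euclidean_space) fn"
 shows "test_function D \<eta> ==> \<eta> \<in> LM"
 by (intro borel_lebesgue borel_measurable_continuous_onI test_cont)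

lemma in_L2_indicator: "A \<in> sets lebesgue ==> emeasure lebesgue A < \<infinity> ==> in_L2 (indicator A :: real fn)"
 unfolding in_L2w_def
 by (auto simp: power2_eq_square indicator_inter_arith[symmetric] abs_mult[symmetric] intro: integrable_real_indicator)

lemma in_L2_indicator_bounded:
 fixes A :: "(real^3) set"
 assumes "bounded A" "A \<in> sets lebesgue"
 shows "in_L2 (indicator A :: real fn)"
proof (rule in_L2_indicator[OF assms(2)])
 show "emeasure lebesgue A < \<infinity>"
  using fmeasurableD2[OF bounded_set_imp_lmeasurable[OF assms]] by (simp add: less_top)
qed

lemma in_L2_indicator_compact: "compact K ==> in_L2 (indicator K :: real fn)"
 by (rule in_L2_indicator_bounded) (simp_all add: compact_imp_bounded lmeasurable_compact fmeasurableD)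

lemma in_L2_indicator_ball: "in_L2 (indicator (ball a r) :: real fn)"
 by (rule in_L2_indicator_bounded) auto

lemma subspace_closure:
 fixes S :: "'h::real_normed_vector set"
 assumes "subspace S" shows "subspace (closure S)"
 unfolding subspace_def
proof (intro conjI ballI allI)
 show "0 \<in> closure S" using subspace_0[OF assms] closure_subset by blast
next
 fix x y assume "x \<in> closure S" "y \<in> closure S"
 then obtain u v where "!!n. u n \<in> S" "u ----> x" "!!n. v n \<in> S" "v ----> y"
  unfolding closure_sequential by blast
 thus "x + y \<in> closure S"
  unfolding closure_sequential by (intro exI[of _ "%n. u n + v n"]) (auto intro: subspace_add[OF assms] tendsto_add)
next
 fix c x assume "x \<in> closure S"
 then obtain u where "!!n. u n \<in> S" "u ----> x"
  unfolding closure_sequential by blast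
 thus "c *R x \<in> closure S"
  unfolding closure_sequential by (intro exI[of _ "%n. c *R u n"]) (auto intro: subspace_scale[OF assms] tendsto_intros)
qed

lemma in_L2_test:
 fixes \<eta> :: "('a::euclidean_space) fn"
 assumes "test_function D \<eta>" shows "in_L2 \<eta>"
proof -
 obtain K where K: "compact K" "!!x. x \<notin> K ==> \<eta> x = 0"
  by (rule test_functionE[OF assms]) blast
 obtain B where B: "B > 0" "!!x. norm (\<eta> x) <= B"
  by (rule test_bounded[OF assms]) blast
 have "norm (\<eta> x) <= B * norm (indicator K x :: real)" for x
  using B K(2)[of x] by (cases "x \<in> K") auto
 thus ?thesis
  by (intro in_L2_bound[OF in_L2_indicator_compact[OF K(1)] test_borel[OF assms]]) auto
qed

lemma L2_loc_integrable:
 fixes f :: "('a::euclidean_space) fn"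
 assumes "in_L2 f" shows "loc_integrable D f"
 unfolding loc_integrable_def set_integrable_def
proof (intro allI impI)
 fix K assume "compact K \<and> K \<subseteq> D"
 hence K: "in_L2 (indicator K :: real fn)" by (simp add: in_L2_indicator_compact)
 have "(%x. indicator K x *R f x) \<in> LM"
  by (intro borel_measurable_scaleR in_L2_measurable K assms)
 thus "Lint (%x. indicator K x *R f x)"
  by (rule L2_prod_integrable[OF K assms, of _ 1]) simp
qed

lemma subspace_test_image:
 fixes e :: "(('a::euclidean_space) fn) => 'b::real_vector"
 assumes add: "!!\<eta> \<zeta>. test_function D \<eta> ==> test_function D \<zeta> ==> e (%x. \<eta> x + \<zeta> x) = e \<eta> + e \<zeta>"
  and scale: "!!c \<eta>. test_function D \<eta> ==> e (%x. c *R \<eta> x) = c *R e \<eta>"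
 shows "subspace {e \<eta> |\<eta>. test_function D \<eta>}"
 unfolding subspace_def
proof (intro conjI ballI allI)
 have "e (%x. 0) = 0" using scale[OF test_zero, of 0] by simp
 thus "0 \<in> {e \<eta> |\<eta>. test_function D \<eta>}" using test_zero[of D] by (metis (mono_tags, lifting) mem_Collect_eq)
 fix x assume "x \<in> {e \<eta> |\<eta>. test_function D \<eta>}"
 then obtain \<eta> where \<eta>: "x = e \<eta>" "test_function D \<eta>" by blast
 show "c *R x \<in> {e \<eta> |\<eta>. test_function D \<eta>}" for c
  unfolding \<eta>(1) scale[OF \<eta>(2), symmetric] using test_linear[OF bounded_linear_scaleR_right \<eta>(2)] by blast
 fix y assume "y \<in> {e \<eta> |\<eta>. test_function D \<eta>}"
 then obtain \<zeta> where \<zeta>: "y = e \<zeta>" "test_function D \<zeta>" by blast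
 show "x + y \<in> {e \<eta> |\<eta>. test_function D \<eta>}"
  unfolding \<eta>(1) \<zeta>(1) add[OF \<eta>(2) \<zeta>(2), symmetric] using test_add[OF \<eta>(2) \<zeta>(2)] by blast
qed

text \<open>Density in the form of a transfer rule: closed conditions pass from test functions
  supported in \<open>D\<close> to L2 functions vanishing off \<open>D\<close>. The residual of the
  projection onto the closure is orthogonal to all test functions, hence zero in \<open>D\<close> by
  the fundamental lemma.\<close>

lemma L2_test_dense:
 fixes f :: "('a::euclidean_space) fn"
 assumes D: "open D" and f: "in_L2 f" and f0: "AE x. x \<notin> D --> f x = 0"
  and closed: "closed {X. P X}" and P: "!!\<eta>. test_function D \<eta> ==> P (abs_l2 \<eta>)"
 shows "P (abs_l2 f)"
proof -
 define S where "S = {abs_l2 \<eta> |\<eta>::real^3 => 'a. test_function D \<eta>}"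
 have sub: "subspace S"
  unfolding S_def by (rule subspace_test_image) (simp_all add: abs_l2_add abs_l2_scaleR in_L2_test)
 obtain p where p: "p \<in> closure S" "!!s. s \<in> closure S ==> (abs_l2 f - p) \<bullet> s = 0"
  by (rule closed_subspace_projection[OF subspace_closure[OF sub] closed_closure]) blast
 obtain q where q: "in_L2 q" "p = abs_l2 q" by (rule l2_of_surj)
 define r where "r x = f x - q x" for x
 have r: "in_L2 r" "abs_l2 f - p = abs_l2 r"
  using f q by (auto simp: r_def[abs_def] in_L2_diff abs_l2_diff)
 have rD: "AE x. x \<in> D --> r x = 0"
 proof (rule fundamental_lemma[OF D L2_loc_integrable[OF r(1)]])
  fix \<eta> :: "real fn" assume \<eta>: "test_function D \<eta>"
  show "(LINT x. \<eta> x *R r x) = 0"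
  proof (rule euclidean_eqI)
   fix v :: 'a
   have t: "test_function D (%x. \<eta> x *R v)"
    by (rule test_linear[OF bounded_linear_scaleR_left \<eta>])
   hence "abs_l2 (%x. \<eta> x *R v) \<in> closure S"
    using closure_subset by (fastforce simp: S_def)
   hence "(LINT x. r x \<bullet> (\<eta> x *R v)) = 0"
    using p(2) r t by (metis inner_abs_l2 in_L2_test)
   moreover have "(LINT x. \<eta> x *R r x) \<bullet> v = (LINT x. (\<eta> x *R r x) \<bullet> v)"
    by (rule integral_inner_left[symmetric, OF integrable_test_scaleR[OF \<eta> L2_loc_integrable[OF r(1)]]])
   ultimately show "(LINT x. \<eta> x *R r x) \<bullet> v = 0 \<bullet> v" by simp
  qed
 qed
 \<comment> \<open>The residual vanishes in \<open>D\<close> and \<open>f\<close> vanishes outside,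
   so their product is zero almost everywhere.\<close>
 have "(abs_l2 f - p) \<bullet> abs_l2 f = 0"
 proof -
  have "(LINT x. r x \<bullet> f x) = (LINT x|(lebesgue::(real^3) measure). (0::real))"
  proof (rule integral_cong_AE)
   show "AE x. r x \<bullet> f x = 0"
    using rD f0 by eventually_elim auto
  qed (auto intro: borel_measurable_inner in_L2_measurable r f)
  thus ?thesis using r f by (simp add: inner_abs_l2)
 qed
 with p have "(abs_l2 f - p) \<bullet> (abs_l2 f - p) = 0" by (simp add: inner_diff_right)
 hence "abs_l2 f \<in> closure S" using p by simp
 moreover have "closure S \<subseteq> {X. P X}" by (rule closure_minimal[OF _ closed]) (use P in \<open>auto simp: S_def\<close>)
 ultimately show ?thesis by blast
qed

section \<open>Translations of weakly differentiable functions\<close>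

lemma
 fixes h :: "real^3"
 shows lebesgue_translate_measurable: "(%x. x + h) \<in> lebesgue \<rightarrow>\<^sub>M lebesgue"
  and lebesgue_distr_translate: "distr lebesgue lebesgue (%x. x + h) = lebesgue"
proof -
 have T: "(%x. h + (\<Sum>j\<in>Basis. (1 * (x \<bullet> j)) *R j)) = (%x. x + h)"
  by (simp add: euclidean_representation add.commute)
 show "(%x. x + h) \<in> lebesgue \<rightarrow>\<^sub>M lebesgue"
  using lebesgue_affine_measurable[of "%_. 1" h] unfolding T by simp
 have "lebesgue = density (distr lebesgue lebesgue (%x. x + h)) (%_. 1)"
  using lebesgue_affine_euclidean[of "%_. 1" h] unfolding T by simp
 thus "distr lebesgue lebesgue (%x. x + h) = lebesgue"
  by (simp add: density_1)
qed

lemma measurable_translate: "f \<in> LM ==> (%x::real^3. f (x + h)) \<in> LM"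
 by (rule measurable_compose[OF lebesgue_translate_measurable])

lemma integral_translate:
 fixes f :: "real^3 => 'a::{banach, second_countable_topology}"
 assumes "f \<in> LM"
 shows "(LINT x. f (x + h)) = (LINT x. f x)"
 using integral_distr[OF lebesgue_translate_measurable[of h] assms] by (simp add: lebesgue_distr_translate)

lemma integrable_translate:
 fixes f :: "real^3 => 'a::{banach, second_countable_topology}"
 assumes "Lint f"
 shows "Lint (%x. f (x + h))"
 using integrable_distr_eq[OF lebesgue_translate_measurable[of h] borel_measurable_integrable[OF assms]] assms
 by (simp add: lebesgue_distr_translate)

lemma AE_translate:
 fixes h :: "real^3"
 assumes "AE x. P x"
 shows "AE x. P (x + h)"
 by (rule AE_distrD[OF lebesgue_translate_measurable[of h]]) (subst lebesgue_distr_translate, rule assms)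

lemma in_L2_translate:
 fixes f :: "('a::euclidean_space) fn"
 assumes "in_L2 f"
 shows "in_L2 (%x. f (x + h))" "L2n (%x. f (x + h)) = L2n f"
proof -
 show L: "in_L2 (%x. f (x + h))"
  using measurable_translate[OF in_L2_measurable[OF assms], of h] integrable_translate[OF in_L2_integrable[OF assms], of h]
  by (simp add: in_L2w_def)
 have "(%x. (norm (f x))^2) \<in> LM"
  by (rule borel_measurable_integrable[OF in_L2_integrable[OF assms]])
 from integral_translate[OF this, of h]
 have "(L2n (%x. f (x + h)))^2 = (L2n f)^2"
  by (simp add: norm_abs_l2 L assms)
 thus "L2n (%x. f (x + h)) = L2n f" by simp
qed

lemma has_weak_pderivD:
 assumes "has_weak_pderiv D i f g" "test_function D \<eta>"
 shows "(LINT x. pd i \<eta> x *R f x) = - (LINT x. \<eta> x *R g x)"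
proof -
 obtain K where K: "compact K" "K \<subseteq> D" "!!x. x \<notin> K ==> \<eta> x = 0"
  by (rule test_functionE[OF assms(2)]) blast
 have e1: "indicator D x *R (pd i \<eta> x *R f x) = pd i \<eta> x *R f x" for x
 proof (cases "x \<in> D")
  case False
  hence "x \<notin> K" using K(2) by blast
  hence "pd i \<eta> x = 0" by (intro pderiv_at_zero_outside[OF K(1)] K(3))
  thus ?thesis by simp
 qed simp
 have e2: "indicator D x *R (\<eta> x *R g x) = \<eta> x *R g x" for x
  using K(2) K(3)[of x] by (cases "x \<in> D") auto
 have "(LINT x:D|lebesgue. pd i \<eta> x *R f x) = - (LINT x:D|lebesgue. \<eta> x *R g x)"
  using assms unfolding has_weak_pderiv_def by blast
 thus ?thesis unfolding set_lebesgue_integral_def e1 e2 .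
qed

text \<open>The pairing of \<open>\<psi>\<close> with translates of \<open>\<phi>\<close> is a
  smooth function of the translation. The mean value theorem along the segment from 0 to
  \<open>h\<close>, with the derivative moved onto the weak derivative, gives the identity; the last
  hypothesis keeps the translated supports inside \<open>D\<close>.\<close>

lemma translation_difference:
 fixes \<psi> :: "real fn"
 assumes \<psi>: "L1loc \<psi>" and g: "!!i. has_weak_pderiv D i \<psi> (g i)"
  and \<phi>: "test_function D0 \<phi>"
  and sub: "!!s. 0 <= s ==> s <= 1 ==> (%x. x + s *R h) ` D0 \<subseteq> D"
 obtains s where "0 < s" "s < 1"
  "(LINT x. \<phi> x * (\<psi> (x + h) - \<psi> x)) = (\<Sum>i. h $ i * (LINT x. \<phi> (x - s *R h) * g i x))"
proof -
 have \<phi>U: "test \<phi>" using \<phi> test_mono by blast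
 define \<phi>' where "\<phi>' = (%y. \<phi> (0 - y))"
 have \<phi>': "test \<phi>'" unfolding \<phi>'_def by (rule test_reflect[OF \<phi>U])
 define c where "c = conv \<psi> \<phi>'"
 have c: "c z = (LINT x. \<phi> (x - z) * \<psi> x)" for z
  by (simp add: c_def conv_def \<phi>'_def)
 have p': "pd i \<phi>' y = - pd i \<phi> (0 - y)" for i y
  unfolding \<phi>'_def by (rule pderiv_at_reflect[OF test_smooth[OF \<phi>]])
 have cp: "pd i c (s *R h) = (LINT x. \<phi> (x - s *R h) * g i x)" if s: "0 <= s" "s <= 1" for i s
 proof -
  let ?z = "s *R h"
  have t: "test_function D (%x. \<phi> (x - ?z))"
   using test_mono[OF test_translate[OF \<phi>, of ?z] sub[OF s]] .
  have "pd i c ?z = (LINT x. pd i \<phi>' (?z - x) *R \<psi> x)"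
   unfolding c_def pderiv_at_conv[OF \<phi>' \<psi>] conv_def ..
  also have "... = (LINT x. - (pd i (%x. \<phi> (x - ?z)) x *R \<psi> x))"
   by (rule Bochner_Integration.integral_cong) (simp_all add: p' pderiv_at_translate[OF test_smooth[OF \<phi>]])
  also have "... = (LINT x. \<phi> (x - ?z) *R g i x)"
   using has_weak_pderivD[OF g[of i] t] by simp
  finally show ?thesis by simp
 qed
 have cd: "c differentiable (at x)" for x
  unfolding c_def by (rule smooth_diff[OF smooth_conv[OF \<phi>' \<psi>]])
 obtain s where s: "0 < s" "s < 1" "c (0 + h) - c 0 = (\<Sum>i. h $ i * pd i c (0 + s *R h))"
  by (rule line_mvt[OF cd])
 have i1: "Lint (%x. \<phi> (x - z) * \<psi> x)" for z
  using conv_integrable[OF \<phi>' \<psi>, of z] by (simp add: \<phi>'_def)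
 have i2: "Lint (%x. \<phi> x * \<psi> (x + h))"
  using integrable_translate[OF i1[of h], of h] by simp
 have i3: "Lint (%x. \<phi> x * \<psi> x)"
  using i1[of 0] by simp
 have ch: "c h = (LINT x. \<phi> x * \<psi> (x + h))"
  using integral_translate[OF borel_measurable_integrable[OF i1[of h]], of h] by (simp add: c)
 have "(LINT x. \<phi> x * (\<psi> (x + h) - \<psi> x)) = (LINT x. \<phi> x * \<psi> (x + h) - \<phi> x * \<psi> x)"
  by (simp add: right_diff_distrib)
 also have "... = (LINT x. \<phi> x * \<psi> (x + h)) - (LINT x. \<phi> x * \<psi> x)"
  by (rule Bochner_Integration.integral_diff[OF i2 i3])
 also have "... = c (0 + h) - c 0" by (simp add: ch) (simp add: c)
 also have "... = (\<Sum>i. h $ i * (LINT x. \<phi> (x - s *R h) * g i x))"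
  unfolding s(3) using s(1,2) by (simp add: cp)
 finally show ?thesis by (rule that[OF s(1,2)])
qed

section \<open>Duality bounds and difference quotients\<close>

lemma dense_bound:
 fixes F :: "real fn"
 assumes D: "open D" and F: "in_L2 F" "!!x. x \<notin> D ==> F x = 0" and C: "C >= 0"
  and b: "!!\<phi>. test_function D \<phi> ==> \<bar>LINT x. \<phi> x * F x\<bar> <= C * L2n \<phi>"
 shows "L2n F <= C"
proof -
 let ?F = "abs_l2 F"
 have F0: "AE x. x \<notin> D --> F x = 0" using F(2) by auto
 have "?F \<bullet> ?F <= C * norm ?F"
 proof (rule L2_test_dense[OF D F(1) F0, where P="%X. X \<bullet> ?F <= C * norm X"])
  show "abs_l2 \<eta> \<bullet> ?F <= C * L2n \<eta>" if "test_function D \<eta>" for \<eta>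
   using b[OF that] by (simp add: inner_abs_l2 in_L2_test[OF that] F)
 qed (intro closed_Collect_le continuous_intros)
 thus ?thesis
  using C by (cases "norm ?F = 0") (auto simp: power2_eq_square simp flip: power2_norm_eq_inner)
qed

text \<open>Duality between L1 and the essential supremum: the extremal test function is the sign of
  \<open>F\<close> on the set where its modulus exceeds \<open>C\<close>. It is approximated in L2,
  which controls L1 because \<open>D\<close> is bounded.\<close>

lemma dense_sup_bound:
 fixes F :: "real fn"
 assumes D: "open D" "bounded D" and F: "in_L2 F" "!!x. x \<notin> D ==> F x = 0" and C: "C >= 0"
  and b: "!!\<phi>. test_function D \<phi> ==> \<bar>LINT x. \<phi> x * F x\<bar> <= C * (LINT x. \<bar>\<phi> x\<bar>)"
 shows "AE x. \<bar>F x\<bar> <= C"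
proof -
 have Fm: "F \<in> LM" using F(1) by (rule in_L2_measurable)
 define E where "E = {x. \<bar>F x\<bar> > C}"
 have Em: "E \<in> sets lebesgue"
  unfolding E_def using borel_measurable_less[of "%_. C" lebesgue "%x. \<bar>F x\<bar>"] Fm by simp
 have ED: "E \<subseteq> D" using F(2) C by (force simp: E_def)
 define s where "s x = sgn (F x) * indicator E x" for x
 have sm: "s \<in> LM"
  unfolding s_def using Fm Em by simp
 have iE: "in_L2 (indicator E :: real fn)"
  by (rule in_L2_indicator_bounded[OF bounded_subset[OF D(2) ED] Em])
 have iD: "in_L2 (indicator D :: real fn)"
  using D by (intro in_L2_indicator_bounded) (auto simp: lebesgue_openin)
 have sL: "in_L2 s"
  by (rule in_L2_bound[OF iE sm, of 1]) (auto simp: s_def abs_mult sgn_if split: split_indicator)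
 have sD: "AE x. x \<notin> D --> s x = 0"
  using ED by (auto simp: s_def split: split_indicator)
 have sF: "s x * F x = indicator E x * \<bar>F x\<bar>" "\<bar>s x\<bar> = indicator E x" for x
  using C by (auto simp: s_def E_def abs_mult sgn_if split: split_indicator)
 have intE: "Lint (indicator E :: real fn)"
  using L2_inner_integrable[OF iE iE] by (simp add: indicator_inter_arith[symmetric])
 have intEF: "Lint (%x. indicator E x * \<bar>F x\<bar>)"
  using L2_inner_integrable[OF sL F(1)] by (simp add: sF)
 let ?i = "indicator D :: real fn"
 \<comment> \<open>The seemingly void last term is the approximation error. It makes the inequality
   a closed condition in the first argument that every test function satisfies, and it disappears at
   \<open>s\<close> itself.\<close>
 have "abs_l2 s \<bullet> abs_l2 F <= C * ((LINT x. indicator E x) + L2n ?i * norm (abs_l2 s - abs_l2 s))"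
 proof (rule L2_test_dense[OF D(1) sL sD, where P="%X. X \<bullet> abs_l2 F <= C * ((LINT x. indicator E x) + L2n ?i * norm (X - abs_l2 s))"])
  fix \<eta> :: "real fn" assume \<eta>: "test_function D \<eta>"
  have \<eta>L: "in_L2 \<eta>" by (rule in_L2_test[OF \<eta>])
  have dL: "in_L2 (%x. \<bar>\<eta> x - s x\<bar>)" using in_L2_norm[OF in_L2_diff[OF \<eta>L sL]] by simp
  obtain K where K: "K \<subseteq> D" "!!x. x \<notin> K ==> \<eta> x = 0"
   by (rule test_functionE[OF \<eta>]) blast
  have "(LINT x. \<bar>\<eta> x\<bar>) <= (LINT x. indicator E x + ?i x \<bullet> \<bar>\<eta> x - s x\<bar>)"
  proof (rule integral_mono[OF integrable_abs[OF test_integrable[OF \<eta>]] Bochner_Integration.integrable_add[OF intE L2_inner_integrable[OF iD dL]]])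
   fix x
   have "\<bar>\<eta> x\<bar> <= \<bar>s x\<bar> + \<bar>\<eta> x - s x\<bar>" by linarith
   moreover have "\<eta> x = 0" if "x \<notin> D" using K that by blast
   ultimately show "\<bar>\<eta> x\<bar> <= indicator E x + ?i x \<bullet> \<bar>\<eta> x - s x\<bar>"
    unfolding sF(2) by (cases "x \<in> D") auto
  qed
  also have "... = (LINT x. indicator E x) + abs_l2 ?i \<bullet> abs_l2 (%x. \<bar>\<eta> x - s x\<bar>)"
   unfolding inner_abs_l2[OF iD dL] by (rule Bochner_Integration.integral_add[OF intE L2_inner_integrable[OF iD dL]])
  also have "abs_l2 ?i \<bullet> abs_l2 (%x. \<bar>\<eta> x - s x\<bar>) <= L2n ?i * L2n (%x. \<bar>\<eta> x - s x\<bar>)"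
   by (rule norm_cauchy_schwarz)
  also have "L2n (%x. \<bar>\<eta> x - s x\<bar>) = norm (abs_l2 \<eta> - abs_l2 s)"
   by (rule power2_eq_imp_eq) (simp_all add: norm_abs_l2 dL abs_l2_diff[OF \<eta>L sL] in_L2_diff[OF \<eta>L sL])
  finally have "C * (LINT x. \<bar>\<eta> x\<bar>) <= C * ((LINT x. indicator E x) + L2n ?i * norm (abs_l2 \<eta> - abs_l2 s))"
   by (simp add: mult_left_mono C)
  thus "abs_l2 \<eta> \<bullet> abs_l2 F <= C * ((LINT x. indicator E x) + L2n ?i * norm (abs_l2 \<eta> - abs_l2 s))"
   using b[OF \<eta>] by (simp add: inner_abs_l2[OF \<eta>L F(1)])
 qed (intro closed_Collect_le continuous_intros)
 hence "(LINT x. indicator E x * \<bar>F x\<bar>) <= C * (LINT x. indicator E x)"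
  by (simp add: inner_abs_l2[OF sL F(1)] sF)
 hence le: "(LINT x. indicator E x * \<bar>F x\<bar> - C * indicator E x) <= 0"
  by (subst Bochner_Integration.integral_diff[OF intEF integrable_mult_right[OF intE]]) simp
 have nn: "0 <= indicator E x * \<bar>F x\<bar> - C * indicator E x" for x
  by (auto simp: E_def split: split_indicator)
 have i: "Lint (%x. indicator E x * \<bar>F x\<bar> - C * indicator E x)"
  by (rule Bochner_Integration.integrable_diff[OF intEF integrable_mult_right[OF intE]])
 have "(LINT x. indicator E x * \<bar>F x\<bar> - C * indicator E x) = 0"
  by (intro antisym le integral_nonneg_AE AE_I2 nn)
 hence "AE x. indicator E x * \<bar>F x\<bar> - C * indicator E x = 0"
  by (subst (asm) integral_nonneg_eq_0_iff_AE[OF i]) (use nn in auto)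
 thus ?thesis
  by (rule eventually_mono) (auto simp: E_def indicator_def split: if_splits)
qed

lemma test_zero_outside: "test_function D \<eta> ==> x \<notin> D ==> \<eta> x = 0"
 unfolding test_function_def using closure_subset[of "{x. \<eta> x \<noteq> 0}"] by blast

lemma in_L2_loc_ball:
 fixes f :: "('a::euclidean_space) fn"
 assumes "in_L2_loc f" shows "in_L2 (%x. indB r x *R f x)"
proof -
 have e: "(norm (indB r x *R f x))^2 = indB r x *R (norm (f x))\<^sup>2" for x
  by (simp split: split_indicator)
 have "f \<in> LM" using assms by (simp add: in_L2_loc_def)
 moreover have "(indB r :: real fn) \<in> LM"
  by (rule in_L2_measurable[OF in_L2_indicator_ball])
 ultimately have "(%x. indB r x *R f x) \<in> LM"
  by (intro borel_measurable_scaleR)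
 moreover have "Lint (%x. (norm (indB r x *R f x))^2)"
  unfolding e using assms by (simp add: in_L2_loc_def set_integrable_def)
 ultimately show ?thesis unfolding in_L2w_def by simp
qed

lemma in_L2_locI:
 fixes f :: "('a::euclidean_space) fn"
 assumes "f \<in> LM" "!!r. in_L2 (%x. indB r x *R f x)"
 shows "in_L2_loc f"
proof -
 have e: "(norm (indB r x *R f x))^2 = indB r x *R (norm (f x))\<^sup>2" for x r
  by (simp split: split_indicator)
 show ?thesis
  using assms(1) in_L2_integrable[OF assms(2)] unfolding in_L2_loc_def set_integrable_def e by blast
qed

lemma L2_loc_loc_integrable:
 fixes f :: "('a::euclidean_space) fn"
 assumes "in_L2_loc f" shows "loc_integrable D f"
 unfolding loc_integrable_def set_integrable_def
proof (intro allI impI)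
 fix K assume K: "compact K \<and> K \<subseteq> D"
 then obtain r where r: "K \<subseteq> ball 0 r"
  using compact_imp_bounded bounded_subset_ballD by blast
 have e: "indicator K x *R f x = indicator K x *R (indB r x *R f x)" for x
  using r by (auto split: split_indicator)
 have "Lint (%x. indicator K x *R (indB r x *R f x))"
  using L2_loc_integrable[OF in_L2_loc_ball[OF assms, of r], of UNIV] K
  unfolding loc_integrable_def set_integrable_def by blast
 thus "Lint (%x. indicator K x *R f x)" unfolding e[symmetric] .
qed

text \<open>By duality it suffices to test with \<open>\<phi>\<close> supported in the ball;
  \<open>translation_difference\<close> and Cauchy-Schwarz bound the result, since translations
  preserve the L2 norm.\<close>

lemma L2_difference_bound:
 fixes \<psi> :: "real fn"
 assumes \<psi>: "in_L2_loc \<psi>" and g: "!!i. weakd i \<psi> (g i)" and gL: "!!i. in_L2 (g i)"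
 shows "in_L2 (%x. indB r x * (\<psi> (x + h) - \<psi> x))"
  "L2n (%x. indB r x * (\<psi> (x + h) - \<psi> x)) <= norm h * (\<Sum>i. L2n (g i))"
proof -
 let ?B = "ball (0::real^3) r" and ?G = "\<Sum>i. L2n (g i)"
 let ?F = "%x. indicator ?B x * (\<psi> (x + h) - \<psi> x)"
 have m: "\<psi> \<in> LM" using \<psi> by (simp add: in_L2_loc_def)
 have L1: "in_L2 (%x. indicator ?B x * \<psi> x)" using in_L2_loc_ball[OF \<psi>, of r] by simp
 have "in_L2 (%x. indB (r + norm h) x * \<psi> x)" using in_L2_loc_ball[OF \<psi>, of "r + norm h"] by simp
 from in_L2_translate(1)[OF this, of h]
 have L2: "in_L2 (%x. indB (r + norm h) (x + h) * \<psi> (x + h))" .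
 have mB: "(indicator ?B :: real fn) \<in> LM"
  by (rule in_L2_measurable[OF in_L2_indicator_ball])
 have m2: "(%x. indicator ?B x * \<psi> (x + h)) \<in> LM"
  by (rule borel_measurable_times[OF mB measurable_translate[OF m]])
 have L3: "in_L2 (%x. indicator ?B x * \<psi> (x + h))"
 proof (rule in_L2_bound[OF L2 m2, of 1], rule AE_I2)
  fix x
  have "x + h \<in> ball 0 (r + norm h)" if "x \<in> ?B"
   using norm_triangle_ineq[of x h] that by simp
  thus "norm (indicator ?B x * \<psi> (x + h)) <= 1 * norm (indB (r + norm h) (x + h) * \<psi> (x + h))"
   by (cases "x \<in> ?B") auto
 qed
 have "in_L2 (%x. indicator ?B x * \<psi> (x + h) - indicator ?B x * \<psi> x)" by (rule in_L2_diff[OF L3 L1])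
 thus FL: "in_L2 ?F" by (simp add: right_diff_distrib)
 show "L2n ?F <= norm h * ?G"
 proof (rule dense_bound[OF open_ball FL])
  show "norm h * ?G >= 0" by (intro mult_nonneg_nonneg sum_nonneg) auto
  fix \<phi> :: "real fn" assume \<phi>: "test_function ?B \<phi>"
  have "\<phi> x * ?F x = \<phi> x * (\<psi> (x + h) - \<psi> x)" for x
   using test_zero_outside[OF \<phi>, of x] by (cases "x \<in> ?B") auto
  moreover obtain s where s: "0 < s" "s < 1"
   "(LINT x. \<phi> x * (\<psi> (x + h) - \<psi> x)) = (\<Sum>i. h $ i * (LINT x. \<phi> (x - s *R h) * g i x))"
   by (rule translation_difference[OF L2_loc_loc_integrable[OF \<psi>] g \<phi>, of h]) auto
  ultimately have e: "(LINT x. \<phi> x * ?F x) = (\<Sum>i. h $ i * (LINT x. \<phi> (x - s *R h) * g i x))"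
   by (simp only:)
  have \<phi>L: "in_L2 \<phi>" by (rule in_L2_test[OF \<phi>])
  have t: "\<bar>LINT x. \<phi> (x - s *R h) * g i x\<bar> <= L2n \<phi> * L2n (g i)" for i
  proof -
   have "in_L2 (%x. \<phi> (x - s *R h))" "L2n (%x. \<phi> (x - s *R h)) = L2n \<phi>"
    using in_L2_translate[OF \<phi>L, of "- (s *R h)"] by simp_all
   thus ?thesis
    using Cauchy_Schwarz_ineq2[of "abs_l2 (%x. \<phi> (x - s *R h))" "abs_l2 (g i)"] by (simp add: inner_abs_l2 gL)
  qed
  have "\<bar>LINT x. \<phi> x * ?F x\<bar> <= (\<Sum>i. norm h * (L2n \<phi> * L2n (g i)))"
   unfolding e
  proof (rule order_trans[OF sum_abs], rule sum_mono)
   show "\<bar>h $ i * (LINT x. \<phi> (x - s *R h) * g i x)\<bar> <= norm h * (L2n \<phi> * L2n (g i))" for i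
    unfolding abs_mult by (intro mult_mono t component_le_norm_cart) auto
  qed
  also have "... = norm h * ?G * L2n \<phi>"
   by (simp add: sum_distrib_left sum_distrib_right mult_ac)
  finally show "\<bar>LINT x. \<phi> x * ?F x\<bar> <= norm h * ?G * L2n \<phi>" .
 qed simp
qed

lemma in_Linf_L2:
 fixes c :: "real fn"
 assumes "in_Linf (ball 0 r) c"
 shows "in_L2 (%x. indB r x * c x)"
  and "\<exists>C\<ge>0. AE x. x \<in> ball 0 r --> \<bar>c x\<bar> <= C"
proof -
 obtain C where C: "AE x in lebesgue_on (ball 0 r). norm (c x) <= C" and m: "c \<in> borel_measurable (lebesgue_on (ball 0 r))"
  using assms by (auto simp: in_Linf_def)
 have ae: "AE x. x \<in> ball 0 r --> \<bar>c x\<bar> <= max C 0"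
 proof -
  have "AE x. x \<in> ball 0 r --> norm (c x) <= C"
   using C by (subst (asm) AE_restrict_space_iff) auto
  thus ?thesis by (rule eventually_mono) auto
 qed
 thus "\<exists>C\<ge>0. AE x. x \<in> ball 0 r --> \<bar>c x\<bar> <= C"
  by (intro exI[of _ "max C 0"]) auto
 have "(%x. indB r x *R c x) \<in> LM"
  using m by (subst (asm) borel_measurable_restrict_space_iff) auto
 hence m': "(%x. indB r x * c x) \<in> LM" by simp
 show "in_L2 (%x. indB r x * c x)"
 proof (rule in_L2_bound[OF in_L2_indicator_ball[of 0 r] m', of "max C 0"])
  show "AE x. norm (indB r x * c x) <= max C 0 * norm (indB r x :: real)"
   using ae by (rule eventually_mono) (auto split: split_indicator)
 qed
qed

text \<open>A Lipschitz estimate that avoids a continuous representative: for each shift it holds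
  off a null set, which may depend on the shift. The proof is the L1 dual of the argument for L2
  differences.\<close>

lemma W1inf_difference_bound:
 fixes c :: "real fn"
 assumes c: "in_W1inf (ball 0 R) c" and r: "r < R"
 obtains L where "L >= 0" "!!h. norm h < R - r ==> AE x. x \<in> ball 0 r --> \<bar>c (x + h) - c x\<bar> <= L * norm h"
proof -
 let ?R = "ball (0::real^3) R" and ?B = "ball (0::real^3) r"
 obtain g where g: "!!i. has_weak_pderiv ?R i c (g i)" "!!i. in_Linf ?R (g i)"
  using c unfolding in_W1inf_def by metis
 have "\<forall>i. \<exists>C\<ge>0. AE x. x \<in> ?R --> \<bar>g i x\<bar> <= C"
  using in_Linf_L2(2)[OF g(2)] by blast
 then obtain C where C: "!!i. C i >= 0" "!!i. AE x. x \<in> ?R --> \<bar>g i x\<bar> <= C i"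
  by metis
 \<comment> \<open>Extension by zero makes \<open>c\<close> square integrable on the whole space. It
   is weakly differentiable only inside the ball, which suffices because the shifted supports stay
   there.\<close>
 define c0 where "c0 x = indicator ?R x * c x" for x
 have c0L: "in_L2 c0" unfolding c0_def using c by (intro in_Linf_L2) (simp add: in_W1inf_def)
 define g0 where "g0 i x = indicator ?R x * g i x" for i x
 have g0L: "in_L2 (g0 i)" for i unfolding g0_def by (intro in_Linf_L2 g)
 have g0b: "AE x. \<bar>g0 i x\<bar> <= C i" for i
  using C(2)[of i] by (rule eventually_mono) (use C(1)[of i] in \<open>auto simp: g0_def abs_mult split: split_indicator\<close>)
 have w0: "has_weak_pderiv ?R i c0 (g0 i)" for i
  unfolding has_weak_pderiv_def
 proof (intro conjI allI impI)
  show "loc_integrable ?R c0" "loc_integrable ?R (g0 i)" by (rule L2_loc_integrable[OF c0L], rule L2_loc_integrable[OF g0L])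
  fix \<eta> :: "real fn" assume \<eta>: "test_function ?R \<eta>"
  have "(LINT x:?R|lebesgue. pd i \<eta> x *R c0 x) = (LINT x:?R|lebesgue. pd i \<eta> x *R c x)"
   "(LINT x:?R|lebesgue. \<eta> x *R g0 i x) = (LINT x:?R|lebesgue. \<eta> x *R g i x)"
   unfolding set_lebesgue_integral_def by (auto intro!: Bochner_Integration.integral_cong simp: c0_def g0_def split: split_indicator)
  moreover have "(LINT x:?R|lebesgue. pd i \<eta> x *R c x) = - (LINT x:?R|lebesgue. \<eta> x *R g i x)"
   using g(1)[of i] \<eta> unfolding has_weak_pderiv_def by blast
  ultimately show "(LINT x:?R|lebesgue. pd i \<eta> x *R c0 x) = - (LINT x:?R|lebesgue. \<eta> x *R g0 i x)"
   by simp
 qed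
 have "AE x. x \<in> ?B --> \<bar>c (x + h) - c x\<bar> <= sum C UNIV * norm h" if h: "norm h < R - r" for h
 proof -
  let ?F = "%x. indicator ?B x * (c0 (x + h) - c0 x)"
  have "AE x. \<bar>?F x\<bar> <= sum C UNIV * norm h"
  proof (rule dense_sup_bound[of ?B])
   have "in_L2 (%x. c0 (x + h) - c0 x)" by (intro in_L2_diff in_L2_translate c0L)
   moreover have "(%x. indicator ?B x * (c0 (x + h) - c0 x)) \<in> LM"
    by (rule borel_measurable_times[OF in_L2_measurable[OF in_L2_indicator_ball] in_L2_measurable[OF calculation]])
   ultimately show "in_L2 ?F" by (rule in_L2_bound[of _ _ 1]) (auto split: split_indicator)
   show "sum C UNIV * norm h >= 0" by (intro mult_nonneg_nonneg sum_nonneg C) simp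
   fix \<phi> :: "real fn" assume \<phi>: "test_function ?B \<phi>"
   have "\<phi> x * ?F x = \<phi> x * (c0 (x + h) - c0 x)" for x
    using test_zero_outside[OF \<phi>, of x] by (cases "x \<in> ?B") auto
   moreover have "(%x. x + s *R h) ` ?B \<subseteq> ?R" if "0 <= s" "s <= 1" for s
   proof
    fix y assume "y \<in> (%x. x + s *R h) ` ?B"
    then obtain x where x: "norm x < r" "y = x + s *R h" by auto
    have "norm y <= norm x + s * norm h" using norm_triangle_ineq[of x "s *R h"] that x by simp
    also have "s * norm h <= norm h" using that by (simp add: mult_left_le_one_le)
    finally show "y \<in> ?R" using x h by simp
   qed
   moreover obtain s where s: "0 < s" "s < 1"
    "(LINT x. \<phi> x * (c0 (x + h) - c0 x)) = (\<Sum>i. h $ i * (LINT x. \<phi> (x - s *R h) * g0 i x))"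
    by (rule translation_difference[OF L2_loc_integrable[OF c0L] w0 \<phi> calculation(2)])
   ultimately have e: "(LINT x. \<phi> x * ?F x) = (\<Sum>i. h $ i * (LINT x. \<phi> (x - s *R h) * g0 i x))"
    by (simp only:)
   have \<phi>i: "Lint (%x. \<bar>\<phi> x\<bar>)" by (intro integrable_abs test_integrable[OF \<phi>])
   have t: "\<bar>LINT x. \<phi> (x - s *R h) * g0 i x\<bar> <= C i * (LINT x. \<bar>\<phi> x\<bar>)" for i
   proof -
    have i: "Lint (%x. \<bar>\<phi> (x - s *R h)\<bar>)"
     using integrable_translate[OF \<phi>i, of "- (s *R h)"] by simp
    have Ls: "in_L2 (%x. \<phi> (x - s *R h))" using in_L2_translate(1)[OF in_L2_test[OF \<phi>], of "- (s *R h)"] by simp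
    have "\<bar>LINT x. \<phi> (x - s *R h) * g0 i x\<bar> <= (LINT x. \<bar>\<phi> (x - s *R h) * g0 i x\<bar>)"
     by (rule integral_abs_bound)
    also have "... <= (LINT x. C i * \<bar>\<phi> (x - s *R h)\<bar>)"
    proof (rule integral_mono_AE)
     show "Lint (%x. \<bar>\<phi> (x - s *R h) * g0 i x\<bar>)"
      using integrable_abs[OF L2_inner_integrable[OF Ls g0L[of i]]] by simp
     show "AE x. \<bar>\<phi> (x - s *R h) * g0 i x\<bar> <= C i * \<bar>\<phi> (x - s *R h)\<bar>"
      using g0b[of i] by (rule eventually_mono) (simp add: abs_mult mult.commute mult_right_mono)
    qed (intro integrable_mult_right i)
    also have "... = C i * (LINT x. \<bar>\<phi> (x + - (s *R h))\<bar>)" by simp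
    also have "... = C i * (LINT x. \<bar>\<phi> x\<bar>)"
     by (subst integral_translate[OF borel_measurable_integrable[OF \<phi>i]]) simp
    finally show ?thesis .
   qed
   have "\<bar>LINT x. \<phi> x * ?F x\<bar> <= (\<Sum>i. norm h * (C i * (LINT x. \<bar>\<phi> x\<bar>)))"
    unfolding e
   proof (rule order_trans[OF sum_abs], rule sum_mono)
    show "\<bar>h $ i * (LINT x. \<phi> (x - s *R h) * g0 i x)\<bar> <= norm h * (C i * (LINT x. \<bar>\<phi> x\<bar>))" for i
     unfolding abs_mult by (intro mult_mono t component_le_norm_cart) auto
   qed
   also have "... = sum C UNIV * norm h * (LINT x. \<bar>\<phi> x\<bar>)"
    by (simp add: sum_distrib_left sum_distrib_right mult_ac)
   finally show "\<bar>LINT x. \<phi> x * ?F x\<bar> <= sum C UNIV * norm h * (LINT x. \<bar>\<phi> x\<bar>)" .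
  qed auto
  thus ?thesis
  proof (rule eventually_mono, intro impI)
   fix x assume x: "\<bar>?F x\<bar> <= sum C UNIV * norm h" "x \<in> ?B"
   have "norm (x + h) < R" using norm_triangle_ineq[of x h] x(2) h by simp
   moreover have "norm x < R" using x(2) r by simp
   ultimately show "\<bar>c (x + h) - c x\<bar> <= sum C UNIV * norm h" using x by (simp add: c0_def)
  qed
 qed
 thus ?thesis using C(1) by (intro that[of "sum C UNIV"]) (auto intro: sum_nonneg)
qed

section \<open>A Poincare inequality\<close>

lemma lborel_nn_integral_translate:
 fixes f :: "real^3 => ennreal"
 assumes [measurable]: "f \<in> borel_measurable borel"
 shows "(\<integral>\<^sup>+x. f (x + h) \<partial>lborel) = (\<integral>\<^sup>+x. f x \<partial>lborel)"
proof -
 have "(\<integral>\<^sup>+x. f x \<partial>lborel) = (\<integral>\<^sup>+x. f x \<partial>distr lborel borel (%x. h + 1 *R x))"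
  by (subst lborel_distr_affine) auto
 also have "... = (\<integral>\<^sup>+x. f (h + 1 *R x) \<partial>lborel)"
  by (rule nn_integral_distr) auto
 finally show ?thesis by (simp add: add.commute)
qed

text \<open>The constant \<open>t\<close> paired with \<open>v\<close> over the ball gives nothing
  as \<open>v\<close> has mean zero, so the integral of the indicator times \<open>t - v\<close> is
  the volume times \<open>t\<close>; Cauchy-Schwarz does the rest.\<close>

lemma mean_zero_square_bound:
 fixes v :: "real fn"
 assumes v: "in_L2 (%y. indB r y * v y)" and z: "(LINT y. indB r y * v y) = 0"
 shows "ennreal (measure lebesgue (ball (0::real^3) r) * t\<^sup>2) <= (\<integral>\<^sup>+y. ennreal (indB r y * (t - v y)^2) \<partial>lebesgue)"
proof -
 let ?I = "indicator (ball (0::real^3) r) :: real fn"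
 have iL: "in_L2 ?I" by (rule in_L2_indicator_ball)
 have ii: "Lint ?I"
  using L2_inner_integrable[OF iL iL] by (simp add: indicator_inter_arith[symmetric])
 have iv: "Lint (%y. ?I y * v y)"
 proof -
  have "(%y. ?I y \<bullet> (?I y * v y)) = (%y. ?I y * v y)" by (auto simp: fun_eq_iff split: split_indicator)
  thus ?thesis using L2_inner_integrable[OF iL v] by (simp only:)
 qed
 let ?w = "%y. ?I y * t - ?I y * v y"
 have tL: "in_L2 (%y. ?I y * t)" using in_L2_scaleR[OF iL, of t] by (simp add: mult.commute)
 have wL: "in_L2 ?w" by (rule in_L2_diff[OF tL v])
 have sq: "(norm (?w y))^2 = ?I y * (t - v y)^2" for y
  by (simp add: right_diff_distrib[symmetric] power_mult_distrib split: split_indicator)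
 have "(%y. ?I y \<bullet> ?w y) = ?w" by (auto simp: fun_eq_iff split: split_indicator)
 hence "abs_l2 ?I \<bullet> abs_l2 ?w = (LINT y. ?w y)"
  by (simp only: inner_abs_l2[OF iL wL])
 also have "... = (LINT y. ?I y * t) - (LINT y. ?I y * v y)"
  by (rule Bochner_Integration.integral_diff[OF integrable_mult_left[OF ii] iv])
 also have "... = measure lebesgue (ball (0::real^3) r) * t" using z by simp
 finally have e: "abs_l2 ?I \<bullet> abs_l2 ?w = measure lebesgue (ball (0::real^3) r) * t" .
 have n: "(L2n ?I)^2 = measure lebesgue (ball (0::real^3) r)"
 proof -
  have "(norm (?I y))^2 = ?I y" for y by (simp split: split_indicator)
  thus ?thesis unfolding norm_abs_l2[OF iL] by simp
 qed
 have "(measure lebesgue (ball (0::real^3) r) * t)^2 <= measure lebesgue (ball (0::real^3) r) * (L2n ?w)^2"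
  using Cauchy_Schwarz_ineq[of "abs_l2 ?I" "abs_l2 ?w"] unfolding e n[symmetric] power2_norm_eq_inner[symmetric] .
 hence "measure lebesgue (ball (0::real^3) r) * t\<^sup>2 <= (L2n ?w)^2"
 proof -
  have *: "(m * t)^2 <= m * s ==> 0 <= s ==> 0 <= m ==> m * t\<^sup>2 <= s" for m s :: real
   by (cases "m = 0") (auto simp: power2_eq_square mult.assoc mult.left_commute[of t])
  show ?thesis
   by (rule *[OF \<open>(measure lebesgue (ball 0 r) * t)\<^sup>2 <= _\<close>]) auto
 qed
 also have "(L2n ?w)^2 = (LINT y. ?I y * (t - v y)^2)"
  unfolding norm_abs_l2[OF wL] sq ..
 finally have "ennreal (measure lebesgue (ball (0::real^3) r) * t\<^sup>2) <= ennreal (LINT y. ?I y * (t - v y)^2)"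
  by (rule ennreal_leI)
 also have "... = (\<integral>\<^sup>+y. ennreal (?I y * (t - v y)^2) \<partial>lebesgue)"
  using in_L2_integrable[OF wL] unfolding sq by (intro nn_integral_eq_integral[symmetric]) auto
 finally show ?thesis .
qed

text \<open>Mean zero bounds the square of the value at \<open>x\<close>, times the volume V of the
  small ball, by the integral of squared differences to points \<open>y\<close> of that ball.
  Integrating over \<open>x\<close> in the large ball and writing x = y + h with |h| < R + r leaves
  the L2 difference bound; this is where (R + r) and the volume ratio in \<open>C\<close> come
  from.\<close>

lemma poincare_real:
 assumes r: "r > 0" and R: "R > 0"
 obtains C where "C >= 0" "!!\<psi> g. in_L2_loc \<psi> ==> (!!i. weakd i \<psi> (g i)) ==> (!!i. in_L2 (g i)) ==>
   (LINT x. indB r x * \<psi> x) = (0::real) ==>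
   L2n (%x. indB R x * \<psi> x) <= C * (\<Sum>i. L2n (g i))"
proof -
 define V where "V = measure lebesgue (ball (0::real^3) r)"
 define W where "W = measure lebesgue (ball (0::real^3) (R + r))"
 have V: "V > 0" unfolding V_def using r by (simp add: content_ball_pos)
 have W: "W >= 0" unfolding W_def by simp
 define C where "C = sqrt (W / V) * (R + r)"
 have bound: "L2n (%x. indB R x * \<psi> x) <= C * (\<Sum>i. L2n (g i))"
  if \<psi>: "in_L2_loc \<psi>" and g: "!!i. weakd i \<psi> (g i)" "!!i. in_L2 (g i)"
   and z: "(LINT x. indB r x * \<psi> x) = (0::real)" for \<psi> g
 proof -
  let ?G = "\<Sum>i. L2n (g i)"
  have G: "?G >= 0" by (intro sum_nonneg) auto
  have m: "\<psi> \<in> LM" using \<psi> by (simp add: in_L2_loc_def)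
  \<comment> \<open>Fubini is applied for \<open>lborel\<close>, so a Borel representative replaces
    \<open>\<psi>\<close>.\<close>
  obtain v where v: "v \<in> borel_measurable lborel" "AE x in lborel. \<psi> x = v x"
   using completion_ex_borel_measurable_real[OF m] by blast
  have [measurable]: "v \<in> borel_measurable borel" "v \<in> borel_measurable lborel" using v(1) by simp_all
  have [measurable]: "ball (0::real^3) s \<in> sets borel" "ball (0::real^3) s \<in> sets lborel" for s by simp_all
  have [measurable]: "(%x. x \<in> ball (0::real^3) s) \<in> borel \<rightarrow>\<^sub>M count_space UNIV"
   "(%x. x \<in> ball (0::real^3) s) \<in> lborel \<rightarrow>\<^sub>M count_space UNIV" for s
   by (simp_all add: pred_def)
  have ae: "AE x. \<psi> x = v x" using v(2) by (rule AE_completion)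
  have vm: "v \<in> LM" by (rule borel_lebesgue) simp
  have vL: "in_L2_loc v"
  proof (rule in_L2_locI[OF vm])
   fix s
   have "(%x. indB s x *R v x) \<in> LM"
    by (intro borel_measurable_scaleR vm in_L2_measurable[OF in_L2_indicator_ball])
   thus "in_L2 (%x. indB s x *R v x)"
    by (rule in_L2_AE_cong[OF in_L2_loc_ball[OF \<psi>, of s]]) (use ae in \<open>auto elim: eventually_mono\<close>)
  qed
  have zv: "(LINT x. indB r x * v x) = 0"
  proof -
   have "(LINT x. indB r x * v x) = (LINT x. indB r x * \<psi> x)"
    by (intro integral_cong_AE borel_measurable_times in_L2_measurable[OF in_L2_indicator_ball] vm m)
     (use ae in \<open>auto elim: eventually_mono\<close>)
   thus ?thesis using z by simp
  qed
  have diff: "(\<integral>\<^sup>+y. ennreal (indB r y * (v (y + h) - v y)^2) \<partial>lborel) <= ennreal ((norm h * ?G)^2)" for h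
  proof -
   let ?D = "%y. indB r y * (\<psi> (y + h) - \<psi> y)"
   note D = L2_difference_bound[where r=r and h=h, OF \<psi> g]
   have "(\<integral>\<^sup>+y. ennreal (indB r y * (v (y + h) - v y)^2) \<partial>lborel)
     = (\<integral>\<^sup>+y. ennreal (indB r y * (v (y + h) - v y)^2) \<partial>lebesgue)"
    by (simp add: nn_integral_completion)
   also have "... = (\<integral>\<^sup>+y. ennreal ((norm (?D y))^2) \<partial>lebesgue)"
   proof (rule nn_integral_cong_AE)
    show "AE y. ennreal (indB r y * (v (y + h) - v y)^2) = ennreal ((norm (?D y))^2)"
     using ae AE_translate[OF ae, of h]
     by eventually_elim (auto split: split_indicator)
   qed
   also have "... = ennreal ((L2n ?D)^2)"
    unfolding norm_abs_l2[OF D(1)] by (rule nn_integral_eq_integral[OF in_L2_integrable[OF D(1)]]) simp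
   also have "... <= ennreal ((norm h * ?G)^2)"
    by (intro ennreal_leI power_mono D) auto
   finally show ?thesis .
  qed
  let ?K = "%x y. ennreal (indB r y * (v x - v y)^2)"
  have pt: "ennreal V * ennreal (indB R x * (v x)^2) <= indB R x * (\<integral>\<^sup>+y. ?K x y \<partial>lborel)" for x
  proof (cases "x \<in> ball 0 R")
   case True
   have "in_L2 (%y. indB r y * v y)" using in_L2_loc_ball[OF vL, of r] by simp
   from mean_zero_square_bound[OF this zv, of "v x"]
   have "ennreal (V * (v x)^2) <= (\<integral>\<^sup>+y. ?K x y \<partial>lborel)"
    by (simp add: V_def nn_integral_completion)
   thus ?thesis using True V by (simp add: ennreal_mult)
  qed simp
  have "ennreal V * (\<integral>\<^sup>+x. ennreal (indB R x * (v x)^2) \<partial>lborel) = (\<integral>\<^sup>+x. ennreal V * ennreal (indB R x * (v x)^2) \<partial>lborel)"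
   by (rule nn_integral_cmult[symmetric]) measurable
  also have "... <= (\<integral>\<^sup>+x. indB R x * (\<integral>\<^sup>+y. ?K x y \<partial>lborel) \<partial>lborel)"
   by (intro nn_integral_mono pt)
  also have "... = (\<integral>\<^sup>+x. (\<integral>\<^sup>+y. indB R x * ?K x y \<partial>lborel) \<partial>lborel)"
   by (intro nn_integral_cong nn_integral_cmult[symmetric]) measurable
  also have "... = (\<integral>\<^sup>+y. (\<integral>\<^sup>+x. indB R x * ?K x y \<partial>lborel) \<partial>lborel)"
   by (rule lborel_pair.Fubini'[symmetric]) measurable
  \<comment> \<open>The inner variable becomes the difference h of the two points; relevant
    differences have norm below R + r.\<close>
  also have "... = (\<integral>\<^sup>+y. (\<integral>\<^sup>+h. indB R (h + y) * ?K (h + y) y \<partial>lborel) \<partial>lborel)"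
   by (intro nn_integral_cong lborel_nn_integral_translate[symmetric]) measurable
  also have "... <= (\<integral>\<^sup>+y. (\<integral>\<^sup>+h. indB (R + r) h * ?K (h + y) y \<partial>lborel) \<partial>lborel)"
  proof (intro nn_integral_mono)
   fix y h :: "real^3"
   show "indB R (h + y) * ?K (h + y) y <= indB (R + r) h * ?K (h + y) y"
   proof (cases "h + y \<in> ball 0 R \<and> y \<in> ball 0 r")
    case True
    hence "norm h < R + r" using norm_triangle_ineq4[of "h + y" y] by simp
    thus ?thesis using True by simp
   qed (auto split: split_indicator)
  qed
  also have "... = (\<integral>\<^sup>+h. (\<integral>\<^sup>+y. indB (R + r) h * ?K (h + y) y \<partial>lborel) \<partial>lborel)"
   by (rule lborel_pair.Fubini'[symmetric]) measurable
  also have "... = (\<integral>\<^sup>+h. indB (R + r) h * (\<integral>\<^sup>+y. ?K (y + h) y \<partial>lborel) \<partial>lborel)"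
  proof (intro nn_integral_cong)
   fix h :: "real^3"
   have "(\<integral>\<^sup>+y. indB (R + r) h * ?K (h + y) y \<partial>lborel) = indB (R + r) h * (\<integral>\<^sup>+y. ?K (h + y) y \<partial>lborel)"
    by (rule nn_integral_cmult) measurable
   thus "(\<integral>\<^sup>+y. indB (R + r) h * ?K (h + y) y \<partial>lborel) = indB (R + r) h * (\<integral>\<^sup>+y. ?K (y + h) y \<partial>lborel)"
    by (simp add: add.commute)
  qed
  also have "... <= (\<integral>\<^sup>+h. ennreal (((R + r) * ?G)^2) * indicator (ball (0::real^3) (R + r)) h \<partial>lborel)"
  proof (intro nn_integral_mono)
   fix h :: "real^3"
   show "indB (R + r) h * (\<integral>\<^sup>+y. ?K (y + h) y \<partial>lborel) <= ennreal (((R + r) * ?G)^2) * indB (R + r) h"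
   proof (cases "h \<in> ball 0 (R + r)")
    case True
    hence "norm h * ?G <= (R + r) * ?G" using G by (intro mult_right_mono) auto
    hence "ennreal ((norm h * ?G)^2) <= ennreal (((R + r) * ?G)^2)"
     using G by (intro ennreal_leI power_mono) auto
    thus ?thesis using order_trans[OF diff[of h]] True by simp
   qed simp
  qed
  also have "... = ennreal (((R + r) * ?G)^2) * ennreal W"
  proof -
   have "emeasure lborel (ball (0::real^3) (R + r)) = ennreal W"
    unfolding W_def using emeasure_bounded_finite[of "ball (0::real^3) (R + r)"]
    by (subst emeasure_eq_ennreal_measure) auto
   thus ?thesis by (simp add: nn_integral_cmult_indicator)
  qed
  also have "... = ennreal (((R + r) * ?G)^2 * W)" using W by (simp add: ennreal_mult)
  finally have main: "ennreal V * (\<integral>\<^sup>+x. ennreal (indB R x * (v x)^2) \<partial>lborel) <= ennreal (((R + r) * ?G)^2 * W)" .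
  have PL: "in_L2 (%x. indB R x * \<psi> x)" using in_L2_loc_ball[OF \<psi>, of R] by simp
  let ?N = "L2n (%x. indB R x * \<psi> x)"
  have "ennreal (?N\<^sup>2) = (\<integral>\<^sup>+x. ennreal ((norm (indB R x * \<psi> x))^2) \<partial>lebesgue)"
   unfolding norm_abs_l2[OF PL] by (rule nn_integral_eq_integral[OF in_L2_integrable[OF PL], symmetric]) simp
  also have "... = (\<integral>\<^sup>+x. ennreal (indB R x * (v x)^2) \<partial>lebesgue)"
   by (rule nn_integral_cong_AE) (use ae in \<open>auto elim!: eventually_mono split: split_indicator\<close>)
  also have "... = (\<integral>\<^sup>+x. ennreal (indB R x * (v x)^2) \<partial>lborel)"
   by (simp add: nn_integral_completion)
  finally have "ennreal (V * ?N\<^sup>2) <= ennreal (((R + r) * ?G)^2 * W)"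
   using main V by (simp add: ennreal_mult)
  hence "V * ?N\<^sup>2 <= ((R + r) * ?G)^2 * W"
   using W by (subst (asm) ennreal_le_iff) auto
  hence "?N\<^sup>2 <= (W / V) * ((R + r) * ?G)^2"
   using V by (simp add: pos_le_divide_eq mult.commute)
  also have "... = (C * ?G)^2"
   using V W by (simp add: C_def power_mult_distrib)
  finally show ?thesis
   using r R G W V by (rule_tac power2_le_imp_le) (auto simp: C_def)
 qed
 show ?thesis
  by (rule that[of C]) (use bound r R V W in \<open>auto simp: C_def\<close>)
qed

section \<open>Norm estimates for products and pairings in L2\<close>

lemma in_L2_indicator_mult:
 fixes f :: "('a::euclidean_space) fn"
 assumes "in_L2 f" shows "in_L2 (%x. indicator (ball a r) x *R f x)"
proof (rule in_L2_bound[OF assms, of _ 1])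
 show "(%x. indicator (ball a r) x *R f x) \<in> LM"
  by (intro borel_measurable_scaleR in_L2_measurable[OF in_L2_indicator_ball] in_L2_measurable[OF assms])
qed (simp split: split_indicator)

lemma L2_imp_L2_loc: "in_L2 f ==> in_L2_loc f"
 by (intro in_L2_locI in_L2_indicator_mult in_L2_measurable)

lemma Cauchy_dominated:
 fixes X :: "nat => 'a::real_normed_vector" and Y :: "nat => 'b::real_normed_vector"
 assumes le: "!!m n. norm (X m - X n) <= C * norm (Y m - Y n)" and Y: "Cauchy Y"
 shows "Cauchy X"
proof (rule metric_CauchyI)
 fix e :: real assume "0 < e"
 hence "0 < e / (\<bar>C\<bar> + 1)" by (simp add: add_nonneg_pos)
 from metric_CauchyD[OF Y this] obtain N where N: "!!m n. N <= m ==> N <= n ==> norm (Y m - Y n) < e / (\<bar>C\<bar> + 1)"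
  unfolding dist_norm by blast
 have "norm (X m - X n) < e" if "N <= m" "N <= n" for m n
 proof -
  have "C * norm (Y m - Y n) <= (\<bar>C\<bar> + 1) * norm (Y m - Y n)" by (rule mult_right_mono) simp_all
  also have "... < e" using N[OF that] by (simp add: pos_less_divide_eq mult.commute add_nonneg_pos)
  finally show ?thesis using le[of m n] by linarith
 qed
 thus "\<exists>N. \<forall>m\<ge>N. \<forall>n\<ge>N. dist (X m) (X n) < e" unfolding dist_norm by blast
qed

lemma abs_l2_mono:
 assumes f: "in_L2 f" and g: "in_L2 g" and C: "C >= 0" and le: "AE x. norm (f x) <= C * norm (g x)"
 shows "L2n f <= C * L2n g"
proof (rule power2_le_imp_le)
 have "(LINT x. (norm (f x))^2) <= (LINT x. C\<^sup>2 * (norm (g x))^2)"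
 proof (rule integral_mono_AE)
  show "AE x. (norm (f x))^2 <= C\<^sup>2 * (norm (g x))^2"
   using le
  proof eventually_elim
   case (elim x)
   hence "(norm (f x))^2 <= (C * norm (g x))^2" by (intro power_mono) auto
   thus ?case by (simp add: power_mult_distrib)
  qed
 qed (intro in_L2_integrable f g integrable_mult_right)+
 thus "(L2n f)^2 <= (C * L2n g)^2"
  by (simp add: norm_abs_l2 f g power_mult_distrib)
qed (use C in simp)

lemma L2_integral_bound:
 fixes h :: "real^3 => 'c::{banach, second_countable_topology}"
 assumes f: "in_L2 f" and g: "in_L2 g" and h: "h \<in> LM" and C: "C >= 0"
  and le: "AE x. norm (h x) <= C * norm (f x) * norm (g x)"
 shows "norm (LINT x. h x) <= C * L2n f * L2n g"
proof -
 have fg: "in_L2 (%x. norm (f x))" "in_L2 (%x. norm (g x))" by (intro in_L2_norm f g)+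
 have "norm (LINT x. h x) <= (LINT x. norm (h x))" by (rule integral_norm_bound)
 also have "... <= (LINT x. C * (norm (f x) \<bullet> norm (g x)))"
  by (intro integral_mono_AE integrable_norm L2_prod_integrable[OF f g h le] integrable_mult_right L2_inner_integrable fg)
   (use le in \<open>auto simp: mult.assoc\<close>)
 also have "... = C * (abs_l2 (%x. norm (f x)) \<bullet> abs_l2 (%x. norm (g x)))"
  by (subst inner_abs_l2[OF fg]) simp
 also have "... <= C * (L2n (%x. norm (f x)) * L2n (%x. norm (g x)))"
  by (intro mult_left_mono norm_cauchy_schwarz C)
 also have "... <= C * ((1 * L2n f) * (1 * L2n g))"
  by (intro mult_left_mono mult_mono abs_l2_mono fg f g C) auto
 finally show ?thesis by (simp add: mult.assoc)
qed

lemma L2_bilinear_integrable: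
 fixes prod :: "'a::euclidean_space => 'b::euclidean_space => 'c::euclidean_space"
 assumes "bounded_bilinear prod" "in_L2 f" "in_L2 g"
 shows "Lint (%x. prod (f x) (g x))"
proof -
 interpret bounded_bilinear prod by (rule assms(1))
 from nonneg_bounded obtain K where K: "K >= 0" and K': "\<forall>a b. norm (prod a b) <= norm a * norm b * K" by (elim exE conjE)
 have 1: "(%x. (f x, g x)) \<in> LM"
  using in_L2_measurable[OF assms(2)] in_L2_measurable[OF assms(3)] unfolding borel_prod[symmetric] by (rule measurable_Pair)
 have 2: "(%p. prod (fst p) (snd p)) \<in> borel_measurable borel"
  by (intro borel_measurable_continuous_onI continuous_on continuous_on_fst continuous_on_snd continuous_on_id)
 have "(%x. prod (f x) (g x)) \<in> LM" using measurable_compose[OF 1 2] by simp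
 thus ?thesis
  by (rule L2_prod_integrable[OF assms(2,3), where C=K])
   (use K'[rule_format, of "f _" "g _"] in \<open>intro always_eventually allI, simp only: mult_ac\<close>)
qed

lemma L2_inner_bound:
 fixes prod :: "'a::euclidean_space => 'b::euclidean_space => 'c::euclidean_space"
 assumes "bounded_bilinear prod"
 shows "\<exists>C\<ge>0. \<forall>f g. in_L2 f --> in_L2 g --> norm (LINT x. prod (f x) (g x)) <= C * L2n f * L2n g"
proof -
 interpret bounded_bilinear prod by (rule assms(1))
 from nonneg_bounded obtain C where C: "C >= 0" and C': "\<forall>a b. norm (prod a b) <= norm a * norm b * C" by (elim exE conjE)
 have "norm (LINT x. prod (f x) (g x)) <= C * L2n f * L2n g" if "in_L2 f" "in_L2 g" for f g
  by (rule L2_integral_bound[OF that borel_measurable_integrable[OF L2_bilinear_integrable[OF assms that]] C])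
   (use C'[rule_format, of "f _" "g _"] in \<open>intro always_eventually allI, simp only: mult_ac\<close>)
 with C show ?thesis by blast
qed

lemma L2_bilinear_tendsto:
 fixes prod :: "'a::euclidean_space => 'b::euclidean_space => 'c::euclidean_space"
 assumes b: "bounded_bilinear prod" and f: "!!n. in_L2 (f n)" "in_L2 g"
  and lim: "(%n. abs_l2 (f n)) ----> abs_l2 g" and t: "in_L2 t"
 shows "(%n. LINT x. prod (f n x) (t x)) ----> (LINT x. prod (g x) (t x))"
proof (rule LIM_zero_cancel)
 obtain K where K: "\<forall>f g. in_L2 f --> in_L2 g --> norm (LINT x. prod (f x) (g x)) <= K * L2n f * L2n g"
  using L2_inner_bound[OF b] by (elim exE conjE)
 have *: "norm ((LINT x. prod (f n x) (t x)) - (LINT x. prod (g x) (t x)))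
   <= K * norm (abs_l2 (f n) - abs_l2 g) * L2n t" for n
  unfolding abs_l2_diff[OF f] Bochner_Integration.integral_diff[symmetric, OF L2_bilinear_integrable[OF b f(1) t] L2_bilinear_integrable[OF b f(2) t]]
   bounded_bilinear.diff_left[OF b, symmetric]
  by (rule K[rule_format, OF in_L2_diff[OF f] t])
 have "(%n. K * norm (abs_l2 (f n) - abs_l2 g) * L2n t) ----> K * norm (abs_l2 g - abs_l2 g) * L2n t"
  by (intro tendsto_intros lim)
 thus "(%n. (LINT x. prod (f n x) (t x)) - (LINT x. prod (g x) (t x))) ----> 0"
  using Lim_null_comparison[OF always_eventually[OF allI[OF *]]] by simp
qed

section \<open>Uniqueness and linearity of weak derivatives\<close>

lemma has_weak_pderiv_unique:
 assumes "weakd i f g" "weakd i f g'"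
 shows "AE x. g x = g' x"
proof -
 have "AE x. x \<in> UNIV --> g x = g' x"
 proof (rule fundamental_lemma_eq[OF open_UNIV])
  fix \<eta> :: "real fn" assume "test \<eta>"
  from has_weak_pderivD[OF assms(1) this] has_weak_pderivD[OF assms(2) this]
  show "(LINT x. \<eta> x *R g x) = (LINT x. \<eta> x *R g' x)" by simp
 qed (use assms in \<open>auto simp: has_weak_pderiv_def\<close>)
 thus ?thesis by simp
qed

lemma has_weak_pderivI:
 fixes f :: "('a::euclidean_space) fn"
 assumes "L1loc f" "L1loc g"
  "!!\<eta>. test \<eta> ==> (LINT x. pd i \<eta> x *R f x) = - (LINT x. \<eta> x *R g x)"
 shows "weakd i f g"
 using assms unfolding has_weak_pderiv_def set_lebesgue_integral_def by simp

lemma weak_pderiv_some: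
 "weakd i f g ==> weakd i f (weak_pderiv i f)"
 unfolding weak_pderiv_def by (rule someI[of "weakd i f" g])

lemma weak_pderiv_AE:
 "weakd i f g ==> AE x. weak_pderiv i f x = g x"
 by (rule has_weak_pderiv_unique[OF weak_pderiv_some])

lemma has_weak_pderiv_linear:
 fixes L :: "'a::euclidean_space => 'b::euclidean_space"
 assumes L: "bounded_linear L" and f: "weakd i f g"
 shows "weakd i (%x. L (f x)) (%x. L (g x))"
proof (rule has_weak_pderivI)
 have l: "L1loc f" "L1loc g" using f by (auto simp: has_weak_pderiv_def)
 thus "L1loc (%x. L (f x))" "L1loc (%x. L (g x))"
  by (auto intro: loc_integrable_linear[OF L])
 fix \<eta> :: "real fn" assume \<eta>: "test \<eta>"
 have "(LINT x. pd i \<eta> x *R L (f x)) = (LINT x. L (pd i \<eta> x *R f x))"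
  by (simp add: linear_simps(5)[OF L])
 also have "... = L (LINT x. pd i \<eta> x *R f x)"
  by (rule integral_bounded_linear[OF L integrable_test_scaleR[OF test_pderiv[OF \<eta>] l(1)]])
 also have "... = - L (LINT x. \<eta> x *R g x)"
  unfolding has_weak_pderivD[OF f \<eta>] by (simp add: linear_simps(4)[OF L])
 also have "L (LINT x. \<eta> x *R g x) = (LINT x. L (\<eta> x *R g x))"
  by (rule integral_bounded_linear[OF L integrable_test_scaleR[OF \<eta> l(2)], symmetric])
 also have "... = (LINT x. \<eta> x *R L (g x))"
  by (simp add: linear_simps(5)[OF L])
 finally show "(LINT x. pd i \<eta> x *R L (f x)) = - (LINT x. \<eta> x *R L (g x))" .
qed

lemma has_weak_pderiv_add:
 assumes f: "weakd i f g" and f': "weakd i f' g'"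
 shows "weakd i (%x. f x + f' x) (%x. g x + g' x)"
proof (rule has_weak_pderivI)
 have l: "L1loc f" "L1loc g" "L1loc f'" "L1loc g'"
  using f f' by (auto simp: has_weak_pderiv_def)
 thus "L1loc (%x. f x + f' x)" "L1loc (%x. g x + g' x)"
  by (auto intro: loc_integrable_add)
 fix \<eta> :: "real fn" assume \<eta>: "test \<eta>"
 note i = integrable_test_scaleR[OF \<eta>] integrable_test_scaleR[OF test_pderiv[OF \<eta>]]
 show "(LINT x. pd i \<eta> x *R (f x + f' x)) = - (LINT x. \<eta> x *R (g x + g' x))"
  unfolding scaleR_add_right
  by (simp add: Bochner_Integration.integral_add i l has_weak_pderivD[OF f \<eta>] has_weak_pderivD[OF f' \<eta>])
qed

lemma loc_integrable_AE:
 fixes f g :: "('a::euclidean_space) fn"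
 assumes "loc_integrable D f" "AE x. f x = g x" "g \<in> LM"
 shows "loc_integrable D g"
 unfolding loc_integrable_def set_integrable_def
proof (intro allI impI)
 fix K assume K: "compact K \<and> K \<subseteq> D"
 have i: "Lint (%x. indicator K x *R f x)"
  using assms(1) K unfolding loc_integrable_def set_integrable_def by blast
 have m: "(%x. indicator K x *R g x) \<in> LM"
  by (intro borel_measurable_scaleR assms in_L2_measurable[OF in_L2_indicator_compact]) (use K in auto)
 have "AE x. indicator K x *R f x = indicator K x *R g x"
  using assms(2) by (rule eventually_mono) simp
 with i show "Lint (%x. indicator K x *R g x)"
  by (rule Bochner_Integration.integrable_cong_AE_imp[OF _ m])
qed

lemma loc_integrable_measurable:
 fixes f :: "('a::euclidean_space) fn"
 assumes "L1loc f" shows "f \<in> LM"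
proof (rule borel_measurable_LIMSEQ_metric)
 show "(%x. indicator (cball 0 (real n)) x *R f x) \<in> LM" for n
  using assms unfolding loc_integrable_def set_integrable_def by (intro borel_measurable_integrable) auto
 fix x :: "real^3"
 obtain N where N: "norm x <= real N" using real_arch_simple by blast
 have "\<forall>\<^sub>F n in sequentially. f x = indicator (cball 0 (real n)) x *R f x"
  using eventually_ge_at_top[of N] by eventually_elim (use N in auto)
 thus "(%n. indicator (cball 0 (real n)) x *R f x) ----> f x"
  by (rule Lim_transform_eventually[OF tendsto_const])
qed

section \<open>The gradient space\<close>

lemma weak_grad_has:
 assumes "in_H1loc \<psi>"
 shows "weakd i \<psi> (%x. weak_grad \<psi> x $ i)"
 using assms unfolding in_H1loc_def weak_grad_def by (auto intro: weak_pderiv_some)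

lemma weak_grad_AE:
 assumes "!!i. weakd i \<psi> (%x. g x $ i)"
 shows "AE x. weak_grad \<psi> x = g x"
proof -
 have "AE x. \<forall>i\<in>UNIV. weak_pderiv i \<psi> x = g x $ i"
  by (subst AE_ball_countable) (auto intro: weak_pderiv_AE assms countable_finite)
 thus ?thesis by (rule eventually_mono) (simp add: weak_grad_def vec_eq_iff)
qed

text \<open>The real inequality is applied to real and imaginary parts, whose weak derivatives are
  those parts of the gradient.\<close>

lemma poincare_H1star:
 assumes r: "r > 0" and R: "R > 0"
 obtains C where "C >= 0" "!!\<psi>. in_H1star r \<psi> ==>
   L2n (%x. indB R x *R \<psi> x) <= C * L2n (weak_grad \<psi>)"
proof -
 obtain C where C: "C >= 0" "!!\<psi> g. in_L2_loc \<psi> ==> (!!i. weakd i \<psi> (g i)) ==> (!!i. in_L2 (g i)) ==>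
   (LINT x. indB r x * \<psi> x) = (0::real) ==>
   L2n (%x. indB R x * \<psi> x) <= C * (\<Sum>i. L2n (g i))"
  using poincare_real[OF r R] by blast
 have part: "L2n (%x. indB R x * L (\<psi> x)) <= C * (3 * L2n (weak_grad \<psi>))"
  if \<psi>: "in_H1star r \<psi>" and L: "bounded_linear L" "!!z. \<bar>L z\<bar> <= norm z" for \<psi> and L :: "complex => real"
 proof -
  have H: "in_H1loc \<psi>" "in_L2 (weak_grad \<psi>)" "(LINT x:ball 0 r|lebesgue. \<psi> x) = 0"
   using \<psi> by (auto simp: in_H1star_def)
  have l2: "in_L2_loc \<psi>" using H(1) by (simp add: in_H1loc_def)
  have Ll2: "in_L2_loc (%x. L (\<psi> x))"
  proof (rule in_L2_locI)
   show "(%x. L (\<psi> x)) \<in> LM"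
    using measurable_compose[OF _ borel_measurable_continuous_onI[OF linear_continuous_on[OF L(1)]], of \<psi> lebesgue] l2
    by (simp add: in_L2_loc_def)
   show "in_L2 (%x. indB s x *R L (\<psi> x))" for s
    using in_L2_linear[OF L(1) in_L2_loc_ball[OF l2, of s]] by (simp add: linear_simps(5)[OF L(1)])
  qed
  let ?g = "%i x. L (weak_grad \<psi> x $ i)"
  have bl: "bounded_linear (%v::complex^3. L (v $ i))" for i
   by (rule bounded_linear_compose[OF L(1) bounded_linear_vec_nth])
  have gL: "in_L2 (?g i)" for i by (rule in_L2_linear[OF bl H(2)])
  have z: "(LINT x. indB r x * L (\<psi> x)) = 0"
  proof -
   have "(LINT x. indB r x * L (\<psi> x)) = (LINT x. L (indB r x *R \<psi> x))"
    by (simp add: linear_simps(5)[OF L(1)])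
   also have "... = L (LINT x. indB r x *R \<psi> x)"
    using L2_bilinear_integrable[OF bounded_bilinear_scaleR in_L2_indicator_ball[of 0 r] in_L2_loc_ball[OF l2, of r]]
    by (intro integral_bounded_linear[OF L(1)]) (simp add: indicator_inter_arith[symmetric] flip: mult.assoc)
   finally show ?thesis using H(3) by (simp add: set_lebesgue_integral_def linear_simps(3)[OF L(1)])
  qed
  have "L2n (%x. indB R x * L (\<psi> x)) <= C * (\<Sum>i. L2n (?g i))"
   by (rule C(2)[OF Ll2 has_weak_pderiv_linear[OF L(1) weak_grad_has[OF H(1)]] gL z])
  also have "... <= C * (\<Sum>i\<in>(UNIV::3 set). 1 * L2n (weak_grad \<psi>))"
  proof (intro mult_left_mono sum_mono abs_l2_mono gL H C(1) AE_I2)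
   show "norm (?g i x) <= 1 * norm (weak_grad \<psi> x)" for i x
    using order_trans[OF L(2) Finite_Cartesian_Product.norm_nth_le[of "weak_grad \<psi> x" i]] by simp
  qed auto
  finally show ?thesis by simp
 qed
 \<comment> \<open>Three gradient components for each of the two parts account for the factor
   6.\<close>
 have "L2n (%x. indB R x *R \<psi> x) <= (6 * C) * L2n (weak_grad \<psi>)" if \<psi>: "in_H1star r \<psi>" for \<psi>
 proof -
  have l2: "in_L2_loc \<psi>" using \<psi> by (simp add: in_H1star_def in_H1loc_def)
  let ?f = "%x. indB R x *R \<psi> x"
  let ?Re = "%x. indB R x * Re (\<psi> x)" and ?Im = "%x. indB R x * Im (\<psi> x)"
  have f: "in_L2 ?f" by (rule in_L2_loc_ball[OF l2])
  have ri: "in_L2 ?Re" "in_L2 ?Im"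
   using in_L2_linear[OF bounded_linear_Re f] in_L2_linear[OF bounded_linear_Im f] by simp_all
  have n: "in_L2 (%x. norm (?Re x) + norm (?Im x))" by (intro in_L2_add in_L2_norm ri)
  have "L2n ?f <= 1 * L2n (%x. norm (?Re x) + norm (?Im x))"
   by (rule abs_l2_mono[OF f n]) (auto simp: cmod_le split: split_indicator)
  also have "... <= L2n (%x. norm (?Re x)) + L2n (%x. norm (?Im x))"
   using norm_triangle_ineq[of "abs_l2 (%x. norm (?Re x))" "abs_l2 (%x. norm (?Im x))"]
   by (simp only: abs_l2_add[OF in_L2_norm[OF ri(1)] in_L2_norm[OF ri(2)]] mult_1)
  also have "... <= 1 * L2n ?Re + 1 * L2n ?Im"
   by (intro add_mono abs_l2_mono in_L2_norm ri) auto
  also have "... <= C * (3 * L2n (weak_grad \<psi>)) + C * (3 * L2n (weak_grad \<psi>))"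
   using part[OF \<psi> bounded_linear_Re abs_Re_le_cmod] part[OF \<psi> bounded_linear_Im abs_Im_le_cmod] by simp
  finally show ?thesis by simp
 qed
 thus ?thesis using C(1) by (intro that[of "6 * C"]) auto
qed

text \<open>Completeness of the space of potentials. Convergent gradients make the potentials Cauchy
  in L2 on every ball by the Poincare inequality, and the local limits are glued. Hypothesis
  \<open>sub\<close> supplies differences of members, together with their gradients, up to null
  sets.\<close>

lemma H1star_limit:
 assumes r: "r > 0" and \<psi>: "!!n. in_H1star r (\<psi> n)" and g: "in_L2 g"
  and lim: "(%n. abs_l2 (weak_grad (\<psi> n))) ----> abs_l2 g"
  and sub: "!!m n. \<exists>\<zeta>. in_H1star r \<zeta> \<and> (AE x. \<zeta> x = \<psi> m x - \<psi> n x) \<and> (AE x. weak_grad \<zeta> x = weak_grad (\<psi> m) x - weak_grad (\<psi> n) x)"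
 obtains \<phi> where "in_H1star r \<phi>" "AE x. weak_grad \<phi> x = g x"
proof -
 have H: "in_H1loc (\<psi> n)" "in_L2 (weak_grad (\<psi> n))" "(LINT x:ball 0 r|lebesgue. \<psi> n x) = 0" for n
  using \<psi>[of n] by (auto simp: in_H1star_def)
 have l2: "in_L2_loc (\<psi> n)" for n using H(1)[of n] by (simp add: in_H1loc_def)
 let ?B = "%k. ball (0::real^3) (real k + 1)"
 let ?f = "%k n x. indicator (?B k) x *R \<psi> n x"
 have fL: "in_L2 (?f k n)" for k n by (rule in_L2_loc_ball[OF l2])
 have "\<exists>f. in_L2 f \<and> (%n. abs_l2 (?f k n)) ----> abs_l2 f" for k
 proof -
  have "real k + 1 > 0" by simp
  then obtain C where C: "C >= 0" "!!\<psi>. in_H1star r \<psi> ==>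
    L2n (%x. indicator (?B k) x *R \<psi> x) <= C * L2n (weak_grad \<psi>)"
   using poincare_H1star[OF r] by blast
  have b: "norm (abs_l2 (?f k m) - abs_l2 (?f k n)) <= C * norm (abs_l2 (weak_grad (\<psi> m)) - abs_l2 (weak_grad (\<psi> n)))" for m n
  proof -
   obtain \<zeta> where \<zeta>: "in_H1star r \<zeta>" "AE x. \<zeta> x = \<psi> m x - \<psi> n x" "AE x. weak_grad \<zeta> x = weak_grad (\<psi> m) x - weak_grad (\<psi> n) x"
    using sub by blast
   have \<zeta>L: "in_L2 (%x. indicator (?B k) x *R \<zeta> x)" "in_L2 (weak_grad \<zeta>)"
    using \<zeta>(1) by (auto simp: in_H1star_def in_H1loc_def intro: in_L2_loc_ball)
   have "abs_l2 (?f k m) - abs_l2 (?f k n) = abs_l2 (%x. indicator (?B k) x *R \<zeta> x)"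
    unfolding abs_l2_diff[OF fL fL]
    by (subst abs_l2_eq_iff[OF in_L2_diff[OF fL fL] \<zeta>L(1)])
     (use \<zeta>(2) in \<open>auto elim!: eventually_mono simp: scaleR_diff_right\<close>)
   moreover have "abs_l2 (weak_grad (\<psi> m)) - abs_l2 (weak_grad (\<psi> n)) = abs_l2 (weak_grad \<zeta>)"
    unfolding abs_l2_diff[OF H(2) H(2)]
    by (subst abs_l2_eq_iff[OF in_L2_diff[OF H(2) H(2)] \<zeta>L(2)])
     (use \<zeta>(3) in \<open>auto elim!: eventually_mono\<close>)
   ultimately show ?thesis using C(2)[OF \<zeta>(1)] by simp
  qed
  have "Cauchy (%n. abs_l2 (?f k n))" by (rule Cauchy_dominated[OF b LIMSEQ_imp_Cauchy[OF lim]])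
  then obtain X where X: "(%n. abs_l2 (?f k n)) ----> X" using Cauchy_convergent_iff convergent_def by blast
  obtain f where "in_L2 f" "X = abs_l2 f" by (rule l2_of_surj)
  thus ?thesis using X by blast
 qed
 hence "\<forall>k. \<exists>f. in_L2 f \<and> (%n. abs_l2 (?f k n)) ----> abs_l2 f" by blast
 from choice[OF this] obtain F where F: "!!k. in_L2 (F k)" "!!k. (%n. abs_l2 (?f k n)) ----> abs_l2 (F k)"
  by blast
 have cons: "AE x. indicator (?B k) x *R F l x = F k x" if kl: "k <= l" for k l
 proof -
  note m = in_L2_indicator_mult[where a=0 and r="real k + 1"]
  have s: "?f k n = (%x. indicator (?B k) x *R ?f l n x)" for n
   using kl by (auto simp: fun_eq_iff split: split_indicator)
  have b: "norm (abs_l2 (?f k n) - abs_l2 (%x. indicator (?B k) x *R F l x)) <= 1 * norm (abs_l2 (?f l n) - abs_l2 (F l))" for n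
  proof -
   have "abs_l2 (?f k n) - abs_l2 (%x. indicator (?B k) x *R F l x) = abs_l2 (%x. indicator (?B k) x *R (?f l n x - F l x))"
    unfolding s abs_l2_diff[OF m[OF fL] m[OF F(1)]] by (simp only: scaleR_diff_right)
   also have "norm ... <= 1 * L2n (%x. ?f l n x - F l x)"
    by (rule abs_l2_mono[OF m]) (auto intro!: in_L2_diff fL F split: split_indicator)
   finally show ?thesis unfolding abs_l2_diff[OF fL F(1)] .
  qed
  have "(%n. abs_l2 (?f k n) - abs_l2 (%x. indicator (?B k) x *R F l x)) ----> 0"
  proof (rule Lim_null_comparison[OF always_eventually])
   show "\<forall>n. norm (abs_l2 (?f k n) - abs_l2 (%x. indicator (?B k) x *R F l x)) <= norm (abs_l2 (?f l n) - abs_l2 (F l))"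
    using b by simp
   show "(%n. norm (abs_l2 (?f l n) - abs_l2 (F l))) ----> 0"
    using tendsto_norm[OF LIM_zero[OF F(2)[of l]]] by simp
  qed
  hence "(%n. abs_l2 (?f k n)) ----> abs_l2 (%x. indicator (?B k) x *R F l x)" by (rule LIM_zero_cancel)
  hence "abs_l2 (%x. indicator (?B k) x *R F l x) = abs_l2 (F k)" using F(2)[of k] LIMSEQ_unique by blast
  thus ?thesis by (subst (asm) abs_l2_eq_iff[OF m[OF F(1)] F(1)])
 qed
 \<comment> \<open>The local limits are consistent: at almost every point the sequence is constant
   from some \<open>k\<close> on, so the pointwise limit glues them into one measurable
   function.\<close>
 define \<phi> where "\<phi> x = lim (%k. F k x)" for x
 have \<phi>m: "\<phi> \<in> LM"
  unfolding \<phi>_def[abs_def] by (rule borel_measurable_lim_metric) (rule in_L2_measurable[OF F(1)])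
 have \<phi>F: "AE x. indicator (?B k) x *R \<phi> x = F k x" for k
 proof -
  have "AE x. \<forall>l\<ge>k. indicator (?B k) x *R F l x = F k x"
   unfolding AE_all_countable
  proof
   fix l show "AE x. k <= l --> indicator (?B k) x *R F l x = F k x"
   proof (cases "k <= l")
    case True
    from cons[OF True] show ?thesis by (rule eventually_mono) (rule impI)
   qed (intro AE_I2, blast)
  qed
  thus ?thesis
  proof (rule eventually_mono)
   fix x assume x: "\<forall>l\<ge>k. indicator (?B k) x *R F l x = F k x"
   show "indicator (?B k) x *R \<phi> x = F k x"
   proof (cases "x \<in> ?B k")
    case True
    have "\<forall>\<^sub>F l in sequentially. F k x = F l x"
     using eventually_ge_at_top[of k]
    proof eventually_elim
     case (elim l)
     have "indicator (?B k) x *R F l x = F k x" using x elim by blast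
     thus ?case using True by simp
    qed
    hence "(%l. F l x) ----> F k x" by (rule Lim_transform_eventually[OF tendsto_const])
    thus ?thesis using True by (simp add: \<phi>_def limI)
   next
    case False
    moreover have "indicator (?B k) x *R F k x = F k x" using x by blast
    ultimately show ?thesis by simp
   qed
  qed
 qed
 have mB: "(%x. indB s x *R \<phi> x) \<in> LM" for s
  by (intro borel_measurable_scaleR \<phi>m in_L2_measurable[OF in_L2_indicator_ball])
 have \<phi>B: "in_L2 (%x. indicator (?B k) x *R \<phi> x)" for k
  by (rule in_L2_AE_cong[OF F(1)[of k] mB \<phi>F])
 have \<phi>lim: "(%n. abs_l2 (?f k n)) ----> abs_l2 (%x. indicator (?B k) x *R \<phi> x)" for k
  using F(2)[of k] \<phi>F[of k] by (subst abs_l2_eq_iff[THEN iffD2, OF \<phi>B F(1)])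
 have \<phi>L: "in_L2_loc \<phi>"
 proof (rule in_L2_locI[OF \<phi>m])
  fix s
  obtain k where "s <= real k" using real_arch_simple by blast
  hence k: "s <= real k + 1" by simp
  show "in_L2 (%x. indB s x *R \<phi> x)"
   by (rule in_L2_bound[OF \<phi>B[of k] mB, where C=1]) (use k in \<open>auto split: split_indicator\<close>)
 qed
 have int: "(%n. LINT x. \<eta> x *R \<psi> n x) ----> (LINT x. \<eta> x *R \<phi> x)"
  if \<eta>: "in_L2 \<eta>" "!!x. x \<notin> ?B k ==> \<eta> x = 0" for \<eta> :: "real fn" and k
 proof -
  have e: "\<eta> x *R f x = \<eta> x *R (indicator (?B k) x *R f x)" for f :: "complex fn" and x
   using \<eta>(2)[of x] by (cases "x \<in> ?B k") simp_all
  have "(%n. LINT x. \<eta> x *R ?f k n x) ----> (LINT x. \<eta> x *R (indicator (?B k) x *R \<phi> x))"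
   by (rule L2_bilinear_tendsto[OF bounded_bilinear.flip[OF bounded_bilinear_scaleR] fL \<phi>B \<phi>lim \<eta>(1)])
  thus ?thesis unfolding e[symmetric] .
 qed
 have wd: "weakd i \<phi> (%x. g x $ i)" for i
 proof (rule has_weak_pderivI[OF L2_loc_loc_integrable[OF \<phi>L]])
  have gi: "in_L2 (%x. g x $ i)" by (rule in_L2_linear[OF bounded_linear_vec_nth g])
  thus "L1loc (%x. g x $ i)" by (rule L2_loc_integrable)
  fix \<eta> :: "real fn" assume \<eta>: "test \<eta>"
  obtain K where K: "compact K" "!!x. x \<notin> K ==> \<eta> x = 0"
   by (rule test_functionE[OF \<eta>]) blast
  obtain s where s: "K \<subseteq> ball 0 s" using compact_imp_bounded[OF K(1)] bounded_subset_ballD by blast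
  obtain k where "s <= real k" using real_arch_simple by blast
  hence k: "s <= real k + 1" by simp
  have out: "x \<notin> K" if "x \<notin> ?B k" for x using s k that by auto
  have "(%n. LINT x. pd i \<eta> x *R \<psi> n x) ----> (LINT x. pd i \<eta> x *R \<phi> x)"
   by (rule int[of _ k]) (use out in \<open>auto intro: in_L2_test[OF test_pderiv[OF \<eta>]] pderiv_at_zero_outside[OF K]\<close>)
  moreover have "(%n. LINT x. pd i \<eta> x *R \<psi> n x) ----> - (LINT x. \<eta> x *R (g x $ i))"
  proof -
   note bounded_bilinear.comp1[OF bounded_bilinear.flip[OF bounded_bilinear_scaleR] bounded_linear_vec_nth]
   from tendsto_minus[OF L2_bilinear_tendsto[OF this H(2) g lim in_L2_test[OF \<eta>], of i]]
   show ?thesis by (simp add: has_weak_pderivD[OF weak_grad_has[OF H(1)] \<eta>])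
  qed
  ultimately show "(LINT x. pd i \<eta> x *R \<phi> x) = - (LINT x. \<eta> x *R (g x $ i))"
   by (rule LIMSEQ_unique)
 qed
 have ae: "AE x. weak_grad \<phi> x = g x" by (rule weak_grad_AE[OF wd])
 have mg: "weak_grad \<phi> \<in> LM"
  by (rule borel_measurable_AE[OF in_L2_measurable[OF g]]) (use ae in \<open>auto elim: eventually_mono\<close>)
 have "in_H1star r \<phi>"
  unfolding in_H1star_def
 proof (intro conjI)
  have "in_L2_loc (%x. g x $ i)" for i by (intro L2_imp_L2_loc in_L2_linear[OF bounded_linear_vec_nth g])
  thus "in_H1loc \<phi>" unfolding in_H1loc_def using \<phi>L wd by blast
  show "in_L2 (weak_grad \<phi>)" by (rule in_L2_AE_cong[OF g mg ae])
  obtain k where "r <= real k" using real_arch_simple by blast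
  hence k: "r <= real k + 1" by simp
  have "(%n. LINT x. indB r x *R \<psi> n x) ----> (LINT x. indB r x *R \<phi> x)"
   by (rule int[of _ k]) (use k in \<open>auto intro: in_L2_indicator_ball\<close>)
  moreover have "(LINT x. indB r x *R \<psi> n x) = 0" for n
   using H(3)[of n] by (simp add: set_lebesgue_integral_def)
  ultimately show "(LINT x:ball 0 r|lebesgue. \<phi> x) = 0"
   by (simp add: set_lebesgue_integral_def LIMSEQ_const_iff)
 qed
 thus ?thesis using ae by (rule that)
qed

section \<open>A Liouville theorem\<close>

definition laplacian :: "(('a::real_normed_vector) fn) => 'a fn" where
 "laplacian f x = (\<Sum>i. pd i (pd i f) x)"

lemma axis_line_deriv:
 fixes f :: "real fn"
 assumes "!!x. f differentiable (at x)"
 shows "((%t. f (x + axis i t)) has_real_derivative pd i f (x + axis i t)) (at t)"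
proof -
 define u where "u = axis i (1::real)"
 have e: "axis i t = t *R u" for t :: real by (simp add: u_def axis_def vec_eq_iff)
 have "(\<Sum>j. u $ j * pd j f y) = pd i f y" for y
  by (subst sum.remove[of _ i]) (auto simp: u_def axis_def intro!: sum.neutral)
 thus ?thesis
  using line_has_derivative[OF assms, of x u t] unfolding e by simp
qed

text \<open>At a maximum of f minus a quadratic penalty, each pure second derivative of
  \<open>f\<close> is at most that of the penalty. The proof restricts to an axis line: a positive
  second derivative there would make the function increase to the right of its maximum.\<close>

lemma second_derivative_at_max:
 fixes f :: "real fn"
 assumes f: "smooth f" and max: "!!y. f y - \<delta> * (y \<bullet> y) <= f x - \<delta> * (x \<bullet> x)" and \<delta>: "\<delta> > 0"
 shows "pd i (pd i f) x <= 2 * \<delta>"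
proof (rule ccontr)
 assume neg: "\<not> pd i (pd i f) x <= 2 * \<delta>"
 define k where "k t = f (x + axis i t) - \<delta> * ((x + axis i t) \<bullet> (x + axis i t))" for t
 define k' where "k' t = pd i f (x + axis i t) - \<delta> * (2 * (x $ i + t))" for t
 have d: "f differentiable (at y)" "pd j f differentiable (at y)" for y j
  using f by (auto intro!: smooth_diff smooth_pderiv)
 have sq: "(x + axis i t) \<bullet> (x + axis i t) = x \<bullet> x + 2 * t * x $ i + t\<^sup>2" for t
 proof -
  have "(x + axis i t) \<bullet> (x + axis i t) = x \<bullet> x + 2 * (x \<bullet> axis i t) + axis i t \<bullet> axis i t"
   by (simp add: inner_add_left inner_add_right inner_commute)
  thus ?thesis by (simp only: inner_axis inner_axis_axis power2_eq_square) simp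
 qed
 have k: "(k has_real_derivative k' t) (at t)" for t
 proof -
  have "((%t. x \<bullet> x + 2 * t * x $ i + t\<^sup>2) has_real_derivative 2 * (x $ i + t)) (at t)"
   by (rule DERIV_cong, (rule derivative_intros)+) (simp add: algebra_simps)
  from DERIV_diff[OF axis_line_deriv[OF d(1)] DERIV_cmult[OF this]]
  show ?thesis unfolding k_def[abs_def] k'_def sq .
 qed
 have k'': "(k' has_real_derivative (pd i (pd i f) (x + axis i 0) - 2 * \<delta>)) (at 0)"
 proof -
  have "((%t. 2 * (x $ i + t)) has_real_derivative 2) (at 0)"
   by (rule DERIV_cong, (rule derivative_intros)+) simp
  from DERIV_diff[OF axis_line_deriv[OF d(2)] DERIV_cmult[OF this]]
  show ?thesis unfolding k'_def[abs_def] by (simp add: mult.commute)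
 qed
 have x0: "x + axis i 0 = x" by (simp add: axis_def vec_eq_iff)
 have kmax: "k t <= k 0" for t
  using max[of "x + axis i t"] by (simp add: k_def x0)
 have k0: "k' 0 = 0"
  by (rule DERIV_local_max[OF k[of 0], of 1]) (auto simp: kmax)
 have "pd i (pd i f) (x + axis i 0) - 2 * \<delta> > 0" using neg by (simp add: x0)
 from DERIV_pos_inc_right[OF k'' this] obtain e where e: "e > 0" "!!h. 0 < h ==> h < e ==> k' h > 0"
  unfolding k0 by auto
 have "\<exists>s>0. s < e/2 \<and> k (e/2) - k 0 = (e/2 - 0) * k' s"
  by (rule MVT2) (use e(1) k in \<open>simp_all\<close>)
 then obtain s where s: "0 < s" "s < e / 2" "k (e/2) - k 0 = (e/2) * k' s" by auto
 have "k' s > 0" using e s by auto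
 hence "(e/2) * k' s > 0" using e(1) by simp
 thus False using s(3) kmax[of "e/2"] by linarith
qed

text \<open>Maximum principle for bounded solutions of \<Delta>f = f on the whole space. A small
  quadratic penalty forces a maximum to exist, and there f = \<Delta>f is at most three times 2
  \<delta>.\<close>

lemma helmholtz_bounded_le:
 fixes f :: "real fn"
 assumes f: "smooth f" and eq: "!!x. laplacian f x = f x" and bnd: "!!x. \<bar>f x\<bar> <= B"
 shows "f x <= 0"
proof (rule field_le_epsilon)
 fix e :: real assume e: "e > 0"
 have B: "B >= 0" using bnd[of 0] by linarith
 \<comment> \<open>Chosen so that 6 \<delta>, the bound at the maximum, plus the penalty at
   \<open>x\<close> add up to \<open>e\<close>.\<close>
 define \<delta> where "\<delta> = e / (6 + x \<bullet> x)"
 have p: "6 + x \<bullet> x > 0" by (simp add: add_pos_nonneg)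
 have \<delta>: "\<delta> > 0" using e p by (simp add: \<delta>_def)
 \<comment> \<open>Beyond this radius the penalty is at least 2 B, so the penalized function lies
   below its value at the origin.\<close>
 define R where "R = sqrt (2 * B / \<delta>)"
 have R: "R >= 0" "R\<^sup>2 = 2 * B / \<delta>" using B \<delta> by (simp_all add: R_def)
 let ?k = "%y. f y - \<delta> * (y \<bullet> y)"
 have "continuous_on (cball 0 R) ?k" by (intro continuous_intros smooth_cont f)
 then obtain z where z: "z \<in> cball 0 R" "!!y. y \<in> cball 0 R ==> ?k y <= ?k z"
  using continuous_attains_sup[of "cball 0 R" ?k] R by auto
 have zmax: "?k y <= ?k z" for y
 proof (cases "y \<in> cball 0 R")
  case False
  hence "R\<^sup>2 <= (norm y)^2" using R by (intro power_mono) auto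
  hence "2 * B <= \<delta> * (y \<bullet> y)"
   using R(2) \<delta> by (simp add: power2_norm_eq_inner pos_divide_le_eq mult.commute)
  hence "?k y <= ?k 0" using bnd[of y] bnd[of 0] by simp
  also have "?k 0 <= ?k z" using z(2)[of 0] R by simp
  finally show ?thesis .
 qed (rule z(2))
 have "f z = laplacian f z" by (simp add: eq)
 also have "... <= (\<Sum>i\<in>(UNIV::3 set). 2 * \<delta>)"
  unfolding laplacian_def by (intro sum_mono second_derivative_at_max[OF f zmax \<delta>])
 also have "... = 6 * \<delta>" by simp
 finally have "f z <= 6 * \<delta>" .
 moreover have "\<delta> * (z \<bullet> z) >= 0" using \<delta> by simp
 ultimately have "f x <= 6 * \<delta> + \<delta> * (x \<bullet> x)" using zmax[of x] by linarith
 also have "... = \<delta> * (6 + x \<bullet> x)" by (simp add: distrib_left)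
 also have "... = e" using p by (simp add: \<delta>_def)
 finally show "f x <= 0 + e" by simp
qed

lemma test_laplacian: "test_function D f ==> test_function D (laplacian f)"
 unfolding laplacian_def[abs_def] by (intro test_sum test_pderiv)

lemma laplacian_linear:
 assumes "bounded_linear L" "smooth f"
 shows "laplacian (%x. L (f x)) x = L (laplacian f x)"
proof -
 have 1: "pd i (%x. L (f x)) = (%x. L (pd i f x))" for i
  by (intro ext pderiv_at_linear[OF assms(1)] smooth_diff assms)
 show ?thesis
  unfolding laplacian_def 1
  unfolding linear_sum[OF bounded_linear.linear[OF assms(1)]] o_def
  by (intro sum.cong refl pderiv_at_linear[OF assms(1)] smooth_diff smooth_pderiv assms(2))
qed

text \<open>Convolving a weak L2 solution of \<Delta>g = g with a test function gives a smooth
  solution, bounded by Cauchy-Schwarz. The maximum principle for it and its negative makes it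
  vanish, so \<open>g\<close> is orthogonal to all test functions.\<close>

lemma helmholtz_L2_zero_real:
 fixes g :: "real fn"
 assumes g: "in_L2 g" and eq: "!!\<eta>. test \<eta> ==> (LINT x. (laplacian \<eta> x - \<eta> x) * g x) = 0"
 shows "AE x. g x = 0"
proof -
 have gl: "L1loc g" by (rule L2_loc_integrable[OF g])
 have "(LINT x. \<phi> x * g x) = 0" if \<phi>: "test \<phi>" for \<phi>
 proof -
  \<comment> \<open>Reflected, so that the convolution at the origin is the integral of
    \<open>\<phi>\<close> against \<open>g\<close>.\<close>
  define \<phi>' where "\<phi>' = (%y. \<phi> (0 - y))"
  have \<phi>': "test \<phi>'" unfolding \<phi>'_def by (rule test_reflect[OF \<phi>])
  define G where "G = conv g \<phi>'"
  have Gs: "smooth G" unfolding G_def by (rule smooth_conv[OF \<phi>' gl])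
  have bnd: "\<bar>G z\<bar> <= L2n \<phi> * L2n g" for z
  proof -
   have e: "\<phi>' (z - x) = \<phi> (x + - z)" for x by (simp add: \<phi>'_def)
   have t: "in_L2 (%x. \<phi> (x + - z))" "L2n (%x. \<phi> (x + - z)) = L2n \<phi>"
    using in_L2_translate[OF in_L2_test[OF \<phi>], of "- z"] by blast+
   have "G z = abs_l2 (%x. \<phi> (x + - z)) \<bullet> abs_l2 g"
    unfolding inner_abs_l2[OF t(1) g] G_def conv_def e by simp
   thus ?thesis using Cauchy_Schwarz_ineq2[of "abs_l2 (%x. \<phi> (x + - z))" "abs_l2 g"] t(2) by simp
  qed
  have p1: "pd i G = conv g (pd i \<phi>')" for i
   unfolding G_def by (rule ext, rule pderiv_at_conv[OF \<phi>' gl])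
  have p2: "pd i (pd i G) z = conv g (pd i (pd i \<phi>')) z" for i z
   unfolding p1 by (rule pderiv_at_conv[OF test_pderiv[OF \<phi>'] gl])
  have lap: "laplacian G z = G z" for z
  proof -
   define \<eta> where "\<eta> = (%x. \<phi>' (z - x))"
   have \<eta>: "test \<eta>" unfolding \<eta>_def by (rule test_reflect[OF \<phi>'])
   have q1: "pd i \<eta> = (%x. - pd i \<phi>' (z - x))" for i
    unfolding \<eta>_def by (rule ext, rule pderiv_at_reflect[OF test_smooth[OF \<phi>']])
   have q2: "pd i (pd i \<eta>) x = pd i (pd i \<phi>') (z - x)" for i x
   proof -
    have sm: "smooth (%x. pd i \<phi>' (z - x))"
     by (rule test_smooth[OF test_reflect[OF test_pderiv[OF \<phi>']]])
    have "pd i (%x. - pd i \<phi>' (z - x)) x = - pd i (%x. pd i \<phi>' (z - x)) x"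
     by (rule pderiv_at_linear[OF bounded_linear_minus[OF bounded_linear_ident] smooth_diff[OF sm]])
    thus ?thesis
     unfolding q1 pderiv_at_reflect[OF smooth_pderiv[OF test_smooth[OF \<phi>']]] by simp
   qed
   have i: "Lint (%x. pd i (pd i \<phi>') (z - x) * g x)" for i
    using conv_integrable[OF test_pderiv[OF test_pderiv[OF \<phi>']] gl] by simp
   have i0: "Lint (%x. \<phi>' (z - x) * g x)" using conv_integrable[OF \<phi>' gl] by simp
   have "laplacian G z - G z = (\<Sum>i. LINT x. pd i (pd i \<phi>') (z - x) * g x) - (LINT x. \<phi>' (z - x) * g x)"
    unfolding laplacian_def p2 unfolding conv_def G_def by simp
   also have "... = (LINT x. (\<Sum>i. pd i (pd i \<phi>') (z - x) * g x) - \<phi>' (z - x) * g x)"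
    unfolding Bochner_Integration.integral_diff[OF Bochner_Integration.integrable_sum[OF i] i0] Bochner_Integration.integral_sum[OF i] ..
   also have "... = (LINT x. (laplacian \<eta> x - \<eta> x) * g x)"
    unfolding laplacian_def q2 by (simp add: \<eta>_def left_diff_distrib sum_distrib_right)
   also have "... = 0" by (rule eq[OF \<eta>])
   finally show ?thesis by simp
  qed
  have "G 0 <= 0" by (rule helmholtz_bounded_le[OF Gs lap bnd])
  moreover have "- G 0 <= 0"
  proof (rule helmholtz_bounded_le[OF smooth_minus[OF Gs]])
   show "laplacian (%x. - G x) x = - G x" for x
    using laplacian_linear[OF bounded_linear_minus[OF bounded_linear_ident] Gs] lap by simp
   show "\<bar>- G x\<bar> <= L2n \<phi> * L2n g" for x using bnd[of x] by simp
  qed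
  ultimately have "G 0 = 0" by simp
  thus ?thesis by (simp add: G_def conv_def \<phi>'_def)
 qed
 hence "AE x. x \<in> UNIV --> g x = 0"
  by (intro fundamental_lemma_real[OF open_UNIV gl]) auto
 thus ?thesis by simp
qed

section \<open>Gradients of test functions with prescribed divergence\<close>

lemma integrable_test_prod:
 fixes f :: "('a::euclidean_space) fn" and g :: "'a fn"
 assumes "test_function D f" "in_L2 g"
 shows "Lint (%x. f x \<bullet> g x)"
 by (rule L2_inner_integrable[OF in_L2_test[OF assms(1)] assms(2)])

lemma integration_by_parts_inner:
 fixes f g :: "('a::euclidean_space) fn"
 assumes f: "test_function D f" and g: "smooth g"
 shows "(LINT x. pd i f x \<bullet> g x) = - (LINT x. f x \<bullet> pd i g x)"
proof -
 note bb = bounded_bilinear_inner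
 have t: "test_function D (%x. f x \<bullet> g x)"
  by (rule bounded_bilinear.test_bilinear_left[OF bb f g])
 have i: "Lint (%x. pd i f x \<bullet> g x)" "Lint (%x. f x \<bullet> pd i g x)"
  by (intro test_integrable[where D=D] bounded_bilinear.test_bilinear_left[OF bb] test_pderiv f g smooth_pderiv)+
 have "0 = (LINT x. pd i (%x. f x \<bullet> g x) x)"
  by (rule integral_pderiv_zero[OF t, symmetric])
 also have "... = (LINT x. f x \<bullet> pd i g x + pd i f x \<bullet> g x)"
  by (simp add: bounded_bilinear.pderiv_at_bilinear[OF bb] test_diff[OF f] smooth_diff[OF g])
 also have "... = (LINT x. f x \<bullet> pd i g x) + (LINT x. pd i f x \<bullet> g x)"
  by (rule Bochner_Integration.integral_add[OF i(2,1)])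
 finally show ?thesis by simp
qed

definition grad :: "(('a::real_normed_vector) fn) => real^3 => 'a^3" where
 "grad f x = (\<chi> i. pd i f x)"

lemma bounded_linear_axis: "bounded_linear (%v::'a::euclidean_space. axis i v :: 'a^3)"
proof (rule bounded_linear_intro[of _ 1])
 show "norm (axis i v :: 'a^3) <= norm v * 1" for v
  by (simp add: norm_eq_sqrt_inner inner_axis_axis)
qed (auto simp: axis_def vec_eq_iff)

lemma vec_axis_sum: "(\<chi> i. f i) = (\<Sum>i. axis i (f i) :: 'a::euclidean_space^3)"
 by (simp add: vec_eq_iff axis_def if_distrib cong: if_cong)

lemma test_vec: "(!!i. test_function D (%x. f x i)) ==> test_function D (%x. (\<chi> i. f x i) :: 'a::euclidean_space^3)"
 unfolding vec_axis_sum by (intro test_sum test_linear[OF bounded_linear_axis])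

lemma test_grad: "test_function D f ==> test_function D (grad f :: real^3 => 'a::euclidean_space^3)"
 unfolding grad_def[abs_def] by (intro test_vec test_pderiv)

text \<open>Two integrations by parts and commuting derivatives turn each squared mixed derivative
  into the product of two pure ones. The exact equality, with constant 1, is what the smallness of
  the flow is later compared with.\<close>

lemma hessian_laplacian:
 fixes \<eta> :: "('a::euclidean_space) fn"
 assumes \<eta>: "test_function D \<eta>"
 shows "(\<Sum>i. \<Sum>j. LINT x. (norm (pd i (pd j \<eta>) x))^2) = (LINT x. (norm (laplacian \<eta> x))^2)"
proof -
 let ?d = "%i j. pd i (pd j \<eta>)"
 have s: "smooth \<eta>" by (rule test_smooth[OF \<eta>])
 have t: "test_function D (?d i j)" for i j by (intro test_pderiv \<eta>)
 have com: "pd i (pd j f) = pd j (pd i f)" if "smooth f" for i j and f :: "'a fn"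
  by (rule ext, rule pderiv_at_commute[OF that])
 have eq: "(LINT x. ?d i j x \<bullet> ?d i j x) = (LINT x. ?d i i x \<bullet> ?d j j x)" for i j
 proof -
  have "(LINT x. ?d i j x \<bullet> ?d i j x) = - (LINT x. pd j \<eta> x \<bullet> pd i (?d i j) x)"
   by (rule integration_by_parts_inner[OF test_pderiv[OF \<eta>] test_smooth[OF t]])
  also have "pd i (?d i j) = pd j (?d i i)"
   by (simp only: com[OF s, of i j] com[OF smooth_pderiv[OF s], of i j])
  also have "(LINT x. pd j \<eta> x \<bullet> pd j (?d i i) x) = - (LINT x. pd j (pd j \<eta>) x \<bullet> ?d i i x)"
   using integration_by_parts_inner[OF test_pderiv[OF \<eta>, of j] test_smooth[OF t[of i i]], of j] by simp
  finally show ?thesis by (simp add: inner_commute)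
 qed
 have i: "Lint (%x. ?d i i x \<bullet> ?d j j x)" for i j
  by (rule integrable_test_prod[OF t in_L2_test[OF t]])
 have "(LINT x. (norm (laplacian \<eta> x))^2) = (LINT x. (\<Sum>i. \<Sum>j. ?d i i x \<bullet> ?d j j x))"
 proof (rule Bochner_Integration.integral_cong[OF refl])
  fix x show "(norm (laplacian \<eta> x))^2 = (\<Sum>i. \<Sum>j. ?d i i x \<bullet> ?d j j x)"
   unfolding power2_norm_eq_inner laplacian_def inner_sum_left inner_sum_right by (rule sum.swap)
 qed
 also have "... = (\<Sum>i. \<Sum>j. LINT x. ?d i i x \<bullet> ?d j j x)"
  by (subst Bochner_Integration.integral_sum, intro Bochner_Integration.integrable_sum i)
   (intro sum.cong refl Bochner_Integration.integral_sum i)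
 finally show ?thesis by (simp add: power2_norm_eq_inner eq)
qed

text \<open>The pair (f, d) is projected in L2 x L2 onto the closure of all pairs (\<nabla>\<eta>,
  \<Delta>\<eta>); the orthogonality relations are the weak Euler equation of this least squares
  problem. The second component is matched exactly, while for the first only a bound by the norm of
  \<open>f\<close> results, as \<open>f\<close> need not be a gradient.\<close>

lemma test_grad_dense:
 fixes f :: "(complex^3) fn" and d :: "complex fn"
 assumes f: "in_L2 f" and d: "in_L2 d" and fd: "has_weak_div f d" and \<delta>: "\<delta> > 0"
 obtains \<eta> :: "complex fn" where "test \<eta>"
  "norm (abs_l2 (laplacian \<eta>) - abs_l2 d) < \<delta>" "L2n (grad \<eta>) < L2n f + \<delta>"
proof -
 let ?e = "\<lambda>\<eta>::real^3 => complex. (abs_l2 (grad \<eta>), abs_l2 (laplacian \<eta>))"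
 define S where "S = {?e \<eta> |\<eta>. test \<eta>}"
 have gL: "in_L2 (grad \<eta>)" "in_L2 (laplacian \<eta>)" if "test \<eta>" for \<eta> :: "complex fn"
  by (intro in_L2_test[where D=UNIV] test_grad test_laplacian that)+
 have e_add: "?e (%x. \<eta> x + \<zeta> x) = ?e \<eta> + ?e \<zeta>" if t: "test \<eta>" "test \<zeta>" for \<eta> \<zeta>
 proof -
  have p: "pd i (%x. \<eta> x + \<zeta> x) = (%x. pd i \<eta> x + pd i \<zeta> x)" for i
   by (intro ext pderiv_at_add test_diff[OF t(1)] test_diff[OF t(2)])
  have p2: "pd i (pd i (%x. \<eta> x + \<zeta> x)) x = pd i (pd i \<eta>) x + pd i (pd i \<zeta>) x" for i x
   unfolding p by (intro pderiv_at_add test_diff[OF test_pderiv[OF t(1)]] test_diff[OF test_pderiv[OF t(2)]])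
  have "grad (%x. \<eta> x + \<zeta> x) = (%x. grad \<eta> x + grad \<zeta> x)"
   by (rule ext) (simp add: grad_def p vec_eq_iff)
  moreover have "laplacian (%x. \<eta> x + \<zeta> x) = (%x. laplacian \<eta> x + laplacian \<zeta> x)"
   by (rule ext) (simp add: laplacian_def p2 sum.distrib)
  ultimately show ?thesis by (simp add: abs_l2_add gL t)
 qed
 have e_scale: "?e (%x. c *R \<eta> x) = c *R ?e \<eta>" if t: "test \<eta>" for \<eta> c
 proof -
  have p: "pd i (%x. c *R \<eta> x) = (%x. c *R pd i \<eta> x)" for i
   by (intro ext pderiv_at_linear[OF bounded_linear_scaleR_right] test_diff[OF t])
  have "grad (%x. c *R \<eta> x) = (%x. c *R grad \<eta> x)"
   by (rule ext) (simp add: grad_def p vec_eq_iff)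
  moreover have "laplacian (%x. c *R \<eta> x) = (%x. c *R laplacian \<eta> x)"
   by (rule ext, rule laplacian_linear[OF bounded_linear_scaleR_right test_smooth[OF t]])
  ultimately show ?thesis by (simp add: abs_l2_scaleR gL t)
 qed
 have sub: "subspace S" unfolding S_def by (rule subspace_test_image[where e="?e"]) (rule e_add e_scale; assumption)+
 let ?p = "(abs_l2 f, abs_l2 d)"
 obtain s where s: "s \<in> closure S" "!!v. v \<in> closure S ==> (?p - s) \<bullet> v = 0"
  by (rule closed_subspace_projection[OF subspace_closure[OF sub] closed_closure]) blast
 obtain v where v: "in_L2 v" "fst s = abs_l2 v" by (rule l2_of_surj)
 obtain e where e: "in_L2 e" "snd s = abs_l2 e" by (rule l2_of_surj)
 have ts: "in_L2 (%x. \<phi> x *R z)" "in_L2 (%x. (\<chi> i. pd i \<phi> x *R z))" if \<phi>: "test \<phi>" for \<phi> :: "real fn" and z :: complex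
  by (intro in_L2_test[where D=UNIV] test_vec test_linear[OF bounded_linear_scaleR_left] test_pderiv \<phi>)+
 txt \<open>\<open>(f, d)\<close> and the elements of the closure both satisfy the weak divergence relation, so the projection
  error \<open>w = d - e\<close> is a weak solution of \<open>\<Delta>w = w\<close> and vanishes.\<close>
 have weakf: "abs_l2 f \<bullet> abs_l2 (%x. (\<chi> i. pd i \<phi> x *R z)) = - (abs_l2 d \<bullet> abs_l2 (%x. \<phi> x *R z))"
  if \<phi>: "test \<phi>" for \<phi> :: "real fn" and z :: complex
 proof -
  have fl: "L1loc f" "L1loc d" using fd by (auto simp: has_weak_div_def)
  have i1: "Lint (%x. \<Sum>i. pd i \<phi> x *R (f x $ i))"
   by (intro Bochner_Integration.integrable_sum integrable_test_scaleR[OF test_pderiv[OF \<phi>]] loc_integrable_linear[OF bounded_linear_vec_nth fl(1)])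
  have i2: "Lint (%x. \<phi> x *R d x)" by (rule integrable_test_scaleR[OF \<phi> fl(2)])
  have "abs_l2 f \<bullet> abs_l2 (%x. (\<chi> i. pd i \<phi> x *R z)) = (LINT x. (\<Sum>i. pd i \<phi> x *R (f x $ i)) \<bullet> z)"
   unfolding inner_abs_l2[OF f ts(2)[OF \<phi>]] by (simp add: inner_vec_def inner_sum_left)
  also have "... = (LINT x. (\<Sum>i. pd i \<phi> x *R (f x $ i))) \<bullet> z"
   by (rule integral_inner_left[OF i1])
  also have "... = - (LINT x. \<phi> x *R d x) \<bullet> z"
   using fd \<phi> unfolding has_weak_div_def by simp
  also have "... = - (LINT x. (\<phi> x *R d x) \<bullet> z)"
   by (simp only: inner_minus_left integral_inner_left[OF i2])
  finally show ?thesis unfolding inner_abs_l2[OF d ts(1)[OF \<phi>]] by simp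
 qed
 have weaks: "fst t \<bullet> abs_l2 (%x. (\<chi> i. pd i \<phi> x *R z)) + snd t \<bullet> abs_l2 (%x. \<phi> x *R z) = 0"
  if t: "t \<in> closure S" and \<phi>: "test \<phi>" for \<phi> :: "real fn" and z :: complex and t
 proof -
  let ?A = "{t. fst t \<bullet> abs_l2 (%x. (\<chi> i. pd i \<phi> x *R z)) + snd t \<bullet> abs_l2 (%x. \<phi> x *R z) = 0}"
  have "closed ?A" by (intro closed_Collect_eq continuous_intros)
  moreover have "S \<subseteq> ?A"
  proof
   fix t assume "t \<in> S"
   then obtain \<eta> where \<eta>: "test \<eta>" "t = ?e \<eta>" by (auto simp: S_def)
   have i: "Lint (%x. pd i \<eta> x \<bullet> (pd i \<phi> x *R z))" for i
    by (intro integrable_test_prod[where D=UNIV] test_pderiv \<eta> in_L2_test[where D=UNIV] test_linear[OF bounded_linear_scaleR_left] \<phi>)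
   have i': "Lint (%x. pd i (pd i \<eta>) x \<bullet> (\<phi> x *R z))" for i
    by (intro integrable_test_prod[where D=UNIV] test_pderiv \<eta> in_L2_test[where D=UNIV] test_linear[OF bounded_linear_scaleR_left] \<phi>)
   have ibp: "(LINT x. pd i (pd i \<eta>) x \<bullet> (\<phi> x *R z)) = - (LINT x. pd i \<eta> x \<bullet> (pd i \<phi> x *R z))" for i
   proof -
    have sm: "smooth (%x. \<phi> x *R z)" by (rule smooth_linear[OF bounded_linear_scaleR_left test_smooth[OF \<phi>]])
    have "pd i (%x. \<phi> x *R z) x = pd i \<phi> x *R z" for x
     by (rule pderiv_at_linear[OF bounded_linear_scaleR_left test_diff[OF \<phi>]])
    thus ?thesis using integration_by_parts_inner[OF test_pderiv[OF \<eta>(1)] sm, of i i] by simp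
   qed
   have "fst t \<bullet> abs_l2 (%x. (\<chi> i. pd i \<phi> x *R z)) = (\<Sum>i. LINT x. pd i \<eta> x \<bullet> (pd i \<phi> x *R z))"
    unfolding \<eta>(2) fst_conv inner_abs_l2[OF gL(1)[OF \<eta>(1)] ts(2)[OF \<phi>]]
    by (subst Bochner_Integration.integral_sum[OF i, symmetric]) (simp add: grad_def inner_vec_def)
   moreover have "snd t \<bullet> abs_l2 (%x. \<phi> x *R z) = (\<Sum>i. LINT x. pd i (pd i \<eta>) x \<bullet> (\<phi> x *R z))"
    unfolding \<eta>(2) snd_conv inner_abs_l2[OF gL(2)[OF \<eta>(1)] ts(1)[OF \<phi>]]
    by (subst Bochner_Integration.integral_sum[OF i', symmetric]) (simp add: laplacian_def inner_sum_left sum_distrib_left)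
   ultimately show "t \<in> ?A" unfolding ibp by (simp add: sum_negf)
  qed
  ultimately have "closure S \<subseteq> ?A" by (rule closure_minimal[rotated])
  with t show ?thesis by blast
 qed
 have r: "in_L2 (%x. d x - e x)" "abs_l2 d - abs_l2 e = abs_l2 (%x. d x - e x)"
  using d e by (simp_all add: in_L2_diff abs_l2_diff)
 have zero: "AE x. (d x - e x) \<bullet> z = 0" for z
 proof (rule helmholtz_L2_zero_real)
  show "in_L2 (%x. (d x - e x) \<bullet> z)" by (rule in_L2_linear[OF bounded_linear_inner_left r(1)])
  fix \<phi> :: "real fn" assume \<phi>: "test \<phi>"
  let ?\<eta> = "%x. \<phi> x *R z"
  have \<eta>: "test ?\<eta>" by (rule test_linear[OF bounded_linear_scaleR_left \<phi>])
  have g: "grad ?\<eta> = (%x. (\<chi> i. pd i \<phi> x *R z))"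
   by (rule ext) (simp add: grad_def pderiv_at_linear[OF bounded_linear_scaleR_left test_diff[OF \<phi>]])
  have l: "laplacian ?\<eta> = (%x. laplacian \<phi> x *R z)"
   by (rule ext, rule laplacian_linear[OF bounded_linear_scaleR_left test_smooth[OF \<phi>]])
  have "?e ?\<eta> \<in> closure S" using \<eta> closure_subset[of S] by (auto simp: S_def)
  from s(2)[OF this] have "(abs_l2 f - fst s) \<bullet> abs_l2 (grad ?\<eta>) + (abs_l2 d - snd s) \<bullet> abs_l2 (laplacian ?\<eta>) = 0"
   by (simp add: inner_prod_def)
  moreover have "(abs_l2 f - fst s) \<bullet> abs_l2 (grad ?\<eta>) = - ((abs_l2 d - snd s) \<bullet> abs_l2 ?\<eta>)"
   using weakf[OF \<phi>, of z] weaks[OF s(1) \<phi>, of z] unfolding g by (simp add: inner_diff_left)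
  ultimately have "(abs_l2 d - snd s) \<bullet> (abs_l2 (laplacian ?\<eta>) - abs_l2 ?\<eta>) = 0"
   by (simp add: inner_diff_right)
  hence "abs_l2 (%x. d x - e x) \<bullet> abs_l2 (%x. laplacian ?\<eta> x - ?\<eta> x) = 0"
   using r(2) e(2) by (simp add: abs_l2_diff gL[OF \<eta>] in_L2_test[OF \<eta>])
  hence "(LINT x. (d x - e x) \<bullet> (laplacian ?\<eta> x - ?\<eta> x)) = 0"
   by (simp add: inner_abs_l2 r(1) in_L2_diff gL[OF \<eta>] in_L2_test[OF \<eta>])
  moreover have "(d x - e x) \<bullet> (laplacian ?\<eta> x - ?\<eta> x) = (laplacian \<phi> x - \<phi> x) * ((d x - e x) \<bullet> z)" for x
   unfolding l by (simp add: scaleR_left_diff_distrib[symmetric])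
  ultimately show "(LINT x. (laplacian \<phi> x - \<phi> x) * ((d x - e x) \<bullet> z)) = 0" by (simp only:)
 qed
 have "AE x. \<forall>z\<in>Basis. (d x - e x) \<bullet> z = 0"
  by (subst AE_ball_countable) (auto intro: zero countable_finite)
 hence "AE x. d x = e x"
  by (rule eventually_mono) (auto intro!: euclidean_eqI[of "d _" "e _"] simp: inner_diff_left)
 hence de: "snd s = abs_l2 d" unfolding e(2) by (subst abs_l2_eq_iff[OF e(1) d]) (auto elim: eventually_mono)
 \<comment> \<open>The projection is orthogonal to its own error; as the second components agree,
   the first component alone is orthogonal to its error.\<close>
 have "norm (fst s) <= L2n f"
 proof -
  have "(?p - s) \<bullet> s = 0" by (rule s(2)[OF s(1)])
  hence "(abs_l2 f - fst s) \<bullet> fst s = 0" using de by (simp add: inner_prod_def)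
  hence "norm (fst s) * norm (fst s) = abs_l2 f \<bullet> fst s"
   by (simp add: inner_diff_left power2_norm_eq_inner[symmetric] power2_eq_square)
  also have "... <= L2n f * norm (fst s)" by (rule norm_cauchy_schwarz)
  finally show ?thesis by (cases "norm (fst s) = 0") auto
 qed
 moreover obtain t where t: "t \<in> S" "dist t s < \<delta>" using s(1) \<delta> unfolding closure_approachable by blast
 moreover obtain \<eta> where \<eta>: "test \<eta>" "t = ?e \<eta>" using t(1) by (auto simp: S_def)
 moreover have "dist (fst t) (fst s) <= dist t s" "dist (snd t) (snd s) <= dist t s" by (rule dist_fst_le dist_snd_le)+
 ultimately show ?thesis
  using norm_triangle_sub[of "abs_l2 (grad \<eta>)" "fst s"]
  by (intro that[OF \<eta>(1)]) (auto simp: dist_norm de)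
qed

section \<open>Smooth weights\<close>

lemma mollifier_exists:
 assumes e: "\<epsilon> > 0"
 shows "\<exists>\<phi>::real^3 => real. test \<phi> \<and> (\<forall>x. \<phi> x >= 0) \<and> (\<forall>x. \<phi> x \<noteq> 0 --> norm x < \<epsilon>)
  \<and> (LINT x. \<phi> x) = 1"
proof -
 \<comment> \<open>Half side \<epsilon>/4: the sum of the three coordinates in modulus is then at
   most 3 \<epsilon>/4, below \<epsilon>.\<close>
 define b :: "real^3" where "b = (\<chi> i. \<epsilon> / 4)"
 let ?k = "box_bump (- b) b"
 have out: "norm x < \<epsilon>" if "x \<in> box (- b) b" for x
 proof -
  have "norm x <= (\<Sum>i. \<bar>x $ i\<bar>)" by (rule norm_le_l1_cart)
  also have "... <= (\<Sum>i\<in>(UNIV::3 set). \<epsilon> / 4)"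
  proof (rule sum_mono)
   fix i
   have "- (\<epsilon> / 4) < x $ i" "x $ i < \<epsilon> / 4" using that by (auto simp: mem_box_cart b_def)
   thus "\<bar>x $ i\<bar> <= \<epsilon> / 4" by linarith
  qed
  also have "... < \<epsilon>" using e by simp
  finally show ?thesis .
 qed
 have supp: "x \<in> box (- b) b" if "?k x \<noteq> 0" for x
  using box_bump_bounds(1,3)[of "-b" b x] that by linarith
 have t: "test ?k"
  by (rule test_functionI[of _ "cbox (- b) b"])
   (use supp box_subset_cbox[of "-b" b] in \<open>auto simp: box_bump_smooth\<close>)
 have nn: "0 <= ?k x" for x by (rule box_bump_bounds)
 define c where "c = (LINT x. ?k x)"
 have "c \<noteq> 0"
 proof
  assume "c = 0"
  hence "AE x. ?k x = 0"
   unfolding c_def by (subst (asm) integral_nonneg_eq_0_iff_AE[OF test_integrable[OF t]]) (auto simp: nn)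
  hence "AE x. x \<notin> box (- b) b"
   by (rule eventually_mono) (use box_bump_bounds(3)[of "-b" b] in force)
  hence "negligible (box (- b) b)"
   by (simp add: negligible_iff_null_sets AE_iff_null_sets)
  moreover have "0 \<in> box (- b) b" using e by (simp add: mem_box_cart b_def)
  ultimately show False using open_not_negligible[OF open_box] by blast
 qed
 moreover have "c >= 0" unfolding c_def by (rule integral_nonneg_AE) (simp add: nn)
 ultimately have c: "c > 0" by simp
 show ?thesis
 proof (intro exI[of _ "%x. inverse c * ?k x"] conjI allI impI)
  show "test (%x. inverse c * ?k x)"
   by (rule test_linear[OF bounded_linear_mult_right t])
  show "(LINT x. inverse c * ?k x) = 1" using c by (simp add: c_def[symmetric])
  fix x
  show "0 <= inverse c * ?k x" using c nn by simp
  assume "inverse c * ?k x \<noteq> 0"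
  hence "?k x \<noteq> 0" by auto
  thus "norm x < \<epsilon>" by (intro out supp)
 qed
qed

text \<open>\<open>M\<close> averages \<open>k\<close> over shifts below \<epsilon>. As
  \<open>k\<close> changes by at most a factor 1 - \<delta> or 1 + \<delta> under such shifts, k(x)
  can be pulled out of the average, and the cut-off that remains is the mollified indicator
  \<open>\<kappa>\<close>.\<close>

lemma mollified_comparison:
 fixes k :: "real fn"
 assumes kL: "in_L2 (%x. indB R x * k x)" and \<epsilon>: "\<epsilon> > 0"
  and radii: "r' + \<epsilon> <= r" "r + \<epsilon> <= R"
  and cmp: "!!h. norm h < \<epsilon> ==> AE x. x \<in> ball 0 r --> (1 - \<delta>) * k x <= k (x + h) \<and> k (x + h) <= (1 + \<delta>) * k x"
  and \<phi>: "test \<phi>" "!!x. \<phi> x >= 0" "!!x. \<phi> x \<noteq> 0 ==> norm x < \<epsilon>"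
 defines "M \<equiv> conv (%x. indB r' x * k x) \<phi>" and "\<kappa> \<equiv> conv (indB r') \<phi>"
 shows "test_function (ball 0 R) M"
  and "AE x. (1 - \<delta>) * (\<kappa> x * k x) <= M x \<and> M x <= (1 + \<delta>) * (\<kappa> x * k x)"
proof -
 let ?B = "ball (0::real^3) r'"
 have e0: "indicator ?B x * k x = indicator ?B x * (indB R x * k x)" for x
  using radii \<epsilon> by (auto split: split_indicator)
 have gL: "in_L2 (%x. indicator ?B x * k x)"
  using in_L2_indicator_mult[OF kL, of 0 r'] unfolding e0[symmetric] real_scaleR_def .
 have zero: "M x = 0 \<and> \<kappa> x = 0" if x: "r' + \<epsilon> <= norm x" for x
 proof -
  have c: "\<phi> (x - y) = 0 \<or> y \<notin> ?B" for y
   using \<phi>(3)[of "x - y"] x norm_triangle_ineq[of "x - y" y] by force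
  have "\<phi> (x - y) *R (indicator ?B y * k y) = 0" "\<phi> (x - y) *R (indicator ?B y :: real) = 0" for y
   using c[of y] by auto
  thus ?thesis by (simp only: M_def \<kappa>_def conv_def) simp
 qed
 show "test_function (ball 0 R) M"
 proof (rule test_functionI[of _ "cball 0 (r' + \<epsilon>)"])
  show "smooth M" unfolding M_def by (rule smooth_conv[OF \<phi>(1) L2_loc_integrable[OF gL]])
  show "cball 0 (r' + \<epsilon>) \<subseteq> ball (0::real^3) R" using radii \<epsilon> by auto
 qed (use zero in auto)
 obtain v where v: "v \<in> borel_measurable lborel" "AE x in lborel. indB R x * k x = v x"
  using completion_ex_borel_measurable_real[OF in_L2_measurable[OF kL]] by blast
 have [measurable]: "v \<in> borel_measurable borel" "v \<in> borel_measurable lborel" using v(1) by simp_all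
 have ae: "AE x. indB R x * k x = v x" using v(2) by (rule AE_completion)
 have [measurable]: "(%x. x \<in> ball (0::real^3) s) \<in> borel \<rightarrow>\<^sub>M count_space UNIV"
   "(%x. x \<in> ball (0::real^3) s) \<in> lborel \<rightarrow>\<^sub>M count_space UNIV" for s
   by (simp_all add: pred_def)
 let ?P = "%x h. x \<in> ball 0 r \<and> norm h < \<epsilon> --> (1 - \<delta>) * v x <= v (x + h) \<and> v (x + h) <= (1 + \<delta>) * v x"
 have "AE x in lborel. ?P x h" for h
 proof (cases "norm h < \<epsilon>")
  case True
  have "AE x. ?P x h"
   using cmp[OF True] ae AE_translate[OF ae, of h]
  proof eventually_elim
   case (elim x)
   show ?case
   proof
    assume x: "x \<in> ball 0 r \<and> norm h < \<epsilon>"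
    hence "norm (x + h) < r + \<epsilon>" using norm_triangle_ineq[of x h] by simp
    hence "x + h \<in> ball 0 R" "x \<in> ball 0 R" using radii x \<epsilon> by auto
    hence "v x = k x" "v (x + h) = k (x + h)" using elim by auto
    thus "(1 - \<delta>) * v x <= v (x + h) \<and> v (x + h) <= (1 + \<delta>) * v x" using elim x by simp
   qed
  qed
  thus ?thesis by (simp add: AE_completion_iff)
 qed simp
 \<comment> \<open>The comparison holds for each shift off a null set depending on it. Exchanging
   the quantifiers makes almost every \<open>x\<close> good for almost every shift; this needs a
   jointly measurable statement, hence the Borel representative \<open>v\<close>.\<close>
 hence "AE h in lborel. AE x in lborel. ?P x h" by simp
 moreover have "(AE x in lborel. AE h in lborel. ?P x h) = (AE h in lborel. AE x in lborel. ?P x h)"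
  by (rule lborel_pair.AE_commute) measurable
 ultimately have "AE x in lborel. AE h in lborel. ?P x h" by simp
 hence sw: "AE x. AE h. ?P x h"
  by (simp add: AE_completion_iff)
 show "AE x. (1 - \<delta>) * (\<kappa> x * k x) <= M x \<and> M x <= (1 + \<delta>) * (\<kappa> x * k x)"
  using sw ae
 proof eventually_elim
  case (elim x)
  show ?case
  proof (cases "x \<in> ball 0 r")
   case False
   hence "M x = 0 \<and> \<kappa> x = 0" using radii by (intro zero) auto
   thus ?thesis by simp
  next
   case True
   hence kv: "k x = v x" using elim(2) radii \<epsilon> by auto
   have i1: "Lint (%y. \<phi> (x - y) * (indicator ?B y * k y))"
    using conv_integrable[OF \<phi>(1) L2_loc_integrable[OF gL], of x] by simp
   have i2: "Lint (%y. \<phi> (x - y) * indicator ?B y)"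
    using conv_integrable[OF \<phi>(1) L2_loc_integrable[OF in_L2_indicator_ball[of 0 r']], of x] by simp
   have t1: "Lint (%h. \<phi> (- h) * (indicator ?B (h + x) * k (h + x)))"
    using integrable_translate[OF i1, of x] by simp
   have t2: "Lint (%h. \<phi> (- h) * indicator ?B (h + x))"
    using integrable_translate[OF i2, of x] by simp
   have M: "M x = (LINT h. \<phi> (- h) * (indicator ?B (h + x) * k (h + x)))"
    using integral_translate[OF borel_measurable_integrable[OF i1], of x] by (simp add: M_def conv_def)
   have K: "\<kappa> x = (LINT h. \<phi> (- h) * indicator ?B (h + x))"
    using integral_translate[OF borel_measurable_integrable[OF i2], of x] by (simp add: \<kappa>_def conv_def)
   have pt: "AE h. (1 - \<delta>) * k x * (\<phi> (- h) * indicator ?B (h + x)) <= \<phi> (- h) * (indicator ?B (h + x) * k (h + x))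
     \<and> \<phi> (- h) * (indicator ?B (h + x) * k (h + x)) <= (1 + \<delta>) * k x * (\<phi> (- h) * indicator ?B (h + x))"
    using elim(1) AE_translate[OF ae, of x]
   proof eventually_elim
    case (elim h)
    show ?case
    proof (cases "\<phi> (- h) * indicator ?B (h + x) = 0")
     case True
     hence "\<phi> (- h) * (indicator ?B (h + x) * k (h + x)) = 0" by auto
     thus ?thesis using True by (simp only: mult_zero_right) simp
    next
     case False
     hence h: "norm h < \<epsilon>" "h + x \<in> ?B" using \<phi>(3)[of "- h"] by (auto split: split_indicator_asm)
     hence "h + x \<in> ball 0 R" using radii \<epsilon> by auto
     hence "k (h + x) = v (x + h)" using elim(2) by (simp add: add.commute)
     hence "(1 - \<delta>) * k x <= k (h + x)" "k (h + x) <= (1 + \<delta>) * k x"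
      using elim(1) h(1) True kv by auto
     thus ?thesis
      using h(2) \<phi>(2)[of "- h"] by (auto simp: mult.commute[of _ "\<phi> (- h)"] intro: mult_left_mono)
    qed
   qed
   have "(LINT h. (1 - \<delta>) * k x * (\<phi> (- h) * indicator ?B (h + x))) <= M x"
    unfolding M by (rule integral_mono_AE[OF integrable_mult_right[OF t2] t1]) (use pt in \<open>auto elim: eventually_mono\<close>)
   moreover have "M x <= (LINT h. (1 + \<delta>) * k x * (\<phi> (- h) * indicator ?B (h + x)))"
    unfolding M by (rule integral_mono_AE[OF t1 integrable_mult_right[OF t2]]) (use pt in \<open>auto elim: eventually_mono\<close>)
   ultimately show ?thesis by (simp add: K[symmetric] mult_ac)
  qed
 qed
qed

text \<open>Turns an absolute increment into a relative one, using the common positive lower bound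
  \<open>a0\<close>.\<close>

lemma ratio_bounds:
 fixes a b :: real
 assumes "0 < a0" "a0 <= a" "a0 <= b" "\<bar>b - a\<bar> <= s * a0"
 shows "(1 - s) * a <= b" "b <= (1 + s) * a"
proof -
 have "s * a0 >= 0" using assms(4) abs_ge_zero order_trans by blast
 hence "s >= 0" using assms(1) by (simp add: zero_le_mult_iff)
 hence "s * a0 <= s * a" using assms by (intro mult_left_mono)
 thus "(1 - s) * a <= b" "b <= (1 + s) * a" using assms(4) by (auto simp: algebra_simps abs_le_iff)
qed

lemma sqrt_ratio_bounds:
 fixes a b :: real
 assumes "0 <= a" "0 <= s" "s < 1" "(1 - s) * a <= b" "b <= (1 + s) * a"
 shows "(1 - s) * sqrt a <= sqrt b" "sqrt b <= (1 + s) * sqrt a"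
proof -
 have "(1 - s)^2 * a <= (1 - s) * a"
  using assms by (intro mult_right_mono) (auto simp: power2_eq_square mult_left_le)
 hence "(1 - s)^2 * a <= b" using assms by linarith
 hence "sqrt ((1 - s)^2 * a) <= sqrt b" by (rule real_sqrt_le_mono)
 thus "(1 - s) * sqrt a <= sqrt b" using assms by (simp add: real_sqrt_mult)
 have "(1 + s) * a <= (1 + s)^2 * a"
  using assms by (intro mult_right_mono) (auto simp: power2_eq_square algebra_simps)
 hence "b <= (1 + s)^2 * a" using assms by linarith
 hence "sqrt b <= sqrt ((1 + s)^2 * a)" by (rule real_sqrt_le_mono)
 thus "sqrt b <= (1 + s) * sqrt a" using assms by (simp add: real_sqrt_mult)
qed

text \<open>Two relative errors of \<delta>/3 combine to at most \<delta>, because the squares of 1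
  + \<delta>/3 and 1 - \<delta>/3 stay between 1 - \<delta> and 1 + \<delta>.\<close>

lemma product_ratio:
 fixes c c' q q' \<delta> :: real
 assumes \<delta>: "0 < \<delta>" "\<delta> < 1" and pos: "0 < c" "0 < q" "0 < c'" "0 < q'"
  and c: "(1 - \<delta>/3) * c <= c'" "c' <= (1 + \<delta>/3) * c"
  and q: "(1 - \<delta>/3) * q <= q'" "q' <= (1 + \<delta>/3) * q"
 shows "(1 - \<delta>) * (c * q) <= c' * q'" "c' * q' <= (1 + \<delta>) * (c * q)"
proof -
 have "((1 - \<delta>/3) * c) * ((1 - \<delta>/3) * q) <= c' * q'"
  using \<delta> pos by (intro mult_mono c q) auto
 moreover have "(1 - \<delta>) * (c * q) <= ((1 - \<delta>/3) * (1 - \<delta>/3)) * (c * q)"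
  using \<delta> pos by (intro mult_right_mono) (auto simp: algebra_simps)
 ultimately show "(1 - \<delta>) * (c * q) <= c' * q'" by (simp add: mult_ac)
 have "c' * q' <= ((1 + \<delta>/3) * c) * ((1 + \<delta>/3) * q)"
  using \<delta> pos by (intro mult_mono c q) auto
 moreover have "((1 + \<delta>/3) * (1 + \<delta>/3)) * (c * q) <= (1 + \<delta>) * (c * q)"
 proof (rule mult_right_mono)
  have "\<delta> * \<delta> <= \<delta>" using \<delta> by (simp add: mult_left_le)
  moreover have "(1 + \<delta>/3) * (1 + \<delta>/3) = 1 + 2 * \<delta> / 3 + \<delta> * \<delta> / 9" by (simp add: algebra_simps)
  ultimately show "(1 + \<delta>/3) * (1 + \<delta>/3) <= 1 + \<delta>" using \<delta> by linarith
 qed (use pos in simp)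
 ultimately show "c' * q' <= (1 + \<delta>) * (c * q)" by (simp add: mult_ac)
qed

text \<open>Both weights arise by mollifying a cut-off function, c times the root of
  \<open>\<rho>\<close> and its reciprocal, with one mollifier; hence the same cut-off
  \<open>\<kappa>\<close> appears in both estimates. Lipschitz bounds for \<open>c\<close> and
  \<open>\<rho>\<close> and their positive lower bounds make the relative error small.\<close>

lemma smooth_weights:
 fixes c \<rho> :: "real fn"
 assumes c: "in_W1inf (ball 0 R) c" and \<rho>: "in_W1inf (ball 0 R) \<rho>" and r: "0 < r" "r < R"
  and c0: "0 < c0" "AE x. x \<in> ball 0 R --> c0 <= c x"
  and \<rho>0: "0 < \<rho>0" "AE x. x \<in> ball 0 R --> \<rho>0 <= \<rho> x"
  and \<delta>: "0 < \<delta>" "\<delta> < 1"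
 obtains M1 M2 \<kappa> :: "real fn" where "test_function (ball 0 R) M1" "test_function (ball 0 R) M2"
  "!!x. 0 <= \<kappa> x" "!!x. \<kappa> x <= 1" "!!x. norm x <= r ==> \<kappa> x = 1"
  "AE x. (1 - \<delta>) * (\<kappa> x * (c x * sqrt (\<rho> x))) <= M1 x \<and> M1 x <= (1 + \<delta>) * (\<kappa> x * (c x * sqrt (\<rho> x)))"
  "AE x. (1 - \<delta>) * (\<kappa> x * inverse (c x * sqrt (\<rho> x))) <= M2 x \<and> M2 x <= (1 + \<delta>) * (\<kappa> x * inverse (c x * sqrt (\<rho> x)))"
proof -
 define d where "d = R - r"
 have d: "d > 0" using r by (simp add: d_def)
 \<comment> \<open>Nested radii r < r' < r'' < R with gaps of at least d/4, the largest admissible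
   mollification radius: \<open>\<kappa>\<close> is then 1 up to radius \<open>r\<close>, and all
   shifts stay inside the large ball.\<close>
 define r' where "r' = r + d / 4"
 define r'' where "r'' = r + d / 2"
 have req: "2 * r'' = R + r" "4 * r' = R + 3 * r" "d = R - r"
  by (simp_all add: r'_def r''_def d_def field_simps)
 have rr: "r'' < R" using d req by linarith
 obtain L1 where L1: "L1 >= 0" "!!h. norm h < R - r'' ==> AE x. x \<in> ball 0 r'' --> \<bar>c (x + h) - c x\<bar> <= L1 * norm h"
  by (rule W1inf_difference_bound[OF c rr]) blast
 obtain L2 where L2: "L2 >= 0" "!!h. norm h < R - r'' ==> AE x. x \<in> ball 0 r'' --> \<bar>\<rho> (x + h) - \<rho> x\<bar> <= L2 * norm h"
  by (rule W1inf_difference_bound[OF \<rho> rr]) blast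
 \<comment> \<open>Small enough that increments of \<open>c\<close> and \<open>\<rho>\<close> are at
   most \<delta>/3 times their lower bounds; adding 1 to the Lipschitz constants avoids division by
   zero.\<close>
 define \<epsilon> where "\<epsilon> = min (d / 4) (min (\<delta> / 3 * c0 / (L1 + 1)) (\<delta> / 3 * \<rho>0 / (L2 + 1)))"
 have "\<epsilon> > 0" using d \<delta> c0(1) \<rho>0(1) L1(1) L2(1) by (simp add: \<epsilon>_def)
 moreover have "\<epsilon> <= d / 4" unfolding \<epsilon>_def by (rule min.cobounded1)
 ultimately have \<epsilon>: "\<epsilon> > 0" "\<epsilon> <= d / 4" by auto
 have \<epsilon>1: "L1 * \<epsilon> <= \<delta> / 3 * c0"
 proof -
  have "\<epsilon> <= \<delta> / 3 * c0 / (L1 + 1)" unfolding \<epsilon>_def by (meson min.cobounded1 min.cobounded2 order_trans)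
  hence "(L1 + 1) * \<epsilon> <= \<delta> / 3 * c0" using L1(1) by (simp add: pos_le_divide_eq algebra_simps)
  thus ?thesis using \<epsilon>(1) by (simp add: algebra_simps)
 qed
 have \<epsilon>2: "L2 * \<epsilon> <= \<delta> / 3 * \<rho>0"
 proof -
  have "\<epsilon> <= \<delta> / 3 * \<rho>0 / (L2 + 1)" unfolding \<epsilon>_def by (meson min.cobounded2 order_trans)
  hence "(L2 + 1) * \<epsilon> <= \<delta> / 3 * \<rho>0" using L2(1) by (simp add: pos_le_divide_eq algebra_simps)
  thus ?thesis using \<epsilon>(1) by (simp add: algebra_simps)
 qed
 let ?m = "%x. c x * sqrt (\<rho> x)" and ?n = "%x. inverse (c x * sqrt (\<rho> x))"
 let ?cmp = "%k x h. (1 - \<delta>) * k x <= k (x + h) \<and> k (x + h) <= (1 + \<delta>) * k x"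
 have cmp: "AE x. x \<in> ball 0 r'' --> ?cmp ?m x h \<and> ?cmp ?n x h" if h: "norm h < \<epsilon>" for h
 proof -
  have h': "norm h < R - r''" using h \<epsilon> d req by linarith
  show ?thesis
   using L1(2)[OF h'] L2(2)[OF h'] c0(2) \<rho>0(2) AE_translate[OF c0(2), of h] AE_translate[OF \<rho>0(2), of h]
  proof eventually_elim
   case (elim x)
   show ?case
   proof
    assume x: "x \<in> ball 0 r''"
    have "norm (x + h) < R" using norm_triangle_ineq[of x h] x h' by simp
    hence xR: "x + h \<in> ball 0 R" "x \<in> ball 0 R" using x rr by auto
    have cc: "c0 <= c x" "c0 <= c (x + h)" and rh: "\<rho>0 <= \<rho> x" "\<rho>0 <= \<rho> (x + h)"
     using elim xR by auto
    have "L1 * norm h <= L1 * \<epsilon>" "L2 * norm h <= L2 * \<epsilon>" using h L1(1) L2(1) by (auto intro!: mult_left_mono)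
    hence dc: "\<bar>c (x + h) - c x\<bar> <= \<delta> / 3 * c0" and dr: "\<bar>\<rho> (x + h) - \<rho> x\<bar> <= \<delta> / 3 * \<rho>0"
     using elim x \<epsilon>1 \<epsilon>2 by auto
    have dc': "\<bar>c x - c (x + h)\<bar> <= \<delta> / 3 * c0" and dr': "\<bar>\<rho> x - \<rho> (x + h)\<bar> <= \<delta> / 3 * \<rho>0"
     using dc dr by (simp_all add: abs_minus_commute)
    note C = ratio_bounds[OF c0(1) cc dc] and C' = ratio_bounds[OF c0(1) cc(2,1) dc']
    have s3: "0 <= \<delta> / 3" "\<delta> / 3 < 1" using \<delta> by auto
    have rp: "0 <= \<rho> x" "0 <= \<rho> (x + h)" using rh \<rho>0(1) by auto
    note S = sqrt_ratio_bounds[OF rp(1) s3 ratio_bounds[OF \<rho>0(1) rh dr]]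
     and S' = sqrt_ratio_bounds[OF rp(2) s3 ratio_bounds[OF \<rho>0(1) rh(2,1) dr']]
    have pos: "0 < c x" "0 < sqrt (\<rho> x)" "0 < c (x + h)" "0 < sqrt (\<rho> (x + h))"
     using cc rh c0(1) \<rho>0(1) by auto
    have P: "(1 - \<delta>) * ?m x <= ?m (x + h)" "?m (x + h) <= (1 + \<delta>) * ?m x"
     by (rule product_ratio[OF \<delta> pos C S])+
    \<comment> \<open>The comparison with \<open>x\<close> and \<open>x + h\<close> exchanged is
      what reciprocals turn into the bounds for the second weight.\<close>
    have P': "(1 - \<delta>) * ?m (x + h) <= ?m x" "?m x <= (1 + \<delta>) * ?m (x + h)"
     by (rule product_ratio[OF \<delta> pos(3,4,1,2) C' S'])+
    have inv: "(1 - \<delta>) * inverse a <= inverse b" "inverse b <= (1 + \<delta>) * inverse a"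
     if "0 < a" "0 < b" "(1 - \<delta>) * b <= a" "a <= (1 + \<delta>) * b" for a b :: real
     using that by (simp_all add: field_simps)
    have mp: "0 < ?m x" "0 < ?m (x + h)" using pos by simp_all
    show "?cmp ?m x h \<and> ?cmp ?n x h"
     using P inv[OF mp P'] by blast
   qed
  qed
 qed
 have cmp1: "AE x. x \<in> ball 0 r'' --> ?cmp ?m x h"
  and cmp2: "AE x. x \<in> ball 0 r'' --> ?cmp ?n x h"
  if "norm h < \<epsilon>" for h
  using cmp[OF that] by (rule eventually_mono, blast)+
 have L: "in_L2 (%x. indB R x * c x)" "in_L2 (%x. indB R x * \<rho> x)"
  using c \<rho> by (auto simp: in_W1inf_def intro: in_Linf_L2)
 obtain Cc where Cc: "Cc >= 0" "AE x. x \<in> ball 0 R --> \<bar>c x\<bar> <= Cc"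
  using in_Linf_L2(2)[of R c] c by (auto simp: in_W1inf_def)
 obtain Cr where Cr: "Cr >= 0" "AE x. x \<in> ball 0 R --> \<bar>\<rho> x\<bar> <= Cr"
  using in_Linf_L2(2)[of R \<rho>] \<rho> by (auto simp: in_W1inf_def)
 have meq: "indB R x * ?m x = (indB R x * c x) * sqrt (indB R x * \<rho> x)"
  "indB R x * ?n x = inverse ((indB R x * c x) * sqrt (indB R x * \<rho> x))" for x :: "real^3"
  by (auto split: split_indicator)
 have mm: "(%x. indB R x * ?m x) \<in> LM"
  unfolding meq using in_L2_measurable[OF L(1)] in_L2_measurable[OF L(2)] by measurable
 have mn: "(%x. indB R x * ?n x) \<in> LM"
  unfolding meq using in_L2_measurable[OF L(1)] in_L2_measurable[OF L(2)] by measurable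
 have mL: "in_L2 (%x. indB R x * ?m x)"
 proof (rule in_L2_bound[OF in_L2_indicator_ball[of 0 R] mm, of "Cc * sqrt Cr"])
  show "AE x. norm (indB R x * ?m x) <= Cc * sqrt Cr * norm (indB R x :: real)"
   using Cc(2) Cr(2)
  proof eventually_elim
   case (elim x)
   show ?case
   proof (cases "x \<in> ball 0 R")
    case True
    hence "\<bar>c x\<bar> * sqrt \<bar>\<rho> x\<bar> <= Cc * sqrt Cr" using elim Cc Cr by (intro mult_mono) auto
    moreover have "\<bar>sqrt (\<rho> x)\<bar> = sqrt \<bar>\<rho> x\<bar>" by (simp add: abs_if real_sqrt_minus)
    ultimately show ?thesis using True by (simp add: abs_mult)
   qed simp
  qed
 qed
 have nL: "in_L2 (%x. indB R x * ?n x)"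
 proof (rule in_L2_bound[OF in_L2_indicator_ball[of 0 R] mn, of "inverse (c0 * sqrt \<rho>0)"])
  show "AE x. norm (indB R x * ?n x) <= inverse (c0 * sqrt \<rho>0) * norm (indB R x :: real)"
   using c0(2) \<rho>0(2)
  proof eventually_elim
   case (elim x)
   show ?case
   proof (cases "x \<in> ball 0 R")
    case True
    hence "c0 * sqrt \<rho>0 <= ?m x" using elim c0 \<rho>0 by (intro mult_mono) auto
    moreover have "0 < c0 * sqrt \<rho>0" using c0 \<rho>0 by simp
    ultimately have "inverse (?m x) <= inverse (c0 * sqrt \<rho>0)" "0 < inverse (?m x)"
     by (rule le_imp_inverse_le, intro positive_imp_inverse_positive) (rule less_le_trans)
    thus ?thesis using True by (simp del: inverse_mult_distrib)
   qed simp
  qed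
 qed
 from mollifier_exists[OF \<epsilon>(1)] obtain \<phi> :: "real fn" where "test \<phi> \<and> (\<forall>x. \<phi> x >= 0)
   \<and> (\<forall>x. \<phi> x \<noteq> 0 --> norm x < \<epsilon>) \<and> (LINT x. \<phi> x) = 1" ..
 hence \<phi>: "test \<phi>" "!!x. \<phi> x >= 0" "!!x. \<phi> x \<noteq> 0 ==> norm x < \<epsilon>" "(LINT x. \<phi> x) = 1"
  by simp_all
 have radii: "r' + \<epsilon> <= r''" "r'' + \<epsilon> <= R" using \<epsilon> d req by linarith+
 define \<kappa> where "\<kappa> = conv (indB r' :: real fn) \<phi>"
 have \<kappa>i: "Lint (%y. \<phi> (x - y) * indB r' y)" for x
  using conv_integrable[OF \<phi>(1) L2_loc_integrable[OF in_L2_indicator_ball[of 0 r']], of x] by simp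
 have \<phi>i: "Lint (%y. \<phi> (x - y))" for x by (rule test_integrable[OF test_reflect[OF \<phi>(1)]])
 have \<phi>1: "(LINT y. \<phi> (x - y)) = 1" for x
  using integral_reflect[OF borel_measurable_continuous_onI[OF test_cont[OF \<phi>(1)]], of x] \<phi>(4) by simp
 let ?M = "%k. conv (%x. indB r' x * k x) \<phi>"
 show ?thesis
 proof (rule that[of "?M ?m" "?M ?n" \<kappa>])
  show "test_function (ball 0 R) (?M ?m)"
   by (rule mollified_comparison(1)[OF mL \<epsilon>(1) radii cmp1 \<phi>(1-3)])
  show "test_function (ball 0 R) (?M ?n)"
   by (rule mollified_comparison(1)[OF nL \<epsilon>(1) radii cmp2 \<phi>(1-3)])
  show "AE x. (1 - \<delta>) * (\<kappa> x * ?m x) <= ?M ?m x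
    \<and> ?M ?m x <= (1 + \<delta>) * (\<kappa> x * ?m x)"
   unfolding \<kappa>_def by (rule mollified_comparison(2)[OF mL \<epsilon>(1) radii cmp1 \<phi>(1-3)])
  show "AE x. (1 - \<delta>) * (\<kappa> x * ?n x) <= ?M ?n x
    \<and> ?M ?n x <= (1 + \<delta>) * (\<kappa> x * ?n x)"
   unfolding \<kappa>_def by (rule mollified_comparison(2)[OF nL \<epsilon>(1) radii cmp2 \<phi>(1-3)])
  fix x :: "real^3"
  have k: "\<kappa> x = (LINT y. \<phi> (x - y) * indB r' y)" by (simp add: \<kappa>_def conv_def)
  show "0 <= \<kappa> x" unfolding k by (rule integral_nonneg_AE) (simp add: \<phi>(2))
  have "\<kappa> x <= (LINT y. \<phi> (x - y))" unfolding k
   by (rule integral_mono[OF \<kappa>i \<phi>i]) (simp add: \<phi>(2) split: split_indicator)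
  thus "\<kappa> x <= 1" unfolding \<phi>1 .
  assume x: "norm x <= r"
  have "(%y. \<phi> (x - y) * indB r' y) = (%y. \<phi> (x - y))"
  proof
   fix y
   show "\<phi> (x - y) * indB r' y = \<phi> (x - y)"
   proof (cases "\<phi> (x - y) = 0")
    case False
    hence "norm (x - y) < d / 4" using \<phi>(3)[of "x - y"] \<epsilon>(2) by simp
    hence "norm y < r'" using x norm_triangle_ineq4[of x "x - y"] by (simp add: r'_def)
    thus ?thesis by simp
   qed simp
  qed
  thus "\<kappa> x = 1" unfolding k by (simp only: \<phi>1)
 qed
qed

section \<open>Sesquilinear forms in the pointwise variables\<close>

lemma hdot_add_left: "hdot (u + v) w = hdot u w + hdot v w"
 and hdot_add_right: "hdot u (v + w) = hdot u v + hdot u w"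
 and hdot_cscale_left: "hdot (c *s u) v = c * hdot u v"
 and hdot_cscale_right: "hdot u (c *s v) = cnj c * hdot u v"
 and hdot_scaleR_left: "hdot (r *R u) v = r *R hdot u v"
 and hdot_scaleR_right: "hdot u (r *R v) = r *R hdot u v"
 and hdot_diff_left: "hdot (u - v) w = hdot u w - hdot v w"
 and hdot_zero: "hdot 0 v = 0" "hdot u 0 = 0"
 by (simp_all add: hdot_def sum.distrib distrib_left distrib_right sum_distrib_left scaleR_sum_right mult_ac
   sum_negf sum_subtractf left_diff_distrib right_diff_distrib)

lemma hdot_commute: "hdot v u = cnj (hdot u v)"
 by (simp add: hdot_def mult.commute)

lemma Re_hdot: "Re (hdot u v) = u \<bullet> v"
 by (simp add: hdot_def inner_vec_def inner_complex_def)

lemma hdot_self: "hdot u u = of_real ((norm u)^2)"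
proof (rule complex_eqI)
 show "Re (hdot u u) = Re (of_real ((norm u)^2))" by (simp add: Re_hdot power2_norm_eq_inner)
 show "Im (hdot u u) = Im (of_real ((norm u)^2))" by (simp add: hdot_def mult.commute)
qed

lemma norm_hdot_le: "norm (hdot u v) <= 3 * norm u * norm v"
proof -
 have "norm (hdot u v) <= (\<Sum>i\<in>(UNIV::3 set). norm u * norm v)"
  unfolding hdot_def
 proof (rule order_trans[OF norm_sum], rule sum_mono)
  fix i show "norm (u $ i * cnj (v $ i)) <= norm u * norm v"
   unfolding norm_mult complex_mod_cnj by (intro mult_mono Finite_Cartesian_Product.norm_nth_le) auto
 qed
 thus ?thesis by simp
qed

lemma bounded_bilinear_hdot: "bounded_bilinear hdot"
proof
 show "\<exists>K. \<forall>a b. norm (hdot a b) <= norm a * norm b * K"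
  using norm_hdot_le by (intro exI[of _ 3]) (simp add: mult_ac)
qed (simp_all add: hdot_add_left hdot_add_right hdot_scaleR_left hdot_scaleR_right)

lemma ccross_linear: "ccross \<Omega> (u + v) = ccross \<Omega> u + ccross \<Omega> v" "ccross \<Omega> (c *s u) = c *s ccross \<Omega> u"
 unfolding vec_eq_iff forall_3
 by (simp_all add: ccross_def cross3_simps complex_eq_iff algebra_simps)

lemma vector_cscale_of_real: "of_real r *s (u::complex^'n) = r *R u"
 by (simp add: vec_eq_iff flip: scaleR_conv_of_real)

lemma bounded_linear_ccross: "bounded_linear (ccross \<Omega>)"
 unfolding linear_conv_bounded_linear[symmetric]
proof
 show "ccross \<Omega> (r *R u) = r *R ccross \<Omega> u" for r u
  using ccross_linear(2)[of \<Omega> "of_real r" u] by (simp add: vector_cscale_of_real)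
qed (rule ccross_linear)

lemma rdot_linear: "rdot q (u + v) = rdot q u + rdot q v" "rdot q (c *s u) = c * rdot q u"
 by (simp_all add: rdot_def distrib_left sum.distrib sum_distrib_left mult_ac)

type_synonym point = "(complex^3) \<times> complex \<times> (complex^3) \<times> (complex^3)"
type_synonym coefs = "real \<times> (real^3) \<times> (real^3^3) \<times> real \<times> real"

text \<open>As a product type, \<open>point\<close> carries only real scalars; complex
  multiplication is therefore defined componentwise.\<close>

definition vscale :: "complex => point => point" where
 "vscale c z = (c *s fst z, c * fst (snd z), c *s fst (snd (snd z)), c *s snd (snd (snd z)))"

lemma vscale_of_real: "vscale (of_real r) z = r *R z"
 by (simp add: vscale_def prod_eq_iff vector_cscale_of_real scaleR_conv_of_real)

definition sesquilinear :: "(point => point => complex) => bool" where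
 "sesquilinear f \<longleftrightarrow> (\<forall>z1 z2 z. f (z1 + z2) z = f z1 z + f z2 z) \<and> (\<forall>z z1 z2. f z (z1 + z2) = f z z1 + f z z2)
   \<and> (\<forall>c z z'. f (vscale c z) z' = c * f z z') \<and> (\<forall>c z z'. f z (vscale c z') = cnj c * f z z')"

definition product_form :: "point => point => complex" where
 "product_form z z' = fst (snd z) * cnj (fst (snd z')) + hdot (fst (snd (snd z))) (fst (snd (snd z')))
   + hdot (fst z) (fst z') + hdot (snd (snd (snd z))) (snd (snd (snd z')))"

definition rotation :: "real => real^3 => complex^3 => complex^3 => complex^3" where
 "rotation \<omega> \<Omega> u w = of_real \<omega> *s u + \<i> *s w + \<i> *s ccross \<Omega> u"

text \<open>The coefficients are \<open>c\<^sub>s\<^sup>2\<close>, \<open>q\<close>, \<open>\<rho>\<^sup>-\<^sup>1 Hess p - Hess \<phi>\<close>, \<open>\<gamma>\<close> and \<open>\<surd>\<rho>\<close>; the arguments are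
 \<open>\<surd>\<rho> u\<close>, \<open>\<surd>\<rho> div u\<close>, \<open>\<surd>\<rho> \<partial>\<^sub>b u\<close> and \<open>\<nabla>\<psi>\<close>.\<close>

definition oscillation_form :: "real => real^3 => real => coefs => point => point => complex" where
 "oscillation_form \<omega> \<Omega> G K z z' =
  (case K of (k, q, N, \<gamma>, s) => case z of (u, d, w, g) => case z' of (u', d', w', g') =>
   of_real k * d * cnj d' + of_real k * rdot q u * cnj d' + of_real k * d * cnj (rdot q u')
   - hdot (rotation \<omega> \<Omega> u w) (rotation \<omega> \<Omega> u' w') + hdot (cmat N *v u) u'
   - \<i> * of_real \<omega> * of_real \<gamma> * hdot u u' - of_real s * hdot g u' - of_real s * hdot u g'
   + of_real (1 / (4 * pi * G)) * hdot g g')"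

lemma sesquilinear_product: "sesquilinear product_form"
 unfolding sesquilinear_def product_form_def vscale_def
 by (simp add: hdot_add_left hdot_add_right hdot_cscale_left hdot_cscale_right distrib_left distrib_right mult_ac)

lemma rotation_linear: "rotation \<omega> \<Omega> (u + u') (w + w') = rotation \<omega> \<Omega> u w + rotation \<omega> \<Omega> u' w'"
 "rotation \<omega> \<Omega> (c *s u) (c *s w) = c *s rotation \<omega> \<Omega> u w"
 by (simp_all add: rotation_def ccross_linear vector_add_ldistrib algebra_simps)

lemma sesquilinear_oscillation: "sesquilinear (oscillation_form \<omega> \<Omega> G K)"
proof -
 obtain k q N \<gamma> s where K: "K = (k, q, N, \<gamma>, s)" by (metis prod.collapse)
 show ?thesis
  unfolding sesquilinear_def
 proof (intro conjI allI)
  fix z1 z2 z :: point and c :: complex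
  obtain u d w g where z: "z = (u, d, w, g)" by (metis prod.collapse)
  obtain u1 d1 w1 g1 where z1: "z1 = (u1, d1, w1, g1)" by (metis prod.collapse)
  obtain u2 d2 w2 g2 where z2: "z2 = (u2, d2, w2, g2)" by (metis prod.collapse)
  show "oscillation_form \<omega> \<Omega> G K (z1 + z2) z = oscillation_form \<omega> \<Omega> G K z1 z + oscillation_form \<omega> \<Omega> G K z2 z"
   unfolding K z z1 z2 oscillation_form_def
   by (simp add: rotation_linear rdot_linear hdot_add_left matrix_vector_right_distrib algebra_simps add_divide_distrib)
  show "oscillation_form \<omega> \<Omega> G K z (z1 + z2) = oscillation_form \<omega> \<Omega> G K z z1 + oscillation_form \<omega> \<Omega> G K z z2"
   unfolding K z z1 z2 oscillation_form_def
   by (simp add: rotation_linear rdot_linear hdot_add_right algebra_simps add_divide_distrib)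
  have mv: "cmat N *v (c *s u) = c *s (cmat N *v u)" for u
   by (simp add: matrix_vector_mult_def vec_eq_iff sum_distrib_left mult_ac)
  show "oscillation_form \<omega> \<Omega> G K (vscale c z1) z = c * oscillation_form \<omega> \<Omega> G K z1 z"
   unfolding K z z1 oscillation_form_def vscale_def
   by (simp add: rotation_linear rdot_linear hdot_cscale_left mv algebra_simps add_divide_distrib)
  show "oscillation_form \<omega> \<Omega> G K z1 (vscale c z) = cnj c * oscillation_form \<omega> \<Omega> G K z1 z"
   unfolding K z z1 oscillation_form_def vscale_def
   by (simp add: rotation_linear rdot_linear hdot_cscale_right algebra_simps)
 qed
qed

lemma continuous_hdot:
 "continuous_on A f ==> continuous_on A g ==> continuous_on A (%x. hdot (f x) (g x))"
 by (rule bounded_bilinear.continuous_on[OF bounded_bilinear_hdot])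

lemma continuous_product: "continuous_on UNIV (%p. product_form (fst (snd p)) (snd (snd p)))"
 unfolding product_form_def by (intro continuous_intros continuous_hdot)

lemma continuous_cscale:
 "continuous_on A f ==> continuous_on A (%x. c *s (f x :: complex^3))"
 by (simp add: vector_scalar_mult_def) (intro continuous_intros)

lemma continuous_cmat_mult:
 fixes N :: "'a::topological_space => real^3^3"
 assumes "continuous_on A N" "continuous_on A u"
 shows "continuous_on A (%x. cmat (N x) *v u x)"
 unfolding matrix_vector_mult_def cmat_def by simp (intro continuous_intros assms)

lemma continuous_rdot:
 "continuous_on A q ==> continuous_on A u ==> continuous_on A (%x. rdot (q x) (u x))"
 unfolding rdot_def by (intro continuous_intros)

lemma continuous_rotation:
 "continuous_on A u ==> continuous_on A w ==> continuous_on A (%x. rotation \<omega> \<Omega> (u x) (w x))"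
 unfolding rotation_def
 by (intro continuous_intros continuous_cscale bounded_linear.continuous_on[OF bounded_linear_ccross])

lemma continuous_oscillation: "continuous_on UNIV (%p. oscillation_form \<omega> \<Omega> G (fst p) (fst (snd p)) (snd (snd p)))"
 unfolding oscillation_form_def split_beta
 by (intro continuous_intros continuous_hdot continuous_cmat_mult continuous_rdot continuous_rotation)

lemma sesquilinear_scaleR:
 assumes "sesquilinear f"
 shows "f (r *R z) z' = r *R f z z'" "f z (r *R z') = r *R f z z'"
proof -
 have "f (vscale (of_real r) z) z' = of_real r * f z z'" "f z (vscale (of_real r) z') = cnj (of_real r) * f z z'"
  using assms unfolding sesquilinear_def by blast+
 thus "f (r *R z) z' = r *R f z z'" "f z (r *R z') = r *R f z z'"
  unfolding vscale_of_real scaleR_conv_of_real complex_cnj_complex_of_real by blast+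
qed

text \<open>Compactness of the coefficient ball and of the two unit balls gives a bound on
  normalized arguments, and homogeneity extends it. One estimate thus bounds all terms of the form
  simultaneously.\<close>

lemma sesquilinear_bound:
 fixes f :: "'k::euclidean_space => point => point => complex"
 assumes c: "continuous_on UNIV (%p. f (fst p) (fst (snd p)) (snd (snd p)))" and s: "!!K. sesquilinear (f K)"
 shows "\<exists>C\<ge>0. \<forall>K z z'. norm K <= R --> norm (f K z z') <= C * norm z * norm z'"
proof -
 let ?F = "%p. f (fst p) (fst (snd p)) (snd (snd p))"
 have "compact (cball (0::'k) R \<times> cball (0::point) 1 \<times> cball (0::point) 1)"
  by (intro compact_Times compact_cball)
 hence "bounded (?F ` (cball 0 R \<times> cball 0 1 \<times> cball 0 1))"
  by (intro compact_imp_bounded compact_continuous_image continuous_on_subset[OF c]) auto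
 then obtain C where C: "C > 0" "!!p. p \<in> cball 0 R \<times> cball 0 1 \<times> cball 0 1 ==> norm (?F p) <= C"
  unfolding bounded_pos by blast
 have "norm (f K z z') <= C * norm z * norm z'" if K: "norm K <= R" for K z z'
 proof -
  let ?z = "inverse (norm z) *R z" and ?z' = "inverse (norm z') *R z'"
  have e: "z = norm z *R ?z" "z' = norm z' *R ?z'" by (cases "z = 0", simp_all, cases "z' = 0", simp_all)
  have n: "norm ?z <= 1" "norm ?z' <= 1" by (cases "z = 0", simp_all, cases "z' = 0", simp_all)
  have "f K z z' = norm z *R (norm z' *R f K ?z ?z')"
   by (metis e sesquilinear_scaleR[OF s])
  hence "norm (f K z z') = norm z * (norm z' * norm (f K ?z ?z'))" by simp
  also have "... <= norm z * (norm z' * C)"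
   using C(2)[of "(K, ?z, ?z')"] K n by (intro mult_left_mono) auto
  finally show ?thesis by (simp add: mult_ac)
 qed
 thus ?thesis using C(1) by (intro exI[of _ C] conjI allI impI) simp_all
qed

lemma form_measurable:
 fixes f :: "'k::euclidean_space => point => point => complex"
 assumes c: "continuous_on UNIV (%p. f (fst p) (fst (snd p)) (snd (snd p)))"
  and K: "K \<in> LM" and Z: "Z \<in> LM" "Z' \<in> LM"
 shows "(%x. f (K x) (Z x) (Z' x)) \<in> LM"
proof -
 have "(%x. (K x, Z x, Z' x)) \<in> lebesgue \<rightarrow>\<^sub>M borel \<Otimes>\<^sub>M (borel \<Otimes>\<^sub>M borel)"
  by (intro measurable_Pair K Z)
 hence "(%x. (K x, Z x, Z' x)) \<in> LM"
  by (simp only: borel_prod)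
 from measurable_compose[OF this borel_measurable_continuous_onI[OF c]]
 show ?thesis by simp
qed

lemma form_integrable:
 fixes f :: "'k::euclidean_space => point => point => complex"
 assumes c: "continuous_on UNIV (%p. f (fst p) (fst (snd p)) (snd (snd p)))" and s: "!!K. sesquilinear (f K)"
  and K: "K \<in> LM" "AE x. norm (K x) <= R" and Z: "in_L2 Z" "in_L2 Z'"
 shows "Lint (%x. f (K x) (Z x) (Z' x))"
proof -
 obtain C where C: "C >= 0" "!!K z z'. norm K <= R ==> norm (f K z z') <= C * norm z * norm z'"
  using sesquilinear_bound[of f R, OF c s] by metis
 show ?thesis
  by (rule L2_prod_integrable[OF Z form_measurable[where f=f, OF c K(1) in_L2_measurable[OF Z(1)] in_L2_measurable[OF Z(2)]], of C])
   (rule eventually_mono[OF K(2)], rule C(2))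
qed

lemma form_integral_bound:
 fixes f :: "'k::euclidean_space => point => point => complex"
 assumes c: "continuous_on UNIV (%p. f (fst p) (fst (snd p)) (snd (snd p)))" and s: "!!K. sesquilinear (f K)"
  and K: "K \<in> LM" "AE x. norm (K x) <= R"
 shows "\<exists>C\<ge>0. \<forall>Z Z'. in_L2 Z --> in_L2 Z' --> norm (LINT x. f (K x) (Z x) (Z' x)) <= C * L2n Z * L2n Z'"
proof -
 obtain C where C: "C >= 0" "!!K z z'. norm K <= R ==> norm (f K z z') <= C * norm z * norm z'"
  using sesquilinear_bound[of f R, OF c s] by metis
 show ?thesis
 proof (intro exI[of _ C] conjI allI impI C(1))
  fix Z Z' :: "real^3 => point" assume Z: "in_L2 Z" "in_L2 Z'"
  show "norm (LINT x. f (K x) (Z x) (Z' x)) <= C * L2n Z * L2n Z'"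
   by (rule L2_integral_bound[OF Z form_measurable[where f=f, OF c K(1) in_L2_measurable[OF Z(1)] in_L2_measurable[OF Z(2)]] C(1)])
    (rule eventually_mono[OF K(2)], rule C(2))
 qed
qed

lemma Re_product_form: "Re (product_form z z') = z \<bullet> z'"
 by (simp add: product_form_def Re_hdot inner_prod_def inner_complex_def)

text \<open>Separates every term containing \<open>u\<close> or \<open>u'\<close> from the principal
  part. The first summand keeps only \<open>u\<close> on the left, the second only \<open>u'\<close>
  on the right; with the potential component zero on the right, nothing else couples.\<close>

lemma oscillation_split:
 "oscillation_form \<omega> \<Omega> G (k, q, N, \<gamma>, s) (u, d, w, g) (u', d', w', 0) =
  oscillation_form \<omega> \<Omega> G (k, q, N, \<gamma>, s) (u, 0, 0, 0) (u', d', w', 0)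
  + oscillation_form \<omega> \<Omega> G (k, q, N, \<gamma>, s) (0, d, w, g) (u', 0, 0, 0)
  + (of_real k * d * cnj d' - hdot w w')"
proof -
 let ?f = "oscillation_form \<omega> \<Omega> G (k, q, N, \<gamma>, s)"
 have s: "sesquilinear ?f" by (rule sesquilinear_oscillation)
 have "?f (u, d, w, g) (u', d', w', 0) = ?f ((u, 0, 0, 0) + (0, d, w, g)) (u', d', w', 0)" by simp
 also have "... = ?f (u, 0, 0, 0) (u', d', w', 0) + ?f (0, d, w, g) (u', d', w', 0)"
  using s unfolding sesquilinear_def by blast
 also have "?f (0, d, w, g) (u', d', w', 0) = ?f (0, d, w, g) ((u', 0, 0, 0) + (0, d', w', 0))" by simp
 also have "... = ?f (0, d, w, g) (u', 0, 0, 0) + ?f (0, d, w, g) (0, d', w', 0)"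
  using s unfolding sesquilinear_def by blast
 also have "?f (0, d, w, g) (0, d', w', 0) = of_real k * d * cnj d' - hdot w w'"
 proof -
  have cz: "ccross \<Omega> 0 = 0" by (rule linear_simps(3)[OF bounded_linear_ccross])
  have "rotation \<omega> \<Omega> 0 w = \<i> *s w" "rotation \<omega> \<Omega> 0 w' = \<i> *s w'" by (simp_all add: rotation_def cz)
  thus ?thesis
   by (simp add: oscillation_form_def hdot_zero rdot_def hdot_cscale_left hdot_cscale_right)
 qed
 finally show ?thesis by simp
qed

text \<open>Apart from the damping, each term is real or accompanied by its own conjugate; for the
  matrix term this uses the symmetry of \<open>N\<close>.\<close>

lemma Im_oscillation:
 assumes "!!i j. N $ i $ j = N $ j $ i"
 shows "Im (oscillation_form \<omega> \<Omega> G (k, q, N, \<gamma>, s) (u, d, w, g) (u, d, w, g)) = - \<omega> * \<gamma> * (norm u)^2"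
proof -
 have h: "Im (hdot v v) = 0" for v by (simp add: hdot_self)
 have N: "Im (hdot (cmat N *v u) u) = 0"
 proof -
  have e: "hdot (cmat N *v u) u = (\<Sum>i. \<Sum>j. of_real (N $ i $ j) * u $ j * cnj (u $ i))"
   by (simp add: hdot_def matrix_vector_mult_def cmat_def sum_distrib_right)
  have "cnj (hdot (cmat N *v u) u) = (\<Sum>i. \<Sum>j. of_real (N $ i $ j) * cnj (u $ j) * u $ i)"
   unfolding e by simp
  also have "... = (\<Sum>j. \<Sum>i. of_real (N $ i $ j) * cnj (u $ j) * u $ i)" by (rule sum.swap)
  also have "... = hdot (cmat N *v u) u"
   unfolding e using assms by (intro sum.cong refl) (simp add: mult_ac)
  finally have "cnj (hdot (cmat N *v u) u) = hdot (cmat N *v u) u" .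
  from arg_cong[OF this, of Im] show ?thesis by simp
 qed
 have r: "hdot (rotation \<omega> \<Omega> u w) (rotation \<omega> \<Omega> u w) = of_real ((norm (rotation \<omega> \<Omega> u w))^2)" by (rule hdot_self)
 have c: "hdot g u = cnj (hdot u g)" by (rule hdot_commute)
 have cc: "of_real k * d * cnj d = of_real (k * (norm d)^2)" by (simp add: mult.assoc complex_norm_square[symmetric])
 let ?x = "of_real k * rdot q u * cnj d" and ?y = "of_real s * hdot u g"
 have e: "oscillation_form \<omega> \<Omega> G (k, q, N, \<gamma>, s) (u, d, w, g) (u, d, w, g) =
   of_real (k * (norm d)^2) + (?x + cnj ?x) - of_real ((norm (rotation \<omega> \<Omega> u w))^2) + hdot (cmat N *v u) u
   - \<i> * of_real (\<omega> * \<gamma> * (norm u)^2) - (cnj ?y + ?y) + of_real (1 / (4 * pi * G) * (norm g)^2)"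
  unfolding oscillation_form_def prod.case r hdot_self[of u] hdot_self[of g] c cc complex_cnj_mult
   complex_cnj_cnj complex_cnj_complex_of_real of_real_mult
  by (simp only: algebra_simps)
 show ?thesis
  unfolding e using N by (simp del: of_real_mult of_real_power complex_cnj_mult)
qed

section \<open>Essential bounds, supports and Hessians\<close>

lemma ess_inf_positive:
 assumes "ess_inf M f > 0"
 obtains c :: real where "c > 0" "AE x in M. c <= f x"
proof -
 let ?e = "esssup M (%x. - ereal (f x))"
 have "0 < - ?e" using assms unfolding ess_inf_def by simp
 then obtain c :: real where c: "0 < ereal c" "ereal c < - ?e" using ereal_dense2 by blast
 have "AE x in M. - ereal (f x) <= ?e" by (rule esssup_AE)
 hence "AE x in M. c <= f x"
 proof (rule eventually_mono)
  fix x assume "- ereal (f x) <= ?e"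
  hence "- ?e <= - (- ereal (f x))" by (rule ereal_minus_le_minus[THEN iffD2])
  from less_le_trans[OF c(2) this] show "c <= f x" by simp
 qed
 with c(1) show ?thesis using that by simp
qed

lemma AE_lebesgue_on: "open S ==> (AE x in lebesgue_on S. P x) \<longleftrightarrow> (AE x. x \<in> S --> P x)"
 by (subst AE_restrict_space_iff) auto

lemma in_Linf_UNIV:
 "in_Linf UNIV f \<longleftrightarrow> f \<in> LM \<and> (\<exists>C>0. AE x. norm (f x) <= C)"
proof -
 have "\<exists>C>0. AE x. norm (f x) <= C" if "AE x. norm (f x) <= C" for C
  by (rule exI[of _ "\<bar>C\<bar> + 1"], intro conjI eventually_mono[OF that]) auto
 thus ?thesis unfolding in_Linf_def lebesgue_on_UNIV_eq by blast
qed

text \<open>The complement is covered by balls on which \<open>f\<close> vanishes almost everywhere,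
  but uncountably many; Lindelof's theorem leaves countably many null sets.\<close>

lemma ess_support_AE:
 fixes f :: "('a::euclidean_space) fn"
 shows "AE x. x \<notin> ess_support f --> f x = 0"
proof -
 define \<F> where "\<F> = {ball x r |x r. r > 0 \<and> (AE y. y \<in> ball x r --> f y = 0)}"
 have "!!S. S \<in> \<F> ==> open S" unfolding \<F>_def by auto
 then obtain \<F>' where F': "\<F>' \<subseteq> \<F>" "countable \<F>'" "\<Union>\<F>' = \<Union>\<F>" by (rule Lindelof) blast
 have "AE y. \<forall>S\<in>\<F>'. y \<in> S --> f y = 0"
  using F'(1) by (subst AE_ball_countable[OF F'(2)]) (auto simp: \<F>_def)
 thus ?thesis
 proof (rule eventually_mono)
  fix y assume y: "\<forall>S\<in>\<F>'. y \<in> S --> f y = 0"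
  show "y \<notin> ess_support f --> f y = 0"
  proof
   assume "y \<notin> ess_support f"
   then obtain r where "r > 0" "AE z. z \<in> ball y r --> f z = 0" unfolding ess_support_def by blast
   hence "ball y r \<in> \<F>" "y \<in> ball y r" unfolding \<F>_def by auto
   hence "y \<in> \<Union>\<F>'" unfolding F'(3) by blast
   with y show "f y = 0" by blast
  qed
 qed
qed

lemma has_weak_pderiv_AE:
 assumes "weakd i f g" "AE x. f x = f' x" "f' \<in> LM"
 shows "weakd i f' g"
proof (rule has_weak_pderivI)
 show "L1loc f'" "L1loc g"
  using assms(1) loc_integrable_AE[OF _ assms(2,3)] unfolding has_weak_pderiv_def by blast+
 fix \<eta> :: "real fn" assume \<eta>: "test \<eta>"
 have "(LINT x. pd i \<eta> x *R f' x) = (LINT x. pd i \<eta> x *R f x)"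
 proof (rule integral_cong_AE)
  have [measurable]: "pd i \<eta> \<in> LM" by (rule test_borel[OF test_pderiv[OF \<eta>]])
  have [measurable]: "f \<in> LM" "f' \<in> LM"
   using assms(1,3) loc_integrable_measurable unfolding has_weak_pderiv_def by blast+
  show "(%x. pd i \<eta> x *R f' x) \<in> LM" by measurable
  show "(%x. pd i \<eta> x *R f x) \<in> LM" by measurable
  show "AE x. pd i \<eta> x *R f' x = pd i \<eta> x *R f x"
   using assms(2) by eventually_elim simp
 qed
 with has_weak_pderivD[OF assms(1) \<eta>]
 show "(LINT x. pd i \<eta> x *R f' x) = - (LINT x. \<eta> x *R g x)" by simp
qed

text \<open>\<open>weak_hess\<close> nests two choices. The inner one agrees with a twice
  differentiable representative only almost everywhere, so the second derivative is transferred
  along that equality.\<close>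

lemma weak_hess_has:
 assumes "in_W2inf_loc f"
 shows "weakd i f (weak_pderiv i f)"
  "weakd j (weak_pderiv i f) (%x. weak_hess f x $ j $ i)"
proof -
 obtain g h where g: "weakd i f g" and h: "weakd j g h"
  using assms unfolding in_W2inf_loc_def by blast
 show 1: "weakd i f (weak_pderiv i f)" by (rule weak_pderiv_some[OF g])
 have "weak_pderiv i f \<in> LM"
  using 1 loc_integrable_measurable unfolding has_weak_pderiv_def by blast
 moreover have "AE x. g x = weak_pderiv i f x" using weak_pderiv_AE[OF g] by eventually_elim simp
 ultimately have "weakd j (weak_pderiv i f) h" using has_weak_pderiv_AE[OF h] by blast
 from weak_pderiv_some[OF this]
 show "weakd j (weak_pderiv i f) (%x. weak_hess f x $ j $ i)" unfolding weak_hess_def by simp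
qed

text \<open>Both entries integrate against a test function to the same integral of \<open>f\<close>,
  since mixed derivatives of the test function commute.\<close>

lemma weak_hess_symmetric:
 assumes "in_W2inf_loc f"
 shows "AE x. weak_hess f x $ i $ j = weak_hess f x $ j $ i"
proof -
 have li: "L1loc (%x. weak_hess f x $ i $ j)" for i j
  using weak_hess_has(2)[OF assms, of i j] unfolding has_weak_pderiv_def by blast
 have eq: "(LINT x. \<eta> x *R weak_hess f x $ i $ j) = (LINT x. pd j (pd i \<eta>) x *R f x)"
  if \<eta>: "test \<eta>" for \<eta> :: "real fn" and i j
  using has_weak_pderivD[OF weak_hess_has(2)[OF assms, of i j] \<eta>] has_weak_pderivD[OF weak_hess_has(1)[OF assms, of j] test_pderiv[OF \<eta>, of i]]
  by simp
 have "AE x. x \<in> UNIV --> weak_hess f x $ i $ j = weak_hess f x $ j $ i"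
 proof (rule fundamental_lemma_eq[OF open_UNIV li li])
  fix \<eta> :: "real fn" assume \<eta>: "test \<eta>"
  show "(LINT x. \<eta> x *R weak_hess f x $ i $ j) = (LINT x. \<eta> x *R weak_hess f x $ j $ i)"
   unfolding eq[OF \<eta>] pderiv_at_commute[OF test_smooth[OF \<eta>], of i j] by (rule refl)
 qed
 thus ?thesis by simp
qed

lemma bounded_bilinear_rdot: "bounded_bilinear (%u v. rdot v u)"
proof
 show "\<exists>K. \<forall>a b. norm (rdot b a) <= norm a * norm b * K"
 proof (intro exI[of _ 3] allI)
  fix a b
  have "norm (rdot b a) <= (\<Sum>i\<in>(UNIV::3 set). norm a * norm b)"
   unfolding rdot_def
  proof (rule order_trans[OF norm_sum], rule sum_mono)
   fix i show "norm (of_real (b $ i) * a $ i) <= norm a * norm b"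
    unfolding norm_mult norm_of_real mult.commute[of "\<bar>b $ i\<bar>"]
    using Finite_Cartesian_Product.norm_nth_le[of a i] component_le_norm_cart[of b i] by (intro mult_mono) auto
  qed
  thus "norm (rdot b a) <= norm a * norm b * 3" by simp
 qed
 show "rdot b (r *R a) = r *R rdot b a" "rdot (r *R b) a = r *R rdot b a" for r a b
  unfolding rdot_def scaleR_sum_right by (intro sum.cong refl; simp add: scaleR_conv_of_real[where 'a=complex] mult_ac)+
qed (simp_all add: rdot_def distrib_left distrib_right sum.distrib)

section \<open>The energy space in weighted variables\<close>

text \<open>No measurability is assumed: the Lebesgue measure is complete, so measurability
  transfers along the equality, and if it fails both integrals take the default value 0.\<close>

lemma lebesgue_integral_AE_eq:
 fixes f g :: "('b::euclidean_space) fn"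
 assumes "AE x. f x = g x"
 shows "(LINT x. f x) = (LINT x. g x)"
proof (cases "f \<in> LM")
 case True
 thus ?thesis using borel_measurable_AE[OF True assms] assms by (intro integral_cong_AE)
next
 case False
 have "AE x. g x = f x" using assms by eventually_elim simp
 hence "g \<notin> LM" using False borel_measurable_AE by metis
 with False have "\<not> Lint f" "\<not> Lint g" using borel_measurable_integrable by metis+
 thus ?thesis by (simp add: not_integrable_integral_eq)
qed

lemma has_weak_divD:
 assumes "has_weak_div f g" "test \<eta>"
 shows "(LINT x. (\<Sum>i. pd i \<eta> x *R (f x $ i))) = - (LINT x. \<eta> x *R g x)"
 using assms unfolding has_weak_div_def by blast

lemma has_weak_div_unique:
 assumes "has_weak_div f g" "has_weak_div f g'"
 shows "AE x. g x = g' x"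
proof -
 have "AE x. x \<in> UNIV --> g x = g' x"
 proof (rule fundamental_lemma_eq[OF open_UNIV])
  show "L1loc g" "L1loc g'" using assms unfolding has_weak_div_def by blast+
  fix \<eta> :: "real fn" assume \<eta>: "test \<eta>"
  have "- (LINT x. \<eta> x *R g x) = - (LINT x. \<eta> x *R g' x)"
   unfolding has_weak_divD[OF assms(1) \<eta>, symmetric] has_weak_divD[OF assms(2) \<eta>, symmetric] by (rule refl)
  thus "(LINT x. \<eta> x *R g x) = (LINT x. \<eta> x *R g' x)" by simp
 qed
 thus ?thesis by simp
qed

lemma weak_div_some: "has_weak_div f g ==> has_weak_div f (weak_div f)"
 unfolding weak_div_def by (rule someI[of "has_weak_div f"])

lemma rdot_grad_scaleR: "rdot (r *R grad \<eta> x) u = r *R (\<Sum>i. pd i \<eta> x *R (u $ i))"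
 unfolding rdot_def grad_def scaleR_sum_right by (intro sum.cong refl) (simp add: scaleR_conv_of_real[where 'a=complex])

lemma grad_mult:
 fixes f g :: "real fn"
 assumes "smooth f" "smooth g"
 shows "grad (%x. f x * g x) x = f x *R grad g x + g x *R grad f x"
 unfolding grad_def vec_eq_iff by (simp add: pderiv_at_mult[OF smooth_diff[OF assms(1)] smooth_diff[OF assms(2)]])

lemma measurable_vec_nth:
 fixes f :: "'m => 'a::euclidean_space^3"
 assumes "f \<in> borel_measurable M" shows "(%x. f x $ l) \<in> borel_measurable M"
 by (rule measurable_compose[OF assms borel_measurable_continuous_onI]) (intro continuous_intros)

text \<open>\<open>R\<close> is the outer radius up to which \<open>c\<close> and
  \<open>\<rho>\<close> are Lipschitz, and \<open>\<beta>\<close> bounds |b|/c almost everywhere;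
  smallness of the flow is encoded by the pointwise inequality \<open>mach\<close>.\<close>

locale stellar =
 fixes \<omega> G r1 R \<beta> :: real and \<Omega> :: "real^3" and \<rho> c \<gamma> p \<phi> :: "real fn" and b :: "(real^3) fn"
 assumes omega: "\<omega> \<noteq> 0" and G: "G > 0"
  and rho: "in_Linf UNIV \<rho>" "!!r. r > 0 ==> ess_inf (lebesgue_on (ball 0 r)) \<rho> > 0"
  and sound: "in_Linf UNIV c" "ess_inf lebesgue c > 0"
    and gamma: "in_Linf UNIV \<gamma>" "ess_inf lebesgue \<gamma> > 0"
    and p_phi: "in_W2inf_loc p" "in_W2inf_loc \<phi>"
  and q: "in_Linf UNIV (q_field \<rho> c p)"
  and m1: "in_Linf UNIV (m1_field \<rho> c p \<phi>)"
  and flow: "in_Linf UNIV b" "\<exists>g. has_weak_div (%x. \<rho> x *R b x) g \<and> in_L2 g"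
  and r1: "r1 > 0" "ess_support b \<subseteq> ball 0 r1" and R: "r1 < R"
  and W1inf: "in_W1inf (ball 0 R) c" "in_W1inf (ball 0 R) \<rho>"
  and mach: "0 <= \<beta>" "\<beta> < 1" "AE x. norm (b x) <= \<beta> * c x"
begin

definition s :: "real fn" where "s x = sqrt (\<rho> x)"

definition dv :: "real fn" where "dv = weak_div (%x. \<rho> x *R b x)"

lemma rho_ball:
 obtains C where "C > 0" "AE x. x \<in> ball 0 r --> C <= \<rho> x"
proof -
 have "\<bar>r\<bar> + 1 > 0" by simp
 from ess_inf_positive[OF rho(2)[OF this]]
 obtain c where c: "c > 0" "AE x in lebesgue_on (ball 0 (\<bar>r\<bar> + 1)). c <= \<rho> x" by blast
 have "AE x. x \<in> ball 0 (\<bar>r\<bar> + 1) --> c <= \<rho> x" using c(2) by (simp add: AE_lebesgue_on)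
 hence "AE x. x \<in> ball 0 r --> c <= \<rho> x" by eventually_elim auto
 with c(1) show ?thesis by (rule that)
qed

lemma rho_pos: "AE x. 0 < \<rho> x"
proof -
 have "!!n::nat. AE x. x \<in> ball 0 (real n) --> 0 < \<rho> x"
 proof -
  fix n :: nat
  obtain c where "c > 0" "AE x. x \<in> ball 0 (real n) --> c <= \<rho> x" by (rule rho_ball)
  thus "AE x. x \<in> ball 0 (real n) --> 0 < \<rho> x" by (auto elim: eventually_mono)
 qed
 hence "AE x. \<forall>n::nat. x \<in> ball 0 (real n) --> 0 < \<rho> x" unfolding AE_all_countable by (rule allI)
 thus ?thesis
 proof eventually_elim
  case (elim x)
  obtain n :: nat where "norm x < real n" using reals_Archimedean2 by blast
  thus ?case using elim by auto
 qed
qed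

lemma s_measurable [measurable]: "s \<in> LM"
 and rho_measurable [measurable]: "\<rho> \<in> LM"
 and b_measurable [measurable]: "b \<in> LM"
proof -
 show [measurable]: "\<rho> \<in> LM" "b \<in> LM"
  using rho(1) flow(1) unfolding in_Linf_UNIV by blast+
 show "s \<in> LM" unfolding s_def by measurable
qed

lemma s_pos: "AE x. 0 < s x \<and> (s x)^2 = \<rho> x"
 using rho_pos by eventually_elim (simp add: s_def)

lemma s_upper: obtains S where "S > 0" "AE x. 0 < s x \<and> s x <= S"
proof -
 obtain C where C: "C > 0" "AE x. norm (\<rho> x) <= C" using rho(1) unfolding in_Linf_UNIV by blast
 have "AE x. 0 < s x \<and> s x <= sqrt C"
  using C(2) rho_pos by eventually_elim (simp add: s_def)
 with C(1) show ?thesis by (intro that[of "sqrt C"]) auto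
qed

lemma s_lower: obtains S where "S > 0" "AE x. x \<in> ball 0 r --> inverse (s x) <= S \<and> 0 < s x"
proof -
 obtain C where C: "C > 0" "AE x. x \<in> ball 0 r --> C <= \<rho> x" by (rule rho_ball)
 have "AE x. x \<in> ball 0 r --> inverse (s x) <= inverse (sqrt C) \<and> 0 < s x"
  using C(2) by eventually_elim (use C(1) in \<open>auto simp: s_def intro!: le_imp_inverse_le\<close>)
 with C(1) show ?thesis by (intro that[of "inverse (sqrt C)"]) auto
qed

lemma b_bounded: obtains B where "B > 0" "AE x. norm (b x) <= B"
 using flow(1) unfolding in_Linf_UNIV by blast

lemma b_support: "AE x. x \<notin> cball 0 r1 --> b x = 0"
 using ess_support_AE[of b] by eventually_elim (use r1 in auto)

lemma dv: "has_weak_div (%x. \<rho> x *R b x) dv" "in_L2 dv"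
proof -
 obtain g where g: "has_weak_div (%x. \<rho> x *R b x) g" "in_L2 g" using flow(2) by blast
 show 1: "has_weak_div (%x. \<rho> x *R b x) dv" unfolding dv_def by (rule weak_div_some[OF g(1)])
 hence "dv \<in> LM" using loc_integrable_measurable unfolding has_weak_div_def by blast
 thus "in_L2 dv" by (rule in_L2_AE_cong[OF g(2) _ has_weak_div_unique[OF 1 g(1)]])
qed

lemma dv_measurable [measurable]: "dv \<in> LM"
 by (rule in_L2_measurable[OF dv(2)])

text \<open>Test functions supported off the ball see only points where \<open>b\<close> vanishes,
  so the weak divergence vanishes there by the fundamental lemma.\<close>

lemma dv_support: "AE x. x \<notin> cball 0 r1 --> dv x = 0"
proof -
 have "AE x. x \<in> - cball 0 r1 --> dv x = 0"
 proof (rule fundamental_lemma_real)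
  show "open (- cball 0 r1 :: (real^3) set)" by (simp add: open_Compl)
  show "loc_integrable (- cball 0 r1) dv" by (rule L2_loc_integrable[OF dv(2)])
  fix \<eta> :: "real fn" assume \<eta>: "test_function (- cball 0 r1) \<eta>"
  have \<eta>': "test \<eta>" by (rule test_mono[OF \<eta>]) simp
  have "(LINT x. (\<Sum>i. pd i \<eta> x *R ((\<rho> x *R b x) $ i))) = (LINT x::real^3. 0)"
  proof (rule lebesgue_integral_AE_eq)
   show "AE x. (\<Sum>i. pd i \<eta> x *R ((\<rho> x *R b x) $ i)) = 0"
    using b_support
   proof eventually_elim
    case (elim x)
    have "pd i \<eta> x * (b x $ i) = 0" for i
     using elim test_zero_outside[OF test_pderiv[OF \<eta>, of i], of x] by (cases "x \<in> cball 0 r1") auto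
    thus ?case by (intro sum.neutral) auto
   qed
  qed
  moreover have "(LINT x. (\<Sum>i. pd i \<eta> x *R ((\<rho> x *R b x) $ i))) = - (LINT x. \<eta> x *R dv x)"
   by (rule has_weak_divD[OF dv(1) \<eta>'])
  ultimately show "(LINT x. \<eta> x * dv x) = 0" by simp
 qed
 thus ?thesis by simp
qed

lemma test_ball:
 assumes "test_function D \<eta>"
 obtains r where "!!x. x \<notin> ball 0 r ==> \<eta> x = 0"
proof -
 obtain K where K: "compact K" "!!x. x \<notin> K ==> \<eta> x = 0" using test_functionE[OF assms] by metis
 obtain r where "!!x. x \<in> K ==> norm x < r" using compact_imp_bounded[OF K(1)] unfolding bounded_pos_less by blast
 with K(2) show ?thesis by (intro that[of r]) auto
qed

text \<open>The reciprocal of \<open>s\<close> is bounded on balls but perhaps not globally; the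
  compactly supported factor \<open>\<eta>\<close> confines the product to a ball.\<close>

lemma in_L2_inverse_s_bound:
 fixes \<eta> :: "('a::euclidean_space) fn" and f :: "('b::euclidean_space) fn"
 assumes \<eta>: "test_function D \<eta>" and f: "in_L2 f" and g: "g \<in> LM"
  and le: "!!x. norm (g x) <= norm (\<eta> x) * norm (f x)"
 shows "in_L2 (%x. inverse (s x) *R (g x :: 'c::euclidean_space))"
proof -
 obtain r where r: "!!x. x \<notin> ball 0 r ==> \<eta> x = 0" by (rule test_ball[OF \<eta>]) blast
 obtain B where B: "B > 0" "!!x. norm (\<eta> x) <= B" by (rule test_bounded[OF \<eta>]) blast
 obtain S where S: "S > 0" "AE x. x \<in> ball 0 r --> inverse (s x) <= S \<and> 0 < s x" by (rule s_lower)
 show ?thesis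
 proof (rule in_L2_bound[OF f, where C="S * B"])
  show "(%x. inverse (s x) *R g x) \<in> LM" using g by measurable
  show "AE x. norm (inverse (s x) *R g x) <= S * B * norm (f x)"
   using S(2)
  proof eventually_elim
   case (elim x)
   show ?case
   proof (cases "x \<in> ball 0 r")
    case True
    hence "\<bar>inverse (s x)\<bar> <= S" using elim by auto
    moreover have "norm (g x) <= B * norm (f x)"
     using order_trans[OF le[of x] mult_right_mono[OF B(2)[of x] norm_ge_zero[of "f x"]]] .
    ultimately have "\<bar>inverse (s x)\<bar> * norm (g x) <= S * (B * norm (f x))" using S(1) by (intro mult_mono) auto
    thus ?thesis by (simp add: mult.assoc)
   next
    case False
    hence "norm (g x) <= 0" using le[of x] r[of x] by simp
    hence "g x = 0" by simp
    thus ?thesis using S(1) B(1) by simp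
   qed
  qed
 qed
qed

lemma in_L2_inverse_s_test:
 fixes \<eta> :: "('a::euclidean_space) fn"
 assumes \<eta>: "test_function D \<eta>"
 shows "in_L2 (%x. inverse (s x) *R \<eta> x)"
proof -
 obtain r where r: "!!x. x \<notin> ball 0 r ==> \<eta> x = 0" by (rule test_ball[OF \<eta>]) blast
 show ?thesis
  by (rule in_L2_inverse_s_bound[OF \<eta> in_L2_indicator_ball[of 0 r] test_borel[OF \<eta>]])
   (metis (no_types, lifting) indicator_simps(1) mult.right_neutral norm_one norm_zero r mult_zero_left order_refl)
qed

lemma in_L2_s:
 assumes f: "in_L2 f" shows "in_L2 (%x. s x *R f x)"
proof -
 obtain S where S: "S > 0" "AE x. 0 < s x \<and> s x <= S" by (rule s_upper)
 show ?thesis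
 proof (rule in_L2_bound[OF f, where C=S])
  show "(%x. s x *R f x) \<in> LM" using in_L2_measurable[OF f] by measurable
  show "AE x. norm (s x *R f x) <= S * norm (f x)"
   using S(2) by eventually_elim (auto intro: mult_right_mono)
 qed
qed

text \<open>The transpose side of the weak identity for the directional derivative: for U = s u, the
  terms \<rho> u \<partial>_b v and div(\<rho> b) u v combine to the pairing of \<open>U\<close>
  with \<open>T2 v\<close>.\<close>

definition T2 :: "((complex^3) fn) => (complex^3) fn" where
 "T2 v x = s x *R (\<Sum>l. (b x $ l) *R pd l v x) + inverse (s x) *R (dv x *R v x)"

lemma in_L2_b:
 fixes f :: "3 => ('a::euclidean_space) fn"
 assumes f: "!!l. in_L2 (f l)"
 shows "in_L2 (%x. \<Sum>l. (b x $ l) *R f l x)"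
proof -
 obtain B where B: "B > 0" "AE x. norm (b x) <= B" by (rule b_bounded)
 have 1: "in_L2 (%x. (b x $ l) *R f l x)" for l
 proof (rule in_L2_bound[OF f, where C=B])
  have [measurable]: "(%x. b x $ l) \<in> LM" "f l \<in> LM"
   by (rule measurable_vec_nth[OF b_measurable], rule in_L2_measurable[OF f])
  show "(%x. (b x $ l) *R f l x) \<in> LM" by measurable
  show "AE x. norm ((b x $ l) *R f l x) <= B * norm (f l x)"
   using B(2)
  proof eventually_elim
   case (elim x)
   have "\<bar>b x $ l\<bar> <= B" using component_le_norm_cart[of "b x" l] elim by linarith
   thus ?case by (auto intro: mult_right_mono)
  qed
 qed
 show ?thesis unfolding sum_3 by (intro in_L2_add 1)
qed

lemma in_L2_T2:
 assumes "test v" shows "in_L2 (T2 v)"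
 unfolding T2_def
proof (intro in_L2_add in_L2_s in_L2_b in_L2_test[OF test_pderiv[OF assms]])
 show "in_L2 (%x. inverse (s x) *R dv x *R v x)"
 proof (rule in_L2_inverse_s_bound[OF assms dv(2)])
  show "(%x. dv x *R v x) \<in> LM" using test_borel[OF assms] by measurable
  show "norm (dv x *R v x) <= norm (v x) * norm (dv x)" for x by simp
 qed
qed

text \<open>States that (U, D, W) is \<open>s\<close> times (u, div u, \<partial>_b u) for some u in
  X, through the two weak identities alone. In this form all fields lie in unweighted L2 and the
  test side is fixed, so the relation is linear and survives L2 limits.\<close>

definition energy :: "((complex^3) fn) => (complex fn) => ((complex^3) fn) => bool" where
 "energy U D W \<longleftrightarrow> in_L2 U \<and> in_L2 D \<and> in_L2 W \<and>
  (\<forall>\<eta>::real^3 => real. test \<eta> -->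
   (LINT x. rdot (inverse (s x) *R grad \<eta> x) (U x)) + (LINT x. (inverse (s x) *R \<eta> x) *R D x) = 0) \<and>
  (\<forall>v. test v -->
   (LINT x. hdot (W x) (s x *R v x)) + (LINT x. hdot (U x) (T2 v x)) = 0)"

end

lemma bounded_linear_cscale: "bounded_linear (%u::complex^3. c *s u)"
 unfolding linear_conv_bounded_linear[symmetric]
 by standard (simp_all add: vec_eq_iff distrib_left)

lemma add_cancelling_pairs: "x + y = 0 ==> x' + y' = 0 ==> (x + x') + (y + y') = (0::complex)"
 by (simp add: add_eq_0_iff)

context stellar
begin

lemma energy_L2: "energy U D W ==> in_L2 U" "energy U D W ==> in_L2 D" "energy U D W ==> in_L2 W"
 unfolding energy_def by blast+

lemma energy_div:
 fixes \<eta> :: "real fn"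
 shows "energy U D W ==> test \<eta> ==>
  (LINT x. rdot (inverse (s x) *R grad \<eta> x) (U x)) + (LINT x. (inverse (s x) *R \<eta> x) *R D x) = 0"
 unfolding energy_def by blast

lemma energy_dir:
 "energy U D W ==> test v ==>
  (LINT x. hdot (W x) (s x *R v x)) + (LINT x. hdot (U x) (T2 v x)) = 0"
 unfolding energy_def by blast

lemma energyI:
 assumes "in_L2 U" "in_L2 D" "in_L2 W"
  and "!!\<eta>::real^3 => real. test \<eta> ==>
   (LINT x. rdot (inverse (s x) *R grad \<eta> x) (U x)) + (LINT x. (inverse (s x) *R \<eta> x) *R D x) = 0"
  and "!!v. test v ==>
   (LINT x. hdot (W x) (s x *R v x)) + (LINT x. hdot (U x) (T2 v x)) = 0"
 shows "energy U D W"
 unfolding energy_def using assms by blast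

lemma test_pairings:
 fixes \<eta> :: "real fn"
 assumes "test \<eta>"
 shows "in_L2 (%x. inverse (s x) *R grad \<eta> x)" "in_L2 (%x. inverse (s x) *R \<eta> x)"
 by (rule in_L2_inverse_s_test[OF test_grad[OF assms]], rule in_L2_inverse_s_test[OF assms])

lemma test_pairing_integrable:
 assumes "test \<eta>" "in_L2 U" "in_L2 D"
 shows "Lint (%x. rdot (inverse (s x) *R grad \<eta> x) (U x))"
  "Lint (%x. (inverse (s x) *R \<eta> x) *R D x)"
 by (rule L2_bilinear_integrable[OF bounded_bilinear_rdot assms(2) test_pairings(1)[OF assms(1)]],
   rule L2_bilinear_integrable[OF bounded_bilinear_scaleR test_pairings(2)[OF assms(1)] assms(3)])

lemma vector_pairing_integrable:
 assumes "test v" "in_L2 U" "in_L2 W"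
 shows "Lint (%x. hdot (W x) (s x *R v x))" "Lint (%x. hdot (U x) (T2 v x))"
 by (rule L2_bilinear_integrable[OF bounded_bilinear_hdot assms(3) in_L2_s[OF in_L2_test[OF assms(1)]]],
   rule L2_bilinear_integrable[OF bounded_bilinear_hdot assms(2) in_L2_T2[OF assms(1)]])

lemma energy_AE:
 assumes e: "energy U D W" and L: "in_L2 U'" "in_L2 D'" "in_L2 W'"
  and ae: "AE x. U x = U' x" "AE x. D x = D' x" "AE x. W x = W' x"
 shows "energy U' D' W'"
proof (rule energyI[OF L])
 fix \<eta> :: "real fn" assume \<eta>: "test \<eta>"
 have "(LINT x. rdot (inverse (s x) *R grad \<eta> x) (U x)) = (LINT x. rdot (inverse (s x) *R grad \<eta> x) (U' x))"
  by (rule lebesgue_integral_AE_eq) (rule eventually_mono[OF ae(1)], simp)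
 moreover have "(LINT x. (inverse (s x) *R \<eta> x) *R D x) = (LINT x. (inverse (s x) *R \<eta> x) *R D' x)"
  by (rule lebesgue_integral_AE_eq) (rule eventually_mono[OF ae(2)], simp)
 ultimately show "(LINT x. rdot (inverse (s x) *R grad \<eta> x) (U' x)) + (LINT x. (inverse (s x) *R \<eta> x) *R D' x) = 0"
  using energy_div[OF e \<eta>] by (simp only:)
next
 fix v :: "(complex^3) fn" assume v: "test v"
 have "(LINT x. hdot (W x) (s x *R v x)) = (LINT x. hdot (W' x) (s x *R v x))"
  by (rule lebesgue_integral_AE_eq) (rule eventually_mono[OF ae(3)], simp)
 moreover have "(LINT x. hdot (U x) (T2 v x)) = (LINT x. hdot (U' x) (T2 v x))"
  by (rule lebesgue_integral_AE_eq) (rule eventually_mono[OF ae(1)], simp)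
 ultimately show "(LINT x. hdot (W' x) (s x *R v x)) + (LINT x. hdot (U' x) (T2 v x)) = 0"
  using energy_dir[OF e v] by (simp only:)
qed

lemma energy_add:
 assumes e: "energy U D W" "energy U' D' W'"
 shows "energy (%x. U x + U' x) (%x. D x + D' x) (%x. W x + W' x)"
proof (rule energyI)
 show "in_L2 (%x. U x + U' x)" "in_L2 (%x. D x + D' x)" "in_L2 (%x. W x + W' x)"
  by (intro in_L2_add energy_L2[OF e(1)] energy_L2[OF e(2)])+
 fix \<eta> :: "real fn" assume \<eta>: "test \<eta>"
 note i = test_pairing_integrable[OF \<eta> energy_L2(1,2)[OF e(1)]] test_pairing_integrable[OF \<eta> energy_L2(1,2)[OF e(2)]]
 show "(LINT x. rdot (inverse (s x) *R grad \<eta> x) (U x + U' x)) + (LINT x. (inverse (s x) *R \<eta> x) *R (D x + D' x)) = 0"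
  unfolding rdot_linear(1) scaleR_right_distrib[of "inverse (s _) *R \<eta> _"] Bochner_Integration.integral_add[OF i(1,3)] Bochner_Integration.integral_add[OF i(2,4)]
  by (rule add_cancelling_pairs[OF energy_div[OF e(1) \<eta>] energy_div[OF e(2) \<eta>]])
next
 fix v :: "(complex^3) fn" assume v: "test v"
 note i = vector_pairing_integrable[OF v energy_L2(1,3)[OF e(1)]] vector_pairing_integrable[OF v energy_L2(1,3)[OF e(2)]]
 show "(LINT x. hdot (W x + W' x) (s x *R v x)) + (LINT x. hdot (U x + U' x) (T2 v x)) = 0"
  unfolding hdot_add_left Bochner_Integration.integral_add[OF i(1,3)] Bochner_Integration.integral_add[OF i(2,4)]
  by (rule add_cancelling_pairs[OF energy_dir[OF e(1) v] energy_dir[OF e(2) v]])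
qed

lemma energy_cscale:
 assumes e: "energy U D W"
 shows "energy (%x. z *s U x) (%x. z * D x) (%x. z *s W x)"
proof (rule energyI)
 show "in_L2 (%x. z *s U x)" "in_L2 (%x. z * D x)" "in_L2 (%x. z *s W x)"
  by (rule in_L2_linear[OF bounded_linear_cscale energy_L2(1)[OF e]], rule in_L2_linear[OF bounded_linear_mult_right energy_L2(2)[OF e]],
    rule in_L2_linear[OF bounded_linear_cscale energy_L2(3)[OF e]])
 fix \<eta> :: "real fn" assume \<eta>: "test \<eta>"
 have "(LINT x. rdot (inverse (s x) *R grad \<eta> x) (z *s U x)) + (LINT x. (inverse (s x) *R \<eta> x) *R (z * D x))
  = z * ((LINT x. rdot (inverse (s x) *R grad \<eta> x) (U x)) + (LINT x. (inverse (s x) *R \<eta> x) *R D x))"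
  unfolding rdot_linear(2) mult_scaleR_right[symmetric] distrib_left integral_mult_right_zero by (rule refl)
 thus "(LINT x. rdot (inverse (s x) *R grad \<eta> x) (z *s U x)) + (LINT x. (inverse (s x) *R \<eta> x) *R (z * D x)) = 0"
  unfolding energy_div[OF e \<eta>] by simp
next
 fix v :: "(complex^3) fn" assume v: "test v"
 have "(LINT x. hdot (z *s W x) (s x *R v x)) + (LINT x. hdot (z *s U x) (T2 v x))
  = z * ((LINT x. hdot (W x) (s x *R v x)) + (LINT x. hdot (U x) (T2 v x)))"
  unfolding hdot_cscale_left distrib_left integral_mult_right_zero by (rule refl)
 thus "(LINT x. hdot (z *s W x) (s x *R v x)) + (LINT x. hdot (z *s U x) (T2 v x)) = 0"
  unfolding energy_dir[OF e v] by simp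
qed

lemma energy_zero: "energy (%x. 0) (%x. 0) (%x. 0)"
 by (rule energyI) (simp_all add: in_L2_zero hdot_zero rdot_def)

lemma energy_limit:
 assumes e: "!!n. energy (U n) (D n) (W n)" and L: "in_L2 U'" "in_L2 D'" "in_L2 W'"
  and lim: "(%n. abs_l2 (U n)) ----> abs_l2 U'" "(%n. abs_l2 (D n)) ----> abs_l2 D'" "(%n. abs_l2 (W n)) ----> abs_l2 W'"
 shows "energy U' D' W'"
proof (rule energyI[OF L])
 fix \<eta> :: "real fn" assume \<eta>: "test \<eta>"
 have "(%n. (LINT x. rdot (inverse (s x) *R grad \<eta> x) (U n x)) + (LINT x. (inverse (s x) *R \<eta> x) *R D n x))
  ----> (LINT x. rdot (inverse (s x) *R grad \<eta> x) (U' x)) + (LINT x. (inverse (s x) *R \<eta> x) *R D' x)"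
  by (rule tendsto_add[OF L2_bilinear_tendsto[OF bounded_bilinear_rdot energy_L2(1)[OF e] L(1) lim(1) test_pairings(1)[OF \<eta>]]
     L2_bilinear_tendsto[OF bounded_bilinear.flip[OF bounded_bilinear_scaleR] energy_L2(2)[OF e] L(2) lim(2) test_pairings(2)[OF \<eta>]]])
 thus "(LINT x. rdot (inverse (s x) *R grad \<eta> x) (U' x)) + (LINT x. (inverse (s x) *R \<eta> x) *R D' x) = 0"
  unfolding energy_div[OF e \<eta>] by (rule LIMSEQ_unique) (rule tendsto_const)
next
 fix v :: "(complex^3) fn" assume v: "test v"
 have "(%n. (LINT x. hdot (W n x) (s x *R v x)) + (LINT x. hdot (U n x) (T2 v x)))
  ----> (LINT x. hdot (W' x) (s x *R v x)) + (LINT x. hdot (U' x) (T2 v x))"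
  by (rule tendsto_add[OF L2_bilinear_tendsto[OF bounded_bilinear_hdot energy_L2(3)[OF e] L(3) lim(3) in_L2_s[OF in_L2_test[OF v]]]
     L2_bilinear_tendsto[OF bounded_bilinear_hdot energy_L2(1)[OF e] L(1) lim(1) in_L2_T2[OF v]]])
 thus "(LINT x. hdot (W' x) (s x *R v x)) + (LINT x. hdot (U' x) (T2 v x)) = 0"
  unfolding energy_dir[OF e v] by (rule LIMSEQ_unique) (rule tendsto_const)
qed

lemma hdot_axis: "hdot u (r *R (\<eta> *R axis k 1)) = (r * \<eta>) *R (u $ k)"
 unfolding hdot_scaleR_right by (simp add: hdot_def axis_def if_distrib cong: if_cong)

lemma scalar_test_vec: "test_function D \<eta> ==> test_function D (%x. (\<eta> x :: real) *R (a :: complex^3))"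
 by (rule test_linear[OF bounded_linear_scaleR_left])

lemma loc_integrable_weighted:
 fixes W :: "('a::euclidean_space) fn"
 assumes "in_L2 W" shows "loc_integrable A (%x. s x *R W x)"
 by (rule L2_loc_integrable[OF in_L2_s[OF assms]])

text \<open>Locality: a test field supported in \<open>A\<close> pairs to zero with the
  \<open>T2\<close> side, either because \<open>U\<close> vanishes or because both coefficients do.
  It yields the support property of \<open>W\<close> as well as its uniqueness.\<close>

lemma energy_zero_dir:
 assumes e: "energy U D W" and A: "open A"
  and z: "AE x. x \<in> A --> U x = 0 \<or> b x = 0 \<and> dv x = 0"
 shows "AE x. x \<in> A --> W x = 0"
proof -
 have k: "AE x. x \<in> A --> (s x *R W x) = 0"
 proof -
  have "AE x. x \<in> A --> (s x *R W x) $ k = 0" for k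
  proof (rule fundamental_lemma[OF A])
   show "loc_integrable A (%x. (s x *R W x) $ k)"
    by (rule loc_integrable_linear[OF bounded_linear_vec_nth loc_integrable_weighted[OF energy_L2(3)[OF e]]])
   fix \<eta> :: "real fn" assume \<eta>: "test_function A \<eta>"
   let ?v = "%x. \<eta> x *R (axis k 1 :: complex^3)"
   have v: "test_function A ?v" by (rule scalar_test_vec[OF \<eta>])
   have v': "test ?v" by (rule test_mono[OF v]) simp
   have "(LINT x. hdot (U x) (T2 ?v x)) = (LINT x::real^3. 0)"
   proof (rule lebesgue_integral_AE_eq, use z in eventually_elim)
    case (elim x)
    show ?case
    proof (cases "x \<in> A")
     case True
     thus ?thesis using elim by (auto simp: hdot_zero T2_def)
    next
     case False
     have "?v x = 0" "pd l ?v x = 0" for l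
      using test_zero_outside[OF v False] test_zero_outside[OF test_pderiv[OF v] False] by blast+
     hence "T2 ?v x = 0" unfolding T2_def by simp
     thus ?thesis by (simp add: hdot_zero)
    qed
   qed
   hence "(LINT x. hdot (W x) (s x *R ?v x)) = 0" using energy_dir[OF e v'] by simp
   thus "(LINT x. \<eta> x *R (s x *R W x) $ k) = 0"
    unfolding hdot_axis by (simp add: mult.commute)
  qed
  hence "AE x. \<forall>k\<in>UNIV. x \<in> A --> (s x *R W x) $ k = 0" by (intro AE_finite_allI) auto
  thus ?thesis by eventually_elim (simp add: vec_eq_iff)
 qed
 show ?thesis using k s_pos by eventually_elim auto
qed

lemma loc_integrable_inverse_s:
 fixes D :: "('a::euclidean_space) fn"
 assumes D: "in_L2 D" shows "L1loc (%x. inverse (s x) *R D x)"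
proof (rule L2_loc_loc_integrable, rule in_L2_locI)
   show "(%x. inverse (s x) *R D x) \<in> LM" using in_L2_measurable[OF D] by measurable
   fix r
   obtain S where S: "S > 0" "AE x. x \<in> ball 0 r --> inverse (s x) <= S \<and> 0 < s x" by (rule s_lower)
   show "in_L2 (%x. indB r x *R inverse (s x) *R D x)"
   proof (rule in_L2_bound[OF D, where C=S])
    have [measurable]: "D \<in> LM" by (rule in_L2_measurable[OF D])
    have [measurable]: "ball (0::real^3) r \<in> sets lebesgue" by simp
    show "(%x. indB r x *R inverse (s x) *R D x) \<in> LM" by measurable
    show "AE x. norm (indicat_real (ball 0 r) x *R inverse (s x) *R D x) <= S * norm (D x)"
     using S(2) by eventually_elim (use S(1) in \<open>auto simp: indicator_def intro!: mult_right_mono\<close>)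
   qed
  qed

lemma energy_zero_div:
 assumes e: "energy U D W" and z: "AE x. U x = 0"
 shows "AE x. D x = 0"
proof -
 have "AE x. x \<in> UNIV --> inverse (s x) *R D x = 0"
 proof (rule fundamental_lemma[OF open_UNIV])
  show "L1loc (%x. inverse (s x) *R D x)"
   by (rule loc_integrable_inverse_s[OF energy_L2(2)[OF e]])
  fix \<eta> :: "real fn" assume \<eta>: "test \<eta>"
  have "(LINT x. rdot (inverse (s x) *R grad \<eta> x) (U x)) = (LINT x::real^3. 0)"
   by (rule lebesgue_integral_AE_eq, rule eventually_mono[OF z]) (simp add: rdot_def)
  thus "(LINT x. \<eta> x *R inverse (s x) *R D x) = 0"
   using energy_div[OF e \<eta>] by (simp add: mult.commute)
 qed
 thus ?thesis using s_pos by eventually_elim auto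
qed

lemma energy_unique:
 assumes e: "energy U D W" "energy U' D' W'" and U: "AE x. U x = U' x"
 shows "AE x. D x = D' x" "AE x. W x = W' x"
proof -
 have "energy (%x. U x + (-1) *s U' x) (%x. D x + (-1) * D' x) (%x. W x + (-1) *s W' x)"
  by (rule energy_add[OF e(1) energy_cscale[OF e(2)]])
 hence d: "energy (%x. U x - U' x) (%x. D x - D' x) (%x. W x - W' x)" by (simp add: vector_sneg_minus1[symmetric])
 have z: "AE x. U x - U' x = 0" using U by eventually_elim simp
 show "AE x. D x = D' x" using energy_zero_div[OF d z] by eventually_elim simp
 have "AE x. x \<in> UNIV --> W x - W' x = 0"
  by (rule energy_zero_dir[OF d open_UNIV], rule eventually_mono[OF z]) blast
 thus "AE x. W x = W' x" by eventually_elim simp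
qed

lemma energy_support:
 assumes "energy U D W" shows "AE x. x \<notin> cball 0 r1 --> W x = 0"
proof -
 have "AE x. x \<in> - cball 0 r1 --> W x = 0"
  by (rule energy_zero_dir[OF assms]) (use b_support dv_support in \<open>auto elim: eventually_elim2 simp: open_Compl\<close>)
 thus ?thesis by simp
qed

end

section \<open>Cut-offs, smooth fields and the correspondence with the space X\<close>

lemma integral_add_cong:
 fixes A :: "('b::euclidean_space) fn"
 assumes i: "Lint A" "Lint B" "Lint A'" "Lint B'"
  and eq: "AE x. A x + B x = A' x + B' x"
 shows "(LINT x. A x) + (LINT x. B x) = (LINT x. A' x) + (LINT x. B' x)"
 unfolding Bochner_Integration.integral_add[OF i(1,2), symmetric] Bochner_Integration.integral_add[OF i(3,4), symmetric]
 by (rule lebesgue_integral_AE_eq[OF eq])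

text \<open>The divergence relation is defined with real test functions; applying it to real and
  imaginary parts gives it for complex ones.\<close>

lemma has_weak_div_complex:
 fixes \<zeta> :: "complex fn"
 assumes f: "has_weak_div f (g :: real fn)" and \<zeta>: "test \<zeta>"
 shows "Lint (%x. \<Sum>i. (f x $ i) *R pd i \<zeta> x)" "Lint (%x. g x *R \<zeta> x)"
  "(LINT x. (\<Sum>i. (f x $ i) *R pd i \<zeta> x)) + (LINT x. g x *R \<zeta> x) = 0"
proof -
 have lf: "L1loc f" "L1loc g" using f unfolding has_weak_div_def by blast+
 have bb: "bounded_bilinear (%z (r::real). r *R (z::complex))"
  using bounded_bilinear.flip[OF bounded_bilinear_scaleR] .
 show 1: "Lint (%x. \<Sum>i. (f x $ i) *R pd i \<zeta> x)"
  by (rule Bochner_Integration.integrable_sum,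
    rule integrable_test[OF bb test_pderiv[OF \<zeta>] loc_integrable_linear[OF bounded_linear_vec_nth lf(1)]])
 show 2: "Lint (%x. g x *R \<zeta> x)" by (rule integrable_test[OF bb \<zeta> lf(2)])
 have part: "L ((LINT x. (\<Sum>i. (f x $ i) *R pd i \<zeta> x)) + (LINT x. g x *R \<zeta> x)) = 0"
  if L: "bounded_linear L" for L :: "complex => real"
 proof -
  interpret L: bounded_linear L by (rule L)
  have "L (\<Sum>i. (f x $ i) *R pd i \<zeta> x) = (\<Sum>i. pd i (%x. L (\<zeta> x)) x *R (f x $ i))" for x
   unfolding L.sum L.scaleR pderiv_at_linear[OF L test_diff[OF \<zeta>]] by (simp add: mult.commute)
  thus ?thesis
   unfolding L.add integral_bounded_linear[OF L 1, symmetric] integral_bounded_linear[OF L 2, symmetric]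
   using has_weak_divD[OF f test_linear[OF L \<zeta>]] by (simp add: L.scaleR mult.commute)
 qed
 show "(LINT x. (\<Sum>i. (f x $ i) *R pd i \<zeta> x)) + (LINT x. g x *R \<zeta> x) = 0"
  by (rule complex_eqI) (simp_all only: part[OF bounded_linear_Re] part[OF bounded_linear_Im] zero_complex.sel)
qed

lemma in_L2_bounded_mult:
 fixes f :: "('a::euclidean_space) fn"
 assumes f: "in_L2 f" and m: "m \<in> LM" and B: "AE x. \<bar>m x\<bar> <= B"
 shows "in_L2 (%x. m x *R f x)"
proof (rule in_L2_bound[OF f, where C=B])
 have [measurable]: "f \<in> LM" by (rule in_L2_measurable[OF f])
 show "(%x. m x *R f x) \<in> LM" using m by measurable
 show "AE x. norm (m x *R f x) <= B * norm (f x)" using B by eventually_elim (auto intro: mult_right_mono)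
qed

lemma in_L2_test_mult:
 fixes f :: "('a::euclidean_space) fn" and M :: "real fn"
 assumes M: "test_function A M" and f: "in_L2 f"
 shows "in_L2 (%x. M x *R f x)"
proof -
 obtain B where "B > 0" "!!x. norm (M x) <= B" by (rule test_bounded[OF M]) blast
 thus ?thesis by (intro in_L2_bounded_mult[OF f test_borel[OF M], where B=B]) simp
qed

lemma rdot_grad: "rdot (grad \<eta> x) u = (\<Sum>i. pd i \<eta> x *R (u $ i))"
 using rdot_grad_scaleR[of 1] by simp

lemma rdot_inverse: "r \<noteq> 0 ==> rdot (inverse r *R t) (r *R u) = rdot t u"
 by (simp add: bounded_bilinear.scaleR_left[OF bounded_bilinear_rdot] bounded_bilinear.scaleR_right[OF bounded_bilinear_rdot])

lemma in_L2_rdot_grad: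
 assumes M: "test_function A M" and U: "in_L2 U"
 shows "in_L2 (%x. rdot (grad M x) (U x))"
 unfolding rdot_grad sum_3
 by (intro in_L2_add in_L2_test_mult[OF test_pderiv[OF M]] in_L2_linear[OF bounded_linear_vec_nth U])

context stellar
begin

text \<open>The weak product rule: testing with M times the test function and moving the derivative
  of \<open>M\<close> to the other side. The extra terms contain \<open>U\<close>
  undifferentiated.\<close>

lemma energy_mult:
 fixes M :: "real fn"
 assumes e: "energy U D W" and M: "test M"
 shows "energy (%x. M x *R U x) (%x. M x *R D x + rdot (grad M x) (U x))
   (%x. M x *R W x + (\<Sum>l. (b x $ l) *R (pd l M x *R U x)))"
proof -
 note L = energy_L2[OF e]
 have L': "in_L2 (%x. M x *R U x)" "in_L2 (%x. M x *R D x + rdot (grad M x) (U x))"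
  "in_L2 (%x. M x *R W x + (\<Sum>l. (b x $ l) *R (pd l M x *R U x)))"
  by (intro in_L2_add in_L2_test_mult[OF M] in_L2_b in_L2_test_mult[OF test_pderiv[OF M]] in_L2_rdot_grad[OF M] L)+
 show ?thesis
 proof (rule energyI[OF L'])
  fix \<eta> :: "real fn" assume \<eta>: "test \<eta>"
  have M\<eta>: "test (%x. M x * \<eta> x)" by (rule test_mult_left[OF M test_smooth[OF \<eta>]])
  have eq: "rdot (inverse (s x) *R grad \<eta> x) (M x *R U x) + (inverse (s x) *R \<eta> x) *R (M x *R D x + rdot (grad M x) (U x))
   = rdot (inverse (s x) *R grad (%x. M x * \<eta> x) x) (U x) + (inverse (s x) *R (M x * \<eta> x)) *R D x" for x
  proof -
   interpret bounded_bilinear "%u v. rdot v u" by (rule bounded_bilinear_rdot)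
   show ?thesis
    unfolding grad_mult[OF test_smooth[OF M] test_smooth[OF \<eta>]] scaleR_left scaleR_right add_right
    by (simp add: scaleR_add_right mult_ac)
  qed
  show "(LINT x. rdot (inverse (s x) *R grad \<eta> x) (M x *R U x)) + (LINT x. (inverse (s x) *R \<eta> x) *R (M x *R D x + rdot (grad M x) (U x))) = 0"
   using integral_add_cong[OF test_pairing_integrable[OF \<eta> L'(1,2)] test_pairing_integrable[OF M\<eta> L(1,2)] always_eventually[rule_format, OF eq]]
    energy_div[OF e M\<eta>] by simp
 next
  fix v :: "(complex^3) fn" assume v: "test v"
  have Mv: "test (%x. M x *R v x)" by (rule test_scaleR_left[OF M test_smooth[OF v]])
  have eq: "hdot (M x *R W x + (\<Sum>l. (b x $ l) *R (pd l M x *R U x))) (s x *R v x) + hdot (M x *R U x) (T2 v x)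
   = hdot (W x) (s x *R (M x *R v x)) + hdot (U x) (T2 (%x. M x *R v x) x)" for x
   unfolding T2_def pderiv_at_scaleR[OF test_diff[OF M] test_diff[OF v]] sum_3
    hdot_add_left hdot_add_right hdot_scaleR_left hdot_scaleR_right scaleR_add_right
   by (simp add: algebra_simps)
  show "(LINT x. hdot (M x *R W x + (\<Sum>l. (b x $ l) *R (pd l M x *R U x))) (s x *R v x)) + (LINT x. hdot (M x *R U x) (T2 v x)) = 0"
   using integral_add_cong[OF vector_pairing_integrable[OF v L'(1,3)] vector_pairing_integrable[OF Mv L(1,3)] always_eventually[rule_format, OF eq]]
    energy_dir[OF e Mv] by simp
 qed
qed

text \<open>For smooth fields the first identity is the vanishing integral of a divergence, and the
  second is the defining relation of div(\<rho> b), tested with the scalar function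
  \<open>hdot v w\<close>.\<close>

lemma energy_test:
 assumes v: "test v"
 shows "energy (%x. s x *R v x) (%x. s x *R (\<Sum>i. pd i v x $ i)) (%x. s x *R (\<Sum>l. (b x $ l) *R pd l v x))"
proof -
 have L: "in_L2 (%x. s x *R v x)" "in_L2 (%x. s x *R (\<Sum>i. pd i v x $ i))"
  "in_L2 (%x. s x *R (\<Sum>l. (b x $ l) *R pd l v x))"
  unfolding sum_3[of "%i. pd i v _ $ i"]
  by (intro in_L2_s in_L2_b in_L2_add in_L2_linear[OF bounded_linear_vec_nth] in_L2_test[OF v] in_L2_test[OF test_pderiv[OF v]])+
 show ?thesis
 proof (rule energyI[OF L])
  fix \<eta> :: "real fn" assume \<eta>: "test \<eta>"
  note i = test_pairing_integrable[OF \<eta> L(1,2)]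
  have t: "test (%x. \<eta> x *R v x)" by (rule test_scaleR_left[OF \<eta> test_smooth[OF v]])
  have "(LINT x. rdot (inverse (s x) *R grad \<eta> x) (s x *R v x) + (inverse (s x) *R \<eta> x) *R (s x *R (\<Sum>i. pd i v x $ i)))
   = (LINT x. (\<Sum>i. pd i (%x. (\<eta> x *R v x) $ i) x))"
  proof (rule lebesgue_integral_AE_eq, use s_pos in eventually_elim)
   case (elim x)
   have d: "pd i (%x. (\<eta> x *R v x) $ i) x = \<eta> x *R (pd i v x $ i) + pd i \<eta> x *R (v x $ i)" for i
    unfolding pderiv_at_linear[OF bounded_linear_vec_nth test_diff[OF t]] pderiv_at_scaleR[OF test_diff[OF \<eta>] test_diff[OF v]] by simp
   have "rdot (inverse (s x) *R grad \<eta> x) (s x *R v x) = (\<Sum>i. pd i \<eta> x *R (v x $ i))"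
    unfolding rdot_grad[symmetric] by (rule rdot_inverse) (use elim in simp)
   moreover have "(inverse (s x) *R \<eta> x) *R (s x *R (\<Sum>i. pd i v x $ i)) = (\<Sum>i. \<eta> x *R (pd i v x $ i))"
    using elim by (simp add: scaleR_sum_right[symmetric])
   ultimately show ?case unfolding d sum.distrib by simp
  qed
  also have "... = (\<Sum>i. LINT x. pd i (%x. (\<eta> x *R v x) $ i) x)"
   by (rule Bochner_Integration.integral_sum, rule test_integrable[OF test_pderiv[OF test_linear[OF bounded_linear_vec_nth t]]])
  also have "... = 0" by (rule sum.neutral) (simp only: integral_pderiv_zero[OF test_linear[OF bounded_linear_vec_nth t]] ball_simps simp_thms)
  finally show "(LINT x. rdot (inverse (s x) *R grad \<eta> x) (s x *R v x)) + (LINT x. (inverse (s x) *R \<eta> x) *R (s x *R (\<Sum>i. pd i v x $ i))) = 0"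
   unfolding Bochner_Integration.integral_add[OF i] .
 next
  fix w :: "(complex^3) fn" assume w: "test w"
  have t: "test (%x. hdot (v x) (w x))"
   by (rule bounded_bilinear.test_bilinear_left[OF bounded_bilinear_hdot v test_smooth[OF w]])
  note z = has_weak_div_complex[OF dv(1) t]
  have "AE x. hdot (s x *R (\<Sum>l. (b x $ l) *R pd l v x)) (s x *R w x) + hdot (s x *R v x) (T2 w x)
   = (\<Sum>i. ((\<rho> x *R b x) $ i) *R pd i (%x. hdot (v x) (w x)) x) + dv x *R hdot (v x) (w x)"
   using s_pos
  proof eventually_elim
   case (elim x)
   hence "\<rho> x = s x * s x" "s x \<noteq> 0" by (simp_all add: power2_eq_square)
   thus ?case
    unfolding T2_def bounded_bilinear.pderiv_at_bilinear[OF bounded_bilinear_hdot test_diff[OF v] test_diff[OF w]] sum_3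
     hdot_add_left hdot_add_right hdot_scaleR_left hdot_scaleR_right scaleR_add_right vector_scaleR_component
    by (simp add: algebra_simps)
  qed
  from integral_add_cong[OF vector_pairing_integrable[OF w L(1,3)] z(1,2) this]
  show "(LINT x. hdot (s x *R (\<Sum>l. (b x $ l) *R pd l v x)) (s x *R w x)) + (LINT x. hdot (s x *R v x) (T2 w x)) = 0"
   unfolding z(3) .
 qed
qed

lemma in_L2w_iff:
 fixes f :: "('a::euclidean_space) fn"
 assumes "f \<in> LM"
 shows "in_L2w \<rho> f \<longleftrightarrow> in_L2 (%x. s x *R f x)"
proof -
 have [measurable]: "f \<in> LM" by (rule assms)
 have "Lint (%x. \<rho> x * (norm (f x))^2) \<longleftrightarrow> Lint (%x. 1 * (norm (s x *R f x))^2)"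
 proof (rule integrable_cong_AE)
  show "AE x. \<rho> x * (norm (f x))^2 = 1 * (norm (s x *R f x))^2"
   using s_pos by eventually_elim (simp add: power_mult_distrib)
 qed measurable
 thus ?thesis unfolding in_L2w_def by simp
qed

lemma in_L2w_s:
 fixes f :: "('a::euclidean_space) fn"
 assumes "in_L2w \<rho> f" shows "in_L2 (%x. s x *R f x)"
proof -
 have "f \<in> LM" using assms unfolding in_L2w_def by blast
 from in_L2w_iff[OF this] assms show ?thesis by blast
qed

lemma div_pairing:
 fixes \<eta> :: "real fn" and u :: "(complex^3) fn"
 assumes "AE x. U x = s x *R u x" "AE x. D x = s x *R d x"
 shows "(LINT x. rdot (inverse (s x) *R grad \<eta> x) (U x)) = (LINT x. (\<Sum>i. pd i \<eta> x *R (u x $ i)))"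
  "(LINT x. (inverse (s x) *R \<eta> x) *R (D x :: complex)) = (LINT x. \<eta> x *R d x)"
proof -
 show "(LINT x. rdot (inverse (s x) *R grad \<eta> x) (U x)) = (LINT x. (\<Sum>i. pd i \<eta> x *R (u x $ i)))"
  by (rule lebesgue_integral_AE_eq, use s_pos assms(1) in eventually_elim) (simp add: rdot_inverse flip: rdot_grad)
 show "(LINT x. (inverse (s x) *R \<eta> x) *R D x) = (LINT x. \<eta> x *R d x)"
  by (rule lebesgue_integral_AE_eq, use s_pos assms(2) in eventually_elim) simp
qed

lemma dir_pairing:
 fixes u w v :: "(complex^3) fn"
 assumes v: "test v" and U: "in_L2 U"
  and ae: "AE x. U x = s x *R u x" "AE x. W x = s x *R w x"
 shows "(LINT x. hdot (W x) (s x *R v x)) = (LINT x. \<rho> x *R hdot (w x) (v x))"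
  "(LINT x. hdot (U x) (T2 v x)) = (LINT x. \<rho> x *R hdot (u x) (\<Sum>l. (b x $ l) *R pd l v x))
    + (LINT x. dv x *R hdot (u x) (v x))"
proof -
 show "(LINT x. hdot (W x) (s x *R v x)) = (LINT x. \<rho> x *R hdot (w x) (v x))"
  by (rule lebesgue_integral_AE_eq, use s_pos ae(2) in eventually_elim)
   (simp add: hdot_scaleR_left hdot_scaleR_right power2_eq_square)
 have i: "Lint (%x. hdot (U x) (s x *R (\<Sum>l. (b x $ l) *R pd l v x)))"
  "Lint (%x. hdot (U x) (inverse (s x) *R (dv x *R v x)))"
 proof -
  show "Lint (%x. hdot (U x) (s x *R (\<Sum>l. (b x $ l) *R pd l v x)))"
   by (rule L2_bilinear_integrable[OF bounded_bilinear_hdot U in_L2_s[OF in_L2_b[OF in_L2_test[OF test_pderiv[OF v]]]]])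
  show "Lint (%x. hdot (U x) (inverse (s x) *R (dv x *R v x)))"
  proof (rule L2_bilinear_integrable[OF bounded_bilinear_hdot U], rule in_L2_inverse_s_bound[OF v dv(2)])
   show "(%x. dv x *R v x) \<in> LM" using test_borel[OF v] by measurable
  qed simp
 qed
 have 1: "(LINT x. hdot (U x) (s x *R (\<Sum>l. (b x $ l) *R pd l v x))) = (LINT x. \<rho> x *R hdot (u x) (\<Sum>l. (b x $ l) *R pd l v x))"
  by (rule lebesgue_integral_AE_eq, use s_pos ae(1) in eventually_elim)
   (simp add: hdot_scaleR_left hdot_scaleR_right power2_eq_square)
 have 2: "(LINT x. hdot (U x) (inverse (s x) *R (dv x *R v x))) = (LINT x. dv x *R hdot (u x) (v x))"
  by (rule lebesgue_integral_AE_eq, use s_pos ae(1) in eventually_elim) (simp add: hdot_scaleR_left hdot_scaleR_right)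
 show "(LINT x. hdot (U x) (T2 v x)) = (LINT x. \<rho> x *R hdot (u x) (\<Sum>l. (b x $ l) *R pd l v x))
    + (LINT x. dv x *R hdot (u x) (v x))"
  unfolding T2_def hdot_add_right Bochner_Integration.integral_add[OF i] 1 2 ..
qed

lemma energy_of_X:
 assumes L: "in_L2w \<rho> u" "in_L2w \<rho> d" "in_L2w \<rho> w" and div: "has_weak_div u d" and dir: "has_weak_dirderiv \<rho> b u w"
 shows "energy (%x. s x *R u x) (%x. s x *R d x) (%x. s x *R w x)"
proof -
 have L': "in_L2 (%x. s x *R u x)" "in_L2 (%x. s x *R d x)" "in_L2 (%x. s x *R w x)"
  by (rule in_L2w_s[OF L(1)], rule in_L2w_s[OF L(2)], rule in_L2w_s[OF L(3)])
 show ?thesis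
 proof (rule energyI[OF L'])
  fix \<eta> :: "real fn" assume \<eta>: "test \<eta>"
  show "(LINT x. rdot (inverse (s x) *R grad \<eta> x) (s x *R u x)) + (LINT x. (inverse (s x) *R \<eta> x) *R (s x *R d x)) = 0"
   unfolding div_pairing[OF AE_I2[OF refl] AE_I2[OF refl]] has_weak_divD[OF div \<eta>] by simp
 next
  fix v :: "(complex^3) fn" assume v: "test v"
  have "(LINT x. \<rho> x *R hdot (w x) (v x))
     = - (LINT x. \<rho> x *R hdot (u x) (\<Sum>l. (b x $ l) *R pd l v x))
      - (LINT x. dv x *R hdot (u x) (v x))"
   using dir v unfolding has_weak_dirderiv_def dv_def by blast
  thus "(LINT x. hdot (s x *R w x) (s x *R v x)) + (LINT x. hdot (s x *R u x) (T2 v x)) = 0"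
   unfolding dir_pairing[OF v L'(1) AE_I2[OF refl] AE_I2[OF refl]] by simp
 qed
qed

lemma inverse_s:
 assumes "in_L2 U" "AE x. U x = s x *R u x"
 shows "in_L2w \<rho> u" "L1loc u"
proof -
 have ae: "AE x. inverse (s x) *R U x = u x" using s_pos assms(2) by eventually_elim simp
 have m: "u \<in> LM"
 proof (rule borel_measurable_AE[OF _ ae])
  have [measurable]: "U \<in> LM" by (rule in_L2_measurable[OF assms(1)])
  show "(%x. inverse (s x) *R U x) \<in> LM" by measurable
 qed
 show "L1loc u" by (rule loc_integrable_AE[OF loc_integrable_inverse_s[OF assms(1)] ae m])
 have "in_L2 (%x. s x *R u x)"
 proof (rule in_L2_AE_cong[OF assms(1)])
  show "(%x. s x *R u x) \<in> LM" using m by measurable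
  show "AE x. s x *R u x = U x" using assms(2) by eventually_elim simp
 qed
 thus "in_L2w \<rho> u" using in_L2w_iff[OF m] by blast
qed

text \<open>The fields need to be \<open>s\<close> times the functions only almost everywhere, so
  they may come from L2 limits or from chosen representatives.\<close>

lemma X_of_energy:
 assumes e: "energy U D W" and ae: "AE x. U x = s x *R u x" "AE x. D x = s x *R d x" "AE x. W x = s x *R w x"
 shows "in_L2w \<rho> u" "in_L2w \<rho> d" "in_L2w \<rho> w" "has_weak_div u d" "has_weak_dirderiv \<rho> b u w"
proof -
 note iu = inverse_s[OF energy_L2(1)[OF e] ae(1)] and id = inverse_s[OF energy_L2(2)[OF e] ae(2)] and iw = inverse_s[OF energy_L2(3)[OF e] ae(3)]
 show "in_L2w \<rho> u" "in_L2w \<rho> d" "in_L2w \<rho> w" by (rule iu id iw)+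
 show "has_weak_div u d"
  unfolding has_weak_div_def
 proof (intro conjI allI impI iu(2) id(2))
  fix \<eta> :: "real fn" assume \<eta>: "test \<eta>"
  show "(LINT x. (\<Sum>i. pd i \<eta> x *R (u x $ i))) = - (LINT x. \<eta> x *R d x)"
   using energy_div[OF e \<eta>] unfolding div_pairing[OF ae(1,2)] by (simp only: add_eq_0_iff2)
 qed
 show "has_weak_dirderiv \<rho> b u w"
  unfolding has_weak_dirderiv_def
 proof (intro conjI allI impI iu(2) iw(2))
  fix v :: "(complex^3) fn" assume v: "test v"
  show "(LINT x. \<rho> x *R hdot (w x) (v x))
     = - (LINT x. \<rho> x *R hdot (u x) (\<Sum>l. (b x $ l) *R pd l v x))
      - (LINT x. weak_div (%y. \<rho> y *R b y) x *R hdot (u x) (v x))"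
   using energy_dir[OF e v] unfolding dir_pairing[OF v energy_L2(1)[OF e] ae(1,3)] dv_def[symmetric]
   by (simp only: add_eq_0_iff2) simp
 qed
qed

end

section \<open>Quadruples of fields and gradients of potentials\<close>

lemma in_L2_AE: "in_L2 f ==> AE x. f x = g x ==> in_L2 (g :: ('a::euclidean_space) fn)"
proof -
 assume f: "in_L2 f" and ae: "AE x. f x = g x"
 have ae': "AE x. g x = f x" using ae by eventually_elim simp
 show "in_L2 g" by (rule in_L2_AE_cong[OF f borel_measurable_AE[OF in_L2_measurable[OF f] ae] ae'])
qed

lemma integrable_AE_eq:
 fixes f g :: "('b::euclidean_space) fn"
 assumes "Lint f" "AE x. f x = g x"
 shows "Lint g"
 by (rule integrable_cong_AE_imp[OF assms(1) borel_measurable_AE[OF borel_measurable_integrable[OF assms(1)] assms(2)]])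
  (rule eventually_mono[OF assms(2)], simp)

lemma in_L2_Pair: "in_L2 f ==> in_L2 g ==> in_L2 (%x. (f x, g x))"
proof -
 assume f: "in_L2 f" and g: "in_L2 g"
 have "in_L2 (%x. (f x, 0) + (0, g x))"
  by (intro in_L2_add in_L2_linear[OF _ f] in_L2_linear[OF _ g] bounded_linear_Pair bounded_linear_ident bounded_linear_zero)
 thus ?thesis by simp
qed

lemma in_L2_fst: "in_L2 f ==> in_L2 (%x. fst (f x))" and in_L2_snd: "in_L2 f ==> in_L2 (%x. snd (f x))"
 by (rule in_L2_linear[OF bounded_linear_fst], assumption) (rule in_L2_linear[OF bounded_linear_snd], assumption)

definition quad :: "((complex^3) fn) => (complex fn) => ((complex^3) fn) => ((complex^3) fn) => real^3 => point" where
 "quad U D W g x = (U x, D x, W x, g x)"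

lemma in_L2_quad: "in_L2 U ==> in_L2 D ==> in_L2 W ==> in_L2 g ==> in_L2 (quad U D W g)"
 unfolding quad_def by (intro in_L2_Pair)

lemma L2n_triangle: "in_L2 f ==> in_L2 g ==> L2n (%x. f x + g x) <= L2n f + L2n g"
 unfolding abs_l2_add[symmetric] by (rule norm_triangle_ineq)

lemma L2n_quad:
 assumes L: "in_L2 U" "in_L2 D" "in_L2 W" "in_L2 g"
 shows "(L2n (quad U D W g))^2 = (L2n U)^2 + (L2n D)^2 + (L2n W)^2 + (L2n g)^2"
proof -
 have "(norm (quad U D W g x))^2 = (norm (U x))^2 + (norm (D x))^2 + (norm (W x))^2 + (norm (g x))^2" for x
  by (simp add: quad_def norm_Pair)
 thus ?thesis
  unfolding norm_abs_l2[OF in_L2_quad[OF L]] norm_abs_l2[OF L(1)] norm_abs_l2[OF L(2)] norm_abs_l2[OF L(3)] norm_abs_l2[OF L(4)]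
  using in_L2_integrable[OF L(1)] in_L2_integrable[OF L(2)] in_L2_integrable[OF L(3)] in_L2_integrable[OF L(4)] by simp
qed

lemma sum_squares_le_square_sum:
 fixes u d w g :: real
 assumes "0 <= u" "0 <= d" "0 <= w" "0 <= g"
 shows "u\<^sup>2 + d\<^sup>2 + w\<^sup>2 + g\<^sup>2 <= (u + d + w + g)^2"
proof -
 have e: "(u + d + w + g)^2 = u\<^sup>2 + d\<^sup>2 + w\<^sup>2 + g\<^sup>2 + 2 * (u*d + u*w + u*g + d*w + d*g + w*g)"
  by (simp add: power2_eq_square algebra_simps)
 moreover have "0 <= u*d + u*w + u*g + d*w + d*g + w*g" using assms by (intro add_nonneg_nonneg mult_nonneg_nonneg)
 ultimately show ?thesis unfolding e by simp
qed

lemma L2n_quad_le: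
 assumes L: "in_L2 U" "in_L2 D" "in_L2 W" "in_L2 g"
 shows "L2n U <= L2n (quad U D W g)" "L2n D <= L2n (quad U D W g)" "L2n W <= L2n (quad U D W g)" "L2n g <= L2n (quad U D W g)"
  "L2n (quad U D W g) <= L2n U + L2n D + L2n W + L2n g"
proof -
 note q = L2n_quad[OF L]
 show "L2n U <= L2n (quad U D W g)" "L2n D <= L2n (quad U D W g)" "L2n W <= L2n (quad U D W g)" "L2n g <= L2n (quad U D W g)"
  by (rule power2_le_imp_le; simp add: q)+
 show "L2n (quad U D W g) <= L2n U + L2n D + L2n W + L2n g"
  by (rule power2_le_imp_le) (simp_all add: q sum_squares_le_square_sum)
qed

lemma L2n_zero: "L2n (%x. 0) = 0" by (simp add: abs_l2_zero)

lemma H1star_combine: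
 assumes \<psi>: "in_H1star r \<psi>" and \<psi>': "in_H1star r \<psi>'"
 shows "in_H1star r (%x. \<psi> x + z * \<psi>' x)"
  "AE x. weak_grad (%x. \<psi> x + z * \<psi>' x) x = weak_grad \<psi> x + z *s weak_grad \<psi>' x"
proof -
 have H: "in_H1loc \<psi>" "in_H1loc \<psi>'" using \<psi> \<psi>' unfolding in_H1star_def by blast+
 have L: "in_L2_loc \<psi>" "in_L2_loc \<psi>'" using H unfolding in_H1loc_def by blast+
 have ball: "in_L2 (%x. indB r x *R f x) ==> in_L2 (%x. indB r x *R f' x) ==>
   in_L2 (%x. indB r x *R (f x + z * f' x))" for f f' :: "complex fn" and r
 proof -
  assume "in_L2 (%x. indB r x *R f x)" "in_L2 (%x. indB r x *R f' x)"
  hence "in_L2 (%x. indB r x *R f x + z * (indB r x *R f' x))"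
   by (intro in_L2_add in_L2_linear[OF bounded_linear_mult_right])
  thus ?thesis by (simp add: scaleR_right_distrib)
 qed
 have loc: "in_L2_loc (%x. f x + z * f' x)" if f: "in_L2_loc f" "in_L2_loc f'" for f f' :: "complex fn"
 proof (rule in_L2_locI)
  have [measurable]: "f \<in> LM" "f' \<in> LM" using f unfolding in_L2_loc_def by blast+
  show "(%x. f x + z * f' x) \<in> LM" by measurable
  show "in_L2 (%x. indB r x *R (f x + z * f' x))" for r
   by (rule ball[OF in_L2_loc_ball[OF f(1)] in_L2_loc_ball[OF f(2)]])
 qed
 have d: "weakd i (%x. \<psi> x + z * \<psi>' x) (%x. (weak_grad \<psi> x + z *s weak_grad \<psi>' x) $ i)" for i
  using has_weak_pderiv_add[OF weak_grad_has[OF H(1)] has_weak_pderiv_linear[OF bounded_linear_mult_right weak_grad_has[OF H(2)]], of i z]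
  by simp
 show ae: "AE x. weak_grad (%x. \<psi> x + z * \<psi>' x) x = weak_grad \<psi> x + z *s weak_grad \<psi>' x"
  by (rule weak_grad_AE[OF d])
 have g: "in_L2 (weak_grad \<psi>)" "in_L2 (weak_grad \<psi>')" using \<psi> \<psi>' unfolding in_H1star_def by blast+
 have "in_L2_loc (%x. (weak_grad \<psi> x + z *s weak_grad \<psi>' x) $ i)" for i
  by (rule L2_imp_L2_loc[OF in_L2_linear[OF bounded_linear_vec_nth in_L2_add[OF g(1) in_L2_linear[OF bounded_linear_cscale g(2)]]]])
 hence 1: "in_H1loc (%x. \<psi> x + z * \<psi>' x)"
  unfolding in_H1loc_def using loc[OF L] d by blast
 have 2: "in_L2 (weak_grad (%x. \<psi> x + z * \<psi>' x))"
  by (rule in_L2_AE[OF in_L2_add[OF g(1) in_L2_linear[OF bounded_linear_cscale[of z] g(2)]]]) (use ae in eventually_elim, simp)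
 have i: "Lint (%x. indB r x *R f x)" if "in_L2_loc f" for f :: "complex fn"
  using L2_bilinear_integrable[OF bounded_bilinear_scaleR in_L2_indicator_ball[of 0 r] in_L2_loc_ball[OF that, of r]]
  by (simp add: indicator_inter_arith[symmetric] flip: mult.assoc)
 have zz: "(LINT x. indB r x *R \<psi> x) = 0" "(LINT x. indB r x *R \<psi>' x) = 0"
  using \<psi> \<psi>' unfolding in_H1star_def set_lebesgue_integral_def by blast+
 have "(LINT x:ball 0 r|lebesgue. \<psi> x + z * \<psi>' x) = (LINT x. indB r x *R \<psi> x + z * (indB r x *R \<psi>' x))"
  unfolding set_lebesgue_integral_def by (simp add: scaleR_right_distrib)
 also have "... = 0"
  unfolding Bochner_Integration.integral_add[OF i[OF L(1)] integrable_mult_right[OF i[OF L(2)], of z]] integral_mult_right_zero zz by simp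
 finally show "in_H1star r (%x. \<psi> x + z * \<psi>' x)" unfolding in_H1star_def using 1 2 by blast
qed

lemma H1star_zero: "in_H1star r (%x. 0)" "AE x. weak_grad (%x. 0::complex) x = 0"
proof -
 have d: "weakd i (%x. 0::complex) (%x. (0::complex^3) $ i)" for i
  by (rule has_weak_pderivI) (simp_all add: L2_loc_integrable[OF in_L2_zero])
 show ae: "AE x. weak_grad (%x. 0::complex) x = 0" by (rule weak_grad_AE[OF d])
 have l: "in_L2_loc (%x. 0::complex)" by (rule in_L2_locI) (simp_all add: in_L2_zero)
 have "in_L2 (weak_grad (%x. 0::complex))" by (rule in_L2_AE[OF in_L2_zero]) (use ae in eventually_elim, simp)
 moreover have "in_H1loc (%x. 0)" unfolding in_H1loc_def using l d by (metis zero_index)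
 ultimately show "in_H1star r (%x. 0)" unfolding in_H1star_def by (simp add: set_lebesgue_integral_def)
qed

lemma H1star_AE:
 assumes \<psi>: "in_H1star r \<psi>" and ae: "AE x. \<psi> x = \<psi>' x"
 shows "in_H1star r \<psi>'" "AE x. weak_grad \<psi>' x = weak_grad \<psi> x"
proof -
 have H: "in_H1loc \<psi>" using \<psi> unfolding in_H1star_def by blast
 have L: "in_L2_loc \<psi>" using H unfolding in_H1loc_def by blast
 have m: "\<psi>' \<in> LM" using L borel_measurable_AE[OF _ ae] unfolding in_L2_loc_def by blast
 have d: "weakd i \<psi>' (%x. weak_grad \<psi> x $ i)" for i by (rule has_weak_pderiv_AE[OF weak_grad_has[OF H] ae m])
 show wg: "AE x. weak_grad \<psi>' x = weak_grad \<psi> x" by (rule weak_grad_AE[OF d])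
 have g: "in_L2 (weak_grad \<psi>)" using \<psi> unfolding in_H1star_def by blast
 have L': "in_L2_loc \<psi>'"
 proof (rule in_L2_locI[OF m])
  show "in_L2 (%x. indB r x *R \<psi>' x)" for r
   by (rule in_L2_AE[OF in_L2_loc_ball[OF L, of r]]) (use ae in eventually_elim, simp)
 qed
 have "in_L2_loc (%x. weak_grad \<psi> x $ i)" for i
  by (intro L2_imp_L2_loc in_L2_linear[OF bounded_linear_vec_nth g])
 hence "in_H1loc \<psi>'" unfolding in_H1loc_def using L' d by blast
 moreover have "in_L2 (weak_grad \<psi>')" by (rule in_L2_AE[OF g]) (use wg in eventually_elim, simp)
 moreover have "(LINT x:ball 0 r|lebesgue. \<psi>' x) = (LINT x:ball 0 r|lebesgue. \<psi> x)"
  unfolding set_lebesgue_integral_def by (rule lebesgue_integral_AE_eq) (use ae in eventually_elim, simp)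
 ultimately show "in_H1star r \<psi>'" using \<psi> unfolding in_H1star_def by simp
qed

context stellar
begin

definition H1field :: "((complex^3) fn) => bool" where
 "H1field g \<longleftrightarrow> (\<exists>\<psi>. in_H1star r1 \<psi> \<and> (AE x. weak_grad \<psi> x = g x))"

lemma H1field_L2: "H1field g ==> in_L2 g"
 unfolding H1field_def in_H1star_def using in_L2_AE by blast

lemma H1field_zero: "H1field (%x. 0)"
 unfolding H1field_def using H1star_zero by blast

text \<open>Gradients of potentials are closed in L2. The Poincare inequality recovers a limiting
  potential through \<open>H1star_limit\<close>; differences are combinations with coefficient
  -1.\<close>

lemma H1field_limit:
 assumes g: "!!n. H1field (g n)" and L: "in_L2 g'" and lim: "(%n. abs_l2 (g n)) ----> abs_l2 g'"
 shows "H1field g'"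
proof -
 obtain \<psi> where \<psi>: "!!n. in_H1star r1 (\<psi> n)" "!!n. AE x. weak_grad (\<psi> n) x = g n x"
  using g unfolding H1field_def by metis
 have "abs_l2 (weak_grad (\<psi> n)) = abs_l2 (g n)" for n
  using abs_l2_eq_iff[OF _ H1field_L2[OF g]] \<psi> unfolding in_H1star_def by blast
 hence lim': "(%n. abs_l2 (weak_grad (\<psi> n))) ----> abs_l2 g'" using lim by simp
 have sub: "\<exists>\<zeta>. in_H1star r1 \<zeta> \<and> (AE x. \<zeta> x = \<psi> m x - \<psi> n x) \<and> (AE x. weak_grad \<zeta> x = weak_grad (\<psi> m) x - weak_grad (\<psi> n) x)" for m n
 proof (intro exI conjI)
  show "in_H1star r1 (%x. \<psi> m x + (-1) * \<psi> n x)" by (rule H1star_combine(1)[OF \<psi>(1) \<psi>(1)])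
  show "AE x. weak_grad (%x. \<psi> m x + (-1) * \<psi> n x) x = weak_grad (\<psi> m) x - weak_grad (\<psi> n) x"
   using H1star_combine(2)[OF \<psi>(1)[of m] \<psi>(1)[of n], of "-1"] by eventually_elim (simp add: vector_sneg_minus1[symmetric])
 qed simp
 from H1star_limit[OF r1(1) \<psi>(1) L lim' sub]
 show ?thesis unfolding H1field_def by metis
qed

definition adm :: "((complex^3) fn) => (complex fn) => ((complex^3) fn) => ((complex^3) fn) => bool" where
 "adm U D W g \<longleftrightarrow> energy U D W \<and> H1field g"

lemma adm_L2: "adm U D W g ==> in_L2 U" "adm U D W g ==> in_L2 D" "adm U D W g ==> in_L2 W" "adm U D W g ==> in_L2 g"
 "adm U D W g ==> in_L2 (quad U D W g)"
 unfolding adm_def using energy_L2 H1field_L2 in_L2_quad by blast+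

end

section \<open>The oscillation form on the energy space\<close>

lemma bounded_continuous_coefficient:
 fixes \<Phi> :: "'a::euclidean_space => 'b::euclidean_space"
 assumes \<Phi>: "continuous_on UNIV \<Phi>" and f: "f \<in> LM" and B: "AE x. norm (f x) <= B"
 shows "(%x. \<Phi> (f x)) \<in> LM" "\<exists>C. AE x. norm (\<Phi> (f x)) <= C"
proof -
 show "(%x. \<Phi> (f x)) \<in> LM"
  using measurable_compose[OF f borel_measurable_continuous_onI[OF \<Phi>]] .
 have "bounded (\<Phi> ` cball 0 B)"
  by (intro compact_imp_bounded compact_continuous_image continuous_on_subset[OF \<Phi>]) auto
 then obtain C where C: "!!y. y \<in> cball 0 B ==> norm (\<Phi> y) <= C" unfolding bounded_iff by blast
 have "AE x. norm (\<Phi> (f x)) <= C" using B by eventually_elim (use C in simp)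
 thus "\<exists>C. AE x. norm (\<Phi> (f x)) <= C" by blast
qed

lemma bounded_Pair:
 assumes "f \<in> LM \<and> (\<exists>C. AE x. norm (f x) <= C)"
  and "g \<in> LM \<and> (\<exists>C. AE x. norm (g x) <= C)"
 shows "(%x. (f x, g x)) \<in> LM \<and> (\<exists>C. AE x. norm ((f x :: 'a::euclidean_space, g x :: 'b::euclidean_space)) <= C)"
proof
 show "(%x. (f x, g x)) \<in> LM"
  unfolding borel_prod[symmetric] by (rule measurable_Pair) (use assms in blast)+
 obtain C C' where C: "AE x. norm (f x) <= C" "AE x. norm (g x) <= C'" using assms by blast
 have "AE x. norm (f x, g x) <= C + C'"
  using C by eventually_elim (rule order_trans[OF norm_Pair_le], simp)
 thus "\<exists>C. AE x. norm (f x, g x) <= C" by blast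
qed

lemma oscillation_zero_left:
 "oscillation_form \<omega> \<Omega> G (k, q, N, \<gamma>, s) (u, d, w, g) (0, 0, 0, g') = of_real (1 / (4 * pi * G)) * hdot g g' - of_real s * hdot u g'"
proof -
 have "rotation \<omega> \<Omega> 0 0 = 0" by (simp add: rotation_def linear_simps(3)[OF bounded_linear_ccross])
 thus ?thesis by (simp add: oscillation_form_def hdot_zero rdot_def)
qed

context stellar
begin

text \<open>Equals Hess p divided by \<rho>, minus Hess \<phi>, almost everywhere. Writing it
  through \<open>q_field\<close> and \<open>m1_field\<close> makes it visibly bounded, whereas the
  Hessians are controlled only locally.\<close>

definition coefN :: "(real^3^3) fn" where
 "coefN x = (c x)^2 *R (\<chi> i j. q_field \<rho> c p x $ i * q_field \<rho> c p x $ j) - m1_field \<rho> c p \<phi> x"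

definition coef :: "real^3 => coefs" where
 "coef x = ((c x)^2, q_field \<rho> c p x, coefN x, \<gamma> x, s x)"

lemma coef_bounded: "coef \<in> LM" "\<exists>B. AE x. norm (coef x) <= B"
proof -
 define \<Phi> :: "real \<times> (real^3) \<times> (real^3^3) \<times> real \<times> real => coefs" where
  "\<Phi> = (%t. ((fst t)^2, fst (snd t), (fst t)^2 *R (\<chi> i j. fst (snd t) $ i * fst (snd t) $ j) - fst (snd (snd t)), snd (snd (snd t))))"
 have cont: "continuous_on UNIV \<Phi>" unfolding \<Phi>_def by (intro continuous_intros)
 have "s \<in> LM \<and> (\<exists>C. AE x. norm (s x) <= C)"
 proof -
  obtain S where S: "S > 0" "AE x. 0 < s x \<and> s x <= S" by (rule s_upper)
  have "AE x. norm (s x) <= S" using S(2) by eventually_elim simp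
  thus ?thesis using s_measurable by blast
 qed
 hence "(%x. (c x, q_field \<rho> c p x, m1_field \<rho> c p \<phi> x, \<gamma> x, s x)) \<in> LM \<and>
  (\<exists>C. AE x. norm (c x, q_field \<rho> c p x, m1_field \<rho> c p \<phi> x, \<gamma> x, s x) <= C)"
  using sound(1) q m1 gamma(1) unfolding in_Linf_UNIV by (intro bounded_Pair) blast+
 then obtain C where m: "(%x. (c x, q_field \<rho> c p x, m1_field \<rho> c p \<phi> x, \<gamma> x, s x)) \<in> LM"
  and C: "AE x. norm (c x, q_field \<rho> c p x, m1_field \<rho> c p \<phi> x, \<gamma> x, s x) <= C" by blast
 have e: "\<Phi> (c x, q_field \<rho> c p x, m1_field \<rho> c p \<phi> x, \<gamma> x, s x) = coef x" for x
  by (simp add: \<Phi>_def coef_def coefN_def)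
 show "coef \<in> LM" "\<exists>B. AE x. norm (coef x) <= B"
  using bounded_continuous_coefficient[OF cont m C] unfolding e by blast+
qed

lemma sound_pos: obtains c0 where "c0 > 0" "AE x. c0 <= c x"
 using ess_inf_positive[OF sound(2)] by blast

lemma coefficient_identities:
 "AE x. (1 / \<rho> x) *R weak_grad p x = (c x)^2 *R q_field \<rho> c p x"
 "AE x. (1 / \<rho> x) *R weak_hess p x - weak_hess \<phi> x = coefN x"
proof -
 obtain c0 where c0: "c0 > 0" "AE x. c0 <= c x" by (rule sound_pos)
 show "AE x. (1 / \<rho> x) *R weak_grad p x = (c x)^2 *R q_field \<rho> c p x"
  using c0(2) by eventually_elim (use c0(1) in \<open>auto simp: q_field_def\<close>)
 show "AE x. (1 / \<rho> x) *R weak_hess p x - weak_hess \<phi> x = coefN x"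
  using rho_pos by eventually_elim (simp add: coefN_def m1_field_def scaleR_diff_right)
qed

lemma coefN_symmetric: "AE x. \<forall>i j. coefN x $ i $ j = coefN x $ j $ i"
proof -
 have "AE x. coefN x $ i $ j = coefN x $ j $ i" for i j
  using coefficient_identities(2) weak_hess_symmetric[OF p_phi(1), of i j] weak_hess_symmetric[OF p_phi(2), of i j]
 proof eventually_elim
  case (elim x)
  show ?case unfolding elim(1)[symmetric] using elim(2,3) by simp
 qed
 hence "AE x. \<forall>i\<in>UNIV. \<forall>j\<in>UNIV. coefN x $ i $ j = coefN x $ j $ i" by (intro AE_finite_allI) auto
 thus ?thesis by simp
qed

definition F :: "(real^3 => point) => (real^3 => point) => complex" where
 "F Z Z' = (LINT x. oscillation_form \<omega> \<Omega> G (coef x) (Z x) (Z' x))"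

lemma F_integrable:
 assumes "in_L2 Z" "in_L2 Z'"
 shows "Lint (%x. oscillation_form \<omega> \<Omega> G (coef x) (Z x) (Z' x))"
proof -
 obtain B where B: "AE x. norm (coef x) <= B" using coef_bounded(2) by blast
 show ?thesis
  by (rule form_integrable[where f="oscillation_form \<omega> \<Omega> G", OF continuous_oscillation sesquilinear_oscillation coef_bounded(1) B assms])
qed

lemma F_bound: "\<exists>C\<ge>0. \<forall>Z Z'. in_L2 Z --> in_L2 Z' --> norm (F Z Z') <= C * L2n Z * L2n Z'"
proof -
 obtain B where B: "AE x. norm (coef x) <= B" using coef_bounded(2) by blast
 show ?thesis
  unfolding F_def
  by (rule form_integral_bound[where f="oscillation_form \<omega> \<Omega> G", OF continuous_oscillation sesquilinear_oscillation coef_bounded(1) B])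
qed

text \<open>The residual functional of the form has norm at most \<open>K\<close>. It ranges over
  admissible quadruples of fields rather than states, so that constructed fields can be used as test
  elements directly.\<close>

definition approx_null :: "((complex^3) fn) => (complex fn) => ((complex^3) fn) => ((complex^3) fn) => real => bool" where
 "approx_null U D W g K \<longleftrightarrow> 0 <= K \<and> adm U D W g \<and>
  (\<forall>U' D' W' g'. adm U' D' W' g' --> norm (F (quad U D W g) (quad U' D' W' g')) <= K * L2n (quad U' D' W' g'))"


lemma approx_nullD:
 "approx_null U D W g K ==> 0 <= K"
 "approx_null U D W g K ==> adm U' D' W' g' ==> norm (F (quad U D W g) (quad U' D' W' g')) <= K * L2n (quad U' D' W' g')"
 "approx_null U D W g K ==> adm U D W g"
 unfolding approx_null_def by blast+

text \<open>The imaginary part of the form is -\<omega> times the integral of \<gamma> |U|^2; the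
  constant is |\<omega>| times a lower bound of \<open>\<gamma>\<close>.\<close>

lemma Im_F_lower: "\<exists>m>0. \<forall>U D W g. adm U D W g --> m * (L2n U)^2 <= norm (F (quad U D W g) (quad U D W g))"
proof -
 obtain g0 where g0: "g0 > 0" "AE x. g0 <= \<gamma> x" using ess_inf_positive[OF gamma(2)] by blast
 have "\<bar>\<omega>\<bar> * g0 * (L2n U)^2 <= norm (F (quad U D W g) (quad U D W g))" if a: "adm U D W g" for U D W g
 proof -
  note L = adm_L2[OF a]
  note i = F_integrable[OF L(5) L(5)]
  have U: "Lint (%x. (norm (U x))^2)" by (rule in_L2_integrable[OF L(1)])
  have ae: "AE x. Im (oscillation_form \<omega> \<Omega> G (coef x) (quad U D W g x) (quad U D W g x)) = - \<omega> * \<gamma> x * (norm (U x))^2"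
   using coefN_symmetric
  proof eventually_elim
   case (elim x)
   show ?case unfolding coef_def quad_def by (rule Im_oscillation) (use elim in blast)
  qed
  have "Im (F (quad U D W g) (quad U D W g)) = (LINT x. Im (oscillation_form \<omega> \<Omega> G (coef x) (quad U D W g x) (quad U D W g x)))"
   unfolding F_def by (rule integral_Im[OF i, symmetric])
  also have "... = (LINT x. - \<omega> * (\<gamma> x * (norm (U x))^2))"
   by (rule lebesgue_integral_AE_eq) (use ae in eventually_elim, simp)
  also have "... = - \<omega> * (LINT x. \<gamma> x * (norm (U x))^2)" by (rule integral_mult_right_zero)
  finally have Im: "\<bar>Im (F (quad U D W g) (quad U D W g))\<bar> = \<bar>\<omega>\<bar> * \<bar>LINT x. \<gamma> x * (norm (U x))^2\<bar>" by (simp add: abs_mult)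
  have ig: "Lint (%x. \<gamma> x * (norm (U x))^2)"
  proof -
   have "Lint (%x. - inverse \<omega> * Im (oscillation_form \<omega> \<Omega> G (coef x) (quad U D W g x) (quad U D W g x)))"
    by (intro integrable_mult_right integrable_Im i)
   moreover have "AE x. - inverse \<omega> * Im (oscillation_form \<omega> \<Omega> G (coef x) (quad U D W g x) (quad U D W g x)) = \<gamma> x * (norm (U x))^2"
    using ae by eventually_elim (simp add: omega)
   ultimately show ?thesis by (rule integrable_AE_eq)
  qed
  have "g0 * (L2n U)^2 = (LINT x. g0 * (norm (U x))^2)" unfolding norm_abs_l2[OF L(1)] by simp
  also have "... <= (LINT x. \<gamma> x * (norm (U x))^2)"
   by (rule integral_mono_AE[OF integrable_mult_right[OF U] ig]) (use g0(2) in \<open>eventually_elim, simp add: mult_right_mono\<close>)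
  finally have "g0 * (L2n U)^2 <= \<bar>LINT x. \<gamma> x * (norm (U x))^2\<bar>" by simp
  hence "\<bar>\<omega>\<bar> * (g0 * (L2n U)^2) <= \<bar>Im (F (quad U D W g) (quad U D W g))\<bar>" unfolding Im by (intro mult_left_mono) auto
  also have "... <= norm (F (quad U D W g) (quad U D W g))" by (rule abs_Im_le_cmod)
  finally show ?thesis by (simp add: mult.assoc)
 qed
 thus ?thesis using g0(1) omega by (intro exI[of _ "\<bar>\<omega>\<bar> * g0"]) auto
qed

text \<open>Testing with the potential component alone leaves k |g|^2 minus the pairing of s U with
  g, where k = 1/(4 \<pi> G). So \<open>g\<close> is controlled by \<open>U\<close> and the
  residual.\<close>

lemma potential_bound: "\<exists>C\<ge>0. \<forall>U D W g K. approx_null U D W g K --> L2n g <= C * (L2n U + K)"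
proof -
 obtain B where B: "B >= 0" "!!f g. in_L2 f ==> in_L2 g ==> norm (LINT x. hdot (f x) (g x)) <= B * L2n f * L2n g"
  using L2_inner_bound[OF bounded_bilinear_hdot] by blast
 obtain S where S: "S > 0" "AE x. 0 < s x \<and> s x <= S" by (rule s_upper)
 define k where "k = 1 / (4 * pi * G)"
 have k: "k > 0" using G by (simp add: k_def)
 have bound: "L2n g <= inverse k * (B * S + 1) * (L2n U + K)" if n: "approx_null U D W g K" for U D W g K
 proof -
  have a: "adm U D W g" by (rule approx_nullD(3)[OF n])
  note L = adm_L2[OF a]
  have z: "adm (%x. 0) (%x. 0) (%x. 0) g" using a energy_zero unfolding adm_def by blast
  have sU: "in_L2 (%x. s x *R U x)" by (rule in_L2_s[OF L(1)])
  have sUn: "L2n (%x. s x *R U x) <= S * L2n U"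
   by (rule abs_l2_mono[OF sU L(1) less_imp_le[OF S(1)]]) (rule eventually_mono[OF S(2)], simp add: mult_right_mono)
  have i: "Lint (%x. of_real k * hdot (g x) (g x))" "Lint (%x. hdot (s x *R U x) (g x))"
   by (rule integrable_mult_right[OF L2_bilinear_integrable[OF bounded_bilinear_hdot L(4) L(4)]],
     rule L2_bilinear_integrable[OF bounded_bilinear_hdot sU L(4)])
  define Fz where "Fz = F (quad U D W g) (quad (%x. 0) (%x. 0) (%x. 0) g)"
  define I where "I = (LINT x. hdot (s x *R U x) (g x))"
  have "Fz = (LINT x. of_real k * hdot (g x) (g x) - hdot (s x *R U x) (g x))"
   unfolding Fz_def F_def coef_def quad_def oscillation_zero_left k_def[symmetric] hdot_scaleR_left scaleR_conv_of_real[where 'a=complex] by (rule refl)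
  also have "... = of_real k * (LINT x. hdot (g x) (g x)) - I"
   unfolding I_def Bochner_Integration.integral_diff[OF i] integral_mult_right_zero by (rule refl)
  also have "(LINT x. hdot (g x) (g x)) = of_real ((L2n g)^2)"
   unfolding hdot_self norm_abs_l2[OF L(4)] by (rule integral_complex_of_real)
  finally have "Fz = of_real k * of_real ((L2n g)^2) - I" .
  hence e: "of_real (k * (L2n g)^2) = Fz + I" by (simp only: of_real_mult diff_add_cancel)
  have K: "norm Fz <= K * L2n (quad (%x. 0) (%x. 0) (%x. 0) g)"
   unfolding Fz_def by (rule approx_nullD(2)[OF n z])
  have qz: "(L2n (quad (%x. 0) (%x. 0) (%x. 0) g))^2 = (L2n g)^2"
   unfolding L2n_quad[OF in_L2_zero in_L2_zero in_L2_zero L(4)] by (simp add: L2n_zero)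
  hence qz: "L2n (quad (%x. 0) (%x. 0) (%x. 0) g) = L2n g" by (simp add: power2_eq_iff_nonneg)
  have "k * (L2n g)^2 = norm (of_real (k * (L2n g)^2) :: complex)" using k by (simp only: norm_of_real) simp
  also have "... <= K * L2n g + B * (S * L2n U) * L2n g"
   unfolding e
  proof (rule order_trans[OF norm_triangle_ineq], rule add_mono)
   show "norm Fz <= K * L2n g" using K unfolding qz .
   show "norm I <= B * (S * L2n U) * L2n g"
    unfolding I_def by (rule order_trans[OF B(2)[OF sU L(4)]]) (intro mult_right_mono mult_left_mono sUn B norm_ge_zero)
  qed
  finally have m: "L2n g * (k * L2n g) <= L2n g * (K + B * S * L2n U)" by (simp add: algebra_simps power2_eq_square)
  have K0: "0 <= K" by (rule approx_nullD(1)[OF n])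
  have "k * L2n g <= K + B * S * L2n U"
  proof (cases "L2n g = 0")
   case True
   thus ?thesis using K0 B(1) S(1) by simp
  next
   case False
   hence "L2n g > 0" using norm_ge_zero[of "abs_l2 g"] by linarith
   thus ?thesis using m mult_le_cancel_left_pos by blast
  qed
  also have "... <= (B * S + 1) * (L2n U + K)"
   using K0 B(1) S(1) by (simp add: algebra_simps)
  finally have "inverse k * (k * L2n g) <= inverse k * ((B * S + 1) * (L2n U + K))" using k by (intro mult_left_mono) auto
  moreover have "inverse k * (k * L2n g) = L2n g" using k by simp
  ultimately show ?thesis by (simp only: mult.assoc)
 qed
 show ?thesis
 proof (intro exI[of _ "inverse k * (B * S + 1)"] conjI allI impI)
  show "0 <= inverse k * (B * S + 1)" using k B(1) S(1) by simp
 qed (rule bound)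
qed

end

section \<open>Bounded maps of L2 and the principal part of the form\<close>

definition l2bounded :: "((('a::euclidean_space) fn) => ('b::euclidean_space) fn) => bool" where
 "l2bounded T \<longleftrightarrow> (\<exists>B\<ge>0. \<forall>f. in_L2 f --> in_L2 (T f) \<and> L2n (T f) <= B * L2n f)"

lemma l2boundedI:
 fixes T :: "(('a::euclidean_space) fn) => ('b::euclidean_space) fn"
 assumes "0 <= B" and m: "!!f. in_L2 f ==> T f \<in> LM"
  and le: "!!f. AE x. norm (T f x) <= B * norm (f x)"
 shows "l2bounded T"
 unfolding l2bounded_def
proof (intro exI[of _ B] conjI allI impI assms(1))
 fix f :: "'a fn" assume f: "in_L2 f"
 show L: "in_L2 (T f)" by (rule in_L2_bound[OF f m[OF f] le])
 show "L2n (T f) <= B * L2n f" by (rule abs_l2_mono[OF L f assms(1) le])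
qed

lemma l2bounded_L2: "l2bounded T ==> in_L2 f ==> in_L2 (T f)"
 unfolding l2bounded_def by blast

lemma l2bounded_add:
 fixes T :: "(('a::euclidean_space) fn) => ('b::euclidean_space) fn"
 assumes "l2bounded S" "l2bounded T" shows "l2bounded (%f x. S f x + T f x)"
proof -
 obtain A B where A: "A >= 0" "\<forall>f. in_L2 f --> in_L2 (S f) \<and> L2n (S f) <= A * L2n f"
  and B: "B >= 0" "\<forall>f. in_L2 f --> in_L2 (T f) \<and> L2n (T f) <= B * L2n f"
  using assms unfolding l2bounded_def by (elim exE conjE)
 show ?thesis
  unfolding l2bounded_def
 proof (intro exI[of _ "A + B"] conjI allI impI)
  fix f :: "'a fn" assume f: "in_L2 f"
  note S = A(2)[rule_format, OF f] and T = B(2)[rule_format, OF f]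
  show "in_L2 (%x. S f x + T f x)" using S T by (intro in_L2_add) auto
  show "L2n (%x. S f x + T f x) <= (A + B) * L2n f"
   using L2n_triangle[OF conjunct1[OF S] conjunct1[OF T]] S T unfolding distrib_right by linarith
 qed (use A B in simp)
qed

lemma l2bounded_comp:
 fixes T :: "(('a::euclidean_space) fn) => ('b::euclidean_space) fn"
 assumes "l2bounded S" "l2bounded T" shows "l2bounded (%f. S (T f))"
proof -
 obtain A B where A: "A >= 0" "\<forall>f. in_L2 f --> in_L2 (S f) \<and> L2n (S f) <= A * L2n f"
  and B: "B >= 0" "\<forall>f. in_L2 f --> in_L2 (T f) \<and> L2n (T f) <= B * L2n f"
  using assms unfolding l2bounded_def by (elim exE conjE)
 show ?thesis
  unfolding l2bounded_def
 proof (intro exI[of _ "A * B"] conjI allI impI)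
  fix f :: "'a fn" assume f: "in_L2 f"
  note T = B(2)[rule_format, OF f]
  show "in_L2 (S (T f))" using A(2) T by blast
  have "L2n (S (T f)) <= A * L2n (T f)" using A(2) T by blast
  also have "... <= A * B * L2n f" using T A(1) by (simp add: mult.assoc mult_left_mono)
  finally show "L2n (S (T f)) <= A * B * L2n f" .
 qed (use A B in simp)
qed

text \<open>The norm bound alone carries null sequences over; linearity of the map is not part of
  \<open>l2bounded\<close>.\<close>

lemma l2bounded_null:
 assumes T: "l2bounded T" and f: "!!n. in_L2 (f n)" and lim: "(%n. abs_l2 (f n)) ----> 0"
 shows "(%n. abs_l2 (T (f n))) ----> 0"
proof -
 obtain B where B: "\<forall>f. in_L2 f --> in_L2 (T f) \<and> L2n (T f) <= B * L2n f" using T unfolding l2bounded_def by (elim exE conjE)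
 show ?thesis
  by (rule Lim_null_comparison[OF always_eventually tendsto_mult_right_zero[OF tendsto_norm_zero[OF lim], of B]])
   (use B f in blast)
qed

lemma l2bounded_Bseq:
 assumes T: "l2bounded T" and f: "!!n. in_L2 (f n)" and b: "Bseq (%n. abs_l2 (f n))"
 shows "Bseq (%n. abs_l2 (T (f n)))"
proof -
 obtain B where B: "B >= 0" "\<forall>f. in_L2 f --> in_L2 (T f) \<and> L2n (T f) <= B * L2n f" using T unfolding l2bounded_def by (elim exE conjE)
 obtain K where K: "!!n. L2n (f n) <= K" using b by (rule BseqE) blast
 show ?thesis
 proof (rule BseqI')
  fix n
  have "L2n (T (f n)) <= B * L2n (f n)" using B(2) f by blast
  also have "... <= B * K" by (rule mult_left_mono[OF K B(1)])
  finally show "L2n (T (f n)) <= B * K" .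
 qed
qed

lemma l2_Bseq_add:
 assumes "!!n. in_L2 (f n)" "!!n. in_L2 (g n)" "Bseq (%n. abs_l2 (f n))" "(%n. abs_l2 (g n)) ----> 0"
 shows "Bseq (%n. abs_l2 (%x. f n x + g n x))"
proof -
 obtain K K' where "!!n. L2n (f n) <= K" "!!n. L2n (g n) <= K'"
  using assms(3) convergent_imp_Bseq[OF convergentI[OF assms(4)]] by (metis BseqE)
 thus ?thesis by (intro BseqI'[of _ "K + K'"] order_trans[OF L2n_triangle[OF assms(1,2)]] add_mono)
qed

lemma inner_null:
 fixes X Y :: "nat => 'a::real_inner"
 assumes "Bseq X" "Y ----> 0" shows "(%n. X n \<bullet> Y n) ----> 0"
 using bounded_bilinear.Bfun_prod_Zfun[OF bounded_bilinear_inner, of X sequentially Y] assms by (simp add: tendsto_Zfun_iff)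

context stellar
begin

lemma csq_bounded: "l2bounded (%f x. (c x)^2 *R (f x :: 'a::euclidean_space))"
proof -
 obtain C where C: "C > 0" "AE x. norm (c x) <= C" and m: "c \<in> LM"
  using sound(1) unfolding in_Linf_UNIV by blast
 show ?thesis
 proof (rule l2boundedI[of "C\<^sup>2"])
  show "AE x. norm ((c x)^2 *R f x) <= C\<^sup>2 * norm (f x)" for f :: "'a fn"
   using C(2) by eventually_elim (simp add: abs_le_square_iff[symmetric] mult_right_mono)
  show "(%x. (c x)^2 *R f x) \<in> LM" if "in_L2 f" for f :: "'a fn"
   using m in_L2_measurable[OF that] by measurable
 qed simp
qed

lemma in_L2_csq: "in_L2 f ==> in_L2 (%x. (c x)^2 *R (f x :: 'a::euclidean_space))"
 by (rule l2bounded_L2[OF csq_bounded])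

text \<open>The real part of what the form retains when all terms containing u or u'
  undifferentiated are dropped; it is indefinite.\<close>

definition principal :: "(complex fn) => ((complex^3) fn) => (complex fn) => ((complex^3) fn) => real" where
 "principal D W D' W' = abs_l2 (%x. (c x)^2 *R D x) \<bullet> abs_l2 D' - abs_l2 W \<bullet> abs_l2 W'"

text \<open>By \<open>oscillation_split\<close> the principal part is the full form minus two forms,
  one with only \<open>U\<close> on the left, the other with only \<open>U'\<close> on the right.
  Both are small once \<open>U\<close> and \<open>U'\<close> are.\<close>

lemma principal_le_remainder:
 assumes L: "in_L2 U" "in_L2 D" "in_L2 W" "in_L2 g" and L': "in_L2 U'" "in_L2 D'" "in_L2 W'"
 shows "\<bar>principal D W D' W'\<bar> <= norm (F (quad U D W g) (quad U' D' W' (%x. 0)))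
  + norm (F (quad U (%x. 0) (%x. 0) (%x. 0)) (quad U' D' W' (%x. 0)))
  + norm (F (quad (%x. 0) D W g) (quad U' (%x. 0) (%x. 0) (%x. 0)))"
proof -
 let ?f = "%Z Z' x. oscillation_form \<omega> \<Omega> G (coef x) (Z x) (Z' x)"
 note z = in_L2_zero
 note i = F_integrable[OF in_L2_quad[OF L] in_L2_quad[OF L' z]] F_integrable[OF in_L2_quad[OF L(1) z z z] in_L2_quad[OF L' z]]
  F_integrable[OF in_L2_quad[OF z L(2,3,4)] in_L2_quad[OF L'(1) z z z]]
 have eq: "of_real ((c x)^2) * D x * cnj (D' x) - hdot (W x) (W' x) = ?f (quad U D W g) (quad U' D' W' (%x. 0)) x
   - ?f (quad U (%x. 0) (%x. 0) (%x. 0)) (quad U' D' W' (%x. 0)) x - ?f (quad (%x. 0) D W g) (quad U' (%x. 0) (%x. 0) (%x. 0)) x" for x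
  unfolding quad_def coef_def oscillation_split[of _ _ _ _ _ _ _ _ "U x" "D x"] by simp
 have "principal D W D' W' = (LINT x. ((c x)^2 *R D x) \<bullet> D' x - W x \<bullet> W' x)"
  unfolding principal_def inner_abs_l2[OF in_L2_csq[OF L(2)] L'(2)] inner_abs_l2[OF L(3) L'(3)]
  by (rule Bochner_Integration.integral_diff[symmetric]; rule L2_inner_integrable) (intro in_L2_csq L L')+
 also have "... = (LINT x. Re (of_real ((c x)^2) * D x * cnj (D' x) - hdot (W x) (W' x)))"
  by (rule Bochner_Integration.integral_cong) (simp_all add: Re_hdot inner_complex_def algebra_simps)
 also have "... = Re (LINT x. of_real ((c x)^2) * D x * cnj (D' x) - hdot (W x) (W' x))"
  unfolding eq by (rule integral_Re) (intro Bochner_Integration.integrable_diff i)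
 also have "(LINT x. of_real ((c x)^2) * D x * cnj (D' x) - hdot (W x) (W' x)) = F (quad U D W g) (quad U' D' W' (%x. 0))
   - F (quad U (%x. 0) (%x. 0) (%x. 0)) (quad U' D' W' (%x. 0)) - F (quad (%x. 0) D W g) (quad U' (%x. 0) (%x. 0) (%x. 0))"
  unfolding eq F_def Bochner_Integration.integral_diff[OF Bochner_Integration.integrable_diff[OF i(1,2)] i(3)] Bochner_Integration.integral_diff[OF i(1,2)] by (rule refl)
 finally have "\<bar>principal D W D' W'\<bar> <= norm (F (quad U D W g) (quad U' D' W' (%x. 0))
   - F (quad U (%x. 0) (%x. 0) (%x. 0)) (quad U' D' W' (%x. 0)) - F (quad (%x. 0) D W g) (quad U' (%x. 0) (%x. 0) (%x. 0)))"
  using abs_Re_le_cmod by metis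
 also have "... <= norm (F (quad U D W g) (quad U' D' W' (%x. 0)))
  + norm (F (quad U (%x. 0) (%x. 0) (%x. 0)) (quad U' D' W' (%x. 0)))
  + norm (F (quad (%x. 0) D W g) (quad U' (%x. 0) (%x. 0) (%x. 0)))"
  by (rule order_trans[OF norm_triangle_ineq4 add_right_mono[OF norm_triangle_ineq4]])
 finally show ?thesis .
qed

end

text \<open>The compact support of \<open>\<eta>\<close> allows weights that are bounded only on
  balls, such as the reciprocal of \<open>s\<close>.\<close>

lemma weighted_test_bounded:
 fixes prod :: "'a::euclidean_space => 'b::euclidean_space => 'd::euclidean_space" and \<eta> :: "'a fn"
 assumes bb: "bounded_bilinear prod" and \<eta>: "test_function A \<eta>" and m: "m \<in> LM"
  and loc: "!!r. \<exists>C. AE x. x \<in> ball 0 r --> \<bar>m x\<bar> <= C"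
 shows "l2bounded (%f x. m x *R prod (\<eta> x) (f x))"
proof -
 interpret bounded_bilinear prod by (rule bb)
 from nonneg_bounded obtain K where K: "K >= 0" and K': "\<forall>a b. norm (prod a b) <= norm a * norm b * K" by (elim exE conjE)
 obtain D where D: "compact D" "!!x. x \<notin> D ==> \<eta> x = 0" using test_functionE[OF \<eta>] by metis
 obtain r where r: "!!x. x \<in> D ==> norm x < r" using compact_imp_bounded[OF D(1)] unfolding bounded_pos_less by blast
 obtain B where B: "B > 0" "!!x. norm (\<eta> x) <= B" by (rule test_bounded[OF \<eta>]) blast
 obtain C where C: "AE x. x \<in> ball 0 r --> \<bar>m x\<bar> <= C" using loc by blast
 show ?thesis
 proof (rule l2boundedI[of "\<bar>C\<bar> * (B * K)"])
  show "AE x. norm (m x *R prod (\<eta> x) (f x)) <= \<bar>C\<bar> * (B * K) * norm (f x)" for f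
   using C
  proof eventually_elim
   case (elim x)
   show ?case
   proof (cases "x \<in> D")
    case True
    have "norm (prod (\<eta> x) (f x)) <= norm (\<eta> x) * norm (f x) * K" using K' by blast
    also have "... <= B * norm (f x) * K" using B(2)[of x] K by (intro mult_right_mono) auto
    finally have "\<bar>m x\<bar> * norm (prod (\<eta> x) (f x)) <= \<bar>C\<bar> * (B * norm (f x) * K)" using elim r[OF True] by (intro mult_mono) auto
    thus ?thesis by (simp add: mult_ac)
   next
    case False
    show ?thesis using B(1) K by (simp add: D(2)[OF False] zero_left)
   qed
  qed
  fix f :: "'b fn" assume f: "in_L2 f"
  have [measurable]: "(%x. prod (\<eta> x) (f x)) \<in> LM"
   by (rule borel_measurable_integrable[OF L2_bilinear_integrable[OF bb in_L2_test[OF \<eta>] f]])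
  show "(%x. m x *R prod (\<eta> x) (f x)) \<in> LM" using m by measurable
 qed (use B K in simp)
qed

text \<open>Cauchy-Schwarz in the three components with constant 1. A larger constant would be lost
  in the strict condition \<beta> < 1.\<close>

lemma norm_weighted_sum_le:
 fixes h :: "3 => 'a::euclidean_space" and v :: "real^3"
 shows "norm (\<Sum>l. (v $ l) *R h l) <= norm v * norm (\<chi> l. h l)"
proof -
 have "norm (\<Sum>l. (v $ l) *R h l) <= (\<Sum>l. \<bar>v $ l\<bar> * \<bar>norm (h l)\<bar>)"
  by (rule order_trans[OF norm_sum]) simp
 also have "... <= L2_set (%l. v $ l) UNIV * L2_set (%l. norm (h l)) UNIV" by (rule L2_set_mult_ineq)
 also have "... = norm v * norm (\<chi> l. h l)" by (simp add: norm_vec_def L2_set_def)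
 finally show ?thesis .
qed

definition hessian :: "(complex fn) => (complex^3^3) fn" where
 "hessian \<eta> x = (\<chi> l. pd l (grad \<eta>) x)"

lemma pderiv_at_grad:
 fixes \<eta> :: "complex fn"
 assumes "test_function A \<eta>"
 shows "pd l (grad \<eta>) x $ i = pd l (pd i \<eta>) x"
 using pderiv_at_linear[OF bounded_linear_vec_nth test_diff[OF test_grad[OF assms]], of l i x] by (simp add: grad_def)

lemma test_hessian:
 assumes "test_function A \<eta>" shows "in_L2 (hessian \<eta>)"
 unfolding hessian_def by (rule in_L2_test[OF test_vec]) (rule test_pderiv[OF test_grad[OF assms]])

text \<open>The Euclidean norm on matrices is the Frobenius norm, so
  \<open>hessian_laplacian\<close> applies without loss.\<close>

lemma L2n_hessian:
 assumes \<eta>: "test_function A \<eta>"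
 shows "L2n (hessian \<eta>) = L2n (laplacian \<eta>)"
proof -
 have "(norm (hessian \<eta> x))^2 = (\<Sum>l. \<Sum>i. (norm (pd l (pd i \<eta>) x))^2)" for x
  unfolding hessian_def norm_vec_def L2_set_def by (simp add: sum_nonneg pderiv_at_grad[OF \<eta>])
 hence "(L2n (hessian \<eta>))^2 = (LINT x. (\<Sum>l. \<Sum>i. (norm (pd l (pd i \<eta>) x))^2))"
  unfolding norm_abs_l2[OF test_hessian[OF \<eta>]] by simp
 also have "... = (\<Sum>l. \<Sum>i. LINT x. (norm (pd l (pd i \<eta>) x))^2)"
  using in_L2_integrable[OF in_L2_test[OF test_pderiv[OF test_pderiv[OF \<eta>]]]] by simp
 also have "... = (L2n (laplacian \<eta>))^2"
  unfolding hessian_laplacian[OF \<eta>] norm_abs_l2[OF in_L2_test[OF test_laplacian[OF \<eta>]]] by (rule refl)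
 finally show ?thesis by (simp add: power2_eq_iff_nonneg)
qed

lemma div_scaled_grad:
 fixes M :: "real fn" and \<eta> :: "complex fn"
 assumes M: "test_function A M" and \<eta>: "test_function B \<eta>"
 shows "pd l (%x. M x *R grad \<eta> x) x = M x *R pd l (grad \<eta>) x + pd l M x *R grad \<eta> x"
  and "(\<Sum>i. pd i (%x. M x *R grad \<eta> x) x $ i) = M x *R laplacian \<eta> x + rdot (grad M x) (grad \<eta> x)"
proof -
 show e: "pd l (%x. M x *R grad \<eta> x) x = M x *R pd l (grad \<eta>) x + pd l M x *R grad \<eta> x" for l
  by (rule pderiv_at_scaleR[OF test_diff[OF M] test_diff[OF test_grad[OF \<eta>]]])
 show "(\<Sum>i. pd i (%x. M x *R grad \<eta> x) x $ i) = M x *R laplacian \<eta> x + rdot (grad M x) (grad \<eta> x)"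
  unfolding e rdot_grad laplacian_def sum_3 by (simp add: pderiv_at_grad[OF \<eta>] scaleR_add_right)
qed

lemma bb_rdot: "bounded_bilinear rdot" by (rule bounded_bilinear.flip[OF bounded_bilinear_rdot])

context stellar
begin

lemma s_local: "\<exists>C. AE x. x \<in> ball 0 r --> \<bar>s x\<bar> <= C"
proof -
 obtain S where S: "S > 0" "AE x. 0 < s x \<and> s x <= S" by (rule s_upper)
 show ?thesis by (rule exI[of _ S], rule eventually_mono[OF S(2)]) simp
qed

lemma inverse_s_local: "\<exists>C. AE x. x \<in> ball 0 r --> \<bar>inverse (s x)\<bar> <= C"
 by (rule s_lower[of r]) (auto elim!: eventually_mono)

lemma one_local: "\<exists>C. AE x::real^3. x \<in> ball 0 r --> \<bar>1::real\<bar> <= C"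
 by (rule exI[of _ 1]) simp

lemma b_local: "\<exists>C. AE x. x \<in> ball 0 r --> \<bar>b x $ l\<bar> <= C"
 by (rule b_bounded) (blast intro: eventually_mono order_trans[OF component_le_norm_cart])

lemma inverse_s_measurable [measurable]: "(%x. inverse (s x)) \<in> LM" by measurable

lemma s_bounded: "l2bounded (%f x. s x *R (f x :: 'a::euclidean_space))"
proof -
 obtain S where S: "S > 0" "AE x. 0 < s x \<and> s x <= S" by (rule s_upper)
 show ?thesis
  by (rule l2boundedI[of S]) (use S(1) in \<open>auto intro!: in_L2_measurable in_L2_s eventually_mono[OF S(2)] mult_right_mono\<close>)
qed

lemma flow_derivative_bounded:
 fixes M :: "real fn"
 assumes "test_function A M"
 shows "l2bounded (%f x. \<Sum>l. (b x $ l) *R (pd l M x *R (f x :: complex^3)))"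
 unfolding sum_3
 by (intro l2bounded_add weighted_test_bounded[OF bounded_bilinear_scaleR test_pderiv[OF assms] measurable_vec_nth[OF b_measurable] b_local])

lemmas mult_bounded = weighted_test_bounded[OF bounded_bilinear_scaleR _ borel_measurable_const one_local, unfolded scaleR_one]
 and inverse_s_mult_bounded = weighted_test_bounded[OF bounded_bilinear_scaleR _ inverse_s_measurable inverse_s_local]
 and s_mult_bounded = weighted_test_bounded[OF bounded_bilinear_scaleR _ s_measurable s_local]
 and rdot_bounded = weighted_test_bounded[OF bb_rdot test_grad borel_measurable_const one_local, unfolded scaleR_one]
 and inverse_s_rdot_bounded = weighted_test_bounded[OF bb_rdot test_grad inverse_s_measurable inverse_s_local]
 and s_rdot_bounded = weighted_test_bounded[OF bb_rdot test_grad s_measurable s_local]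


section \<open>Normalized sequences with vanishing residual\<close>

context
 fixes U W g :: "nat => (complex^3) fn" and D :: "nat => complex fn" and K :: "nat => real"
 assumes null: "!!n. approx_null (U n) (D n) (W n) (g n) (K n)" and K: "K ----> 0"
  and le_1: "!!n. L2n (quad (U n) (D n) (W n) (g n)) <= 1"
begin

lemma seq_adm: "adm (U n) (D n) (W n) (g n)"
 by (rule approx_nullD(3)[OF null])

lemma seq_energy: "energy (U n) (D n) (W n)"
 using seq_adm unfolding adm_def by blast

lemmas seq_L2 = adm_L2[OF seq_adm] and K_nonneg = approx_nullD(1)[OF null]

lemma seq_bounded: "Bseq (%n. abs_l2 (U n))" "Bseq (%n. abs_l2 (D n))" "Bseq (%n. abs_l2 (W n))"
 by (rule BseqI'[of _ 1], rule order_trans[OF L2n_quad_le(1)[OF seq_L2(1-4)] le_1]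
   order_trans[OF L2n_quad_le(2)[OF seq_L2(1-4)] le_1] order_trans[OF L2n_quad_le(3)[OF seq_L2(1-4)] le_1])+

text \<open>Testing a state with itself: the damping bounds the square of its U norm by the
  residual.\<close>

lemma U_limit: "(%n. abs_l2 (U n)) ----> 0"
proof -
 obtain m where m: "m > 0" "\<forall>U D W g. adm U D W g --> m * (L2n U)^2 <= norm (F (quad U D W g) (quad U D W g))"
  using Im_F_lower by (elim exE conjE)
 have "(L2n (U n))^2 <= K n / m" for n
 proof -
  have "m * (L2n (U n))^2 <= K n * L2n (quad (U n) (D n) (W n) (g n))"
   by (rule order_trans[OF m(2)[rule_format, OF seq_adm] approx_nullD(2)[OF null seq_adm]])
  also have "... <= K n * 1" by (rule mult_left_mono[OF le_1 K_nonneg])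
  finally show ?thesis using m(1) by (simp add: pos_le_divide_eq mult.commute)
 qed
 hence "(%n. (L2n (U n))^2) ----> 0"
  by (intro Lim_null_comparison[OF always_eventually tendsto_divide_zero[OF K, of m]]) simp
 thus ?thesis by (simp add: tendsto_norm_zero_iff)
qed

lemma g_limit: "(%n. abs_l2 (g n)) ----> 0"
proof -
 obtain C where C: "\<forall>U D W g K. approx_null U D W g K --> L2n g <= C * (L2n U + K)" using potential_bound by (elim exE conjE)
 have "(%n. C * (L2n (U n) + K n)) ----> 0"
  by (rule tendsto_mult_right_zero[OF tendsto_add_zero[OF tendsto_norm_zero[OF U_limit] K]])
 thus ?thesis by (rule Lim_null_comparison[OF always_eventually[OF allI], rotated]) (rule C[rule_format, OF null])
qed

text \<open>The key consequence of \<open>U_limit\<close>: any admissible test sequence with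
  \<open>U'\<close> tending to 0 and bounded derivatives sees only the principal part. The residual,
  the lower order terms and the potential coupling all vanish.\<close>

lemma principal_limit:
 assumes e: "!!n. energy (U' n) (D' n) (W' n)" and U': "(%n. abs_l2 (U' n)) ----> 0"
  and b: "Bseq (%n. abs_l2 (D' n))" "Bseq (%n. abs_l2 (W' n))"
 shows "(%n. principal (D n) (W n) (D' n) (W' n)) ----> 0"
proof -
 obtain C where C: "C >= 0" "!!Z Z'. in_L2 Z ==> in_L2 Z' ==> norm (F Z Z') <= C * L2n Z * L2n Z'" using F_bound by blast
 obtain B where B: "!!n. L2n (D' n) <= B" using b(1) by (rule BseqE) blast
 obtain B' where B': "!!n. L2n (W' n) <= B'" using b(2) by (rule BseqE) blast
 define m where "m n = L2n (U' n) + B + B'" for n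
 note z = in_L2_zero and L' = energy_L2[OF e]
 have *: "norm (principal (D n) (W n) (D' n) (W' n)) <= K n * m n + C * L2n (U n) * m n + C * 1 * L2n (U' n)" for n
 proof -
  note L = seq_L2[of n]
  have a': "adm (U' n) (D' n) (W' n) (%x. 0)" using e H1field_zero unfolding adm_def by blast
  have N: "L2n (quad (U' n) (D' n) (W' n) (%x. 0)) <= m n"
   using L2n_quad_le(5)[OF L'[of n] z] B[of n] B'[of n] by (simp add: L2n_zero m_def)
  have q: "L2n (quad f (%x. 0) (%x. 0) (%x. 0)) <= L2n f" if "in_L2 f" for f
   using L2n_quad_le(5)[OF that z z z] by (simp add: L2n_zero)
  have "L2n (quad (%x. 0) (D n) (W n) (g n)) <= L2n (quad (U n) (D n) (W n) (g n))"
   by (rule power2_le_imp_le) (simp_all add: L2n_quad[OF L(1-4)] L2n_quad[OF z L(2-4)] L2n_zero)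
  hence 1: "L2n (quad (%x. 0) (D n) (W n) (g n)) <= 1" using le_1 by (rule order_trans)
  have "norm (F (quad (U n) (D n) (W n) (g n)) (quad (U' n) (D' n) (W' n) (%x. 0))) <= K n * m n"
   by (rule order_trans[OF approx_nullD(2)[OF null a'] mult_left_mono[OF N K_nonneg]])
  moreover have "norm (F (quad (U n) (%x. 0) (%x. 0) (%x. 0)) (quad (U' n) (D' n) (W' n) (%x. 0))) <= C * L2n (U n) * m n"
   by (rule order_trans[OF C(2)[OF in_L2_quad[OF L(1) z z z] in_L2_quad[OF L' z]] mult_mono[OF mult_left_mono[OF q[OF L(1)] C(1)] N]]) (simp_all add: C(1))
  moreover have "norm (F (quad (%x. 0) (D n) (W n) (g n)) (quad (U' n) (%x. 0) (%x. 0) (%x. 0))) <= C * 1 * L2n (U' n)"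
   by (rule order_trans[OF C(2)[OF in_L2_quad[OF z L(2-4)] in_L2_quad[OF L'(1) z z z]] mult_mono[OF mult_left_mono[OF 1 C(1)] q[OF L'(1)]]]) (simp_all add: C(1))
  ultimately show ?thesis using principal_le_remainder[OF L(1-4) L'[of n]] unfolding real_norm_def by linarith
 qed
 have "(%n. K n * m n + C * L2n (U n) * m n + C * 1 * L2n (U' n)) ----> 0 * (0 + B + B') + C * 0 * (0 + B + B') + C * 1 * 0"
  unfolding m_def by (intro tendsto_intros K tendsto_norm_zero U_limit U')
 thus ?thesis using Lim_null_comparison[OF always_eventually[OF allI[OF *]]] by simp
qed

text \<open>Testing with \<open>u\<close> itself: the divergence is controlled by the directional derivative.\<close>

lemma D_limit:
 assumes W: "(%n. abs_l2 (W n)) ----> 0"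
 shows "(%n. abs_l2 (D n)) ----> 0"
proof -
 obtain c0 where c0: "c0 > 0" "AE x. c0 <= c x" by (rule sound_pos)
 have "c0\<^sup>2 * (L2n (D n))^2 <= principal (D n) (W n) (D n) (W n) + (L2n (W n))^2" for n
 proof -
  note L = seq_L2[of n]
  have "c0\<^sup>2 * (L2n (D n))^2 = (LINT x. c0\<^sup>2 * (norm (D n x))^2)" unfolding norm_abs_l2[OF L(2)] by simp
  also have "... <= (LINT x. ((c x)^2 *R D n x) \<bullet> D n x)"
  proof (rule integral_mono_AE[OF integrable_mult_right[OF in_L2_integrable[OF L(2)]] L2_inner_integrable[OF in_L2_csq[OF L(2)] L(2)]])
   show "AE x. c0\<^sup>2 * (norm (D n x))^2 <= ((c x)^2 *R D n x) \<bullet> D n x"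
    using c0(2)
   proof eventually_elim
    case (elim x)
    have "c0\<^sup>2 <= (c x)^2" using elim c0(1) by (intro power_mono) auto
    thus ?case by (simp add: mult_right_mono power2_norm_eq_inner)
   qed
  qed
  also have "... = principal (D n) (W n) (D n) (W n) + (L2n (W n))^2"
   unfolding principal_def inner_abs_l2[OF in_L2_csq[OF L(2)] L(2)] by (simp add: power2_norm_eq_inner)
  finally show ?thesis .
 qed
 hence *: "norm ((L2n (D n))^2) <= (principal (D n) (W n) (D n) (W n) + (L2n (W n))^2) / c0\<^sup>2" for n
  using c0(1) by (simp add: pos_le_divide_eq mult.commute)
 have "(%n. (principal (D n) (W n) (D n) (W n) + (L2n (W n))^2) / c0\<^sup>2) ----> (0 + 0\<^sup>2) / c0\<^sup>2"
  using c0(1) by (intro tendsto_intros principal_limit[OF seq_energy U_limit seq_bounded(2,3)] tendsto_norm_zero W) simp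
 hence "(%n. (L2n (D n))^2) ----> 0" using Lim_null_comparison[OF always_eventually[OF allI[OF *]]] by simp
 thus ?thesis by (simp add: tendsto_norm_zero_iff)
qed

lemmas csqD = l2bounded_L2[OF csq_bounded seq_L2(2)] l2bounded_Bseq[OF csq_bounded seq_L2(2) seq_bounded(2)]

text \<open>Testing with \<open>M u\<close> for a cut-off \<open>M\<close> bounds the directional derivative by the divergence.\<close>

lemma flow_limit:
 fixes M :: "real fn"
 assumes M: "test M" and low: "AE x. norm x <= r1 --> \<mu> <= M x"
 shows "\<exists>e. e ----> 0 \<and> (\<forall>n. \<mu> * (L2n (W n))^2 <= abs_l2 (%x. (c x)^2 *R D n x) \<bullet> abs_l2 (%x. M x *R D n x) + e n)"
proof -
 let ?MD = "%n x. M x *R D n x" and ?MW = "%n x. M x *R W n x"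
  and ?e = "%n x. rdot (grad M x) (U n x)" and ?f = "%n x. \<Sum>l. (b x $ l) *R (pd l M x *R U n x)"
 note L = l2bounded_L2[OF mult_bounded[OF M] seq_L2(2)] l2bounded_L2[OF rdot_bounded[OF M] seq_L2(1)]
  l2bounded_L2[OF mult_bounded[OF M] seq_L2(3)] l2bounded_L2[OF flow_derivative_bounded[OF M] seq_L2(1)]
 have lim: "(%n. abs_l2 (?e n)) ----> 0" "(%n. abs_l2 (?f n)) ----> 0"
  by (rule l2bounded_null[OF rdot_bounded[OF M] seq_L2(1) U_limit], rule l2bounded_null[OF flow_derivative_bounded[OF M] seq_L2(1) U_limit])
 let ?P = "%n. principal (D n) (W n) (%x. ?MD n x + ?e n x) (%x. ?MW n x + ?f n x)"
 let ?k = "%n. abs_l2 (%x. (c x)^2 *R D n x)"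
 let ?r = "%n. ?k n \<bullet> abs_l2 (?e n) - abs_l2 (W n) \<bullet> abs_l2 (?f n) - ?P n"
 have P: "?P ----> 0"
  by (rule principal_limit[OF energy_mult[OF seq_energy M] l2bounded_null[OF mult_bounded[OF M] seq_L2(1) U_limit]
     l2_Bseq_add[OF L(1,2) l2bounded_Bseq[OF mult_bounded[OF M] seq_L2(2) seq_bounded(2)] lim(1)]
     l2_Bseq_add[OF L(3,4) l2bounded_Bseq[OF mult_bounded[OF M] seq_L2(3) seq_bounded(3)] lim(2)]])
 have "\<mu> * (L2n (W n))^2 <= ?k n \<bullet> abs_l2 (?MD n) + ?r n" for n
 proof -
  have "\<mu> * (L2n (W n))^2 = (LINT x. \<mu> * (norm (W n x))^2)" unfolding norm_abs_l2[OF seq_L2(3)] by simp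
  also have "... <= (LINT x. W n x \<bullet> ?MW n x)"
  proof (rule integral_mono_AE[OF integrable_mult_right[OF in_L2_integrable[OF seq_L2(3)]] L2_inner_integrable[OF seq_L2(3) L(3)]])
   \<comment> \<open>Outside the closed ball of radius \<open>r1\<close> the field
     \<open>W n\<close> vanishes, so the lower bound on \<open>M\<close> matters only
     inside.\<close>
   show "AE x. \<mu> * (norm (W n x))^2 <= W n x \<bullet> ?MW n x"
    using low energy_support[OF seq_energy[of n]]
   proof eventually_elim
    case (elim y)
    thus ?case by (cases "norm y <= r1") (simp_all add: power2_norm_eq_inner mult_right_mono)
   qed
  qed
  also have "... = abs_l2 (W n) \<bullet> abs_l2 (?MW n)" by (rule inner_abs_l2[symmetric, OF seq_L2(3) L(3)])
  finally show ?thesis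
   unfolding principal_def abs_l2_add[OF L(1,2), symmetric] abs_l2_add[OF L(3,4), symmetric] inner_add_right by linarith
 qed
 moreover have "?r ----> 0 - 0 - 0"
  by (intro tendsto_diff P inner_null csqD seq_bounded lim)
 ultimately show ?thesis by (intro exI[of _ ?r] conjI allI) simp_all
qed

text \<open>By density of gradients, \<open>M\<^sub>1 u\<close> may be replaced by some \<open>\<nabla>\<eta>\<close> with almost the same divergence.
 Testing with \<open>M\<^sub>2 \<nabla>\<eta>\<close> is decisive because \<open>\<parallel>Hess \<eta>\<parallel> = \<parallel>\<Delta>\<eta>\<parallel>\<close>, so that its directional derivative is
 controlled by its divergence.\<close>

lemma gradient_limit:
 fixes M1 M2 :: "real fn"
 assumes M1: "test M1" and M2: "test M2" and \<kappa>: "0 <= \<kappa>"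
  and slow: "AE x. \<bar>s x * M2 x\<bar> * norm (b x) <= \<kappa>"
 shows "\<exists>e. e ----> 0 \<and> (\<forall>n. abs_l2 (%x. (c x)^2 *R D n x) \<bullet> abs_l2 (%x. (M1 x * M2 x) *R D n x)
   <= \<kappa> * L2n (W n) * L2n (%x. inverse (s x) *R (M1 x *R D n x)) + e n)"
proof -
 let ?f = "%n x. inverse (s x) *R (M1 x *R U n x)"
  and ?d1 = "%n x. inverse (s x) *R (M1 x *R D n x)" and ?d2 = "%n x. inverse (s x) *R rdot (grad M1 x) (U n x)"
 \<comment> \<open>With U = s u, \<open>?f n\<close> is M1 u and \<open>d n\<close> its divergence:
   \<open>?d1\<close> carries div u, and \<open>?d2\<close>, with the gradient of \<open>M1\<close>,
   tends to 0.\<close>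
 define d where "d = (%n x. ?d1 n x + ?d2 n x)"
 note f = l2bounded_L2[OF inverse_s_mult_bounded[OF M1] seq_L2(1)] l2bounded_null[OF inverse_s_mult_bounded[OF M1] seq_L2(1) U_limit]
  and d1 = l2bounded_L2[OF inverse_s_mult_bounded[OF M1] seq_L2(2)] l2bounded_Bseq[OF inverse_s_mult_bounded[OF M1] seq_L2(2) seq_bounded(2)]
  and d2 = l2bounded_L2[OF inverse_s_rdot_bounded[OF M1] seq_L2(1)] l2bounded_null[OF inverse_s_rdot_bounded[OF M1] seq_L2(1) U_limit]
 have dL: "in_L2 (d n)" for n unfolding d_def by (rule in_L2_add[OF d1(1) d2(1)])
 have "\<forall>n. \<exists>\<eta>. test \<eta> \<and> norm (abs_l2 (laplacian \<eta>) - abs_l2 (d n)) < inverse (real (Suc n)) \<and> L2n (grad \<eta>) < L2n (?f n) + inverse (real (Suc n))"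
 proof
  fix n
  have pos: "0 < inverse (real (Suc n))" by simp
  have div: "has_weak_div (?f n) (d n)"
  proof (rule X_of_energy(4)[OF energy_mult[OF seq_energy M1]])
   show "AE x. M1 x *R U n x = s x *R inverse (s x) *R M1 x *R U n x" using s_pos by eventually_elim simp
   show "AE x. M1 x *R D n x + rdot (grad M1 x) (U n x) = s x *R d n x"
    unfolding d_def using s_pos by eventually_elim (simp add: scaleR_add_right)
   show "AE x. M1 x *R W n x + (\<Sum>l. b x $ l *R pd l M1 x *R U n x)
     = s x *R (inverse (s x) *R (M1 x *R W n x + (\<Sum>l. b x $ l *R pd l M1 x *R U n x)))"
    using s_pos by eventually_elim simp
  qed
  show "\<exists>\<eta>. test \<eta> \<and> norm (abs_l2 (laplacian \<eta>) - abs_l2 (d n)) < inverse (real (Suc n)) \<and> L2n (grad \<eta>) < L2n (?f n) + inverse (real (Suc n))"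
   by (rule test_grad_dense[OF f(1) dL div pos]) blast
 qed
 from choice[OF this] obtain \<eta> where \<eta>: "!!n. test (\<eta> n)"
  and \<eta>d: "!!n. norm (abs_l2 (laplacian (\<eta> n)) - abs_l2 (d n)) < inverse (real (Suc n))"
  and \<eta>f: "!!n. L2n (grad (\<eta> n)) < L2n (?f n) + inverse (real (Suc n))" by blast
 note gL = in_L2_test[OF test_grad[OF \<eta>]] and lL = in_L2_test[OF test_laplacian[OF \<eta>]]
 \<comment> \<open>As M1 u tends to 0 in norm, the norm bound on the gradients suffices; every term
   with a derivative of \<open>M2\<close> then vanishes in the limit.\<close>
 have g: "(%n. abs_l2 (grad (\<eta> n))) ----> 0"
  by (rule Lim_null_comparison[OF always_eventually[OF allI[OF less_imp_le[OF \<eta>f]]] tendsto_add_zero[OF tendsto_norm_zero[OF f(2)] LIMSEQ_inverse_real_of_nat]])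
 have l: "(%n. abs_l2 (%x. laplacian (\<eta> n) x - d n x)) ----> 0"
  unfolding abs_l2_diff[OF lL dL, symmetric]
  by (rule Lim_null_comparison[OF always_eventually[OF allI[OF less_imp_le[OF \<eta>d]]] LIMSEQ_inverse_real_of_nat])
 have lB: "Bseq (%n. abs_l2 (laplacian (\<eta> n)))"
 proof -
  have "Bseq (%n. abs_l2 (d n))" unfolding d_def by (rule l2_Bseq_add[OF d1(1) d2(1) d1(2) d2(2)])
  from l2_Bseq_add[where f=d and g="%n x. laplacian (\<eta> n) x - d n x", OF dL in_L2_diff[OF lL dL] this l]
  show ?thesis by simp
 qed
 let ?D1 = "%n x. s x *R (M2 x *R laplacian (\<eta> n) x)" and ?e1 = "%n x. s x *R rdot (grad M2 x) (grad (\<eta> n) x)"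
  and ?W1 = "%n x. s x *R (M2 x *R (\<Sum>l. (b x $ l) *R pd l (grad (\<eta> n)) x))"
  and ?e2 = "%n x. s x *R (\<Sum>l. (b x $ l) *R (pd l M2 x *R grad (\<eta> n) x))"
  and ?e3 = "%n x. s x *R (M2 x *R (laplacian (\<eta> n) x - d n x))" and ?e4 = "%n x. s x *R (M2 x *R ?d2 n x)"
  and ?MD = "%n x. (M1 x * M2 x) *R D n x" and ?k = "%n. abs_l2 (%x. (c x)^2 *R D n x)" and ?w = "%n. abs_l2 (W n)"
 note flow = l2bounded_comp[OF s_bounded flow_derivative_bounded[OF M2]]
 note D1 = l2bounded_L2[OF s_mult_bounded[OF M2] lL] l2bounded_Bseq[OF s_mult_bounded[OF M2] lL lB]
  and e1 = l2bounded_L2[OF s_rdot_bounded[OF M2] gL] l2bounded_null[OF s_rdot_bounded[OF M2] gL g]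
  and e2 = l2bounded_L2[OF flow gL] l2bounded_null[OF flow gL g]
  and e3 = l2bounded_L2[OF s_mult_bounded[OF M2] in_L2_diff[OF lL dL]] l2bounded_null[OF s_mult_bounded[OF M2] in_L2_diff[OF lL dL] l]
  and e4 = l2bounded_L2[OF s_mult_bounded[OF M2] d2(1)] l2bounded_null[OF s_mult_bounded[OF M2] d2]
  and sd1 = l2bounded_L2[OF s_mult_bounded[OF M2] d1(1)]
 have W1L: "in_L2 (?W1 n)" for n
  by (rule l2bounded_L2[OF s_mult_bounded[OF M2] in_L2_b[OF in_L2_test[OF test_pderiv[OF test_grad[OF \<eta>]]]]])
 \<comment> \<open>The decisive estimate: the directional derivative of the gradient is bounded
   pointwise by |b| times the Hessian, whose norm is that of the Laplacian.\<close>
 have W1: "L2n (?W1 n) <= \<kappa> * L2n (laplacian (\<eta> n))" for n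
  unfolding L2n_hessian[OF \<eta>, symmetric]
 proof (rule abs_l2_mono[OF W1L test_hessian[OF \<eta>] \<kappa>])
  show "AE x. norm (?W1 n x) <= \<kappa> * norm (hessian (\<eta> n) x)"
   using slow
  proof eventually_elim
   case (elim y)
   have "norm (?W1 n y) = \<bar>s y * M2 y\<bar> * norm (\<Sum>l. (b y $ l) *R pd l (grad (\<eta> n)) y)" by (simp add: abs_mult)
   also have "... <= \<bar>s y * M2 y\<bar> * (norm (b y) * norm (hessian (\<eta> n) y))"
    unfolding hessian_def by (intro mult_left_mono norm_weighted_sum_le abs_ge_zero)
   also have "... <= \<kappa> * norm (hessian (\<eta> n) y)" unfolding mult.assoc[symmetric] using elim by (intro mult_right_mono) auto
   finally show ?case .
  qed
 qed
 have W1B: "Bseq (%n. abs_l2 (?W1 n))"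
 proof -
  obtain B where "!!n. L2n (laplacian (\<eta> n)) <= B" using lB by (rule BseqE) blast
  thus ?thesis by (intro BseqI'[of _ "\<kappa> * B"] order_trans[OF W1 mult_left_mono[OF _ \<kappa>]])
 qed
 let ?P = "%n. principal (D n) (W n) (%x. ?D1 n x + ?e1 n x) (%x. ?W1 n x + ?e2 n x)"
 have P: "?P ----> 0"
 proof (rule principal_limit[OF _ l2bounded_null[OF s_mult_bounded[OF M2] gL g] l2_Bseq_add[OF D1(1) e1(1) D1(2) e1(2)] l2_Bseq_add[OF W1L e2(1) W1B e2(2)]])
  fix n
  let ?v = "%x. M2 x *R grad (\<eta> n) x"
  have eD: "(%x. s x *R (\<Sum>i. pd i ?v x $ i)) = (%x. ?D1 n x + ?e1 n x)"
   unfolding div_scaled_grad(2)[OF M2 \<eta>] by (simp add: scaleR_add_right)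
  have eW: "(%x. s x *R (\<Sum>l. (b x $ l) *R pd l ?v x)) = (%x. ?W1 n x + ?e2 n x)"
   unfolding div_scaled_grad(1)[OF M2 \<eta>] by (simp add: sum_3 scaleR_add_right algebra_simps)
  show "energy (%x. s x *R (M2 x *R grad (\<eta> n) x)) (%x. ?D1 n x + ?e1 n x) (%x. ?W1 n x + ?e2 n x)"
   using energy_test[OF test_scaleR_left[OF M2 test_smooth[OF test_grad[OF \<eta>[of n]]]]] unfolding eD eW .
 qed
 \<comment> \<open>Collects the tested form, the part of the Laplacian bound due to
   \<open>?d2\<close> and the approximation error, and the pairings of bounded with null
   sequences.\<close>
 let ?e = "%n. ?P n + \<kappa> * 1 * (L2n (?d2 n) + inverse (real (Suc n))) + ?w n \<bullet> abs_l2 (?e2 n) - ?k n \<bullet> abs_l2 (?e1 n) - ?k n \<bullet> abs_l2 (?e3 n) - ?k n \<bullet> abs_l2 (?e4 n)"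
 have "?k n \<bullet> abs_l2 (?MD n) <= \<kappa> * L2n (W n) * L2n (?d1 n) + ?e n" for n
 proof -
  \<comment> \<open>The factors \<open>s\<close> of the test field and its reciprocal in M1 u
    cancel, leaving the weight M1 M2.\<close>
  have MDae: "AE x. s x *R (M2 x *R ?d1 n x) = ?MD n x"
   using s_pos by eventually_elim (simp add: mult_ac)
  have "?D1 n = (%x. (s x *R (M2 x *R ?d1 n x) + ?e4 n x) + ?e3 n x)"
   unfolding d_def by (simp add: scaleR_diff_right scaleR_add_right)
  moreover have "abs_l2 (%x. s x *R (M2 x *R ?d1 n x)) = abs_l2 (?MD n)"
   using abs_l2_eq_iff[OF sd1 in_L2_AE[OF sd1 MDae]] MDae by blast
  ultimately have D1eq: "abs_l2 (?D1 n) = abs_l2 (?MD n) + abs_l2 (?e4 n) + abs_l2 (?e3 n)"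
   by (simp only: abs_l2_add[OF in_L2_add[OF sd1 e4(1)] e3(1), symmetric] abs_l2_add[OF sd1 e4(1), symmetric])
  have nl: "L2n (laplacian (\<eta> n)) <= L2n (?d1 n) + (L2n (?d2 n) + inverse (real (Suc n)))"
   using norm_triangle_sub[of "abs_l2 (laplacian (\<eta> n))" "abs_l2 (d n)"] \<eta>d[of n] L2n_triangle[OF d1(1)[of n] d2(1)[of n]] unfolding d_def by linarith
  have "?w n \<bullet> abs_l2 (?W1 n) <= L2n (W n) * (\<kappa> * (L2n (?d1 n) + (L2n (?d2 n) + inverse (real (Suc n)))))"
   by (rule order_trans[OF norm_cauchy_schwarz mult_left_mono[OF order_trans[OF W1 mult_left_mono[OF nl \<kappa>]] norm_ge_zero]])
  also have "... = \<kappa> * L2n (W n) * L2n (?d1 n) + \<kappa> * L2n (W n) * (L2n (?d2 n) + inverse (real (Suc n)))" by (simp add: distrib_left mult_ac)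
  also have "... <= \<kappa> * L2n (W n) * L2n (?d1 n) + \<kappa> * 1 * (L2n (?d2 n) + inverse (real (Suc n)))"
   using order_trans[OF L2n_quad_le(3)[OF seq_L2(1-4)] le_1, of n] \<kappa> by (intro add_left_mono mult_right_mono mult_left_mono) auto
  finally show ?thesis
   unfolding principal_def abs_l2_add[OF D1(1) e1(1), symmetric] abs_l2_add[OF W1L e2(1), symmetric] D1eq inner_add_right by linarith
 qed
 moreover have "?e ----> 0 + \<kappa> * 1 * (0 + 0) + 0 - 0 - 0 - 0"
  by (intro tendsto_diff tendsto_add tendsto_mult tendsto_const P inner_null csqD seq_bounded e1(2) e2(2) e3(2) e4(2) LIMSEQ_inverse_real_of_nat tendsto_norm_zero d2(2))
 ultimately show ?thesis by (intro exI[of _ ?e] conjI allI) simp_all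
qed

end

end

text \<open>\<open>w\<close> is the flow norm, \<open>S\<close> the weighted divergence pairing and
  \<open>T\<close> the norm of the divergence of M1 u up to lower order. The product \<kappa> w T is
  at most l (\<nu> w) sqrt S with l = \<kappa> sqrt \<tau> / \<nu> < 1, hence at most l (S + e1),
  and is absorbed into \<open>S\<close>.\<close>

lemma absorb_product:
 fixes S w T e1 e2 \<kappa> \<tau> \<nu> :: real
 assumes pos: "0 <= S" "0 <= w" "0 <= T" "0 <= e1" "0 <= e2" "0 <= \<kappa>" "0 <= \<tau>" "0 < \<nu>"
  and 1: "\<nu>\<^sup>2 * w\<^sup>2 <= S + e1" and 2: "S <= \<kappa> * w * T + e2" and 3: "T\<^sup>2 <= \<tau> * S"
  and small: "\<kappa> * sqrt \<tau> / \<nu> < 1"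
 shows "w\<^sup>2 <= ((e1 + e2) / (1 - \<kappa> * sqrt \<tau> / \<nu>) + e1) / \<nu>\<^sup>2"
proof -
 define l where "l = \<kappa> * sqrt \<tau> / \<nu>"
 have l: "0 <= l" "l < 1" using pos small unfolding l_def by simp_all
 have T: "T <= sqrt \<tau> * sqrt S" using 3 pos(3) by (simp add: real_le_rsqrt flip: real_sqrt_mult)
 have "\<kappa> * w * T <= \<kappa> * w * (sqrt \<tau> * sqrt S)" using T pos by (intro mult_left_mono) auto
 also have "... = l * ((\<nu> * w) * sqrt S)" using pos(8) by (simp add: l_def)
 also have "... <= l * (S + e1)"
 proof (rule mult_left_mono[OF _ l(1)])
  \<comment> \<open>The arithmetic-geometric inequality with constant exactly 1, so that no part of
    the margin 1 - l is spent.\<close>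
  have "0 <= (\<nu> * w - sqrt S)^2" by simp
  also have "... = \<nu>\<^sup>2 * w\<^sup>2 + S - 2 * ((\<nu> * w) * sqrt S)" using pos(1) by (simp add: power2_diff power_mult_distrib)
  finally have "2 * ((\<nu> * w) * sqrt S) <= 2 * S + e1" using 1 by linarith
  thus "(\<nu> * w) * sqrt S <= S + e1" using pos(4) by linarith
 qed
 finally have "S <= l * S + l * e1 + e2" using 2 by (simp add: distrib_left)
 also have "... <= l * S + 1 * e1 + e2" using l pos by (intro add_mono mult_right_mono) auto
 finally have "(1 - l) * S <= e1 + e2" by (simp add: algebra_simps)
 hence "S <= (e1 + e2) / (1 - l)" using l(2) by (simp add: pos_le_divide_eq mult.commute)
 with 1 have "\<nu>\<^sup>2 * w\<^sup>2 <= (e1 + e2) / (1 - l) + e1" by (simp add: distrib_right)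
 hence "w\<^sup>2 <= ((e1 + e2) / (1 - l) + e1) / \<nu>\<^sup>2" using pos(8) by (simp add: pos_le_divide_eq mult.commute)
 thus ?thesis unfolding l_def by simp
qed

text \<open>The expression is continuous in \<delta> and equals \<beta> at \<delta> = 0.\<close>

lemma weight_ratio_small:
 fixes \<beta> :: real
 assumes "0 <= \<beta>" "\<beta> < 1"
 shows "\<exists>\<delta>>0. \<delta> < 1 \<and> (1 + \<delta>) * \<beta> * sqrt ((1 + \<delta>) / (1 - \<delta>)) / (1 - \<delta>) < 1"
proof -
 have "((\<lambda>\<delta>. (1 + \<delta>) * \<beta> * sqrt ((1 + \<delta>) / (1 - \<delta>)) / (1 - \<delta>)) \<longlongrightarrow> (1 + 0) * \<beta> * sqrt ((1 + 0) / (1 - 0)) / (1 - 0)) (at_right 0)"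
  by (intro tendsto_intros) auto
 hence "\<forall>\<^sub>F \<delta> in at_right 0. (1 + \<delta>) * \<beta> * sqrt ((1 + \<delta>) / (1 - \<delta>)) / (1 - \<delta>) < 1"
  by (rule order_tendstoD(2)) (use assms in simp)
 moreover have "\<forall>\<^sub>F \<delta> in at_right (0::real). \<delta> < 1" by (rule order_tendstoD(2)[OF tendsto_ident_at]) simp
 moreover have "\<forall>\<^sub>F \<delta> in at_right (0::real). 0 < \<delta>" by (simp add: eventually_at_right_less)
 ultimately have "\<forall>\<^sub>F \<delta> in at_right (0::real). 0 < \<delta> \<and> \<delta> < 1 \<and> (1 + \<delta>) * \<beta> * sqrt ((1 + \<delta>) / (1 - \<delta>)) / (1 - \<delta>) < 1"
  by eventually_elim blast
 from eventually_happens[OF this] show ?thesis by (auto simp: trivial_limit_at_right_real)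
qed

context stellar
begin

text \<open>Rewrites the weight estimates in the form used by the tests. The last bound rests on the
  common cut-off: t = M1/s is at most (1 + \<delta>) \<kappa> c, while (1 - \<delta>) \<kappa> c t
  is at most c^2 M1 M2.\<close>

lemma weights:
 assumes \<delta>: "0 < \<delta>" "\<delta> < 1"
 obtains M1 M2 :: "real fn" where "test M1" "test M2"
  "AE x. norm x <= r1 --> (1 - \<delta>)^2 <= M1 x * M2 x"
  "AE x. \<bar>s x * M2 x\<bar> * norm (b x) <= (1 + \<delta>) * \<beta>"
  "AE x. 0 <= M1 x * M2 x \<and> (inverse (s x) * M1 x)^2 <= (1 + \<delta>) / (1 - \<delta>) * ((c x)^2 * (M1 x * M2 x))"
proof -
 obtain c0 where c0: "c0 > 0" "AE x. c0 <= c x" by (rule sound_pos)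
 obtain \<rho>0 where \<rho>0: "\<rho>0 > 0" "AE x. x \<in> ball 0 R --> \<rho>0 <= \<rho> x" by (rule rho_ball)
 have c0': "AE x. x \<in> ball 0 R --> c0 <= c x" using c0(2) by eventually_elim simp
 obtain M1 M2 \<kappa> :: "real fn" where M: "test_function (ball 0 R) M1" "test_function (ball 0 R) M2"
  and \<kappa>: "!!x. 0 <= \<kappa> x" "!!x. \<kappa> x <= 1" "!!x. norm x <= r1 ==> \<kappa> x = 1"
  and b1: "AE x. (1 - \<delta>) * (\<kappa> x * (c x * sqrt (\<rho> x))) <= M1 x \<and> M1 x <= (1 + \<delta>) * (\<kappa> x * (c x * sqrt (\<rho> x)))"
  and b2: "AE x. (1 - \<delta>) * (\<kappa> x * inverse (c x * sqrt (\<rho> x))) <= M2 x \<and> M2 x <= (1 + \<delta>) * (\<kappa> x * inverse (c x * sqrt (\<rho> x)))"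
  by (rule smooth_weights[OF W1inf r1(1) R c0(1) c0' \<rho>0 \<delta>]) blast
 note b1 = b1[folded s_def] and b2 = b2[folded s_def]
 have key: "AE x. 0 < s x \<and> 0 < c x \<and> 0 <= M1 x \<and> 0 <= M2 x
   \<and> inverse (s x) * M1 x <= (1 + \<delta>) * (\<kappa> x * c x) \<and> (1 - \<delta>) * (\<kappa> x * c x) * (inverse (s x) * M1 x) <= (c x)^2 * (M1 x * M2 x)
   \<and> s x * M2 x * c x <= 1 + \<delta> \<and> (norm x <= r1 --> (1 - \<delta>)^2 <= M1 x * M2 x)"
  using b1 b2 s_pos c0(2)
 proof eventually_elim
  case (elim x)
  have p: "0 < s x" "0 < c x" using elim(3,4) c0(1) by auto
  have k: "0 <= \<kappa> x" "\<kappa> x <= 1" by (rule \<kappa>)+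
  have M10: "0 <= M1 x"
   by (rule order_trans[OF _ conjunct1[OF elim(1)]]) (use p k \<delta> in simp)
  have M20: "0 <= M2 x"
   by (rule order_trans[OF _ conjunct1[OF elim(2)]]) (use p k \<delta> in simp)
  have "inverse (s x) * M1 x <= inverse (s x) * ((1 + \<delta>) * (\<kappa> x * (c x * s x)))" using elim(1) p by (intro mult_left_mono) auto
  also have "... = (1 + \<delta>) * (\<kappa> x * c x)" using p by simp
  finally have 1: "inverse (s x) * M1 x <= (1 + \<delta>) * (\<kappa> x * c x)" .
  have "(1 - \<delta>) * (\<kappa> x * c x) * (inverse (s x) * M1 x) = (c x)^2 * (M1 x * ((1 - \<delta>) * (\<kappa> x * inverse (c x * s x))))"
   using p by (simp add: field_simps power2_eq_square)
  also have "... <= (c x)^2 * (M1 x * M2 x)" using elim(2) M10 by (intro mult_left_mono) auto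
  finally have 2: "(1 - \<delta>) * (\<kappa> x * c x) * (inverse (s x) * M1 x) <= (c x)^2 * (M1 x * M2 x)" .
  have "s x * M2 x * c x <= s x * ((1 + \<delta>) * (\<kappa> x * inverse (c x * s x))) * c x"
   using elim(2) p by (intro mult_right_mono mult_left_mono) auto
  also have "... = (1 + \<delta>) * \<kappa> x" using p by (simp add: field_simps)
  also have "... <= (1 + \<delta>) * 1" using k \<delta> by (intro mult_left_mono) auto
  finally have 3: "s x * M2 x * c x <= 1 + \<delta>" by simp
  have 4: "(1 - \<delta>)^2 <= M1 x * M2 x" if "norm x <= r1"
  proof -
   have "(1 - \<delta>)^2 = ((1 - \<delta>) * (\<kappa> x * (c x * s x))) * ((1 - \<delta>) * (\<kappa> x * inverse (c x * s x)))"
    using p \<kappa>(3)[OF that] by (simp add: power2_eq_square field_simps)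
   also have "... <= M1 x * M2 x" using elim(1,2) M10 p k \<delta> by (intro mult_mono) auto
   finally show ?thesis .
  qed
  show ?case using p M10 M20 1 2 3 4 by blast
 qed
 show ?thesis
 proof (rule that[of M1 M2])
  show "test M1" "test M2" by (rule test_mono[OF M(1)], simp, rule test_mono[OF M(2)], simp)
  show "AE x. norm x <= r1 --> (1 - \<delta>)^2 <= M1 x * M2 x" using key by eventually_elim blast
  show "AE x. \<bar>s x * M2 x\<bar> * norm (b x) <= (1 + \<delta>) * \<beta>"
   using key mach(3)
  proof eventually_elim
   case (elim x)
   have "\<bar>s x * M2 x\<bar> = s x * M2 x" using elim by simp
   hence "\<bar>s x * M2 x\<bar> * norm (b x) <= s x * M2 x * (\<beta> * c x)" using elim by (simp add: mult_left_mono)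
   also have "... = s x * M2 x * c x * \<beta>" by simp
   also have "... <= (1 + \<delta>) * \<beta>" using elim mach(1) by (intro mult_right_mono) auto
   finally show ?case .
  qed
  show "AE x. 0 <= M1 x * M2 x \<and> (inverse (s x) * M1 x)^2 <= (1 + \<delta>) / (1 - \<delta>) * ((c x)^2 * (M1 x * M2 x))"
   using key
  proof eventually_elim
   case (elim x)
   let ?t = "inverse (s x) * M1 x"
   have t: "0 <= ?t" using elim by simp
   have "?t\<^sup>2 <= ((1 + \<delta>) * (\<kappa> x * c x)) * ?t" unfolding power2_eq_square using elim t by (intro mult_right_mono) auto
   also have "... = (1 + \<delta>) / (1 - \<delta>) * ((1 - \<delta>) * (\<kappa> x * c x) * ?t)" using \<delta> by simp
   also have "... <= (1 + \<delta>) / (1 - \<delta>) * ((c x)^2 * (M1 x * M2 x))" using elim \<delta> by (intro mult_left_mono) auto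
   finally show ?case using elim by simp
  qed
 qed
qed

text \<open>The cut-off test with M = M1 M2 bounds the flow norm by the weighted divergence, and the
  gradient test bounds that divergence by a product containing the flow norm. The loop closes with a
  constant below 1, after which \<open>D_limit\<close> and \<open>g_limit\<close> handle the
  rest.\<close>

theorem coercivity:
 assumes null: "!!n. approx_null (U n) (D n) (W n) (g n) (K n)" and K: "K ----> 0"
  and le_1: "!!n. L2n (quad (U n) (D n) (W n) (g n)) <= 1"
 shows "(%n. L2n (quad (U n) (D n) (W n) (g n))) ----> 0"
proof -
 note seq = null K le_1 and L = adm_L2[OF approx_nullD(3)[OF null]]
 obtain \<delta> where \<delta>: "0 < \<delta>" "\<delta> < 1" and ratio: "(1 + \<delta>) * \<beta> * sqrt ((1 + \<delta>) / (1 - \<delta>)) / (1 - \<delta>) < 1"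
  using weight_ratio_small[OF mach(1,2)] by blast
 let ?\<tau> = "(1 + \<delta>) / (1 - \<delta>)" and ?\<kappa> = "(1 + \<delta>) * \<beta>"
 obtain M1 M2 :: "real fn" where M: "test M1" "test M2"
  and low: "AE x. norm x <= r1 --> (1 - \<delta>)^2 <= M1 x * M2 x"
  and slow: "AE x. \<bar>s x * M2 x\<bar> * norm (b x) <= ?\<kappa>"
  and cmp: "AE x. 0 <= M1 x * M2 x \<and> (inverse (s x) * M1 x)^2 <= ?\<tau> * ((c x)^2 * (M1 x * M2 x))"
  by (rule weights[OF \<delta>])
 have \<kappa>: "0 <= ?\<kappa>" and \<tau>: "0 <= ?\<tau>" using \<delta> mach(1) by simp_all
 have MM: "test (%x. M1 x * M2 x)" by (rule test_mult_left[OF M(1) test_smooth[OF M(2)]])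
 \<comment> \<open>The common quantity of both tests: the divergence pairing with weight c^2 M1 M2.
   \<open>T n\<close> is the norm of M1 div u, the leading part of the divergence of M1 u.\<close>
 define S where "S n = abs_l2 (%x. (c x)^2 *R D n x) \<bullet> abs_l2 (%x. (M1 x * M2 x) *R D n x)" for n
 define T where "T n = L2n (%x. inverse (s x) *R (M1 x *R D n x))" for n
 obtain e1 where e1: "e1 ----> 0" "\<forall>n. (1 - \<delta>)^2 * (L2n (W n))^2 <= S n + e1 n"
  using flow_limit[OF seq MM low] unfolding S_def by (elim exE conjE)
 obtain e2 where e2: "e2 ----> 0" "\<forall>n. S n <= ?\<kappa> * L2n (W n) * T n + e2 n"
  using gradient_limit[OF seq M \<kappa> slow] unfolding S_def T_def by (elim exE conjE)
 have "(L2n (W n))^2 <= ((\<bar>e1 n\<bar> + \<bar>e2 n\<bar>) / (1 - ?\<kappa> * sqrt ?\<tau> / (1 - \<delta>)) + \<bar>e1 n\<bar>) / (1 - \<delta>)^2" for n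
 proof -
  have L1: "in_L2 (%x. (M1 x * M2 x) *R D n x)" by (rule in_L2_test_mult[OF MM L(2)])
  have L2: "in_L2 (%x. inverse (s x) *R (M1 x *R D n x))" by (rule l2bounded_L2[OF inverse_s_mult_bounded[OF M(1)] L(2)])
  have Sint: "S n = (LINT x. ((c x)^2 *R D n x) \<bullet> ((M1 x * M2 x) *R D n x))"
   unfolding S_def by (rule inner_abs_l2[OF in_L2_csq[OF L(2)] L1])
  have f0: "0 <= S n"
   unfolding Sint by (rule integral_nonneg_AE) (use cmp in \<open>eventually_elim, simp\<close>)
  have "(T n)^2 = (LINT x. (norm (inverse (s x) *R (M1 x *R D n x)))^2)" unfolding T_def by (rule norm_abs_l2[OF L2])
  also have "... <= (LINT x. ?\<tau> * (((c x)^2 *R D n x) \<bullet> ((M1 x * M2 x) *R D n x)))"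
  proof (rule integral_mono_AE[OF in_L2_integrable[OF L2] integrable_mult_right[OF L2_inner_integrable[OF in_L2_csq[OF L(2)] L1]]])
   show "AE x. (norm (inverse (s x) *R (M1 x *R D n x)))^2 <= ?\<tau> * (((c x)^2 *R D n x) \<bullet> ((M1 x * M2 x) *R D n x))"
    using cmp
   proof eventually_elim
    case (elim x)
    have "(norm (inverse (s x) *R (M1 x *R D n x)))^2 = (inverse (s x) * M1 x)^2 * (norm (D n x))^2"
     by (simp add: power_mult_distrib)
    also have "... <= (?\<tau> * ((c x)^2 * (M1 x * M2 x))) * (norm (D n x))^2" using elim by (intro mult_right_mono) auto
    also have "... = ?\<tau> * (((c x)^2 *R D n x) \<bullet> ((M1 x * M2 x) *R D n x))" by (simp add: power2_norm_eq_inner)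
    finally show ?case .
   qed
  qed
  also have "... = ?\<tau> * S n" unfolding Sint by (rule integral_mult_right_zero)
  finally have f3: "(T n)^2 <= ?\<tau> * S n" .
  show ?thesis
  proof (rule absorb_product[where S="S n" and T="T n"])
   \<comment> \<open>The remainders have no sign, whereas \<open>absorb_product\<close> needs
     nonnegative ones.\<close>
   show "(1 - \<delta>)^2 * (L2n (W n))^2 <= S n + \<bar>e1 n\<bar>" using spec[OF e1(2), of n] by linarith
   show "S n <= ?\<kappa> * L2n (W n) * T n + \<bar>e2 n\<bar>" using spec[OF e2(2), of n] by linarith
  qed (use f0 f3 \<kappa> \<tau> \<delta> ratio in \<open>simp_all add: T_def\<close>)
 qed
 hence *: "norm ((L2n (W n))^2) <= ((\<bar>e1 n\<bar> + \<bar>e2 n\<bar>) / (1 - ?\<kappa> * sqrt ?\<tau> / (1 - \<delta>)) + \<bar>e1 n\<bar>) / (1 - \<delta>)^2" for n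
  by simp
 have "(%n. ((\<bar>e1 n\<bar> + \<bar>e2 n\<bar>) / (1 - ?\<kappa> * sqrt ?\<tau> / (1 - \<delta>)) + \<bar>e1 n\<bar>) / (1 - \<delta>)^2) ----> ((\<bar>0\<bar> + \<bar>0\<bar>) / (1 - ?\<kappa> * sqrt ?\<tau> / (1 - \<delta>)) + \<bar>0\<bar>) / (1 - \<delta>)^2"
  by (intro tendsto_divide tendsto_add tendsto_rabs tendsto_const e1(1) e2(1)) (use ratio \<delta> in simp_all)
 hence "(%n. (L2n (W n))^2) ----> 0" using Lim_null_comparison[OF always_eventually[OF allI[OF *]]] by simp
 hence W: "(%n. abs_l2 (W n)) ----> 0" by (simp add: tendsto_norm_zero_iff)
 have lim: "(%n. L2n (U n) + L2n (D n) + L2n (W n) + L2n (g n)) ----> 0"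
  by (intro tendsto_add_zero tendsto_norm_zero U_limit[OF seq] D_limit[OF seq W] W g_limit[OF seq])
 show ?thesis
  by (rule Lim_null_comparison[OF always_eventually lim]) (use L2n_quad_le(5)[OF L(1-4)] in simp)
qed

end

section \<open>States and their fields\<close>

lemma abs_rep_aefun: "abs_aefun (rep_aefun f) = f"
 by (rule Quotient3_abs_rep[OF Quotient3_aefun])

lemma rep_abs_aefun: "AE x. rep_aefun (abs_aefun f) x = f x"
 using abs_rep_aefun[of "abs_aefun f"] unfolding aefun.abs_eq_iff .

lemma aefun_eq_iff: "f = g \<longleftrightarrow> (AE x. rep_aefun f x = rep_aefun g x)"
 using aefun.abs_eq_iff[of "rep_aefun f" "rep_aefun g"] unfolding abs_rep_aefun .

lemma rep_aefun_add: "AE x. rep_aefun (f + g) x = rep_aefun f x + rep_aefun g x"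
 using plus_aefun.abs_eq[of "rep_aefun f" "rep_aefun g"] rep_abs_aefun[of "%x. rep_aefun f x + rep_aefun g x"]
 unfolding abs_rep_aefun by simp

lemma rep_aefun_diff: "AE x. rep_aefun (f - g) x = rep_aefun f x - rep_aefun g x"
 using minus_aefun.abs_eq[of "rep_aefun f" "rep_aefun g"] rep_abs_aefun[of "%x. rep_aefun f x - rep_aefun g x"]
 unfolding abs_rep_aefun by simp

lemma rep_aefun_zero: "AE x. rep_aefun 0 x = 0"
 using rep_abs_aefun[of "%x. 0"] unfolding zero_aefun_def .

lemma rep_aefun_cscaleV: "AE x. rep_aefun (cscaleV z f) x = z *s rep_aefun f x"
 using cscaleV.abs_eq[of z "rep_aefun f"] rep_abs_aefun[of "%x. z *s rep_aefun f x"]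
 unfolding abs_rep_aefun by simp

lemma rep_aefun_cscaleS: "AE x. rep_aefun (cscaleS z f) x = z * rep_aefun f x"
 using cscaleS.abs_eq[of z "rep_aefun f"] rep_abs_aefun[of "%x. z * rep_aefun f x"]
 unfolding abs_rep_aefun by simp

lemma cscale_simps: "cscale 1 y = y" "cscale (-1) y = - y"
proof -
 have "cscaleV 1 (fst y) = fst y" "cscaleS 1 (snd y) = snd y" "cscaleV (-1) (fst y) = - fst y" "cscaleS (-1) (snd y) = - snd y"
  by (transfer, simp add: vector_sneg_minus1[symmetric])+
 thus "cscale 1 y = y" "cscale (-1) y = - y" by (simp_all add: cscale_def prod_eq_iff)
qed

context stellar
begin

lemma loc_integrable_rho:
 fixes w :: "('a::euclidean_space) fn"
 assumes w: "loc_integrable A w" and m: "w \<in> LM"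
 shows "loc_integrable A (%x. \<rho> x *R w x)"
 unfolding loc_integrable_def set_integrable_def
proof (intro allI impI)
 fix K assume K: "compact K \<and> K \<subseteq> A"
 obtain C where C: "C > 0" "AE x. norm (\<rho> x) <= C" using rho(1) unfolding in_Linf_UNIV by blast
 have i: "Lint (%x. indicat_real K x *R w x)"
  using w K unfolding loc_integrable_def set_integrable_def by blast
 show "Lint (%x. indicat_real K x *R \<rho> x *R w x)"
 proof (rule Bochner_Integration.integrable_bound[OF integrable_mult_right[OF integrable_norm[OF i], of C]])
  have [measurable]: "K \<in> sets lebesgue" using K by (simp add: lmeasurable_compact fmeasurableD)
  have [measurable]: "w \<in> LM" by (rule m)
  show "(%x. indicat_real K x *R \<rho> x *R w x) \<in> LM" by measurable
  show "AE x. norm (indicat_real K x *R \<rho> x *R w x) <= norm (C * norm (indicat_real K x *R w x))"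
   using C(2)
  proof eventually_elim
   case (elim x)
   have "\<bar>\<rho> x\<bar> * norm (indicat_real K x *R w x) <= C * norm (indicat_real K x *R w x)"
    using elim by (intro mult_right_mono) auto
   thus ?case using C(1) by (simp add: abs_mult mult_ac)
  qed
 qed
qed

lemma has_weak_dirderivD:
 assumes "has_weak_dirderiv \<rho> b u w" "test v"
 shows "(LINT x. \<rho> x *R hdot (w x) (v x)) = - (LINT x. \<rho> x *R hdot (u x) (\<Sum>l. (b x $ l) *R pd l v x))
   - (LINT x. dv x *R hdot (u x) (v x))"
 using assms unfolding has_weak_dirderiv_def dv_def by blast

text \<open>Testing with a scalar test function times a unit vector determines each component of
  \<rho> w, and \<open>\<rho>\<close> is positive almost everywhere.\<close>

lemma has_weak_dirderiv_unique:
 assumes w: "has_weak_dirderiv \<rho> b u w" "has_weak_dirderiv \<rho> b u w'"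
 shows "AE x. w x = w' x"
proof -
 have l: "L1loc w" "L1loc w'" using w unfolding has_weak_dirderiv_def by blast+
 have "AE x. x \<in> UNIV --> (\<rho> x *R w x) $ k = (\<rho> x *R w' x) $ k" for k
 proof (rule fundamental_lemma_eq[OF open_UNIV])
  show "L1loc (%x. (\<rho> x *R w x) $ k)" "L1loc (%x. (\<rho> x *R w' x) $ k)"
   by (rule loc_integrable_linear[OF bounded_linear_vec_nth loc_integrable_rho[OF l(1) loc_integrable_measurable[OF l(1)]]],
     rule loc_integrable_linear[OF bounded_linear_vec_nth loc_integrable_rho[OF l(2) loc_integrable_measurable[OF l(2)]]])
  fix \<eta> :: "real fn" assume \<eta>: "test \<eta>"
  let ?v = "%x. \<eta> x *R (axis k 1 :: complex^3)"
  have v: "test ?v" by (rule scalar_test_vec[OF \<eta>])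
  have e: "\<rho> x *R hdot z (?v x) = \<eta> x *R (\<rho> x *R z) $ k" for z x
   using hdot_axis[of z 1 "\<eta> x" k] by simp
  have "(LINT x. \<rho> x *R hdot (w x) (?v x)) = (LINT x. \<rho> x *R hdot (w' x) (?v x))"
   unfolding has_weak_dirderivD[OF w(1) v] has_weak_dirderivD[OF w(2) v] by (rule refl)
  thus "(LINT x. \<eta> x *R (\<rho> x *R w x) $ k) = (LINT x. \<eta> x *R (\<rho> x *R w' x) $ k)"
   unfolding e .
 qed
 hence "AE x. \<forall>k\<in>UNIV. (\<rho> x *R w x) $ k = (\<rho> x *R w' x) $ k" by (intro AE_finite_allI) auto
 thus ?thesis using rho_pos by eventually_elim (simp add: vec_eq_iff)
qed

text \<open>\<open>weak_div\<close> and \<open>weak_dirderiv\<close> are choices; by uniqueness,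
  \<open>s\<close> times them agrees almost everywhere with whatever \<open>D\<close> and
  \<open>W\<close> satisfy the energy relation.\<close>

lemma X_fields:
 assumes e: "energy U D W" and u: "AE x. U x = s x *R u x"
 shows "in_X \<rho> b u" "AE x. s x *R weak_div u x = D x" "AE x. s x *R weak_dirderiv \<rho> b u x = W x"
proof -
 let ?d = "%x. inverse (s x) *R D x" and ?w = "%x. inverse (s x) *R W x"
 have ae: "AE x. D x = s x *R ?d x" "AE x. W x = s x *R ?w x"
  using s_pos by (eventually_elim, simp)+
 note X = X_of_energy[OF e u ae]
 show "in_X \<rho> b u" unfolding in_X_def using X by blast
 show "AE x. s x *R weak_div u x = D x"
  using has_weak_div_unique[OF weak_div_some[OF X(4)] X(4)] ae(1) by eventually_elim simp
 have "has_weak_dirderiv \<rho> b u (weak_dirderiv \<rho> b u)"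
  unfolding weak_dirderiv_def by (rule someI[of "has_weak_dirderiv \<rho> b u", OF X(5)])
 from has_weak_dirderiv_unique[OF this X(5)]
 show "AE x. s x *R weak_dirderiv \<rho> b u x = W x" using ae(2) by eventually_elim simp
qed

lemma X_energy:
 assumes "in_X \<rho> b u"
 shows "energy (%x. s x *R u x) (%x. s x *R weak_div u x) (%x. s x *R weak_dirderiv \<rho> b u x)"
proof -
 obtain d w where X: "in_L2w \<rho> u" "has_weak_div u d" "in_L2w \<rho> d" "has_weak_dirderiv \<rho> b u w" "in_L2w \<rho> w"
  using assms unfolding in_X_def by blast
 have e: "energy (%x. s x *R u x) (%x. s x *R d x) (%x. s x *R w x)"
  by (rule energy_of_X[OF X(1,3,5,2,4)])
 note f = X_fields[OF e AE_I2[OF refl]]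
 have d: "AE x. s x *R d x = s x *R weak_div u x" by (rule eventually_mono[OF f(2)]) (rule sym)
 have w: "AE x. s x *R w x = s x *R weak_dirderiv \<rho> b u x" by (rule eventually_mono[OF f(3)]) (rule sym)
 show ?thesis
  by (rule energy_AE[OF e energy_L2(1)[OF e] in_L2_AE[OF energy_L2(2)[OF e] d] in_L2_AE[OF energy_L2(3)[OF e] w] AE_I2[OF refl] d w])
qed

definition Y :: "state set" where "Y = spaceX \<rho> b \<times> spaceH1star r1"

definition Uf :: "state => (complex^3) fn" where "Uf y x = s x *R rep_aefun (fst y) x"
definition Df :: "state => complex fn" where "Df y x = s x *R weak_div (rep_aefun (fst y)) x"
definition Wf :: "state => (complex^3) fn" where "Wf y x = s x *R weak_dirderiv \<rho> b (rep_aefun (fst y)) x"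
definition gf :: "state => (complex^3) fn" where "gf y = weak_grad (rep_aefun (snd y))"
definition fields :: "state => real^3 => point" where "fields y = quad (Uf y) (Df y) (Wf y) (gf y)"

lemma Y_adm:
 assumes "y \<in> Y" shows "adm (Uf y) (Df y) (Wf y) (gf y)"
proof -
 have X: "in_X \<rho> b (rep_aefun (fst y))" and H: "in_H1star r1 (rep_aefun (snd y))"
  using assms unfolding Y_def spaceX_def spaceH1star_def by auto
 have "energy (Uf y) (Df y) (Wf y)" using X_energy[OF X] unfolding Uf_def Df_def Wf_def .
 moreover have "H1field (gf y)" unfolding H1field_def gf_def using H by auto
 ultimately show ?thesis unfolding adm_def by blast
qed

lemma fields_L2: "y \<in> Y ==> in_L2 (fields y)"
 unfolding fields_def by (rule adm_L2(5)[OF Y_adm])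

lemma Y_intro:
 assumes e: "energy U D W" and y1: "AE x. U x = s x *R rep_aefun (fst y) x"
  and \<psi>: "in_H1star r1 \<psi>" and y2: "AE x. \<psi> x = rep_aefun (snd y) x"
  and g: "AE x. weak_grad \<psi> x = g x"
 shows "y \<in> Y" "AE x. fields y x = quad U D W g x"
proof -
 note X = X_fields[OF e y1] and H = H1star_AE[OF \<psi> y2]
 show "y \<in> Y" using X(1) H(1) unfolding Y_def spaceX_def spaceH1star_def by (simp add: mem_Times_iff)
 show "AE x. fields y x = quad U D W g x"
  using X(2,3) y1 H(2) g by eventually_elim (simp add: fields_def quad_def Uf_def Df_def Wf_def gf_def)
qed

text \<open>Dividing \<open>U\<close> by \<open>s\<close> recovers the state. Constructed quadruples
  of fields thus become legitimate test states.\<close>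

lemma adm_state:
 assumes "adm U D W g"
 obtains y where "y \<in> Y" "AE x. fields y x = quad U D W g x"
proof -
 obtain \<psi> where \<psi>: "in_H1star r1 \<psi>" "AE x. weak_grad \<psi> x = g x" and e: "energy U D W"
  using assms unfolding adm_def H1field_def by blast
 let ?y = "(abs_aefun (%x. inverse (s x) *R U x), abs_aefun \<psi>)"
 have 1: "AE x. U x = s x *R rep_aefun (fst ?y) x"
  using rep_abs_aefun[of "%x. inverse (s x) *R U x"] s_pos by eventually_elim simp
 have 2: "AE x. \<psi> x = rep_aefun (snd ?y) x"
  using rep_abs_aefun[of \<psi>] by eventually_elim simp
 from Y_intro[OF e 1 \<psi>(1) 2 \<psi>(2)] show ?thesis by (rule that)
qed

text \<open>One rule with a complex coefficient; sums arise with z = 1, negatives and multiples from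
  the zero state.\<close>

lemma Y_combine:
 assumes y: "y \<in> Y" "y' \<in> Y"
 shows "y + cscale z y' \<in> Y" "AE x. fields (y + cscale z y') x = fields y x + vscale z (fields y' x)"
proof -
 have e: "energy (Uf y) (Df y) (Wf y)" "energy (Uf y') (Df y') (Wf y')" using Y_adm[OF y(1)] Y_adm[OF y(2)] unfolding adm_def by blast+
 have H: "in_H1star r1 (rep_aefun (snd y))" "in_H1star r1 (rep_aefun (snd y'))"
  using y unfolding Y_def spaceH1star_def by auto
 note en = energy_add[OF e(1) energy_cscale[OF e(2), of z]] and Hc = H1star_combine[OF H, of z]
 have 1: "AE x. Uf y x + z *s Uf y' x = s x *R rep_aefun (fst (y + cscale z y')) x"
  using rep_aefun_add[of "fst y" "cscaleV z (fst y')"] rep_aefun_cscaleV[of z "fst y'"]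
  by eventually_elim (simp add: Uf_def cscale_def scaleR_add_right vec_eq_iff algebra_simps)
 have 2: "AE x. rep_aefun (snd y) x + z * rep_aefun (snd y') x = rep_aefun (snd (y + cscale z y')) x"
  using rep_aefun_add[of "snd y" "cscaleS z (snd y')"] rep_aefun_cscaleS[of z "snd y'"]
  by eventually_elim (simp add: cscale_def)
 note I = Y_intro[OF en 1 Hc(1) 2 Hc(2)]
 show "y + cscale z y' \<in> Y" by (rule I(1))
 show "AE x. fields (y + cscale z y') x = fields y x + vscale z (fields y' x)"
  using I(2) by eventually_elim (simp add: fields_def quad_def vscale_def gf_def)
qed

lemma zero_Y: "0 \<in> Y" "AE x. fields 0 x = 0"
proof -
 have 1: "AE x. 0 = s x *R rep_aefun (fst (0::state)) x"
  using rep_aefun_zero[where 'a="complex^3"] by eventually_elim simp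
 have 2: "AE x. 0 = rep_aefun (snd (0::state)) x"
  using rep_aefun_zero[where 'a=complex] by eventually_elim simp
 note I = Y_intro[OF energy_zero 1 H1star_zero(1) 2 H1star_zero(2)]
 show "0 \<in> Y" by (rule I(1))
 show "AE x. fields 0 x = 0" using I(2) by eventually_elim (simp add: quad_def zero_prod_def)
qed

text \<open>The real isometry that realizes \<open>Y\<close>, a mere set of classes, inside a
  Hilbert space type; its norm is \<open>normY\<close>.\<close>

definition J :: "state => point l2" where "J y = abs_l2 (fields y)"

lemma norm_J: "norm (J y) = L2n (quad (Uf y) (Df y) (Wf y) (gf y))"
 unfolding J_def fields_def ..

lemma J_add: "y \<in> Y ==> y' \<in> Y ==> J (y + y') = J y + J y'"
proof -
 assume y: "y \<in> Y" "y' \<in> Y"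
 have v: "vscale 1 p = p" for p by (simp add: vscale_def)
 have ae: "AE x. fields (y + y') x = fields y x + fields y' x"
  using Y_combine(2)[OF y, of 1] unfolding cscale_simps v .
 have "y + y' \<in> Y" using Y_combine(1)[OF y, of 1] unfolding cscale_simps .
 thus ?thesis
  unfolding J_def abs_l2_add[OF fields_L2[OF y(1)] fields_L2[OF y(2)]]
  using abs_l2_eq_iff[OF fields_L2 in_L2_add[OF fields_L2[OF y(1)] fields_L2[OF y(2)]]] ae by blast
qed

lemma J_zero: "J 0 = 0"
 unfolding J_def abs_l2_zero[symmetric]
 using abs_l2_eq_iff[OF fields_L2[OF zero_Y(1)] in_L2_zero] zero_Y(2) by blast

lemma cscale_Y: "y \<in> Y ==> cscale z y \<in> Y" "y \<in> Y ==> AE x. fields (cscale z y) x = vscale z (fields y x)"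
proof -
 assume y: "y \<in> Y"
 show "cscale z y \<in> Y" using Y_combine(1)[OF zero_Y(1) y, of z] by simp
 show "AE x. fields (cscale z y) x = vscale z (fields y x)"
  using Y_combine(2)[OF zero_Y(1) y, of z] zero_Y(2) by eventually_elim simp
qed

lemma J_scaleR: "y \<in> Y ==> J (cscale (of_real r) y) = r *R J y"
 unfolding J_def abs_l2_scaleR[OF fields_L2]
 using abs_l2_eq_iff[OF fields_L2[OF cscale_Y(1)] in_L2_scaleR[OF fields_L2]] cscale_Y(2)[of y "of_real r"] unfolding vscale_of_real by blast

text \<open>For the first component \<open>s\<close> is positive. For the potential, zero gradient
  and mean zero give zero on every ball by the Poincare inequality.\<close>

lemma J_eq_zero:
 assumes y: "y \<in> Y" and z: "J y = 0"
 shows "y = 0"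
proof -
 have "AE x. fields y x = 0"
  using z unfolding J_def abs_l2_zero[symmetric] using abs_l2_eq_iff[OF fields_L2[OF y] in_L2_zero] by blast
 hence ae: "AE x. Uf y x = 0" "AE x. weak_grad (rep_aefun (snd y)) x = 0"
  by (eventually_elim, simp add: fields_def quad_def gf_def zero_prod_def)+
 have "AE x. rep_aefun (fst y) x = rep_aefun 0 x"
  using ae(1) s_pos rep_aefun_zero[where 'a="complex^3"] by eventually_elim (simp add: Uf_def)
 hence 1: "fst y = 0" unfolding aefun_eq_iff .
 have H: "in_H1star r1 (rep_aefun (snd y))" using y unfolding Y_def spaceH1star_def by auto
 hence gL: "in_L2 (weak_grad (rep_aefun (snd y)))" unfolding in_H1star_def by blast
 have gz: "L2n (weak_grad (rep_aefun (snd y))) = 0"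
  using abs_l2_eq_iff[OF gL in_L2_zero] ae(2) abs_l2_zero by simp
 have LL: "in_L2_loc (rep_aefun (snd y))" using H unfolding in_H1star_def in_H1loc_def by blast
 have "!!n::nat. AE x. x \<in> ball 0 (real n) --> rep_aefun (snd y) x = 0"
 proof -
  fix n :: nat
  have "real n + 1 > 0" by simp
  obtain C where "!!\<psi>. in_H1star r1 \<psi> ==> L2n (%x. indB (real n + 1) x *R \<psi> x) <= C * L2n (weak_grad \<psi>)"
   by (rule poincare_H1star[OF r1(1) \<open>real n + 1 > 0\<close>]) blast
  from this[OF H] have "abs_l2 (%x. indB (real n + 1) x *R rep_aefun (snd y) x) = abs_l2 (%x. 0)" by (simp add: gz abs_l2_zero)
  hence "AE x. indB (real n + 1) x *R rep_aefun (snd y) x = 0"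
   using abs_l2_eq_iff[OF in_L2_loc_ball[OF LL] in_L2_zero] by blast
  thus "AE x. x \<in> ball 0 (real n) --> rep_aefun (snd y) x = 0"
   by eventually_elim (auto simp: indicator_def split: if_splits)
 qed
 hence "AE x. \<forall>n::nat. x \<in> ball 0 (real n) --> rep_aefun (snd y) x = 0" unfolding AE_all_countable by (rule allI)
 hence "AE x. rep_aefun (snd y) x = rep_aefun 0 x"
  using rep_aefun_zero[where 'a=complex]
 proof eventually_elim
  case (elim x)
  obtain n :: nat where "norm x < real n" using reals_Archimedean2 by blast
  thus ?case using elim by auto
 qed
 hence "snd y = 0" unfolding aefun_eq_iff .
 with 1 show ?thesis by (simp add: prod_eq_iff)
qed

text \<open>Completeness of the product of X and the gradient space, in concrete form: the energy
  identities and the gradient property both pass to L2 limits, and \<open>adm_state\<close> produces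
  the limiting state.\<close>

lemma closed_J: "closed (J ` Y)"
 unfolding closed_sequential_limits
proof (intro allI impI, elim conjE)
 fix h :: "nat => point l2" and l
 assume h: "\<forall>n. h n \<in> J ` Y" and lim: "h ----> l"
 have "\<forall>n. \<exists>y. y \<in> Y \<and> h n = J y" using h by blast
 from choice[OF this] obtain y where y: "!!n. y n \<in> Y" "!!n. h n = J (y n)" by blast
 obtain Z where Z: "in_L2 Z" "l = abs_l2 Z" using l2_of_surj by blast
 define U D W g where "U = (%x. fst (Z x))" and "D = (%x. fst (snd (Z x)))" and "W = (%x. fst (snd (snd (Z x))))" and "g = (%x. snd (snd (snd (Z x))))"
 have L: "in_L2 U" "in_L2 D" "in_L2 W" "in_L2 g"
  unfolding U_def D_def W_def g_def by (intro in_L2_fst in_L2_snd Z)+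
 have Zq: "Z = quad U D W g" unfolding quad_def U_def D_def W_def g_def by simp
 have a: "adm (Uf (y n)) (Df (y n)) (Wf (y n)) (gf (y n))" for n by (rule Y_adm[OF y(1)])
 note A = adm_L2[OF a]
 have lim0: "(%n. norm (J (y n) - l)) ----> 0" using lim unfolding y(2) by (intro tendsto_norm_zero LIM_zero)
 have q: "norm (J (y n) - l) = L2n (quad (%x. Uf (y n) x - U x) (%x. Df (y n) x - D x) (%x. Wf (y n) x - W x) (%x. gf (y n) x - g x))" for n
  unfolding J_def fields_def Z(2) Zq abs_l2_diff[OF A(5) in_L2_quad[OF L]] by (simp add: quad_def[abs_def])
 have le: "norm (abs_l2 (Uf (y n)) - abs_l2 U) <= norm (J (y n) - l)" "norm (abs_l2 (Df (y n)) - abs_l2 D) <= norm (J (y n) - l)"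
  "norm (abs_l2 (Wf (y n)) - abs_l2 W) <= norm (J (y n) - l)" "norm (abs_l2 (gf (y n)) - abs_l2 g) <= norm (J (y n) - l)" for n
  unfolding q abs_l2_diff[OF A(1)[of n] L(1)] abs_l2_diff[OF A(2)[of n] L(2)] abs_l2_diff[OF A(3)[of n] L(3)] abs_l2_diff[OF A(4)[of n] L(4)]
  by (rule L2n_quad_le[OF in_L2_diff[OF A(1) L(1)] in_L2_diff[OF A(2) L(2)] in_L2_diff[OF A(3) L(3)] in_L2_diff[OF A(4) L(4)]])+
 have conv: "f ----> v" if "!!n. norm (f n - v) <= norm (J (y n) - l)" for f :: "nat => 'z::real_normed_vector" and v
  by (rule LIM_zero_cancel, rule Lim_null_comparison[OF always_eventually lim0]) (use that in blast)
 have e: "energy U D W"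
 proof (rule energy_limit[OF _ L(1-3)])
  show "energy (Uf (y n)) (Df (y n)) (Wf (y n))" for n using a unfolding adm_def by blast
  show "(%n. abs_l2 (Uf (y n))) ----> abs_l2 U" by (rule conv[OF le(1)])
  show "(%n. abs_l2 (Df (y n))) ----> abs_l2 D" by (rule conv[OF le(2)])
  show "(%n. abs_l2 (Wf (y n))) ----> abs_l2 W" by (rule conv[OF le(3)])
 qed
 have "H1field g"
 proof (rule H1field_limit[OF _ L(4)])
  show "H1field (gf (y n))" for n using a unfolding adm_def by blast
  show "(%n. abs_l2 (gf (y n))) ----> abs_l2 g" by (rule conv[OF le(4)])
 qed
 with e have "adm U D W g" unfolding adm_def by blast
 then obtain y' where y': "y' \<in> Y" "AE x. fields y' x = quad U D W g x" by (rule adm_state)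
 have "J y' = l" unfolding J_def Z(2) Zq using abs_l2_eq_iff[OF fields_L2[OF y'(1)] in_L2_quad[OF L]] y'(2) by blast
 with y'(1) show "l \<in> J ` Y" by blast
qed

end

section \<open>Bounded sesquilinear forms with a lower bound\<close>

text \<open>An abstract Lax-Milgram setting on a subset \<open>Y\<close> with its own complex
  scaling; \<open>J\<close> embeds it as a closed real subspace. Hypothesis \<open>lower\<close> is
  an inf-sup condition phrased through residuals, and \<open>nondegenerate\<close> is injectivity of
  the adjoint.\<close>

locale hilbert_form =
 fixes Y :: "'y::ab_group_add set" and sc :: "complex => 'y => 'y" and ip a :: "'y => 'y => complex"
  and J :: "'y => 'h::{real_inner, complete_space}" and C B M :: real
 assumes zero_mem: "0 \<in> Y" and combine: "y \<in> Y ==> y' \<in> Y ==> y + sc z y' \<in> Y"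
  and sc_one: "sc 1 y = y" and sc_minus: "sc (-1) y = - y"
  and J_add: "y \<in> Y ==> y' \<in> Y ==> J (y + y') = J y + J y'" and J_scale: "y \<in> Y ==> J (sc (of_real r) y) = r *R J y"
  and J_inj: "y \<in> Y ==> J y = 0 ==> y = 0" and J_closed: "closed (J ` Y)"
  and ip_Re: "y \<in> Y ==> y' \<in> Y ==> Re (ip y y') = J y \<bullet> J y'"
  and ip_left: "y \<in> Y ==> y' \<in> Y ==> w \<in> Y ==> ip (y + sc z y') w = ip y w + z * ip y' w"
  and ip_right: "y \<in> Y ==> y' \<in> Y ==> w \<in> Y ==> ip w (y + sc z y') = ip w y + cnj z * ip w y'"
  and a_left: "y \<in> Y ==> y' \<in> Y ==> w \<in> Y ==> a (y + sc z y') w = a y w + z * a y' w"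
  and a_right: "y \<in> Y ==> y' \<in> Y ==> w \<in> Y ==> a w (y + sc z y') = a w y + cnj z * a w y'"
  and constants: "0 <= C" "0 <= B" "0 <= M"
  and ip_bound: "y \<in> Y ==> y' \<in> Y ==> norm (ip y y') <= B * norm (J y) * norm (J y')"
  and a_bound: "y \<in> Y ==> y' \<in> Y ==> norm (a y y') <= M * norm (J y) * norm (J y')"
  and lower: "y \<in> Y ==> 0 <= K ==> (!!y'. y' \<in> Y ==> norm (a y y') <= K * norm (J y')) ==> norm (J y) <= C * K"
  and nondegenerate: "y \<in> Y ==> (!!y'. y' \<in> Y ==> a y' y = 0) ==> y = 0"
begin

lemma sc_mem: "y \<in> Y ==> sc z y \<in> Y" using combine[OF zero_mem, of y z] by simp
lemma add_mem: "y \<in> Y ==> y' \<in> Y ==> y + y' \<in> Y" using combine[of y y' 1] by (simp add: sc_one)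
lemma diff_mem: "y \<in> Y ==> y' \<in> Y ==> y - y' \<in> Y" using combine[of y y' "-1"] by (simp add: sc_minus)

lemma J_zero: "J 0 = 0" using J_add[OF zero_mem zero_mem] by simp

lemma J_diff: "y \<in> Y ==> y' \<in> Y ==> J (y - y') = J y - J y'"
 using J_add[OF diff_mem, of y y' y'] by simp

definition antilinear :: "('y => complex) => bool" where
 "antilinear L \<longleftrightarrow> (\<forall>y\<in>Y. \<forall>y'\<in>Y. \<forall>z. L (y + sc z y') = L y + cnj z * L y')"

definition linear_on :: "('y => complex) => bool" where
 "linear_on L \<longleftrightarrow> (\<forall>y\<in>Y. \<forall>y'\<in>Y. \<forall>z. L (y + sc z y') = L y + z * L y')"

lemma antilinear:
 assumes "antilinear L"
 shows "L 0 = 0" "y \<in> Y ==> L (sc z y) = cnj z * L y" "y \<in> Y ==> y' \<in> Y ==> L (y + y') = L y + L y'"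
  "y \<in> Y ==> y' \<in> Y ==> L (y - y') = L y - L y'"
proof -
 have L: "L (y + sc z y') = L y + cnj z * L y'" if "y \<in> Y" "y' \<in> Y" for y y' z
  using assms that unfolding antilinear_def by blast
 show 0: "L 0 = 0" using L[OF zero_mem zero_mem, of 1] by (simp add: sc_one)
 show "L (sc z y) = cnj z * L y" if "y \<in> Y" using L[OF zero_mem that, of z] 0 by simp
 show "L (y + y') = L y + L y'" if "y \<in> Y" "y' \<in> Y" using L[OF that, of 1] by (simp add: sc_one)
 show "L (y - y') = L y - L y'" if "y \<in> Y" "y' \<in> Y" using L[OF that, of "-1"] by (simp add: sc_minus)
qed

lemma linear_on:
 assumes "linear_on L"
 shows "L 0 = 0" "y \<in> Y ==> L (sc z y) = z * L y" "y \<in> Y ==> y' \<in> Y ==> L (y + y') = L y + L y'"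
  "y \<in> Y ==> y' \<in> Y ==> L (y - y') = L y - L y'"
proof -
 have L: "L (y + sc z y') = L y + z * L y'" if "y \<in> Y" "y' \<in> Y" for y y' z
  using assms that unfolding linear_on_def by blast
 show 0: "L 0 = 0" using L[OF zero_mem zero_mem, of 1] by (simp add: sc_one)
 show "L (sc z y) = z * L y" if "y \<in> Y" using L[OF zero_mem that, of z] 0 by simp
 show "L (y + y') = L y + L y'" if "y \<in> Y" "y' \<in> Y" using L[OF that, of 1] by (simp add: sc_one)
 show "L (y - y') = L y - L y'" if "y \<in> Y" "y' \<in> Y" using L[OF that, of "-1"] by (simp add: sc_minus)
qed

lemma ip_antilinear: "w \<in> Y ==> antilinear (ip w)" and a_antilinear: "w \<in> Y ==> antilinear (a w)"
 unfolding antilinear_def using ip_right a_right by blast+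

lemma ip_linear: "w \<in> Y ==> linear_on (%y. ip y w)" and a_linear: "w \<in> Y ==> linear_on (%y. a y w)"
 unfolding linear_on_def using ip_left a_left by blast+

text \<open>The real part of L(i y) is the imaginary part of L(y), so real parts determine an
  antilinear functional.\<close>

lemma antilinear_eqI:
 assumes L: "antilinear L" "antilinear L'" and eq: "!!y. y \<in> Y ==> Re (L y) = Re (L' y)" and y: "y \<in> Y"
 shows "L y = L' y"
proof (rule complex_eqI[OF eq[OF y]])
 have "Re (L (sc \<i> y)) = Re (L' (sc \<i> y))" by (rule eq[OF sc_mem[OF y]])
 thus "Im (L y) = Im (L' y)" unfolding antilinear(2)[OF L(1) y] antilinear(2)[OF L(2) y] by simp
qed

lemma subspace_J: "subspace (J ` Y)"
 unfolding subspace_def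
proof (intro conjI ballI allI)
 show "0 \<in> J ` Y" using J_zero zero_mem by force
 fix u v assume "u \<in> J ` Y" "v \<in> J ` Y"
 then obtain y y' where "u = J y" "v = J y'" "y \<in> Y" "y' \<in> Y" by blast
 hence "u + v = J (y + y')" "y + y' \<in> Y" using J_add add_mem by auto
 thus "u + v \<in> J ` Y" by blast
next
 fix r u assume "u \<in> J ` Y"
 then obtain y where "u = J y" "y \<in> Y" by blast
 hence "r *R u = J (sc (of_real r) y)" "sc (of_real r) y \<in> Y" using J_scale sc_mem by auto
 thus "r *R u \<in> J ` Y" by blast
qed

lemma J_inv: "y \<in> Y ==> y' \<in> Y ==> J y = J y' ==> y = y'"
 using J_inj[OF diff_mem, of y y'] J_diff[of y y'] by simp

lemma representation_unique:
 assumes w: "w \<in> Y" "w' \<in> Y" and eq: "!!y. y \<in> Y ==> ip w y = ip w' y"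
 shows "w = w'"
proof (rule J_inv[OF w])
 have "(J w - J w') \<bullet> J (w - w') = Re (ip w (w - w')) - Re (ip w' (w - w'))"
  using ip_Re[OF w(1) diff_mem[OF w]] ip_Re[OF w(2) diff_mem[OF w]] by (simp add: inner_diff_left)
 also have "... = 0" using eq[OF diff_mem[OF w]] by simp
 finally show "J w = J w'" unfolding J_diff[OF w] by simp
qed

text \<open>The real Riesz theorem represents the real part on the closed image of \<open>J\<close>;
  \<open>antilinear_eqI\<close> upgrades this to the complex identity.\<close>

lemma representation:
 assumes L: "antilinear L" and bnd: "!!y. y \<in> Y ==> norm (L y) <= K * norm (J y)"
 shows "\<exists>w\<in>Y. \<forall>y\<in>Y. ip w y = L y"
proof -
 \<comment> \<open>Transport of the functional to the image of \<open>J\<close> by its inverse;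
   values off the image are irrelevant.\<close>
 define \<phi> where "\<phi> h = Re (L (THE y. y \<in> Y \<and> J y = h))" for h
 have the: "(THE y'. y' \<in> Y \<and> J y' = J y) = y" if "y \<in> Y" for y
  using that J_inv by (intro the_equality) auto
 have \<phi>: "\<phi> (J y) = Re (L y)" if "y \<in> Y" for y unfolding \<phi>_def the[OF that] ..
 obtain h where h: "h \<in> J ` Y" "!!v. v \<in> J ` Y ==> \<phi> v = h \<bullet> v"
 proof (rule riesz_representation[OF subspace_J J_closed, of \<phi> K])
  fix u v assume "u \<in> J ` Y" "v \<in> J ` Y"
  then obtain y y' where y: "u = J y" "v = J y'" "y \<in> Y" "y' \<in> Y" by blast
  show "\<phi> (u + v) = \<phi> u + \<phi> v"
   unfolding y(1,2) J_add[OF y(3,4), symmetric] \<phi>[OF add_mem[OF y(3,4)]] \<phi>[OF y(3)] \<phi>[OF y(4)] antilinear(3)[OF L y(3,4)] by simp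
 next
  fix r v assume "v \<in> J ` Y"
  then obtain y where y: "v = J y" "y \<in> Y" by blast
  show "\<phi> (r *R v) = r * \<phi> v"
   unfolding y(1) J_scale[OF y(2), symmetric] \<phi>[OF sc_mem[OF y(2)]] \<phi>[OF y(2)] antilinear(2)[OF L y(2)] by simp
 next
  fix v assume "v \<in> J ` Y"
  then obtain y where y: "v = J y" "y \<in> Y" by blast
  show "\<bar>\<phi> v\<bar> <= K * norm v"
   unfolding y(1) \<phi>[OF y(2)] by (rule order_trans[OF abs_Re_le_cmod bnd[OF y(2)]])
 qed blast
 then obtain w where w: "w \<in> Y" "h = J w" by blast
 have "ip w y = L y" if "y \<in> Y" for y
 proof (rule antilinear_eqI[OF ip_antilinear[OF w(1)] L _ that])
  fix y assume y: "y \<in> Y"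
  show "Re (ip w y) = Re (L y)"
   using h(2)[of "J y"] y unfolding ip_Re[OF w(1) y] \<phi>[OF y] w(2) by simp
 qed
 with w(1) show ?thesis by blast
qed

definition A :: "'y => 'y" where "A y = (THE w. w \<in> Y \<and> (\<forall>y'\<in>Y. ip w y' = a y y'))"

lemma A: assumes y: "y \<in> Y" shows "A y \<in> Y" "!!y'. y' \<in> Y ==> ip (A y) y' = a y y'"
proof -
 obtain w where w: "w \<in> Y" "\<forall>y'\<in>Y. ip w y' = a y y'"
  using representation[OF a_antilinear[OF y] a_bound[OF y]] by blast
 have "A y = w" unfolding A_def
 proof (rule the_equality)
  show "w \<in> Y \<and> (\<forall>y'\<in>Y. ip w y' = a y y')" using w by blast
  fix v assume "v \<in> Y \<and> (\<forall>y'\<in>Y. ip v y' = a y y')"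
  thus "v = w" using w by (intro representation_unique) auto
 qed
 with w show "A y \<in> Y" "!!y'. y' \<in> Y ==> ip (A y) y' = a y y'" by auto
qed

lemma A_eqI: "y \<in> Y ==> w \<in> Y ==> (!!y'. y' \<in> Y ==> ip w y' = a y y') ==> A y = w"
 using A by (intro representation_unique) auto

lemma A_add: assumes y: "y \<in> Y" "y' \<in> Y" shows "A (y + y') = A y + A y'"
proof (rule A_eqI[OF add_mem[OF y] add_mem[OF A(1)[OF y(1)] A(1)[OF y(2)]]])
 fix v assume v: "v \<in> Y"
 show "ip (A y + A y') v = a (y + y') v"
  unfolding linear_on(3)[OF ip_linear[OF v] A(1)[OF y(1)] A(1)[OF y(2)]] linear_on(3)[OF a_linear[OF v] y]
  using A(2)[OF y(1) v] A(2)[OF y(2) v] by simp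
qed

lemma A_sc: assumes y: "y \<in> Y" shows "A (sc z y) = sc z (A y)"
proof (rule A_eqI[OF sc_mem[OF y] sc_mem[OF A(1)[OF y]]])
 fix v assume v: "v \<in> Y"
 show "ip (sc z (A y)) v = a (sc z y) v"
  unfolding linear_on(2)[OF ip_linear[OF v] A(1)[OF y]] linear_on(2)[OF a_linear[OF v] y]
  using A(2)[OF y v] by simp
qed

lemma A_diff: assumes y: "y \<in> Y" "y' \<in> Y" shows "A (y - y') = A y - A y'"
 using A_add[OF diff_mem[OF y] y(2)] by simp

lemma A_bounded: assumes y: "y \<in> Y" shows "norm (J (A y)) <= M * norm (J y)"
proof -
 have "norm (J (A y)) * norm (J (A y)) = Re (a y (A y))"
  using A(2)[OF y A(1)[OF y]] ip_Re[OF A(1)[OF y] A(1)[OF y]] by (simp add: power2_norm_eq_inner flip: power2_eq_square)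
 also have "... <= norm (a y (A y))" by (rule complex_Re_le_cmod)
 also have "... <= M * norm (J y) * norm (J (A y))" by (rule a_bound[OF y A(1)[OF y]])
 finally have m: "norm (J (A y)) * norm (J (A y)) <= (M * norm (J y)) * norm (J (A y))" .
 show ?thesis
 proof (cases "norm (J (A y)) = 0")
  case True thus ?thesis using constants by simp
 next
  case False
  thus ?thesis using m by (intro mult_right_le_imp_le[OF m]) simp
 qed
qed

lemma A_lower: assumes y: "y \<in> Y" shows "norm (J y) <= C * (B * norm (J (A y)))"
proof (rule lower[OF y])
 show "0 <= B * norm (J (A y))" using constants by simp
 show "norm (a y y') <= B * norm (J (A y)) * norm (J y')" if "y' \<in> Y" for y'
  using ip_bound[OF A(1)[OF y] that] A(2)[OF y that] by simp
qed

lemma A_inj: "inj_on A Y"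
proof (rule inj_onI)
 fix y y' assume y: "y \<in> Y" "y' \<in> Y" and eq: "A y = A y'"
 have "J (A (y - y')) = 0" unfolding A_diff[OF y] eq by (simp add: J_zero)
 hence "J (y - y') = 0" using A_lower[OF diff_mem[OF y]] by simp
 thus "y = y'" using J_inj[OF diff_mem[OF y]] by simp
qed

text \<open>The lower bound makes preimages of a convergent sequence of images Cauchy; boundedness
  of \<open>A\<close> identifies the limit.\<close>

lemma closed_range: "closed (J ` A ` Y)"
 unfolding closed_sequential_limits
proof (intro allI impI, elim conjE)
 fix h l assume h: "\<forall>n. h n \<in> J ` A ` Y" and lim: "h ----> l"
 have "\<forall>n. \<exists>y. y \<in> Y \<and> h n = J (A y)" using h by blast
 from choice[OF this] obtain y where y: "!!n. y n \<in> Y" "!!n. h n = J (A (y n))" by blast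
 have d: "norm (J (y m) - J (y n)) <= C * B * norm (h m - h n)" for m n
  using A_lower[OF diff_mem[OF y(1)[of m] y(1)[of n]]]
  unfolding A_diff[OF y(1) y(1)] J_diff[OF y(1) y(1)] J_diff[OF A(1)[OF y(1)] A(1)[OF y(1)]] y(2) by (simp add: mult.assoc)
 have "Cauchy (%n. J (y n))" by (rule Cauchy_dominated[OF d LIMSEQ_imp_Cauchy[OF lim]])
 then obtain v where v: "(%n. J (y n)) ----> v" using Cauchy_convergent_iff convergent_def by blast
 have "v \<in> J ` Y" by (rule closed_sequentially[OF J_closed _ v]) (use y(1) in blast)
 then obtain w where w: "w \<in> Y" "v = J w" by blast
 have *: "norm (h n - J (A w)) <= M * norm (J (y n) - v)" for n
  using A_bounded[OF diff_mem[OF y(1)[of n] w(1)]]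
  unfolding A_diff[OF y(1) w(1)] J_diff[OF y(1) w(1)] J_diff[OF A(1)[OF y(1)] A(1)[OF w(1)]] y(2) w(2) .
 have "(%n. h n - J (A w)) ----> 0"
  by (rule Lim_null_comparison[OF always_eventually[OF allI[OF *]] tendsto_mult_right_zero[OF tendsto_norm_zero[OF LIM_zero[OF v]]]])
 hence "h ----> J (A w)" by (rule LIM_zero_cancel)
 hence "l = J (A w)" using lim LIMSEQ_unique by blast
 thus "l \<in> J ` A ` Y" using w(1) by blast
qed

lemma subspace_range: "subspace (J ` A ` Y)"
 unfolding subspace_def
proof (intro conjI ballI allI)
 have "A 0 = 0" using A_diff[OF zero_mem zero_mem] by simp
 hence "0 = J (A 0)" by (simp add: J_zero)
 thus "0 \<in> J ` A ` Y" using zero_mem by blast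
 fix u v assume "u \<in> J ` A ` Y" "v \<in> J ` A ` Y"
 then obtain y y' where y: "u = J (A y)" "v = J (A y')" "y \<in> Y" "y' \<in> Y" by blast
 hence "u + v = J (A (y + y'))" using J_add[OF A(1) A(1)] A_add by simp
 thus "u + v \<in> J ` A ` Y" using add_mem[OF y(3,4)] by blast
next
 fix r u assume "u \<in> J ` A ` Y"
 then obtain y where y: "u = J (A y)" "y \<in> Y" by blast
 hence "r *R u = J (A (sc (of_real r) y))" using J_scale[OF A(1)] A_sc by simp
 thus "r *R u \<in> J ` A ` Y" using sc_mem[OF y(2)] by blast
qed

text \<open>The error \<open>?w\<close> of the projection onto the closed range satisfies Re a(v, w)
  = 0 for all v. Replacing v by i v kills the imaginary part too, and nondegeneracy gives w =
  0.\<close>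

lemma A_surj: "A ` Y = Y"
proof (intro equalityI subsetI)
 fix x assume "x \<in> A ` Y" thus "x \<in> Y" using A(1) by blast
next
 fix x assume x: "x \<in> Y"
 obtain p where p: "p \<in> J ` A ` Y" "!!v. v \<in> J ` A ` Y ==> (J x - p) \<bullet> v = 0"
  by (rule closed_subspace_projection[OF subspace_range closed_range]) blast
 then obtain y where y: "y \<in> Y" "p = J (A y)" by blast
 let ?w = "x - A y"
 have w: "?w \<in> Y" by (rule diff_mem[OF x A(1)[OF y(1)]])
 have re: "Re (a v ?w) = 0" if v: "v \<in> Y" for v
 proof -
  have "Re (a v ?w) = J (A v) \<bullet> J ?w" using A(2)[OF v w] ip_Re[OF A(1)[OF v] w] by simp
  also have "... = 0" using p(2)[of "J (A v)"] v unfolding J_diff[OF x A(1)[OF y(1)]] y(2) by (simp add: inner_commute)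
  finally show ?thesis .
 qed
 have "?w = 0"
 proof (rule nondegenerate[OF w])
  fix v assume v: "v \<in> Y"
  show "a v ?w = 0"
  proof (rule complex_eqI)
   show "Re (a v ?w) = Re 0" using re[OF v] by simp
   have "Re (a (sc \<i> v) ?w) = 0" by (rule re[OF sc_mem[OF v]])
   thus "Im (a v ?w) = Im 0" unfolding linear_on(2)[OF a_linear[OF w] v] by simp
  qed
 qed
 thus "x \<in> A ` Y" using y(1) by simp
qed

lemma A_bij: "bij_betw A Y Y"
 using A_inj A_surj unfolding bij_betw_def by blast

lemma unique_solution:
 assumes L: "antilinear L" and bnd: "!!y. y \<in> Y ==> norm (L y) <= K * norm (J y)"
 shows "\<exists>!y. y \<in> Y \<and> (\<forall>y'\<in>Y. a y y' = L y')"
proof -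
 obtain w where w: "w \<in> Y" "!!y. y \<in> Y ==> ip w y = L y" using representation[OF L bnd] by blast
 obtain y where y: "y \<in> Y" "A y = w" using A_surj w(1) by (metis imageE)
 show ?thesis
 proof (rule ex1I[of _ y])
  show "y \<in> Y \<and> (\<forall>y'\<in>Y. a y y' = L y')" using y w A(2)[OF y(1)] by auto
  fix v assume v: "v \<in> Y \<and> (\<forall>y'\<in>Y. a v y' = L y')"
  have "A v = w" by (rule A_eqI) (use v w in auto)
  thus "v = y" using A_inj y v unfolding inj_on_def by blast
 qed
qed

lemma continuous_dependence:
 assumes y: "y \<in> Y" "y' \<in> Y" and K: "0 <= K" and d: "!!v. v \<in> Y ==> norm (a y v - a y' v) <= K * norm (J v)"
 shows "norm (J (y - y')) <= C * K"
proof (rule lower[OF diff_mem[OF y] K])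
 show "norm (a (y - y') v) <= K * norm (J v)" if "v \<in> Y" for v
  unfolding linear_on(4)[OF a_linear[OF that] y] by (rule d[OF that])
qed

end

text \<open>Integrability of \<open>f5\<close>, the matrix term, is not assumed but obtained from
  that of the whole and of the other terms.\<close>

lemma integral_nine_terms:
 fixes f1 f2 f3 f4 f5 f6 f7 f8 f9 t :: "complex fn"
 assumes i: "Lint t" "Lint f1" "Lint f2" "Lint f3" "Lint f4"
  "Lint f6" "Lint f7" "Lint f8" "Lint f9"
  and t: "!!x. t x = f1 x + f2 x + f3 x - f4 x + f5 x - k * f6 x - f7 x - f8 x + l * f9 x"
 shows "(LINT x. t x) = (LINT x. f1 x) + (LINT x. f2 x) + (LINT x. f3 x) - (LINT x. f4 x)
  + (LINT x. f5 x) - k * (LINT x. f6 x) - (LINT x. f7 x) - (LINT x. f8 x) + l * (LINT x. f9 x)"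
proof -
 have "f5 = (%x. t x - f1 x - f2 x - f3 x + f4 x + k * f6 x + f7 x + f8 x - l * f9 x)" using t by (intro ext) simp
 hence "(LINT x. f5 x) = (LINT x. t x) - (LINT x. f1 x) - (LINT x. f2 x) - (LINT x. f3 x) + (LINT x. f4 x)
  + k * (LINT x. f6 x) + (LINT x. f7 x) + (LINT x. f8 x) - l * (LINT x. f9 x)"
  using i by simp
 thus ?thesis by simp
qed

section \<open>Identification of the form on states\<close>

lemma bounded_bilinear_mult_cnj: "bounded_bilinear (%z w::complex. z * cnj w)"
 using bounded_bilinear.comp[OF bounded_bilinear_mult bounded_linear_ident bounded_linear_cnj] .

lemma in_L2_bounded_bilinear:
 fixes prod :: "'a::euclidean_space => 'b::euclidean_space => 'd::euclidean_space"
 assumes b: "bounded_bilinear prod" and m: "m \<in> LM" "AE x. norm (m x) <= B" and f: "in_L2 f"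
 shows "in_L2 (%x. prod (m x) (f x))"
proof -
 interpret bounded_bilinear prod by (rule b)
 from nonneg_bounded obtain K where K: "K >= 0" and K': "\<forall>a b. norm (prod a b) <= norm a * norm b * K" by (elim exE conjE)
 have 1: "(%x. (m x, f x)) \<in> LM"
  using m(1) in_L2_measurable[OF f] unfolding borel_prod[symmetric] by (rule measurable_Pair)
 have 2: "(%p. prod (fst p) (snd p)) \<in> borel_measurable borel"
  by (intro borel_measurable_continuous_onI continuous_on continuous_on_fst continuous_on_snd continuous_on_id)
 have meas: "(%x. prod (m x) (f x)) \<in> LM" using measurable_compose[OF 1 2] by simp
 show ?thesis
 proof (rule in_L2_bound[OF f meas])
  show "AE x. norm (prod (m x) (f x)) <= (B * K) * norm (f x)"
   using m(2)
  proof eventually_elim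
   case (elim x)
   have "norm (prod (m x) (f x)) <= norm (m x) * norm (f x) * K" using K' by blast
   also have "... <= B * norm (f x) * K" using elim K by (intro mult_right_mono) auto
   finally show ?case by (simp add: mult_ac)
  qed
 qed
qed

lemma form_integral_combine:
 fixes f :: "'k::euclidean_space => point => point => complex"
 assumes c: "continuous_on UNIV (%p. f (fst p) (fst (snd p)) (snd (snd p)))" and s: "!!K. sesquilinear (f K)"
  and K: "K \<in> LM" "AE x. norm (K x) <= r" and Z: "in_L2 Z" "in_L2 Z'" "in_L2 Z''"
  and ae: "AE x. V x = Z x + vscale z (Z' x)"
 shows "(LINT x. f (K x) (V x) (Z'' x)) = (LINT x. f (K x) (Z x) (Z'' x)) + z * (LINT x. f (K x) (Z' x) (Z'' x))"
  and "(LINT x. f (K x) (Z'' x) (V x)) = (LINT x. f (K x) (Z'' x) (Z x)) + cnj z * (LINT x. f (K x) (Z'' x) (Z' x))"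
proof -
 note i = form_integrable[where f=f, OF c s K]
 have l: "f k (u + vscale z v) w = f k u w + z * f k v w" for k u v w using s unfolding sesquilinear_def by metis
 have r: "f k w (u + vscale z v) = f k w u + cnj z * f k w v" for k u v w using s unfolding sesquilinear_def by metis
 have "(LINT x. f (K x) (V x) (Z'' x)) = (LINT x. f (K x) (Z x) (Z'' x) + z * f (K x) (Z' x) (Z'' x))"
  by (rule lebesgue_integral_AE_eq, rule eventually_mono[OF ae]) (simp only: l)
 thus "(LINT x. f (K x) (V x) (Z'' x)) = (LINT x. f (K x) (Z x) (Z'' x)) + z * (LINT x. f (K x) (Z' x) (Z'' x))"
  unfolding Bochner_Integration.integral_add[OF i[OF Z(1,3)] integrable_mult_right[OF i[OF Z(2,3)]]] integral_mult_right_zero .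
 have "(LINT x. f (K x) (Z'' x) (V x)) = (LINT x. f (K x) (Z'' x) (Z x) + cnj z * f (K x) (Z'' x) (Z' x))"
  by (rule lebesgue_integral_AE_eq, rule eventually_mono[OF ae]) (simp only: r)
 thus "(LINT x. f (K x) (Z'' x) (V x)) = (LINT x. f (K x) (Z'' x) (Z x)) + cnj z * (LINT x. f (K x) (Z'' x) (Z' x))"
  unfolding Bochner_Integration.integral_add[OF i[OF Z(3,1)] integrable_mult_right[OF i[OF Z(3,2)]]] integral_mult_right_zero .
qed

lemma rotation_scaleR: "rotation \<omega> \<Omega> (r *R u) (r *R w) = r *R rotation \<omega> \<Omega> u w"
 using rotation_linear(2)[of \<omega> \<Omega> "of_real r" u w] unfolding vector_cscale_of_real .

lemma cmat_mult_scaleR: "cmat N *v (r *R u) = r *R (cmat N *v u)"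
 by (simp add: matrix_vector_mult_def vec_eq_iff scaleR_sum_right)

context stellar
begin

lemma ipS_weighted: "ipS \<rho> f g = (LINT x. (s x *R f x) * cnj (s x *R g x))"
 unfolding ipS_def
 by (rule lebesgue_integral_AE_eq, use s_pos in eventually_elim) (simp add: power2_eq_square)

lemma ipV_weighted: "ipV \<rho> f g = (LINT x. hdot (s x *R f x) (s x *R g x))"
 unfolding ipV_def
 by (rule lebesgue_integral_AE_eq, use s_pos in eventually_elim) (simp add: power2_eq_square hdot_scaleR_left hdot_scaleR_right)

lemma ipY_fields:
 assumes y: "y \<in> Y" "y' \<in> Y"
 shows "ipY \<rho> b y y' = (LINT x. product_form (fields y x) (fields y' x))"
proof -
 note L = adm_L2[OF Y_adm[OF y(1)]] and L' = adm_L2[OF Y_adm[OF y(2)]]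
 note i = L2_bilinear_integrable[OF bounded_bilinear_mult_cnj L(2) L'(2)] L2_bilinear_integrable[OF bounded_bilinear_hdot L(3) L'(3)]
  L2_bilinear_integrable[OF bounded_bilinear_hdot L(1) L'(1)] L2_bilinear_integrable[OF bounded_bilinear_hdot L(4) L'(4)]
 have "(LINT x. product_form (fields y x) (fields y' x)) = (LINT x. Df y x * cnj (Df y' x) + hdot (Wf y x) (Wf y' x) + hdot (Uf y x) (Uf y' x) + hdot (gf y x) (gf y' x))"
  by (simp add: product_form_def fields_def quad_def)
 also have "... = (LINT x. Df y x * cnj (Df y' x)) + (LINT x. hdot (Wf y x) (Wf y' x)) + (LINT x. hdot (Uf y x) (Uf y' x)) + (LINT x. hdot (gf y x) (gf y' x))"
  using i by simp
 finally show ?thesis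
  unfolding ipY_def ipX_def ipH_def ipS_weighted ipV_weighted
  by (simp only: ipV_def Uf_def Df_def Wf_def gf_def scaleR_one)
qed

text \<open>The given form has \<nabla>p and the Hessians as coefficients, \<open>F\<close> has
  \<open>q_field\<close> and \<open>coefN\<close>. They agree almost everywhere by
  \<open>coefficient_identities\<close>, and the bounded coefficients of \<open>F\<close> justify
  splitting the integral term by term.\<close>

lemma osc_form_fields:
 assumes y: "y \<in> Y" "y' \<in> Y"
 shows "osc_form \<omega> \<Omega> G \<rho> c \<gamma> p \<phi> b y y' = F (fields y) (fields y')"
proof -
 note L = adm_L2[OF Y_adm[OF y(1)]] and L' = adm_L2[OF Y_adm[OF y(2)]]
 let ?q = "q_field \<rho> c p" and ?u = "rep_aefun (fst y)" and ?u' = "rep_aefun (fst y')"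
 define k where "k = \<i> * complex_of_real \<omega>"
 define l where "l = complex_of_real (1 / (4 * pi * G))"
 have Lq: "in_L2 (%x. rdot ((c x)^2 *R ?q x) (U x))" if "in_L2 U" for U
 proof -
  obtain C where "AE x. norm (?q x) <= C" "?q \<in> LM" using q unfolding in_Linf_UNIV by blast
  thus ?thesis
   unfolding bounded_bilinear.scaleR_left[OF bb_rdot] by (intro in_L2_csq in_L2_bounded_bilinear[OF bb_rdot _ _ that])
 qed
 have q_eq: "AE x. rdot ((c x)^2 *R ?q x) (Uf y x) = s x *R (of_real (1 / \<rho> x) * rdot (weak_grad p x) (rep_aefun (fst y) x))" for y
  using coefficient_identities(1)
 proof eventually_elim
  case (elim x)
  show ?case
   unfolding elim[symmetric] Uf_def bounded_bilinear.scaleR_left[OF bb_rdot] bounded_bilinear.scaleR_right[OF bb_rdot]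
   by (simp add: scaleR_conv_of_real mult_ac)
 qed
 have Lr: "in_L2 (%x. rotation \<omega> \<Omega> (U x) (W x))" if "in_L2 U" "in_L2 W" for U W
  unfolding rotation_def using that
  by (intro in_L2_add in_L2_linear[OF bounded_linear_cscale] in_L2_linear[OF bounded_linear_ccross])
 have L\<gamma>: "in_L2 (%x. \<gamma> x *R Uf y x)"
 proof -
  obtain C where "AE x. \<bar>\<gamma> x\<bar> <= C" "\<gamma> \<in> LM" using gamma(1) unfolding in_Linf_UNIV real_norm_def by blast
  thus ?thesis by (intro in_L2_bounded_mult[OF L(1)])
 qed
 note mc = bounded_bilinear_mult_cnj and bh = bounded_bilinear_hdot
 let ?f1 = "%x. ((c x)^2 *R Df y x) * cnj (Df y' x)" and ?f2 = "%x. rdot ((c x)^2 *R ?q x) (Uf y x) * cnj (Df y' x)"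
  and ?f3 = "%x. Df y x * cnj (rdot ((c x)^2 *R ?q x) (Uf y' x))"
  and ?f4 = "%x. hdot (rotation \<omega> \<Omega> (Uf y x) (Wf y x)) (rotation \<omega> \<Omega> (Uf y' x) (Wf y' x))"
  and ?f5 = "%x. hdot (cmat (coefN x) *v Uf y x) (Uf y' x)" and ?f6 = "%x. hdot (\<gamma> x *R Uf y x) (Uf y' x)"
  and ?f7 = "%x. hdot (gf y x) (s x *R Uf y' x)" and ?f8 = "%x. hdot (s x *R Uf y x) (gf y' x)" and ?f9 = "%x. hdot (gf y x) (gf y' x)"
 have "F (fields y) (fields y') = (LINT x. ?f1 x) + (LINT x. ?f2 x) + (LINT x. ?f3 x) - (LINT x. ?f4 x)
  + (LINT x. ?f5 x) - k * (LINT x. ?f6 x) - (LINT x. ?f7 x) - (LINT x. ?f8 x) + l * (LINT x. ?f9 x)"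
  unfolding F_def
 proof (rule integral_nine_terms[OF F_integrable[OF fields_L2[OF y(1)] fields_L2[OF y(2)]]])
  show "Lint ?f1" by (rule L2_bilinear_integrable[OF mc in_L2_csq[OF L(2)] L'(2)])
  show "Lint ?f2" by (rule L2_bilinear_integrable[OF mc Lq[OF L(1)] L'(2)])
  show "Lint ?f3" by (rule L2_bilinear_integrable[OF mc L(2) Lq[OF L'(1)]])
  show "Lint ?f4" by (rule L2_bilinear_integrable[OF bh Lr[OF L(1,3)] Lr[OF L'(1,3)]])
  show "Lint ?f6" by (rule L2_bilinear_integrable[OF bh L\<gamma> L'(1)])
  show "Lint ?f7" by (rule L2_bilinear_integrable[OF bh L(4) in_L2_s[OF L'(1)]])
  show "Lint ?f8" by (rule L2_bilinear_integrable[OF bh in_L2_s[OF L(1)] L'(4)])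
  show "Lint ?f9" by (rule L2_bilinear_integrable[OF bh L(4) L'(4)])
  fix x
  have e: "rdot (r *R v) u = of_real r * rdot v u" for r v u
   using bounded_bilinear.scaleR_left[OF bb_rdot, of r v u] by (simp only: scaleR_conv_of_real[where 'a=complex])
  show "oscillation_form \<omega> \<Omega> G (coef x) (fields y x) (fields y' x) = ?f1 x + ?f2 x + ?f3 x - ?f4 x + ?f5 x - k * ?f6 x - ?f7 x - ?f8 x + l * ?f9 x"
   unfolding oscillation_form_def coef_def fields_def quad_def prod.case k_def l_def hdot_scaleR_left hdot_scaleR_right
    scaleR_conv_of_real[where 'a=complex] e complex_cnj_mult complex_cnj_complex_of_real
   by (simp only: mult_ac)
 qed
 also have "(LINT x. ?f1 x) = ipS \<rho> (%x. of_real ((c x)^2) * weak_div ?u x) (weak_div ?u')"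
  unfolding ipS_weighted Df_def by (simp add: scaleR_conv_of_real mult_ac)
 also have "(LINT x. ?f2 x) = ipS \<rho> (%x. of_real (1 / \<rho> x) * rdot (weak_grad p x) (?u x)) (weak_div ?u')"
  unfolding ipS_weighted Df_def by (rule lebesgue_integral_AE_eq, rule eventually_mono[OF q_eq[of y]]) simp
 also have "(LINT x. ?f3 x) = ipS \<rho> (weak_div ?u) (%x. of_real (1 / \<rho> x) * rdot (weak_grad p x) (?u' x))"
  unfolding ipS_weighted Df_def by (rule lebesgue_integral_AE_eq, rule eventually_mono[OF q_eq[of y']]) simp
 also have "(LINT x. ?f4 x) = ipV \<rho> (rotating_deriv \<omega> \<Omega> \<rho> b ?u) (rotating_deriv \<omega> \<Omega> \<rho> b ?u')"
  unfolding ipV_weighted Uf_def Wf_def rotation_scaleR by (simp only: rotating_deriv_def rotation_def)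
 also have "(LINT x. ?f5 x) = ipV \<rho> (%x. cmat ((1 / \<rho> x) *R weak_hess p x - weak_hess \<phi> x) *v ?u x) ?u'"
  unfolding ipV_weighted Uf_def cmat_mult_scaleR
  by (rule lebesgue_integral_AE_eq, rule eventually_mono[OF coefficient_identities(2)]) simp
 also have "(LINT x. ?f6 x) = ipV \<rho> (%x. \<gamma> x *R ?u x) ?u'"
  unfolding ipV_weighted Uf_def by (simp add: hdot_scaleR_left mult_ac)
 also have "(LINT x. ?f7 x) = ipV \<rho> (gf y) ?u'"
  unfolding ipV_weighted Uf_def by (simp add: hdot_scaleR_left hdot_scaleR_right)
 also have "(LINT x. ?f8 x) = ipV \<rho> ?u (gf y')"
  unfolding ipV_weighted Uf_def by (simp add: hdot_scaleR_left hdot_scaleR_right)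
 also have "(LINT x. ?f9 x) = ipV (%_. 1) (gf y) (gf y')" unfolding ipV_def by simp
 finally show ?thesis unfolding osc_form_def osc_form_fun_def gf_def k_def l_def by simp
qed


abbreviation osc :: "state => state => complex" where "osc \<equiv> osc_form \<omega> \<Omega> G \<rho> c \<gamma> p \<phi> b"

lemma F_AE:
 assumes "AE x. Z1 x = Z1' x" "AE x. Z2 x = Z2' x"
 shows "F Z1 Z2 = F Z1' Z2'"
 unfolding F_def by (rule lebesgue_integral_AE_eq) (use assms in eventually_elim, simp)

lemma ip_product_Re: "y \<in> Y ==> y' \<in> Y ==> Re (ipY \<rho> b y y') = J y \<bullet> J y'"
proof -
 assume y: "y \<in> Y" "y' \<in> Y"
 have i: "Lint (%x. product_form (fields y x) (fields y' x))"
  by (rule form_integrable[where f="%_::real. product_form" and K="%_. 0" and R=0, OF continuous_product sesquilinear_product _ _ fields_L2[OF y(1)] fields_L2[OF y(2)]]) simp_all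
 show ?thesis
  unfolding ipY_fields[OF y] J_def inner_abs_l2[OF fields_L2[OF y(1)] fields_L2[OF y(2)]] integral_Re[OF i, symmetric] Re_product_form ..
qed

lemma osc_combine:
 assumes y: "y \<in> Y" "y' \<in> Y" "w \<in> Y"
 shows "osc (y + cscale z y') w = osc y w + z * osc y' w" "osc w (y + cscale z y') = osc w y + cnj z * osc w y'"
proof -
 obtain K where K: "AE x. norm (coef x) <= K" using coef_bounded(2) by blast
 note osc = form_integral_combine[where f="oscillation_form \<omega> \<Omega> G", OF continuous_oscillation sesquilinear_oscillation coef_bounded(1) K fields_L2 fields_L2 fields_L2 Y_combine(2)]
 show "osc (y + cscale z y') w = osc y w + z * osc y' w"
  unfolding osc_form_fields[OF Y_combine(1)[OF y(1,2)] y(3)] osc_form_fields[OF y(1,3)] osc_form_fields[OF y(2,3)] F_def by (rule osc(1)[OF y y(1,2)])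
 show "osc w (y + cscale z y') = osc w y + cnj z * osc w y'"
  unfolding osc_form_fields[OF y(3) Y_combine(1)[OF y(1,2)]] osc_form_fields[OF y(3,1)] osc_form_fields[OF y(3,2)] F_def by (rule osc(2)[OF y y(1,2)])
qed

lemma osc_scale:
 assumes y: "y \<in> Y" "w \<in> Y"
 shows "cscale z y \<in> Y" "osc (cscale z y) w = z * osc y w"
proof -
 have "osc 0 w = osc 0 w + 1 * osc 0 w"
  using osc_combine(1)[OF zero_Y(1) zero_Y(1) y(2), of 1] by (simp add: cscale_simps)
 thus "osc (cscale z y) w = z * osc y w" using osc_combine(1)[OF zero_Y(1) y, of z] by simp
 show "cscale z y \<in> Y" using Y_combine(1)[OF zero_Y(1) y(1), of z] by simp
qed

text \<open>Were no constant to work, normalizing counterexamples would give an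
  \<open>approx_null\<close> sequence of norm 1, contradicting \<open>coercivity\<close>.\<close>

lemma lower_bound: "\<exists>C\<ge>0. \<forall>y\<in>Y. \<forall>K\<ge>0. (\<forall>y'\<in>Y. norm (osc y y') <= K * norm (J y')) --> norm (J y) <= C * K"
proof (rule ccontr)
 assume neg: "\<not> ?thesis"
 have "\<forall>n. \<exists>y. y \<in> Y \<and> norm (J y) = 1 \<and> (\<forall>y'\<in>Y. norm (osc y y') <= inverse (real (Suc n)) * norm (J y'))"
 proof
  fix n
  \<comment> \<open>The failure of the constant n + 1 gives (n + 1) K < |J y|; dividing by |J y|
    leaves a residual of at most 1/(n + 1).\<close>
  obtain y K where y: "y \<in> Y" "K >= 0" and le: "\<forall>y'\<in>Y. norm (osc y y') <= K * norm (J y')" and gt: "real (Suc n) * K < norm (J y)"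
   using neg of_nat_0_le_iff[of "Suc n"] by (meson not_le)
  define t where "t = inverse (norm (J y))"
  have J: "0 < norm (J y)" by (rule le_less_trans[OF _ gt]) (use y(2) in simp)
  have tK: "t * K <= inverse (real (Suc n))" unfolding t_def using gt J by (simp add: field_simps)
  have "norm (osc (cscale (of_real t) y) y') <= inverse (real (Suc n)) * norm (J y')" if y': "y' \<in> Y" for y'
  proof -
   have "norm (osc (cscale (of_real t) y) y') = t * norm (osc y y')" unfolding osc_scale(2)[OF y(1) y'] norm_mult norm_of_real by (simp add: t_def)
   also have "... <= t * (K * norm (J y'))" using bspec[OF le y'] by (rule mult_left_mono) (simp add: t_def)
   also have "... <= inverse (real (Suc n)) * norm (J y')" unfolding mult.assoc[symmetric] by (rule mult_right_mono[OF tK norm_ge_zero])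
   finally show ?thesis .
  qed
  moreover have "norm (J (cscale (of_real t) y)) = 1" unfolding J_scaleR[OF y(1)] using J by (simp add: t_def)
  ultimately show "\<exists>y. y \<in> Y \<and> norm (J y) = 1 \<and> (\<forall>y'\<in>Y. norm (osc y y') <= inverse (real (Suc n)) * norm (J y'))"
   using osc_scale(1)[OF y(1,1)] by blast
 qed
 from choice[OF this] obtain y where y: "!!n. y n \<in> Y" "!!n. norm (J (y n)) = 1"
  and le: "!!n y'. y' \<in> Y ==> norm (osc (y n) y') <= inverse (real (Suc n)) * norm (J y')" by blast
 have "approx_null (Uf (y n)) (Df (y n)) (Wf (y n)) (gf (y n)) (inverse (real (Suc n)))" for n
  unfolding approx_null_def
 proof (intro conjI allI impI Y_adm[OF y(1)])
  fix U' D' W' g' assume a: "adm U' D' W' g'"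
  obtain y' where y': "y' \<in> Y" "AE x. fields y' x = quad U' D' W' g' x" by (rule adm_state[OF a])
  have 1: "F (quad (Uf (y n)) (Df (y n)) (Wf (y n)) (gf (y n))) (quad U' D' W' g') = osc (y n) y'"
   unfolding osc_form_fields[OF y(1) y'(1)] fields_def[of "y n", symmetric]
   by (rule F_AE[symmetric, OF AE_I2[OF refl] y'(2)])
  have 2: "J y' = abs_l2 (quad U' D' W' g')"
   unfolding J_def using abs_l2_eq_iff[OF fields_L2[OF y'(1)] adm_L2(5)[OF a]] y'(2) by blast
  show "norm (F (quad (Uf (y n)) (Df (y n)) (Wf (y n)) (gf (y n))) (quad U' D' W' g')) <= inverse (real (Suc n)) * L2n (quad U' D' W' g')"
   unfolding 1 2[symmetric] by (rule le[OF y'(1)])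
 qed simp
 note coercivity[OF this LIMSEQ_inverse_real_of_nat, folded norm_J, unfolded y(2)]
 thus False by (simp add: LIMSEQ_const_iff)
qed

text \<open>The imaginary part gives u = 0, uniqueness of weak derivatives removes \<open>D\<close>
  and \<open>W\<close>, and what is left of the form is a positive multiple of the squared norm of
  \<nabla>\<psi>.\<close>

lemma form_nondegenerate:
 assumes y: "y \<in> Y" and z: "osc y y = 0"
 shows "y = 0"
proof -
 note a = Y_adm[OF y]
 note L = adm_L2[OF a]
 have e: "energy (Uf y) (Df y) (Wf y)" using a unfolding adm_def by blast
 have Fz: "F (fields y) (fields y) = 0" using z unfolding osc_form_fields[OF y y] .
 obtain m where m: "m > 0" "\<forall>U D W g. adm U D W g --> m * (L2n U)^2 <= norm (F (quad U D W g) (quad U D W g))"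
  using Im_F_lower by (elim exE conjE)
 have "m * (L2n (Uf y))^2 <= norm (F (quad (Uf y) (Df y) (Wf y) (gf y)) (quad (Uf y) (Df y) (Wf y) (gf y)))" by (rule m(2)[rule_format, OF a])
 hence "m * (L2n (Uf y))^2 <= 0" using Fz unfolding fields_def by simp
 hence "L2n (Uf y) = 0" using m(1) by (simp add: mult_le_0_iff)
 hence "abs_l2 (Uf y) = abs_l2 (%x. 0)" by (simp add: abs_l2_zero)
 hence U0: "AE x. Uf y x = 0" using abs_l2_eq_iff[OF L(1) in_L2_zero] by blast
 note DW = energy_unique[OF e energy_zero U0]
 have f0: "AE x. fields y x = quad (%x. 0) (%x. 0) (%x. 0) (gf y) x"
  using U0 DW by eventually_elim (simp add: fields_def quad_def)
 define k where "k = 1 / (4 * pi * G)"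
 have k: "k > 0" unfolding k_def using G by simp
 have "F (fields y) (fields y) = F (quad (%x. 0) (%x. 0) (%x. 0) (gf y)) (quad (%x. 0) (%x. 0) (%x. 0) (gf y))"
  by (rule F_AE[OF f0 f0])
 also have "... = (LINT x. of_real (k * (norm (gf y x))^2))"
  unfolding F_def quad_def coef_def oscillation_zero_left hdot_zero hdot_self k_def[symmetric] by simp
 also have "... = of_real (k * (L2n (gf y))^2)" unfolding integral_complex_of_real norm_abs_l2[OF L(4)] by simp
 finally have "L2n (gf y) = 0" using Fz k by simp
 hence "(norm (J y))^2 = 0"
  unfolding J_def using abs_l2_eq_iff[OF fields_L2[OF y] in_L2_quad[OF in_L2_zero in_L2_zero in_L2_zero L(4)]] f0
   L2n_quad[OF in_L2_zero in_L2_zero in_L2_zero L(4)] by (simp add: L2n_zero)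
 thus ?thesis using J_eq_zero[OF y] by simp
qed

lemma hilbert_form_exists: "\<exists>C B M. hilbert_form Y cscale (ipY \<rho> b) osc J C B M"
proof -
 obtain C where C: "C >= 0" "\<forall>y\<in>Y. \<forall>K\<ge>0. (\<forall>y'\<in>Y. norm (osc y y') <= K * norm (J y')) --> norm (J y) <= C * K"
  using lower_bound by (elim exE conjE)
 have const: "(%_. 0::real) \<in> LM" "AE x::real^3. norm (0::real) <= 0" by simp_all
 obtain B where B: "B >= 0" "\<forall>Z Z'. in_L2 Z --> in_L2 Z' --> norm (LINT x. product_form (Z x) (Z' x)) <= B * L2n Z * L2n Z'"
  using form_integral_bound[where f="%_::real. product_form", OF continuous_product sesquilinear_product const] by (elim exE conjE)
 obtain M where M: "M >= 0" "\<forall>Z Z'. in_L2 Z --> in_L2 Z' --> norm (F Z Z') <= M * L2n Z * L2n Z'"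
  using F_bound by (elim exE conjE)
 note prod = form_integral_combine[where f="%_::real. product_form", OF continuous_product sesquilinear_product const fields_L2 fields_L2 fields_L2 Y_combine(2)]
 have "hilbert_form Y cscale (ipY \<rho> b) osc J C B M"
 proof
  show "0 \<in> Y" by (rule zero_Y(1))
  show "cscale 1 y = y" "cscale (-1) y = - y" for y by (rule cscale_simps)+
  show "closed (J ` Y)" by (rule closed_J)
  show "0 <= C" "0 <= B" "0 <= M" by (rule C(1) B(1) M(1))+
  show "y + cscale z y' \<in> Y" if "y \<in> Y" "y' \<in> Y" for y y' z by (rule Y_combine(1)[OF that])
  show "J (y + y') = J y + J y'" if "y \<in> Y" "y' \<in> Y" for y y' by (rule J_add[OF that])
  show "J (cscale (complex_of_real r) y) = r *R J y" if "y \<in> Y" for r y by (rule J_scaleR[OF that])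
  show "y = 0" if "y \<in> Y" "J y = 0" for y by (rule J_eq_zero[OF that])
  show "Re (ipY \<rho> b y y') = J y \<bullet> J y'" if "y \<in> Y" "y' \<in> Y" for y y' by (rule ip_product_Re[OF that])
  show "ipY \<rho> b (y + cscale z y') w = ipY \<rho> b y w + z * ipY \<rho> b y' w" if y: "y \<in> Y" "y' \<in> Y" "w \<in> Y" for y y' w z
   unfolding ipY_fields[OF Y_combine(1)[OF y(1,2)] y(3)] ipY_fields[OF y(1,3)] ipY_fields[OF y(2,3)] by (rule prod(1)[OF y y(1,2)])
  show "ipY \<rho> b w (y + cscale z y') = ipY \<rho> b w y + cnj z * ipY \<rho> b w y'" if y: "y \<in> Y" "y' \<in> Y" "w \<in> Y" for y y' w z
   unfolding ipY_fields[OF y(3) Y_combine(1)[OF y(1,2)]] ipY_fields[OF y(3,1)] ipY_fields[OF y(3,2)] by (rule prod(2)[OF y y(1,2)])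
  show "osc (y + cscale z y') w = osc y w + z * osc y' w" if y: "y \<in> Y" "y' \<in> Y" "w \<in> Y" for y y' w z by (rule osc_combine(1)[OF y])
  show "osc w (y + cscale z y') = osc w y + cnj z * osc w y'" if y: "y \<in> Y" "y' \<in> Y" "w \<in> Y" for y y' w z by (rule osc_combine(2)[OF y])
  show "norm (ipY \<rho> b y y') <= B * norm (J y) * norm (J y')" if "y \<in> Y" "y' \<in> Y" for y y'
   unfolding ipY_fields[OF that] J_def using B(2) fields_L2[OF that(1)] fields_L2[OF that(2)] by blast
  show "norm (osc y y') <= M * norm (J y) * norm (J y')" if "y \<in> Y" "y' \<in> Y" for y y'
   unfolding osc_form_fields[OF that] J_def using M(2) fields_L2[OF that(1)] fields_L2[OF that(2)] by blast
  show "norm (J y) <= C * K" if "y \<in> Y" "0 <= K" "!!y'. y' \<in> Y ==> norm (osc y y') <= K * norm (J y')" for y K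
   using C(2) that by blast
  show "y = 0" if "y \<in> Y" "!!y'. y' \<in> Y ==> osc y' y = 0" for y
   by (rule form_nondegenerate[OF that(1) that(2)[OF that(1)]])
 qed
 thus ?thesis by blast
qed

section \<open>The operator, unique solvability and continuous dependence\<close>

lemma normY_J: "y \<in> Y ==> normY \<rho> b y = norm (J y)"
 unfolding normY_def using ip_product_Re[of y y] by (simp add: norm_eq_sqrt_inner)

lemma load_fields: "ipV \<rho> f (rep_aefun (fst y)) = (LINT x. hdot (s x *R f x) (Uf y x))"
 unfolding ipV_weighted Uf_def ..

lemma Uf_combine:
 assumes "y \<in> Y" "y' \<in> Y" shows "AE x. Uf (y + cscale z y') x = Uf y x + z *s Uf y' x"
 using Y_combine(2)[OF assms, of z] by eventually_elim (simp add: fields_def quad_def vscale_def)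

theorem main:
 fixes A :: "state => state"
 defines "A \<equiv> riesz_operator Y (ipY \<rho> b) osc"
  shows "bounded_operator_on Y (normY \<rho> b) A \<and>
  (\<forall>y\<in>Y. \<forall>y'\<in>Y. ipY \<rho> b (A y) y' = osc y y') \<and> bij_betw A Y Y \<and>
  (\<forall>f\<in>L2w \<rho>. \<exists>!y. weak_solution Y osc \<rho> f y) \<and>
  (\<exists>C. \<forall>f\<in>L2w \<rho>. \<forall>f'\<in>L2w \<rho>. \<forall>y y'. weak_solution Y osc \<rho> f y --> weak_solution Y osc \<rho> f' y' -->
    normY \<rho> b (y - y') <= C * L2w_norm \<rho> (f - f'))"
proof -
 obtain C B M where "hilbert_form Y cscale (ipY \<rho> b) osc J C B M" using hilbert_form_exists by blast
 then interpret H: hilbert_form Y cscale "ipY \<rho> b" osc J C B M .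
 have AH: "A = H.A" unfolding A_def riesz_operator_def H.A_def by (rule ext) (rule refl)
 have bounded: "bounded_operator_on Y (normY \<rho> b) A"
  unfolding bounded_operator_on_def AH
 proof (intro conjI ballI allI)
  show "\<exists>C. \<forall>y\<in>Y. normY \<rho> b (H.A y) <= C * normY \<rho> b y"
   using H.A_bounded normY_J H.A(1) by (intro exI[of _ M]) simp
 qed (simp_all add: H.A H.A_add H.A_sc)
 obtain K where K: "K >= 0" "!!g y. in_L2 g ==> y \<in> Y ==> norm (LINT x. hdot (g x) (Uf y x)) <= K * L2n g * norm (J y)"
 proof -
  obtain K where K: "K >= 0" "\<forall>f g. in_L2 f --> in_L2 g --> norm (LINT x. hdot (f x) (g x)) <= K * L2n f * L2n g"
   using L2_inner_bound[OF bounded_bilinear_hdot] by (elim exE conjE)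
  have "norm (LINT x. hdot (g x) (Uf y x)) <= K * L2n g * norm (J y)" if g: "in_L2 g" and y: "y \<in> Y" for g y
  proof -
   note L = adm_L2[OF Y_adm[OF y]]
   have "K * L2n g * L2n (Uf y) <= K * L2n g * norm (J y)"
    unfolding norm_J using K(1) by (intro mult_left_mono L2n_quad_le(1) L(1-4)) simp
   with K(2)[rule_format, OF g L(1)] show ?thesis by (rule order_trans)
  qed
  with K(1) show ?thesis using that by blast
 qed
 have load: "H.antilinear (%y. ipV \<rho> (rep_aefun f) (rep_aefun (fst y)))"
  "\<exists>K. \<forall>y\<in>Y. norm (ipV \<rho> (rep_aefun f) (rep_aefun (fst y))) <= K * norm (J y)" if f: "f \<in> L2w \<rho>" for f
 proof -
  have sf: "in_L2 (%x. s x *R rep_aefun f x)" using f unfolding L2w_def by (intro in_L2w_s) simp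
  show "H.antilinear (%y. ipV \<rho> (rep_aefun f) (rep_aefun (fst y)))"
   unfolding H.antilinear_def load_fields
  proof (intro ballI allI)
   fix y y' z assume y: "y \<in> Y" "y' \<in> Y"
   have i: "Lint (%x. hdot (s x *R rep_aefun f x) (Uf y x))" if "y \<in> Y" for y
    by (rule L2_bilinear_integrable[OF bounded_bilinear_hdot sf adm_L2(1)[OF Y_adm[OF that]]])
   have "(LINT x. hdot (s x *R rep_aefun f x) (Uf (y + cscale z y') x))
     = (LINT x. hdot (s x *R rep_aefun f x) (Uf y x) + cnj z * hdot (s x *R rep_aefun f x) (Uf y' x))"
    by (rule lebesgue_integral_AE_eq, rule eventually_mono[OF Uf_combine[OF y, of z]]) (simp add: hdot_add_right hdot_cscale_right)
   thus "(LINT x. hdot (s x *R rep_aefun f x) (Uf (y + cscale z y') x))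
     = (LINT x. hdot (s x *R rep_aefun f x) (Uf y x)) + cnj z * (LINT x. hdot (s x *R rep_aefun f x) (Uf y' x))"
    unfolding Bochner_Integration.integral_add[OF i[OF y(1)] integrable_mult_right[OF i[OF y(2)]]] integral_mult_right_zero .
  qed
  show "\<exists>K. \<forall>y\<in>Y. norm (ipV \<rho> (rep_aefun f) (rep_aefun (fst y))) <= K * norm (J y)"
   unfolding load_fields by (intro exI ballI) (rule K(2)[OF sf])
 qed
 have unique: "\<exists>!y. weak_solution Y osc \<rho> f y" if f: "f \<in> L2w \<rho>" for f
 proof -
  obtain K where "\<forall>y\<in>Y. norm (ipV \<rho> (rep_aefun f) (rep_aefun (fst y))) <= K * norm (J y)" using load(2)[OF f] by blast
  thus ?thesis unfolding weak_solution_def by (intro H.unique_solution[OF load(1)[OF f]]) blast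
 qed
 have dependence: "normY \<rho> b (y - y') <= (C * K) * L2w_norm \<rho> (f - f')"
  if f: "f \<in> L2w \<rho>" "f' \<in> L2w \<rho>" and y: "weak_solution Y osc \<rho> f y" "weak_solution Y osc \<rho> f' y'" for f f' y y'
 proof -
  have yY: "y \<in> Y" "y' \<in> Y" and sol: "!!v. v \<in> Y ==> osc y v = ipV \<rho> (rep_aefun f) (rep_aefun (fst v))"
   "!!v. v \<in> Y ==> osc y' v = ipV \<rho> (rep_aefun f') (rep_aefun (fst v))" using y unfolding weak_solution_def by auto
  have sf: "in_L2 (%x. s x *R rep_aefun f x)" "in_L2 (%x. s x *R rep_aefun f' x)" using f unfolding L2w_def by (auto intro: in_L2w_s)
  let ?d = "%x. s x *R rep_aefun f x - s x *R rep_aefun f' x"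
  have d: "in_L2 ?d" by (rule in_L2_diff[OF sf])
  have dae: "AE x. ?d x = s x *R rep_aefun (f - f') x"
   using rep_aefun_diff[of f f'] by eventually_elim (simp add: scaleR_diff_right)
  have "ipV \<rho> (rep_aefun (f - f')) (rep_aefun (f - f')) = (LINT x. hdot (?d x) (?d x))"
   unfolding ipV_weighted by (rule lebesgue_integral_AE_eq) (use dae in eventually_elim, simp)
  also have "... = of_real ((L2n ?d)^2)" unfolding hdot_self norm_abs_l2[OF d] by (rule integral_complex_of_real)
  finally have n: "L2w_norm \<rho> (f - f') = L2n ?d" unfolding L2w_norm_def by simp
  have "norm (J (y - y')) <= C * (K * L2n ?d)"
  proof (rule H.continuous_dependence[OF yY])
   show "0 <= K * L2n ?d" using K(1) by simp
   fix v assume v: "v \<in> Y"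
   note L = adm_L2[OF Y_adm[OF v]]
   note i = L2_bilinear_integrable[OF bounded_bilinear_hdot sf(1) L(1)] L2_bilinear_integrable[OF bounded_bilinear_hdot sf(2) L(1)]
   have "osc y v - osc y' v = (LINT x. hdot (?d x) (Uf v x))"
    unfolding sol(1)[OF v] sol(2)[OF v] load_fields hdot_diff_left by (rule Bochner_Integration.integral_diff[symmetric, OF i])
   thus "norm (osc y v - osc y' v) <= K * L2n ?d * norm (J v)" using K(2)[OF d v] by (simp only:)
  qed
  thus ?thesis unfolding normY_J[OF H.diff_mem[OF yY]] n by (simp add: mult.assoc)
 qed
 show ?thesis
  using bounded H.A(2) H.A_bij unique dependence unfolding AH by blast
qed

end

text \<open>As 1/(1 + t^2) is at most 1, the hypothesis puts the essential supremum of |b|/c below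
  1, and a real number strictly in between serves as a uniform bound.\<close>

lemma subsonic_bound:
 fixes b :: "(real^3) fn"
 assumes sub: "(Linf_norm (%x. inverse (c x) *R b x))^2 < ereal (1 / (1 + t\<^sup>2))" and c: "ess_inf lebesgue c > 0"
 obtains \<beta> where "0 <= \<beta>" "\<beta> < 1" "AE x. norm (b x) <= \<beta> * c x"
proof -
 let ?N = "Linf_norm (%x. inverse (c x) *R b x)"
 have "1 / (1 + t\<^sup>2) <= 1" by (simp add: divide_le_eq_1 add_pos_nonneg)
 hence "ereal (1 / (1 + t\<^sup>2)) <= 1" unfolding one_ereal_def by (rule ereal_less_eq(3)[THEN iffD2])
 with sub have sq: "?N\<^sup>2 < 1" by (rule less_le_trans)
 have "?N < 1"
 proof (rule ccontr)
  assume "\<not> ?N < 1"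
  hence 1: "1 <= ?N" by simp
  have "1 * 1 <= ?N * ?N" by (rule ereal_mult_mono[OF _ _ 1 1]) (use order_trans[OF _ 1, of 0] in simp_all)
  thus False using sq unfolding power2_eq_square by simp
 qed
 then obtain \<beta> :: real where \<beta>: "?N < ereal \<beta>" "ereal \<beta> < 1" using ereal_dense2 by blast
 obtain c0 where c0: "c0 > 0" "AE x. c0 <= c x" using ess_inf_positive[OF c] by blast
 have "AE x. ereal (norm (inverse (c x) *R b x)) <= ?N" unfolding Linf_norm_def by (rule esssup_AE)
 hence "AE x. norm (b x) <= max 0 \<beta> * c x"
  using c0(2)
 proof eventually_elim
  case (elim x)
  have cx: "0 < c x" using elim(2) c0(1) by simp
  have "ereal (norm (inverse (c x) *R b x)) < ereal \<beta>" by (rule le_less_trans[OF elim(1) \<beta>(1)])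
  hence "inverse (c x) * norm (b x) <= max 0 \<beta>" using cx by simp
  hence "norm (b x) / c x <= max 0 \<beta>" by (simp only: divide_inverse mult.commute)
  thus ?case using cx by (simp only: pos_divide_le_eq)
 qed
 \<comment> \<open>The maximum with 0 secures nonnegativity without an argument on the sign of the
   essential supremum.\<close>
 moreover have "max 0 \<beta> < 1" using \<beta>(2) by simp
 ultimately show ?thesis by (intro that[of "max 0 \<beta>"]) auto
qed

theorem theorem4p3:
  fixes \<omega> G r\<^sub>1 r\<^sub>2 r\<^sub>3 \<theta> :: real and \<Omega> :: "real^3"
    and \<rho> c\<^sub>s \<gamma> p \<phi> :: "real^3 \<Rightarrow> real" and b :: "real^3 \<Rightarrow> real^3"
    and Y :: "state set" and a :: "state \<Rightarrow> state \<Rightarrow> complex" and A :: "state \<Rightarrow> state"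
  assumes G: "G > 0"
    and rho: "in_Linf UNIV \<rho>" "\<And>r. r > 0 \<Longrightarrow> ess_inf (lebesgue_on (ball 0 r)) \<rho> > 0"
    and cs: "in_Linf UNIV c\<^sub>s" "ess_inf lebesgue c\<^sub>s > 0"
    and gamma: "in_Linf UNIV \<gamma>" "ess_inf lebesgue \<gamma> > 0"
    and p_phi: "in_W2inf_loc p" "in_W2inf_loc \<phi>"
    and q: "in_Linf UNIV (q_field \<rho> c\<^sub>s p)"
    and m1: "in_Linf UNIV (m1_field \<rho> c\<^sub>s p \<phi>)"
    and b: "in_Linf UNIV b" "\<exists>g. has_weak_div (\<lambda>x. \<rho> x *\<^sub>R b x) g \<and> in_L2 g"
    and r1: "r\<^sub>1 > 0" "ess_support b \<subseteq> ball 0 r\<^sub>1"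
    and radii: "r\<^sub>2 > r\<^sub>1" "r\<^sub>3 > r\<^sub>2"
    and W1inf: "in_W1inf (ball 0 r\<^sub>3) c\<^sub>s" "in_W1inf (ball 0 r\<^sub>3) \<rho>"
    and omega: "\<omega> \<noteq> 0"
    and theta: "\<theta> = theta_angle \<omega> \<gamma> (m1_field \<rho> c\<^sub>s p \<phi>) r\<^sub>2"
    and Y: "Y = spaceX \<rho> b \<times> spaceH1star r\<^sub>1"
    and a: "a = osc_form \<omega> \<Omega> G \<rho> c\<^sub>s \<gamma> p \<phi> b"
    and A: "A = riesz_operator Y (ipY \<rho> b) a"
    and subsonic: "(Linf_norm (\<lambda>x. inverse (c\<^sub>s x) *\<^sub>R b x))\<^sup>2 < ereal (1 / (1 + (tan \<theta>)\<^sup>2))"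
  shows "bounded_operator_on Y (normY \<rho> b) A \<and>
    (\<forall>y\<in>Y. \<forall>y'\<in>Y. ipY \<rho> b (A y) y' = a y y') \<and>
    bij_betw A Y Y \<and>
    (\<forall>F\<in>L2w \<rho>. \<exists>!y. weak_solution Y a \<rho> F y) \<and>
    (\<exists>C. \<forall>F\<in>L2w \<rho>. \<forall>F'\<in>L2w \<rho>. \<forall>y y'.
       weak_solution Y a \<rho> F y \<longrightarrow> weak_solution Y a \<rho> F' y' \<longrightarrow>
       normY \<rho> b (y - y') \<le> C * L2w_norm \<rho> (F - F'))"
proof -
 obtain \<beta> where \<beta>: "0 <= \<beta>" "\<beta> < 1" "AE x. norm (b x) <= \<beta> * c\<^sub>s x"
  by (rule subsonic_bound[OF subsonic cs(2)])
 have "r\<^sub>1 < r\<^sub>3" using radii by simp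
 then interpret S: stellar \<omega> G r\<^sub>1 r\<^sub>3 \<beta> \<Omega> \<rho> c\<^sub>s \<gamma> p \<phi> b
  using G rho cs gamma p_phi q m1 b r1 W1inf omega \<beta> by unfold_locales
 show ?thesis unfolding A a Y S.Y_def[symmetric] by (rule S.main)
qed

end
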